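(* Let $A$ be a hermitian, $^*$-regular, $^*$-semisimple Banach $^*$-algebra. Then $A$ has spectral synthesis in the sense of this paper (defined in the context) if and only if $A$ has spectral synthesis in the usual sense for $^*$-semisimple Banach $^*$-algebras, i.e. every hull-kernel closed subset of $Prim_*(A)$ is the hull (in $Prim_*(A)$) of a unique closed two-sided ideal of $A$.
   Context: A Banach $^*$-algebra $A$ is $^*$-semisimple if the intersection of the kernels of all $^*$-representations of $A$ on Hilbert space is $\{0\}$; its C$^*$-envelope $C^*(A)$ is its completion in the maximal C$^*$-norm. $Prim_*(A)$ is the set of kernels of topologically irreducible $^*$-representations of $A$ on Hilbert space, with the hull-kernel topology. $A$ is $^*$-regular if the map $P\mapsto P\cap A$ from $Prim(C^*(A))$ onto $Prim_*(A)$ is a homeomorphism (both with hull-kernel topologies). $A$ is hermitian if every self-adjoint element has real spectrum. For a Banach algebra $A$: $Prim(A)$ is the set of primitive ideals (kernels of algebraically irreducible representations) with the hull-kernel topology; $Prim^s(A)$ is the set of proper prime ideals $P$ of $A$ which are semisimple (i.e. $P$ is an intersection of primitive ideals), with the hull-kernel topology. $A$ has spectral synthesis (in the sense of this paper) if: (i) $Prim^s(A)$ is locally compact; (ii) whenever a net $(P_\alpha)$ in $Prim(A)$ converges in the hull-kernel topology to $P\in Prim(A)$ and $a\in A\setminus P$, then $\liminf_\alpha\|a+P_\alpha\|>0$ (quotient norms); (iii) every proper closed two-sided ideal of $A$ is semisimple, i.e. is an intersection of primitive ideals. *)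

theory Defs
  imports "HOL-Analysis.Analysis"
begin

record 'a alg =
  car :: "'a set"
  zer :: 'a
  ad  :: "'a \<Rightarrow> 'a \<Rightarrow> 'a"
  sm  :: "complex \<Rightarrow> 'a \<Rightarrow> 'a"
  mu  :: "'a \<Rightarrow> 'a \<Rightarrow> 'a"

record 'a bsalg = "'a alg" +
  st :: "'a \<Rightarrow> 'a"
  nm :: "'a \<Rightarrow> real"

definition cvs :: "'v set \<Rightarrow> 'v \<Rightarrow> ('v \<Rightarrow> 'v \<Rightarrow> 'v) \<Rightarrow> (complex \<Rightarrow> 'v \<Rightarrow> 'v) \<Rightarrow> bool" where
  "cvs V z p s \<longleftrightarrow> z \<in> V \<and>
     (\<forall>x\<in>V. \<forall>y\<in>V. p x y \<in> V) \<and> (\<forall>c. \<forall>x\<in>V. s c x \<in> V) \<and>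
     (\<forall>x\<in>V. \<forall>y\<in>V. \<forall>w\<in>V. p (p x y) w = p x (p y w)) \<and>
     (\<forall>x\<in>V. \<forall>y\<in>V. p x y = p y x) \<and>
     (\<forall>x\<in>V. p z x = x) \<and>
     (\<forall>x\<in>V. \<exists>y\<in>V. p x y = z) \<and>
     (\<forall>c. \<forall>x\<in>V. \<forall>y\<in>V. s c (p x y) = p (s c x) (s c y)) \<and>
     (\<forall>c d. \<forall>x\<in>V. s (c + d) x = p (s c x) (s d x)) \<and>
     (\<forall>c d. \<forall>x\<in>V. s (c * d) x = s c (s d x)) \<and>
     (\<forall>x\<in>V. s 1 x = x)"

definition alg_ax :: "('a, 'z) alg_scheme \<Rightarrow> bool" where
  "alg_ax A \<longleftrightarrow> cvs (car A) (zer A) (ad A) (sm A) \<and>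
     (\<forall>x\<in>car A. \<forall>y\<in>car A. mu A x y \<in> car A) \<and>
     (\<forall>x\<in>car A. \<forall>y\<in>car A. \<forall>w\<in>car A. mu A (mu A x y) w = mu A x (mu A y w)) \<and>
     (\<forall>x\<in>car A. \<forall>y\<in>car A. \<forall>w\<in>car A. mu A (ad A x y) w = ad A (mu A x w) (mu A y w)) \<and>
     (\<forall>x\<in>car A. \<forall>y\<in>car A. \<forall>w\<in>car A. mu A w (ad A x y) = ad A (mu A w x) (mu A w y)) \<and>
     (\<forall>c. \<forall>x\<in>car A. \<forall>y\<in>car A. mu A (sm A c x) y = sm A c (mu A x y) \<and> mu A x (sm A c y) = sm A c (mu A x y))"

definition sub :: "('a, 'z) alg_scheme \<Rightarrow> 'a \<Rightarrow> 'a \<Rightarrow> 'a" where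
  "sub A x y = ad A x (sm A (-1) y)"

definition nconv :: "('a, 'z) bsalg_scheme \<Rightarrow> (nat \<Rightarrow> 'a) \<Rightarrow> 'a \<Rightarrow> bool" where
  "nconv A x y \<longleftrightarrow> (\<lambda>n. nm A (sub A (x n) y)) \<longlonglongrightarrow> 0"

definition banach_star_algebra :: "('a, 'z) bsalg_scheme \<Rightarrow> bool" where
  "banach_star_algebra A \<longleftrightarrow> alg_ax A \<and>
     (\<forall>x\<in>car A. st A x \<in> car A \<and> st A (st A x) = x) \<and>
     (\<forall>x\<in>car A. \<forall>y\<in>car A. st A (ad A x y) = ad A (st A x) (st A y)) \<and>
     (\<forall>c. \<forall>x\<in>car A. st A (sm A c x) = sm A (cnj c) (st A x)) \<and>
     (\<forall>x\<in>car A. \<forall>y\<in>car A. st A (mu A x y) = mu A (st A y) (st A x)) \<and>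
     (\<forall>x\<in>car A. nm A x \<ge> 0 \<and> (nm A x = 0 \<longleftrightarrow> x = zer A)) \<and>
     (\<forall>x\<in>car A. \<forall>y\<in>car A. nm A (ad A x y) \<le> nm A x + nm A y) \<and>
     (\<forall>c. \<forall>x\<in>car A. nm A (sm A c x) = cmod c * nm A x) \<and>
     (\<forall>x\<in>car A. \<forall>y\<in>car A. nm A (mu A x y) \<le> nm A x * nm A y) \<and>
     (\<forall>x. (\<forall>n. x n \<in> car A) \<and>
          (\<forall>e>0. \<exists>N. \<forall>m\<ge>N. \<forall>n\<ge>N. nm A (sub A (x m) (x n)) < e)
          \<longrightarrow> (\<exists>y\<in>car A. nconv A x y))"

definition ideal :: "('a, 'z) alg_scheme \<Rightarrow> 'a set \<Rightarrow> bool" where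
  "ideal A I \<longleftrightarrow> I \<subseteq> car A \<and> zer A \<in> I \<and>
     (\<forall>x\<in>I. \<forall>y\<in>I. ad A x y \<in> I) \<and> (\<forall>c. \<forall>x\<in>I. sm A c x \<in> I) \<and>
     (\<forall>a\<in>car A. \<forall>x\<in>I. mu A a x \<in> I \<and> mu A x a \<in> I)"

definition closed_ideal :: "('a, 'z) bsalg_scheme \<Rightarrow> 'a set \<Rightarrow> bool" where
  "closed_ideal A I \<longleftrightarrow> ideal A I \<and>
     (\<forall>x y. (\<forall>n. x n \<in> I) \<and> y \<in> car A \<and> nconv A x y \<longrightarrow> y \<in> I)"

definition prime_ideal :: "('a, 'z) alg_scheme \<Rightarrow> 'a set \<Rightarrow> bool" where
  "prime_ideal A P \<longleftrightarrow> ideal A P \<and> P \<noteq> car A \<and>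
     (\<forall>I J. ideal A I \<and> ideal A J \<and> (\<forall>a\<in>I. \<forall>b\<in>J. mu A a b \<in> P) \<longrightarrow> I \<subseteq> P \<or> J \<subseteq> P)"

record ('a, 'v) amod =
  vcar :: "'v set"
  vz   :: 'v
  vadd :: "'v \<Rightarrow> 'v \<Rightarrow> 'v"
  vsm  :: "complex \<Rightarrow> 'v \<Rightarrow> 'v"
  act  :: "'a \<Rightarrow> 'v \<Rightarrow> 'v"

definition alg_irred_rep :: "('a, 'z) alg_scheme \<Rightarrow> ('a, 'v) amod \<Rightarrow> bool" where
  "alg_irred_rep A M \<longleftrightarrow> cvs (vcar M) (vz M) (vadd M) (vsm M) \<and>
     (\<forall>a\<in>car A. \<forall>v\<in>vcar M. act M a v \<in> vcar M) \<and>
     (\<forall>a\<in>car A. \<forall>v\<in>vcar M. \<forall>w\<in>vcar M. act M a (vadd M v w) = vadd M (act M a v) (act M a w)) \<and>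
     (\<forall>c. \<forall>a\<in>car A. \<forall>v\<in>vcar M. act M a (vsm M c v) = vsm M c (act M a v)) \<and>
     (\<forall>a\<in>car A. \<forall>b\<in>car A. \<forall>v\<in>vcar M. act M (ad A a b) v = vadd M (act M a v) (act M b v)) \<and>
     (\<forall>c. \<forall>a\<in>car A. \<forall>v\<in>vcar M. act M (sm A c a) v = vsm M c (act M a v)) \<and>
     (\<forall>a\<in>car A. \<forall>b\<in>car A. \<forall>v\<in>vcar M. act M (mu A a b) v = act M a (act M b v)) \<and>
     (\<exists>a\<in>car A. \<exists>v\<in>vcar M. act M a v \<noteq> vz M) \<and>
     (\<forall>W. W \<subseteq> vcar M \<and> vz M \<in> W \<and> (\<forall>v\<in>W. \<forall>w\<in>W. vadd M v w \<in> W) \<and>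
          (\<forall>c. \<forall>v\<in>W. vsm M c v \<in> W) \<and> (\<forall>a\<in>car A. \<forall>v\<in>W. act M a v \<in> W)
          \<longrightarrow> W = {vz M} \<or> W = vcar M)"

definition amod_ker :: "('a, 'z) alg_scheme \<Rightarrow> ('a, 'v) amod \<Rightarrow> 'a set" where
  "amod_ker A M = {a \<in> car A. \<forall>v\<in>vcar M. act M a v = vz M}"

text \<open>Primitive ideals. Every algebraically irreducible module is isomorphic to
  a quotient A/L, hence to a module whose elements are subsets of the algebra
  (this fixes the carrier type of the modules).\<close>
definition Prim :: "('a, 'z) alg_scheme \<Rightarrow> 'a set set" where
  "Prim A = {P. \<exists>M :: ('a, 'a set) amod. alg_irred_rep A M \<and> P = amod_ker A M}"

definition semisimple_ideal :: "('a, 'z) alg_scheme \<Rightarrow> 'a set \<Rightarrow> bool" where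
  "semisimple_ideal A I \<longleftrightarrow> (\<exists>S \<subseteq> Prim A. S \<noteq> {} \<and> I = \<Inter>S)"

definition Prim_s :: "('a, 'z) alg_scheme \<Rightarrow> 'a set set" where
  "Prim_s A = {P. prime_ideal A P \<and> semisimple_ideal A P}"

definition hk_top :: "'a set set \<Rightarrow> 'a set topology" where
  "hk_top X = topology (\<lambda>U. U \<subseteq> X \<and> (\<forall>P\<in>X. \<Inter>(X - U) \<subseteq> P \<longrightarrow> P \<in> X - U))"

definition qnorm :: "('a, 'z) bsalg_scheme \<Rightarrow> 'a \<Rightarrow> 'a set \<Rightarrow> real" where
  "qnorm A a P = Inf ((\<lambda>p. nm A (ad A a p)) ` P)"

text \<open>Spectral synthesis in the sense of the paper. Nets are rendered as proper
  filters on Prim(A) (the image filter of a net), liminf as Liminf along the filter.\<close>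
definition spectral_synthesis :: "('a, 'z) bsalg_scheme \<Rightarrow> bool" where
  "spectral_synthesis A \<longleftrightarrow>
     locally_compact_space (hk_top (Prim_s A)) \<and>
     (\<forall>F :: 'a set filter. \<forall>P\<in>Prim A. \<forall>a\<in>car A - P.
        F \<noteq> bot \<and> eventually (\<lambda>Q. Q \<in> Prim A) F \<and> limitin (hk_top (Prim A)) (\<lambda>Q. Q) P F
        \<longrightarrow> Liminf F (\<lambda>Q. ereal (qnorm A a Q)) > 0) \<and>
     (\<forall>I. closed_ideal A I \<and> I \<noteq> car A \<longrightarrow> semisimple_ideal A I)"

text \<open>Hilbert spaces are realised as l2(J), J a subset of the algebra's type; every
  cyclic (in particular every irreducible) *-representation lives on a Hilbert space of
  dimension at most |A|, and every *-representation is a direct sum of cyclic ones.\<close>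

definition l2 :: "'a set \<Rightarrow> ('a \<Rightarrow> complex) set" where
  "l2 J = {f. (\<forall>i. i \<notin> J \<longrightarrow> f i = 0) \<and> (\<lambda>i. (cmod (f i))\<^sup>2) summable_on J}"

definition l2ip :: "('a \<Rightarrow> complex) \<Rightarrow> ('a \<Rightarrow> complex) \<Rightarrow> complex" where
  "l2ip f g = (\<Sum>\<^sub>\<infinity>i. f i * cnj (g i))"

definition l2nrm :: "('a \<Rightarrow> complex) \<Rightarrow> real" where
  "l2nrm f = sqrt (\<Sum>\<^sub>\<infinity>i. (cmod (f i))\<^sup>2)"

definition bounded_op :: "'a set \<Rightarrow> (('a \<Rightarrow> complex) \<Rightarrow> ('a \<Rightarrow> complex)) \<Rightarrow> bool" where
  "bounded_op J T \<longleftrightarrow> (\<forall>f\<in>l2 J. T f \<in> l2 J) \<and>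
     (\<forall>f\<in>l2 J. \<forall>g\<in>l2 J. T (\<lambda>i. f i + g i) = (\<lambda>i. T f i + T g i)) \<and>
     (\<forall>c. \<forall>f\<in>l2 J. T (\<lambda>i. c * f i) = (\<lambda>i. c * T f i)) \<and>
     (\<exists>K. \<forall>f\<in>l2 J. l2nrm (T f) \<le> K * l2nrm f)"

definition opnrm :: "'a set \<Rightarrow> (('a \<Rightarrow> complex) \<Rightarrow> ('a \<Rightarrow> complex)) \<Rightarrow> real" where
  "opnrm J T = Sup {l2nrm (T f) | f. f \<in> l2 J \<and> l2nrm f \<le> 1}"

definition star_rep :: "('a, 'z) bsalg_scheme \<Rightarrow> 'a set \<Rightarrow> ('a \<Rightarrow> ('a \<Rightarrow> complex) \<Rightarrow> ('a \<Rightarrow> complex)) \<Rightarrow> bool" where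
  "star_rep A J \<pi> \<longleftrightarrow> (\<forall>a\<in>car A. bounded_op J (\<pi> a)) \<and>
     (\<forall>a\<in>car A. \<forall>b\<in>car A. \<forall>f\<in>l2 J. \<pi> (ad A a b) f = (\<lambda>i. \<pi> a f i + \<pi> b f i)) \<and>
     (\<forall>c. \<forall>a\<in>car A. \<forall>f\<in>l2 J. \<pi> (sm A c a) f = (\<lambda>i. c * \<pi> a f i)) \<and>
     (\<forall>a\<in>car A. \<forall>b\<in>car A. \<forall>f\<in>l2 J. \<pi> (mu A a b) f = \<pi> a (\<pi> b f)) \<and>
     (\<forall>a\<in>car A. \<forall>f\<in>l2 J. \<forall>g\<in>l2 J. l2ip (\<pi> a f) g = l2ip f (\<pi> (st A a) g))"

definition rep_ker :: "('a, 'z) bsalg_scheme \<Rightarrow> 'a set \<Rightarrow> ('a \<Rightarrow> ('a \<Rightarrow> complex) \<Rightarrow> ('a \<Rightarrow> complex)) \<Rightarrow> 'a set" where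
  "rep_ker A J \<pi> = {a \<in> car A. \<forall>f\<in>l2 J. \<pi> a f = (\<lambda>i. 0)}"

definition closed_subspace :: "'a set \<Rightarrow> ('a \<Rightarrow> complex) set \<Rightarrow> bool" where
  "closed_subspace J S \<longleftrightarrow> S \<subseteq> l2 J \<and> (\<lambda>i. 0) \<in> S \<and>
     (\<forall>f\<in>S. \<forall>g\<in>S. (\<lambda>i. f i + g i) \<in> S) \<and> (\<forall>c. \<forall>f\<in>S. (\<lambda>i. c * f i) \<in> S) \<and>
     (\<forall>x y. (\<forall>n. x n \<in> S) \<and> y \<in> l2 J \<and> (\<lambda>n. l2nrm (\<lambda>i. x n i - y i)) \<longlonglongrightarrow> 0 \<longrightarrow> y \<in> S)"

definition irred_star_rep :: "('a, 'z) bsalg_scheme \<Rightarrow> 'a set \<Rightarrow> ('a \<Rightarrow> ('a \<Rightarrow> complex) \<Rightarrow> ('a \<Rightarrow> complex)) \<Rightarrow> bool" where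
  "irred_star_rep A J \<pi> \<longleftrightarrow> star_rep A J \<pi> \<and>
     (\<exists>a\<in>car A. \<exists>f\<in>l2 J. \<pi> a f \<noteq> (\<lambda>i. 0)) \<and>
     (\<forall>S. closed_subspace J S \<and> (\<forall>a\<in>car A. \<forall>f\<in>S. \<pi> a f \<in> S) \<longrightarrow> S = {\<lambda>i. 0} \<or> S = l2 J)"

definition Prim_star :: "('a, 'z) bsalg_scheme \<Rightarrow> 'a set set" where
  "Prim_star A = {rep_ker A J \<pi> | J \<pi>. irred_star_rep A J \<pi>}"

definition star_semisimple :: "('a, 'z) bsalg_scheme \<Rightarrow> bool" where
  "star_semisimple A \<longleftrightarrow> \<Inter>{rep_ker A J \<pi> | J \<pi>. star_rep A J \<pi>} = {zer A}"

definition qinv :: "('a, 'z) alg_scheme \<Rightarrow> 'a \<Rightarrow> bool" where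
  "qinv A b \<longleftrightarrow> (\<exists>c\<in>car A. sub A (ad A b c) (mu A b c) = zer A \<and> sub A (ad A b c) (mu A c b) = zer A)"

definition unital :: "('a, 'z) alg_scheme \<Rightarrow> bool" where
  "unital A \<longleftrightarrow> (\<exists>e\<in>car A. \<forall>x\<in>car A. mu A e x = x \<and> mu A x e = x)"

definition invertible_el :: "('a, 'z) alg_scheme \<Rightarrow> 'a \<Rightarrow> bool" where
  "invertible_el A a \<longleftrightarrow> (\<exists>e\<in>car A. (\<forall>x\<in>car A. mu A e x = x \<and> mu A x e = x) \<and>
      (\<exists>b\<in>car A. mu A a b = e \<and> mu A b a = e))"

text \<open>Spectrum (in A if unital, in the unitization otherwise).\<close>
definition spectrum :: "('a, 'z) alg_scheme \<Rightarrow> 'a \<Rightarrow> complex set" where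
  "spectrum A a = {z. z \<noteq> 0 \<and> \<not> qinv A (sm A (inverse z) a)} \<union>
                  {z. z = 0 \<and> (unital A \<longrightarrow> \<not> invertible_el A a)}"

definition hermitian :: "('a, 'z) bsalg_scheme \<Rightarrow> bool" where
  "hermitian A \<longleftrightarrow> (\<forall>a\<in>car A. st A a = a \<longrightarrow> spectrum A a \<subseteq> \<real>)"

definition gamma :: "('a, 'z) bsalg_scheme \<Rightarrow> 'a \<Rightarrow> real" where
  "gamma A a = Sup {opnrm J (\<pi> a) | J \<pi>. star_rep A J \<pi>}"

definition gcauchy :: "('a, 'z) bsalg_scheme \<Rightarrow> (nat \<Rightarrow> 'a) \<Rightarrow> bool" where
  "gcauchy A x \<longleftrightarrow> (\<forall>n. x n \<in> car A) \<and>
     (\<forall>e>0. \<exists>N. \<forall>m\<ge>N. \<forall>n\<ge>N. gamma A (sub A (x m) (x n)) < e)"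

definition gcls :: "('a, 'z) bsalg_scheme \<Rightarrow> (nat \<Rightarrow> 'a) \<Rightarrow> (nat \<Rightarrow> 'a) set" where
  "gcls A x = {y. gcauchy A y \<and> (\<lambda>n. gamma A (sub A (x n) (y n))) \<longlonglongrightarrow> 0}"

definition grep :: "(nat \<Rightarrow> 'a) set \<Rightarrow> nat \<Rightarrow> 'a" where
  "grep X = (SOME x. x \<in> X)"

text \<open>C*(A): completion of A (modulo the kernel of gamma) in the maximal C*-norm,
  realised as classes of gamma-Cauchy sequences.\<close>
definition Cstar :: "('a, 'z) bsalg_scheme \<Rightarrow> (nat \<Rightarrow> 'a) set alg" where
  "Cstar A = \<lparr> car = {gcls A x | x. gcauchy A x},
               zer = gcls A (\<lambda>n. zer A),
               ad = (\<lambda>X Y. gcls A (\<lambda>n. ad A (grep X n) (grep Y n))),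
               sm = (\<lambda>c X. gcls A (\<lambda>n. sm A c (grep X n))),
               mu = (\<lambda>X Y. gcls A (\<lambda>n. mu A (grep X n) (grep Y n))) \<rparr>"

definition cembed :: "('a, 'z) bsalg_scheme \<Rightarrow> 'a \<Rightarrow> (nat \<Rightarrow> 'a) set" where
  "cembed A a = gcls A (\<lambda>n. a)"

definition star_regular :: "('a, 'z) bsalg_scheme \<Rightarrow> bool" where
  "star_regular A \<longleftrightarrow>
     homeomorphic_map (hk_top (Prim (Cstar A))) (hk_top (Prim_star A))
       (\<lambda>P. {a \<in> car A. cembed A a \<in> P})"

definition hull_star :: "('a, 'z) bsalg_scheme \<Rightarrow> 'a set \<Rightarrow> 'a set set" where
  "hull_star A I = {P \<in> Prim_star A. I \<subseteq> P}"

definition usual_spectral_synthesis :: "('a, 'z) bsalg_scheme \<Rightarrow> bool" where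
  "usual_spectral_synthesis A \<longleftrightarrow>
     (\<forall>C. closedin (hk_top (Prim_star A)) C \<longrightarrow>
        (\<exists>!I. closed_ideal A I \<and> hull_star A I = C))"

end

theory Submission
  imports Defs "HOL-Computational_Algebra.Fundamental_Theorem_Algebra" "HOL-Library.Function_Algebras"
begin

text \<open>
In a hermitian algebra every primitive ideal \<open>Q\<close> is the kernel of a *-representation: by the Shirali-Ford
theorem and Hahn-Banach, the annihilator of a vector of the irreducible module lies in the null space of
a state, and the GNS construction applies. By *-regularity such a kernel is the intersection of the
elements of \<open>Prim\<^sub>*(A)\<close> containing it; conversely every element of \<open>Prim\<^sub>*(A)\<close> is an intersection of
primitive ideals, since \<open>h\<^sup>2/s\<^sup>2\<close> is not quasi-invertible modulo \<open>ker \<pi>\<close> when \<open>h\<close> is self-adjoint and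
\<open>s = \<parallel>\<pi>(h)\<parallel>\<close>. So condition (iii) says precisely that a closed ideal is determined by its hull in
\<open>Prim\<^sub>*(A)\<close>.

Conditions (i) and (ii) are in fact automatic. If \<open>\<pi>(h) \<noteq> 0\<close>, functional calculus in \<open>C*(A)\<close> and
*-regularity give \<open>d > 0\<close> such that the primitive ideals \<open>Q\<close> contained in the kernel of an irreducible
\<open>\<pi>'\<close> with \<open>\<parallel>\<pi>'(h)\<parallel> > d\<close> contain a neighbourhood of \<open>ker \<pi>\<close>. With \<open>h = a\<^sup>* a\<close> the quotient norm of \<open>a\<close>
modulo such \<open>Q\<close> is at least \<open>d / \<parallel>a\<^sup>*\<parallel>\<close>; and the set of \<open>P\<close> modulo which \<open>h\<^sup>2/s\<^sup>2\<close> is not left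
quasi-invertible for some \<open>s\<close> in \<open>[d, \<parallel>h\<parallel>]\<close> is a compact neighbourhood.
\<close>

section \<open>The Hilbert space l2(J) and its bounded operators\<close>

text \<open>\<open>Prim\<close> is defined through abstract modules, \<open>Prim_star\<close> and
  \<open>Cstar\<close> through Hilbert spaces, and no continuity links the two: neither the
  involution nor a *-representation is assumed to be continuous. The link is left
  quasi-invertibility modulo an ideal (\<open>lqi\<close>): it is purely algebraic, monotone in the
  ideal, stable under small changes in norm, and its failure is always witnessed by a primitive
  ideal (\<open>ex_Prim_not_lqi\<close>). The square \<open>h^2\<close> occurs because a
  self-adjoint operator of norm \<open>s\<close> has \<open>s\<close> or \<open>-s\<close> in its
  spectrum, and only for the square is the extreme value \<open>s^2\<close> known. The same device
  yields contractivity of *-representations modulo their kernels and closedness of these kernels; in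
  \<open>Cstar\<close>, whose elements are classes of sequences, it is used in a quantitative form
  that survives limits. The possibly discontinuous involution also shapes the square root lemma
  behind the Shirali-Ford theorem, where a limit of self-adjoint elements must be shown to be
  self-adjoint by algebra.\<close>

lemma nonneg_quadratic_imp_cmod_le:
  fixes c :: complex
  assumes q: "\<And>t::complex. 0 \<le> a + 2 * Re (t * c) + (cmod t)\<^sup>2 * b" and a: "0 \<le> a" and b: "0 \<le> b"
  shows "(cmod c)\<^sup>2 \<le> a * b"
proof (cases "b = 0")
  case True
  have "c = 0"
  proof (rule ccontr)
    assume c: "c \<noteq> 0"
    \<comment> \<open>This multiple makes the expression equal to
      \<open>a - (a + 1) = -1\<close>.\<close>
    define r where "r = (a + 1) / (2 * (cmod c)\<^sup>2)"
    have "Re ((- of_real r * cnj c) * c) = - r * (cmod c)\<^sup>2"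
      by (simp add: cmod_power2) (simp add: power2_eq_square algebra_simps)
    with q[of "- of_real r * cnj c"] True have "0 \<le> a + 2 * (- r * (cmod c)\<^sup>2)" by simp
    also have "\<dots> = - 1" using c by (simp add: r_def field_simps)
    finally show False by simp
  qed
  then show ?thesis using True by simp
next
  case False
  then have b: "b > 0" using b by simp
  \<comment> \<open>\<open>t = - cnj c / b\<close> is the minimiser of the quadratic, with minimum
    \<open>a - (cmod c)^2 / b\<close>.\<close>
  have e: "Re ((- cnj c / of_real b) * c) = - (cmod c)\<^sup>2 / b"
    by (simp add: cmod_power2) (simp add: power2_eq_square algebra_simps add_divide_distrib diff_divide_distrib)
  have "cmod (- cnj c / of_real b) = cmod c / b" using b by (simp add: norm_divide)
  with q[of "- cnj c / of_real b"]
  have "0 \<le> a + 2 * (- (cmod c)\<^sup>2 / b) + (cmod c / b)\<^sup>2 * b" unfolding e by metis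
  also have "\<dots> = a - (cmod c)\<^sup>2 / b" using b by (simp add: power2_eq_square field_simps)
  finally show ?thesis using b by (simp add: field_simps)
qed

text \<open>\<open>l2\<close> sums over \<open>J\<close>, but \<open>l2ip\<close> and
  \<open>l2nrm\<close> sum over the whole type; entries outside \<open>J\<close> vanish, so the
  index set \<open>UNIV\<close> can serve everywhere.\<close>

lemma l2_iff: "f \<in> l2 J \<longleftrightarrow> (\<forall>i. i \<notin> J \<longrightarrow> f i = 0) \<and> (\<lambda>i. (cmod (f i))\<^sup>2) summable_on UNIV"
proof -
  have "(\<forall>i. i \<notin> J \<longrightarrow> f i = 0) \<Longrightarrow>
    (\<lambda>i. (cmod (f i))\<^sup>2) summable_on J \<longleftrightarrow> (\<lambda>i. (cmod (f i))\<^sup>2) summable_on UNIV"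
    by (rule summable_on_cong_neutral) auto
  then show ?thesis unfolding l2_def by auto
qed

lemma l2_mono: "J \<subseteq> K \<Longrightarrow> l2 J \<subseteq> l2 K"
  unfolding l2_iff subset_iff by blast

lemma l2_zero [simp]: "(\<lambda>i. 0) \<in> l2 J"
  by (simp add: l2_iff)

lemma l2_summable_mult:
  assumes "f \<in> l2 J" "g \<in> l2 K"
  shows "(\<lambda>i. f i * cnj (g i)) summable_on UNIV"
proof (rule abs_summable_summable, rule summable_on_comparison_test)
  show "(\<lambda>i. (cmod (f i))\<^sup>2 + (cmod (g i))\<^sup>2) summable_on UNIV"
    using assms by (auto intro!: summable_on_add simp: l2_iff)
  fix i
  have "2 * (cmod (f i) * cmod (g i)) \<le> (cmod (f i))\<^sup>2 + (cmod (g i))\<^sup>2"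
    using sum_squares_bound[of "cmod (f i)" "cmod (g i)"] by simp
  moreover have "0 \<le> cmod (f i) * cmod (g i)" by simp
  ultimately show "cmod (f i * cnj (g i)) \<le> (cmod (f i))\<^sup>2 + (cmod (g i))\<^sup>2"
    unfolding norm_mult complex_mod_cnj by linarith
qed auto

lemma l2_scale [intro]: "f \<in> l2 J \<Longrightarrow> (\<lambda>i. c * f i) \<in> l2 J"
  by (auto simp: l2_iff norm_mult power_mult_distrib intro: summable_on_cmult_right)

lemma l2_add [intro]:
  assumes "f \<in> l2 J" "g \<in> l2 J"
  shows "(\<lambda>i. f i + g i) \<in> l2 J"
proof -
  have "(\<lambda>i. (cmod (f i + g i))\<^sup>2) summable_on UNIV"
  proof (rule summable_on_comparison_test)
    show "(\<lambda>i. 2 * (cmod (f i))\<^sup>2 + 2 * (cmod (g i))\<^sup>2) summable_on UNIV"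
      using assms by (intro summable_on_add summable_on_cmult_right) (auto simp: l2_iff)
    fix i
    have "(cmod (f i + g i))\<^sup>2 \<le> (cmod (f i) + cmod (g i))\<^sup>2"
      by (intro power_mono norm_triangle_ineq) auto
    also have "\<dots> \<le> 2 * (cmod (f i))\<^sup>2 + 2 * (cmod (g i))\<^sup>2"
      using sum_squares_bound[of "cmod (f i)" "cmod (g i)"] by (simp add: power2_sum)
    finally show "(cmod (f i + g i))\<^sup>2 \<le> 2 * (cmod (f i))\<^sup>2 + 2 * (cmod (g i))\<^sup>2" .
  qed auto
  then show ?thesis using assms by (auto simp: l2_iff)
qed

lemma l2_diff [intro]: "f \<in> l2 J \<Longrightarrow> g \<in> l2 J \<Longrightarrow> (\<lambda>i. f i - g i) \<in> l2 J"
  using l2_add[of f J "\<lambda>i. (-1) * g i"] l2_scale[of g J "-1"] by simp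

lemma l2ip_cnj: "l2ip g f = cnj (l2ip f g)"
  unfolding l2ip_def infsum_cnj[symmetric] by (simp add: mult.commute)

lemma l2ip_add_left:
  assumes "f \<in> l2 J" "g \<in> l2 J" "h \<in> l2 K"
  shows "l2ip (\<lambda>i. f i + g i) h = l2ip f h + l2ip g h"
  unfolding l2ip_def distrib_right
  by (intro infsum_add l2_summable_mult[OF assms(1,3)] l2_summable_mult[OF assms(2,3)])

lemma l2ip_scale_left: "l2ip (\<lambda>i. c * f i) h = c * l2ip f h"
  unfolding l2ip_def mult.assoc by (rule infsum_cmult_right')

lemma l2ip_diff_left:
  assumes "f \<in> l2 J" "g \<in> l2 J" "h \<in> l2 K"
  shows "l2ip (\<lambda>i. f i - g i) h = l2ip f h - l2ip g h"
  using l2ip_add_left[of f J "\<lambda>i. (-1) * g i" h K] l2ip_scale_left[of "-1" g h] assms l2_scale[of g J "-1"]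
  by simp

lemma l2ip_add_right:
  assumes "f \<in> l2 J" "g \<in> l2 J" "h \<in> l2 K"
  shows "l2ip h (\<lambda>i. f i + g i) = l2ip h f + l2ip h g"
  using l2ip_add_left[OF assms] by (metis complex_cnj_add l2ip_cnj)

lemma l2ip_diff_right:
  assumes "f \<in> l2 J" "g \<in> l2 J" "h \<in> l2 K"
  shows "l2ip h (\<lambda>i. f i - g i) = l2ip h f - l2ip h g"
  using l2ip_diff_left[OF assms] by (metis complex_cnj_diff l2ip_cnj)

lemma l2ip_scale_right: "l2ip h (\<lambda>i. c * f i) = cnj c * l2ip h f"
  by (metis complex_cnj_mult l2ip_cnj l2ip_scale_left)

lemma l2ip_zero [simp]: "l2ip (\<lambda>i. 0) h = 0" "l2ip h (\<lambda>i. 0) = 0"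
  by (simp_all add: l2ip_def)

lemma l2nrm_ge0 [simp]: "0 \<le> l2nrm f"
  by (simp add: l2nrm_def infsum_nonneg)

lemma l2nrm_sq: "(l2nrm f)\<^sup>2 = (\<Sum>\<^sub>\<infinity>i. (cmod (f i))\<^sup>2)"
  by (simp add: l2nrm_def infsum_nonneg)

lemma l2ip_self: "l2ip f f = of_real ((l2nrm f)\<^sup>2)"
proof -
  have "l2ip f f = (\<Sum>\<^sub>\<infinity>i. complex_of_real ((cmod (f i))\<^sup>2))"
    unfolding l2ip_def by (simp only: complex_norm_square)
  also have "\<dots> = of_real (\<Sum>\<^sub>\<infinity>i. (cmod (f i))\<^sup>2)"
  proof (cases "(\<lambda>i. (cmod (f i))\<^sup>2) summable_on UNIV")
    case True
    then have "((\<lambda>i. (cmod (f i))\<^sup>2) has_sum (\<Sum>\<^sub>\<infinity>i. (cmod (f i))\<^sup>2)) UNIV" by simp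
    then show ?thesis using has_sum_of_real infsumI by blast
  next
    \<comment> \<open>Without summability both infinite sums take the default value 0, so the
      identity needs no membership in \<open>l2\<close>.\<close>
    case False
    then have "\<not> (\<lambda>i. complex_of_real ((cmod (f i))\<^sup>2)) summable_on UNIV"
      using summable_on_Re by fastforce
    then show ?thesis using False by (simp add: infsum_not_exists del: of_real_power)
  qed
  finally show ?thesis by (simp add: l2nrm_sq)
qed

lemma l2nrm_zero [simp]: "l2nrm (\<lambda>i. 0) = 0"
  by (simp add: l2nrm_def)

lemma l2nrm_eq_0: "f \<in> l2 J \<Longrightarrow> l2nrm f = 0 \<longleftrightarrow> f = (\<lambda>i. 0)"
proof
  assume f: "f \<in> l2 J" "l2nrm f = 0"
  then have "(\<Sum>\<^sub>\<infinity>i. (cmod (f i))\<^sup>2) = 0" by (metis l2nrm_sq power_zero_numeral)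
  then have "(cmod (f i))\<^sup>2 = 0" for i
    using nonneg_infsum_le_0D[of "\<lambda>i. (cmod (f i))\<^sup>2" UNIV i] f by (auto simp: l2_iff)
  then show "f = (\<lambda>i. 0)" by auto
qed simp

lemma l2nrm_scale: "l2nrm (\<lambda>i. c * f i) = cmod c * l2nrm f"
  by (simp add: l2nrm_def norm_mult power_mult_distrib infsum_cmult_right' real_sqrt_mult)

lemma l2nrm_minus_commute: "l2nrm (\<lambda>i. f i - g i) = l2nrm (\<lambda>i. g i - f i)"
  by (simp add: l2nrm_def norm_minus_commute)

lemma l2nrm_add_scale_sq:
  assumes "f \<in> l2 J" "g \<in> l2 J"
  shows "(l2nrm (\<lambda>i. f i + c * g i))\<^sup>2 = (l2nrm f)\<^sup>2 + 2 * Re (cnj c * l2ip f g) + (cmod c)\<^sup>2 * (l2nrm g)\<^sup>2"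
proof -
  have cg: "(\<lambda>i. c * g i) \<in> l2 J" using assms by auto
  have "l2ip (\<lambda>i. f i + c * g i) (\<lambda>i. f i + c * g i) =
     l2ip f f + (cnj c * l2ip f g + cnj (cnj c * l2ip f g)) + c * (cnj c * l2ip g g)"
    using assms cg
    by (simp add: l2ip_add_left[of _ J _ _ J] l2ip_add_right[of _ J _ _ J] l2ip_scale_left
        l2ip_scale_right l2_add algebra_simps l2ip_cnj[of f g])
  also have "c * (cnj c * l2ip g g) = of_real ((cmod c)\<^sup>2 * (l2nrm g)\<^sup>2)"
    by (simp add: l2ip_self complex_norm_square mult.assoc[symmetric] del: of_real_power)
  also have "cnj c * l2ip f g + cnj (cnj c * l2ip f g) = of_real (2 * Re (cnj c * l2ip f g))"
    by (rule complex_add_cnj)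
  finally show ?thesis
    by (simp only: l2ip_self of_real_eq_iff of_real_add[symmetric])
qed

lemma l2ip_Cauchy_Schwarz:
  assumes "f \<in> l2 J" "g \<in> l2 J"
  shows "cmod (l2ip f g) \<le> l2nrm f * l2nrm g"
proof -
  have "(cmod (l2ip f g))\<^sup>2 \<le> (l2nrm f)\<^sup>2 * (l2nrm g)\<^sup>2"
  proof (rule nonneg_quadratic_imp_cmod_le)
    fix t :: complex
    show "0 \<le> (l2nrm f)\<^sup>2 + 2 * Re (t * l2ip f g) + (cmod t)\<^sup>2 * (l2nrm g)\<^sup>2"
      using l2nrm_add_scale_sq[OF assms, of "cnj t"] by (metis complex_cnj_cnj complex_mod_cnj zero_le_power2)
  qed auto
  then show ?thesis
    by (metis l2nrm_ge0 mult_nonneg_nonneg power2_le_imp_le power_mult_distrib)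
qed

lemma l2nrm_triangle:
  assumes "f \<in> l2 J" "g \<in> l2 J"
  shows "l2nrm (\<lambda>i. f i + g i) \<le> l2nrm f + l2nrm g"
proof -
  have "(l2nrm (\<lambda>i. f i + g i))\<^sup>2 = (l2nrm f)\<^sup>2 + 2 * Re (l2ip f g) + (l2nrm g)\<^sup>2"
    using l2nrm_add_scale_sq[OF assms, of 1] by simp
  also have "\<dots> \<le> (l2nrm f + l2nrm g)\<^sup>2"
    using l2ip_Cauchy_Schwarz[OF assms] complex_Re_le_cmod[of "l2ip f g"] by (simp add: power2_sum)
  finally show ?thesis by (meson add_nonneg_nonneg l2nrm_ge0 power2_le_imp_le)
qed

lemma l2nrm_triangle_diff:
  assumes "f \<in> l2 J" "g \<in> l2 J"
  shows "l2nrm f \<le> l2nrm (\<lambda>i. f i - g i) + l2nrm g"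
  using l2nrm_triangle[of "\<lambda>i. f i - g i" J g] assms by auto

lemma cmod_le_l2nrm: "f \<in> l2 J \<Longrightarrow> cmod (f i) \<le> l2nrm f"
proof -
  assume f: "f \<in> l2 J"
  have "(\<Sum>j\<in>{i}. (cmod (f j))\<^sup>2) \<le> (\<Sum>\<^sub>\<infinity>j. (cmod (f j))\<^sup>2)"
    by (rule finite_sum_le_infsum) (use f in \<open>auto simp: l2_iff\<close>)
  then have "(cmod (f i))\<^sup>2 \<le> (l2nrm f)\<^sup>2" by (simp add: l2nrm_sq)
  then show ?thesis by (rule power2_le_imp_le) simp
qed

lemma l2_boundedI:
  assumes "\<And>i. i \<notin> J \<Longrightarrow> f i = 0" "0 \<le> B"
    and "\<And>F. finite F \<Longrightarrow> (\<Sum>i\<in>F. (cmod (f i))\<^sup>2) \<le> B\<^sup>2"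
  shows "f \<in> l2 J" "l2nrm f \<le> B"
proof -
  have s: "(\<lambda>i. (cmod (f i))\<^sup>2) summable_on UNIV"
    by (rule nonneg_bdd_above_summable_on) (use assms in \<open>auto intro!: bdd_aboveI\<close>)
  then show "f \<in> l2 J" using assms by (auto simp: l2_iff)
  have "(l2nrm f)\<^sup>2 \<le> B\<^sup>2"
    unfolding l2nrm_sq by (rule infsum_le_finite_sums[OF s]) (use assms in auto)
  then show "l2nrm f \<le> B" using assms power2_le_imp_le by blast
qed

lemma sum_cmod_le_l2nrm:
  assumes "f \<in> l2 J" "finite F"
  shows "(\<Sum>i\<in>F. (cmod (f i))\<^sup>2) \<le> (l2nrm f)\<^sup>2"
  unfolding l2nrm_sq by (rule finite_sum_le_infsum) (use assms in \<open>auto simp: l2_iff\<close>)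

text \<open>Coordinates are dominated by the norm, so a pointwise limit exists; a bound on finite
  partial sums survives the pointwise limit and bounds the tail.\<close>

lemma l2_complete:
  assumes x: "\<And>n. x n \<in> l2 J"
    and C: "\<And>e. e > 0 \<Longrightarrow> \<exists>N. \<forall>m\<ge>N. \<forall>n\<ge>N. l2nrm (\<lambda>i. x m i - x n i) < e"
  shows "\<exists>y\<in>l2 J. (\<lambda>n. l2nrm (\<lambda>i. x n i - y i)) \<longlonglongrightarrow> 0"
proof -
  have d: "(\<lambda>i. x m i - x n i) \<in> l2 J" for m n using x by auto
  have "Cauchy (\<lambda>n. x n i)" for i
    unfolding Cauchy_def dist_norm
    using C cmod_le_l2nrm[OF d] by (meson le_less_trans)
  then have "\<forall>i. \<exists>l. (\<lambda>n. x n i) \<longlonglongrightarrow> l"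
    using Cauchy_convergent convergent_def by blast
  then obtain y where y: "\<And>i. (\<lambda>n. x n i) \<longlonglongrightarrow> y i" by metis
  have y0: "y i = 0" if "i \<notin> J" for i
    using y[of i] x that by (auto simp: l2_iff LIMSEQ_const_iff)
  have tail: "(\<lambda>i. x m i - y i) \<in> l2 J \<and> l2nrm (\<lambda>i. x m i - y i) \<le> e"
    if N: "\<forall>n\<ge>N. l2nrm (\<lambda>i. x m i - x n i) < e" and e: "e > 0" for m N e
  proof -
    have "(\<Sum>i\<in>F. (cmod (x m i - y i))\<^sup>2) \<le> e\<^sup>2" if F: "finite F" for F
    proof (rule LIMSEQ_le_const2)
      show "(\<lambda>n. \<Sum>i\<in>F. (cmod (x m i - x n i))\<^sup>2) \<longlonglongrightarrow> (\<Sum>i\<in>F. (cmod (x m i - y i))\<^sup>2)"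
        by (intro tendsto_intros y)
      show "\<exists>N. \<forall>n\<ge>N. (\<Sum>i\<in>F. (cmod (x m i - x n i))\<^sup>2) \<le> e\<^sup>2"
      proof (intro exI allI impI)
        fix n assume "N \<le> n"
        then have "l2nrm (\<lambda>i. x m i - x n i) < e" using N by auto
        then have "(l2nrm (\<lambda>i. x m i - x n i))\<^sup>2 \<le> e\<^sup>2" by (intro power_mono) auto
        with sum_cmod_le_l2nrm[OF d F] show "(\<Sum>i\<in>F. (cmod (x m i - x n i))\<^sup>2) \<le> e\<^sup>2"
          using order_trans by blast
      qed
    qed
    with l2_boundedI[of J "\<lambda>i. x m i - y i" e] y0 x e show ?thesis
      by (auto simp: l2_iff)
  qed
  obtain N1 where N1: "\<forall>m\<ge>N1. \<forall>n\<ge>N1. l2nrm (\<lambda>i. x m i - x n i) < 1" using C[of 1] by auto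
  then have "(\<lambda>i. x N1 i - y i) \<in> l2 J" using tail[of N1 N1 1] by auto
  then have "(\<lambda>i. x N1 i - (x N1 i - y i)) \<in> l2 J" by (rule l2_diff[OF x])
  moreover have "(\<lambda>i. x N1 i - (x N1 i - y i)) = y" by auto
  ultimately have yl: "y \<in> l2 J" by metis
  have "(\<lambda>n. l2nrm (\<lambda>i. x n i - y i)) \<longlonglongrightarrow> 0"
  proof (rule LIMSEQ_I)
    fix e :: real assume e: "e > 0"
    obtain N where N: "\<forall>m\<ge>N. \<forall>n\<ge>N. l2nrm (\<lambda>i. x m i - x n i) < e/2" using C[of "e/2"] e by auto
    have "l2nrm (\<lambda>i. x n i - y i) \<le> e/2" if "n \<ge> N" for n using tail[of N n "e/2"] N e that by auto
    then show "\<exists>no. \<forall>n\<ge>no. norm (l2nrm (\<lambda>i. x n i - y i) - 0) < e"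
      using e by (intro exI[of _ N]) (auto intro: le_less_trans[of _ "e/2"])
  qed
  with yl show ?thesis by blast
qed

lemma l2ip_tendsto_left:
  assumes x: "\<And>n. x n \<in> l2 J" and y: "y \<in> l2 J" and g: "g \<in> l2 J"
    and l: "(\<lambda>n. l2nrm (\<lambda>i. x n i - y i)) \<longlonglongrightarrow> 0"
  shows "(\<lambda>n. l2ip (x n) g) \<longlonglongrightarrow> l2ip y g"
proof -
  have "(\<lambda>n. l2ip (x n) g - l2ip y g) \<longlonglongrightarrow> 0"
  proof (rule Lim_null_comparison)
    show "\<forall>\<^sub>F n in sequentially. norm (l2ip (x n) g - l2ip y g) \<le> l2nrm (\<lambda>i. x n i - y i) * l2nrm g"
    proof (intro always_eventually allI)
      fix n
      have "(\<lambda>i. x n i - y i) \<in> l2 J" using x y by auto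
      from l2ip_Cauchy_Schwarz[OF this g]
      show "norm (l2ip (x n) g - l2ip y g) \<le> l2nrm (\<lambda>i. x n i - y i) * l2nrm g"
        using l2ip_diff_left[OF x[of n] y g] by simp
    qed
    show "(\<lambda>n. l2nrm (\<lambda>i. x n i - y i) * l2nrm g) \<longlonglongrightarrow> 0" using tendsto_mult_left_zero[OF l] .
  qed
  then show ?thesis using LIM_zero_iff by blast
qed

lemma l2nrm_tendsto:
  assumes x: "\<And>n. x n \<in> l2 J" and y: "y \<in> l2 J"
    and l: "(\<lambda>n. l2nrm (\<lambda>i. x n i - y i)) \<longlonglongrightarrow> 0"
  shows "(\<lambda>n. l2nrm (x n)) \<longlonglongrightarrow> l2nrm y"
proof -
  have "(\<lambda>n. l2nrm (x n) - l2nrm y) \<longlonglongrightarrow> 0"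
  proof (rule Lim_null_comparison[OF always_eventually l], intro allI)
    fix n
    show "norm (l2nrm (x n) - l2nrm y) \<le> l2nrm (\<lambda>i. x n i - y i)"
      using l2nrm_triangle_diff[OF x[of n] y] l2nrm_triangle_diff[OF y x[of n]] l2nrm_minus_commute[of y "x n"]
      by (simp add: abs_le_iff)
  qed
  then show ?thesis using LIM_zero_iff by blast
qed

text \<open>\<open>V\<close> need not be closed, so \<open>w\<close> is the limit of a minimising
  sequence in \<open>V\<close> for the energy \<open>E\<close>; the vanishing of the first variation
  at the minimum is the representation formula. The sequence is part of the conclusion because it
  places \<open>w\<close> in the closure of \<open>V\<close>. That \<open>\<psi>\<close> is
  conjugate-linear matches the second argument of \<open>l2ip\<close>.\<close>

lemma l2_subspace_Riesz:
  assumes V: "V \<subseteq> l2 J" "V \<noteq> {}"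
    and V_add: "\<And>f g. f \<in> V \<Longrightarrow> g \<in> V \<Longrightarrow> (\<lambda>i. f i + g i) \<in> V"
    and V_scale: "\<And>c f. f \<in> V \<Longrightarrow> (\<lambda>i. c * f i) \<in> V"
    and psi_add: "\<And>f g. f \<in> V \<Longrightarrow> g \<in> V \<Longrightarrow> \<psi> (\<lambda>i. f i + g i) = \<psi> f + \<psi> g"
    and psi_scale: "\<And>c f. f \<in> V \<Longrightarrow> \<psi> (\<lambda>i. c * f i) = cnj c * \<psi> f"
    and bd: "\<And>f. f \<in> V \<Longrightarrow> cmod (\<psi> f) \<le> C * l2nrm f" and C: "0 \<le> C"
  obtains w x where "w \<in> l2 J" "\<And>n::nat. x n \<in> V" "(\<lambda>n. l2nrm (\<lambda>i. x n i - w i)) \<longlonglongrightarrow> 0"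
    "\<And>f. f \<in> V \<Longrightarrow> l2ip w f = \<psi> f" "l2nrm w \<le> C"
proof -
  define E where "E f = (l2nrm f)\<^sup>2 - 2 * Re (\<psi> f)" for f
  have E_add: "E (\<lambda>i. f i + t * g i) = E f + 2 * Re (cnj t * (l2ip f g - \<psi> g)) + (cmod t)\<^sup>2 * (l2nrm g)\<^sup>2"
    if "f \<in> V" "g \<in> V" for f g t
  proof -
    have "\<psi> (\<lambda>i. f i + t * g i) = \<psi> f + cnj t * \<psi> g"
      using psi_add[OF that(1) V_scale[OF that(2)]] psi_scale[OF that(2)] by simp
    moreover have "f \<in> l2 J" "g \<in> l2 J" using V that by auto
    ultimately show ?thesis
      unfolding E_def using l2nrm_add_scale_sq[of f J g t] by (simp add: algebra_simps)
  qed
  have E_low: "- C\<^sup>2 \<le> E f" if "f \<in> V" for f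
  proof -
    have "Re (\<psi> f) \<le> C * l2nrm f" using bd[OF that] complex_Re_le_cmod[of "\<psi> f"] by linarith
    moreover have "0 \<le> (l2nrm f - C)\<^sup>2" by simp
    ultimately show ?thesis unfolding E_def by (simp add: power2_diff algebra_simps)
  qed
  define m where "m = Inf (E ` V)"
  have bdd: "bdd_below (E ` V)" using E_low by (rule bdd_belowI2)
  have m_le: "m \<le> E f" if "f \<in> V" for f unfolding m_def by (rule cInf_lower[OF _ bdd]) (use that in auto)
  have "\<exists>f\<in>V. E f < m + 1 / real (Suc n)" for n
  proof -
    have "Inf (E ` V) < m + 1 / real (Suc n)" unfolding m_def by simp
    then show ?thesis using cInf_less_iff[OF _ bdd] V by auto
  qed
  then obtain x where x: "\<And>n. x n \<in> V" "\<And>n. E (x n) < m + 1 / real (Suc n)" by metis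
  have xl: "x n \<in> l2 J" for n using x V by auto
  \<comment> \<open>Strict convexity: \<open>E\<close> at the midpoint \<open>g + d/2\<close> is the
    mean of \<open>E f\<close> and \<open>E g\<close> minus a quarter of the squared distance, and
    it is at least \<open>m\<close>.\<close>
  have par: "(l2nrm (\<lambda>i. f i - g i))\<^sup>2 \<le> 2 * (E f - m) + 2 * (E g - m)" if "f \<in> V" "g \<in> V" for f g
  proof -
    define d where "d = (\<lambda>i. f i + (-1) * g i)"
    have d: "d \<in> V" unfolding d_def by (intro V_add V_scale that)
    have f: "f = (\<lambda>i. g i + 1 * d i)" by (simp add: d_def)
    have h: "(\<lambda>i. g i + 1/2 * d i) \<in> V" by (intro V_add V_scale that d)
    have "E f = E g + 2 * Re (cnj 1 * (l2ip g d - \<psi> d)) + (cmod 1)\<^sup>2 * (l2nrm d)\<^sup>2"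
      by (subst f) (rule E_add[OF that(2) d])
    moreover have "E (\<lambda>i. g i + 1/2 * d i) =
        E g + 2 * Re (cnj (1/2) * (l2ip g d - \<psi> d)) + (cmod (1/2))\<^sup>2 * (l2nrm d)\<^sup>2"
      by (rule E_add[OF that(2) d])
    moreover have "l2nrm (\<lambda>i. f i - g i) = l2nrm d" by (simp add: d_def)
    ultimately show ?thesis using m_le[OF h] by (simp add: power2_eq_square algebra_simps)
  qed
  have "\<exists>w\<in>l2 J. (\<lambda>n. l2nrm (\<lambda>i. x n i - w i)) \<longlonglongrightarrow> 0"
  proof (rule l2_complete[OF xl])
    fix e :: real assume e: "e > 0"
    obtain N where N: "1 / real (Suc N) < e\<^sup>2 / 4" using e nat_approx_posE[of "e\<^sup>2/4"] by auto
    show "\<exists>N. \<forall>m\<ge>N. \<forall>n\<ge>N. l2nrm (\<lambda>i. x m i - x n i) < e"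
    proof (intro exI allI impI)
      fix k n assume kn: "N \<le> k" "N \<le> n"
      have *: "E (x j) - m < e\<^sup>2/4" if "N \<le> j" for j
      proof -
        have "1 / real (Suc j) \<le> 1 / real (Suc N)" using that by (simp add: frac_le)
        with x(2)[of j] N show ?thesis by linarith
      qed
      have "(l2nrm (\<lambda>i. x k i - x n i))\<^sup>2 < e\<^sup>2"
        using par[OF x(1)[of k] x(1)[of n]] *[OF kn(1)] *[OF kn(2)] by simp
      then show "l2nrm (\<lambda>i. x k i - x n i) < e" using e by (simp add: power2_less_imp_less)
    qed
  qed
  then obtain w where w: "w \<in> l2 J" and lim: "(\<lambda>n. l2nrm (\<lambda>i. x n i - w i)) \<longlonglongrightarrow> 0" by blast
  have eq: "l2ip w f = \<psi> f" if f: "f \<in> V" for f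
  proof -
    have fl: "f \<in> l2 J" using f V by auto
    have E_lim: "(\<lambda>n. E (x n)) \<longlonglongrightarrow> m"
    proof (rule tendsto_sandwich[OF always_eventually always_eventually])
      show "\<forall>n. m \<le> E (x n)" using m_le x by auto
      show "\<forall>n. E (x n) \<le> m + 1 / real (Suc n)" using x less_imp_le by auto
      show "(\<lambda>n. m + 1 / real (Suc n)) \<longlonglongrightarrow> m"
        using tendsto_add[OF tendsto_const LIMSEQ_Suc[OF lim_1_over_n]] by simp
    qed auto
    \<comment> \<open>Since \<open>E (x n)\<close> tends to the infimum \<open>m\<close>, no
      perturbation of the limit in the direction \<open>f\<close> lowers the energy: the quadratic
      in \<open>t\<close> has constant term 0, so its linear coefficient vanishes.\<close>
    have "(cmod (l2ip w f - \<psi> f))\<^sup>2 \<le> 0 * (l2nrm f)\<^sup>2"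
    proof (rule nonneg_quadratic_imp_cmod_le)
      fix t :: complex
      have "(\<lambda>n. E (x n) + 2 * Re (t * (l2ip (x n) f - \<psi> f)) + (cmod t)\<^sup>2 * (l2nrm f)\<^sup>2) \<longlonglongrightarrow>
         m + 2 * Re (t * (l2ip w f - \<psi> f)) + (cmod t)\<^sup>2 * (l2nrm f)\<^sup>2"
        by (intro tendsto_intros E_lim l2ip_tendsto_left[OF xl w fl lim])
      moreover have "m \<le> E (x n) + 2 * Re (t * (l2ip (x n) f - \<psi> f)) + (cmod t)\<^sup>2 * (l2nrm f)\<^sup>2" for n
        using E_add[OF x(1)[of n] f, of "cnj t"] m_le[OF V_add[OF x(1)[of n] V_scale[OF f, of "cnj t"]]] by simp
      ultimately have "m \<le> m + 2 * Re (t * (l2ip w f - \<psi> f)) + (cmod t)\<^sup>2 * (l2nrm f)\<^sup>2"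
        by (meson LIMSEQ_le_const)
      then show "0 \<le> 0 + 2 * Re (t * (l2ip w f - \<psi> f)) + (cmod t)\<^sup>2 * (l2nrm f)\<^sup>2" by simp
    qed auto
    then show ?thesis by simp
  qed
  have "l2nrm w \<le> C"
  proof -
    have wx: "(\<lambda>n. l2ip (x n) w) \<longlonglongrightarrow> l2ip w w" by (rule l2ip_tendsto_left[OF xl w w lim])
    have "cmod (l2ip (x n) w) \<le> C * l2nrm (x n)" for n
      using bd[OF x(1)[of n]] eq[OF x(1)[of n]] l2ip_cnj[of "x n" w] by simp
    then have "cmod (l2ip w w) \<le> C * l2nrm w"
      by (intro tendsto_le[OF _ tendsto_mult[OF tendsto_const l2nrm_tendsto[OF xl w lim]] tendsto_norm[OF wx]]) auto
    then have "(l2nrm w)\<^sup>2 \<le> C * l2nrm w" by (simp add: l2ip_self norm_mult norm_power)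
    then have "l2nrm w * (l2nrm w - C) \<le> 0" by (simp add: power2_eq_square algebra_simps)
    moreover have "0 < l2nrm w * (l2nrm w - C)" if "C < l2nrm w"
      using C that by (intro mult_pos_pos) auto
    ultimately show ?thesis by linarith
  qed
  note wC = this
  show thesis by (rule that[OF w x(1) lim eq wC])
qed

section \<open>Bounded operators and the operator norm\<close>

lemma bounded_opD:
  assumes "bounded_op J T"
  shows bounded_op_l2: "f \<in> l2 J \<Longrightarrow> T f \<in> l2 J"
    and bounded_op_add: "f \<in> l2 J \<Longrightarrow> g \<in> l2 J \<Longrightarrow> T (\<lambda>i. f i + g i) = (\<lambda>i. T f i + T g i)"
    and bounded_op_scale: "f \<in> l2 J \<Longrightarrow> T (\<lambda>i. c * f i) = (\<lambda>i. c * T f i)"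
  using assms unfolding bounded_op_def by auto

lemma bounded_op_diff:
  assumes "bounded_op J T" "f \<in> l2 J" "g \<in> l2 J"
  shows "T (\<lambda>i. f i - g i) = (\<lambda>i. T f i - T g i)"
  using bounded_op_add[OF assms(1,2) l2_scale[OF assms(3)], of "-1"] bounded_op_scale[OF assms(1,3), of "-1"]
  by simp

lemma bounded_op_bound:
  assumes "bounded_op J T"
  obtains K where "0 \<le> K" "\<And>f. f \<in> l2 J \<Longrightarrow> l2nrm (T f) \<le> K * l2nrm f"
proof -
  obtain K where K: "\<forall>f\<in>l2 J. l2nrm (T f) \<le> K * l2nrm f" using assms unfolding bounded_op_def by auto
  have "l2nrm (T f) \<le> max K 0 * l2nrm f" if "f \<in> l2 J" for f
    using K that mult_right_mono[of K "max K 0" "l2nrm f"] by force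
  then show thesis using that[of "max K 0"] by auto
qed

lemma opnrm_set_nonempty: "{l2nrm (T f) | f. f \<in> l2 J \<and> l2nrm f \<le> 1} \<noteq> {}"
proof -
  have "l2nrm (T (\<lambda>i. 0)) \<in> {l2nrm (T f) | f. f \<in> l2 J \<and> l2nrm f \<le> 1}"
    by (auto intro!: exI[of _ "\<lambda>i. 0"])
  then show ?thesis by blast
qed

lemma opnrm_bdd_above:
  assumes "bounded_op J T"
  shows "bdd_above {l2nrm (T f) | f. f \<in> l2 J \<and> l2nrm f \<le> 1}"
proof -
  obtain K where K: "0 \<le> K" "\<And>f. f \<in> l2 J \<Longrightarrow> l2nrm (T f) \<le> K * l2nrm f"
    using bounded_op_bound[OF assms] by auto
  show ?thesis
  proof (rule bdd_aboveI[of _ K])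
    fix y assume "y \<in> {l2nrm (T f) | f. f \<in> l2 J \<and> l2nrm f \<le> 1}"
    then obtain f where f: "f \<in> l2 J" "l2nrm f \<le> 1" "y = l2nrm (T f)" by auto
    then show "y \<le> K" using K(2)[of f] mult_left_mono[of "l2nrm f" 1 K] K(1) by auto
  qed
qed

lemma opnrm_bound:
  assumes T: "bounded_op J T" and f: "f \<in> l2 J"
  shows "l2nrm (T f) \<le> opnrm J T * l2nrm f"
proof (cases "l2nrm f = 0")
  case True
  then have "f = (\<lambda>i. 0)" using l2nrm_eq_0[OF f] by simp
  then have "T f = (\<lambda>i. 0)" using bounded_op_scale[OF T f, of 0] by simp
  then show ?thesis using True by simp
next
  case False
  then have p: "l2nrm f > 0" using l2nrm_ge0[of f] by linarith
  define u where "u = (\<lambda>i. of_real (inverse (l2nrm f)) * f i)"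
  have u: "u \<in> l2 J" "l2nrm u = 1" using f p by (auto simp: u_def l2nrm_scale simp flip: of_real_inverse)
  have "l2nrm (T u) \<le> opnrm J T"
    unfolding opnrm_def by (rule cSup_upper[OF _ opnrm_bdd_above[OF T]]) (use u in auto)
  moreover have "l2nrm (T u) = inverse (l2nrm f) * l2nrm (T f)"
    unfolding u_def bounded_op_scale[OF T f] using p by (simp add: l2nrm_scale flip: of_real_inverse)
  ultimately show ?thesis using p by (simp add: field_simps)
qed

lemma opnrm_le:
  assumes "\<And>f. f \<in> l2 J \<Longrightarrow> l2nrm (T f) \<le> K * l2nrm f" "0 \<le> K"
  shows "opnrm J T \<le> K"
  unfolding opnrm_def
proof (rule cSup_least[OF opnrm_set_nonempty])
  fix y assume "y \<in> {l2nrm (T f) | f. f \<in> l2 J \<and> l2nrm f \<le> 1}"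
  then obtain f where f: "f \<in> l2 J" "l2nrm f \<le> 1" "y = l2nrm (T f)" by auto
  then show "y \<le> K" using assms(1)[of f] mult_left_mono[of "l2nrm f" 1 K] assms(2) by auto
qed

lemma opnrm_ge0:
  assumes "bounded_op J T" shows "0 \<le> opnrm J T"
  unfolding opnrm_def
  by (rule cSup_upper2[OF _ _ opnrm_bdd_above[OF assms], of "l2nrm (T (\<lambda>i. 0))"])
    (auto intro!: exI[of _ "\<lambda>i. 0"])

lemma opnrm_eq_0:
  assumes "bounded_op J T" "opnrm J T = 0" "f \<in> l2 J"
  shows "T f = (\<lambda>i. 0)"
  using opnrm_bound[OF assms(1,3)] assms(2) l2nrm_eq_0[OF bounded_op_l2[OF assms(1,3)]] l2nrm_ge0[of "T f"]
  by simp

definition selfadjoint_op :: "'a set \<Rightarrow> (('a \<Rightarrow> complex) \<Rightarrow> ('a \<Rightarrow> complex)) \<Rightarrow> bool" where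
  "selfadjoint_op J T \<longleftrightarrow> bounded_op J T \<and> (\<forall>f\<in>l2 J. \<forall>g\<in>l2 J. l2ip (T f) g = l2ip f (T g))"

lemma selfadjoint_opD:
  assumes "selfadjoint_op J T"
  shows "bounded_op J T" "f \<in> l2 J \<Longrightarrow> g \<in> l2 J \<Longrightarrow> l2ip (T f) g = l2ip f (T g)"
  using assms unfolding selfadjoint_op_def by auto

text \<open>For a unit vector \<open>u\<close>, expanding the square bounds the squared norm of
  \<open>T (T u) - s^2 u\<close> by \<open>s^2 * (s^2 - (l2nrm (T u))^2)\<close>, which is small
  once \<open>l2nrm (T u)\<close> is close to the norm \<open>s\<close>. The sign of the extreme
  spectral value of \<open>T\<close> is unknown, hence the square.\<close>

lemma selfadjoint_approx_eigenvector:
  assumes T: "selfadjoint_op J T" and s: "opnrm J T > 0" and e: "e > 0"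
  shows "\<exists>f\<in>l2 J. l2nrm f = 1 \<and> l2nrm (\<lambda>i. T (T f) i - of_real ((opnrm J T)\<^sup>2) * f i) < e"
proof -
  note B = selfadjoint_opD(1)[OF T]
  define s where "s = opnrm J T"
  have s0: "s > 0" using assms s_def by simp
  \<comment> \<open>Solves \<open>s^2 * (s^2 - r^2) = e^2\<close>, truncated at 0 when
    \<open>e\<close> is large.\<close>
  define r where "r = sqrt (max 0 (s\<^sup>2 - (e/s)\<^sup>2))"
  have r: "0 \<le> r" "r < s"
  proof -
    have "max 0 (s\<^sup>2 - (e/s)\<^sup>2) < s\<^sup>2" using s0 e by simp
    then have "r < sqrt (s\<^sup>2)" unfolding r_def by (rule real_sqrt_less_mono)
    then show "r < s" using s0 by simp
  qed (simp add: r_def)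
  have "r < Sup {l2nrm (T f) | f. f \<in> l2 J \<and> l2nrm f \<le> 1}" using r(2) unfolding s_def opnrm_def .
  then obtain f where f: "f \<in> l2 J" "l2nrm f \<le> 1" "r < l2nrm (T f)"
    using less_cSupE[OF _ opnrm_set_nonempty] by blast
  have n0: "l2nrm f > 0"
  proof (rule ccontr)
    assume "\<not> l2nrm f > 0"
    then have "l2nrm f = 0" using l2nrm_ge0[of f] by linarith
    then show False using opnrm_bound[OF B f(1)] f(3) r(1) by simp
  qed
  define u where "u = (\<lambda>i. of_real (inverse (l2nrm f)) * f i)"
  have u: "u \<in> l2 J" "l2nrm u = 1" using f n0 by (auto simp: u_def l2nrm_scale simp flip: of_real_inverse)
  have "l2nrm (T u) = inverse (l2nrm f) * l2nrm (T f)"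
    unfolding u_def bounded_op_scale[OF B f(1)] using n0 by (simp add: l2nrm_scale flip: of_real_inverse)
  moreover have "1 * l2nrm (T f) \<le> inverse (l2nrm f) * l2nrm (T f)"
    using n0 f(2) by (intro mult_right_mono) (auto simp: one_le_inverse)
  ultimately have ru: "r < l2nrm (T u)" using f(3) by linarith
  have Tu: "T u \<in> l2 J" by (rule bounded_op_l2[OF B u(1)])
  have TTu: "T (T u) \<in> l2 J" by (rule bounded_op_l2[OF B Tu])
  note Tu = Tu TTu
  have "(l2nrm (\<lambda>i. T (T u) i + (- of_real (s\<^sup>2)) * u i))\<^sup>2 =
     (l2nrm (T (T u)))\<^sup>2 + 2 * Re (cnj (- of_real (s\<^sup>2)) * l2ip (T (T u)) u) + (cmod (- of_real (s\<^sup>2)))\<^sup>2 * (l2nrm u)\<^sup>2"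
    by (rule l2nrm_add_scale_sq) (use Tu u in auto)
  also have "l2ip (T (T u)) u = of_real ((l2nrm (T u))\<^sup>2)"
    using selfadjoint_opD(2)[OF T Tu(1) u(1)] l2ip_self by metis
  also have "(l2nrm (T (T u)))\<^sup>2 + 2 * Re (cnj (- of_real (s\<^sup>2)) * of_real ((l2nrm (T u))\<^sup>2)) +
     (cmod (- of_real (s\<^sup>2)))\<^sup>2 * (l2nrm u)\<^sup>2 = (l2nrm (T (T u)))\<^sup>2 - 2 * s\<^sup>2 * (l2nrm (T u))\<^sup>2 + s\<^sup>2 * s\<^sup>2"
    using u(2) by (simp add: norm_power norm_mult power2_eq_square)
  also have "\<dots> \<le> (s * l2nrm (T u))\<^sup>2 - 2 * s\<^sup>2 * (l2nrm (T u))\<^sup>2 + s\<^sup>2 * s\<^sup>2"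
  proof -
    have "l2nrm (T (T u)) \<le> s * l2nrm (T u)" using opnrm_bound[OF B Tu(1)] s_def by simp
    then have "(l2nrm (T (T u)))\<^sup>2 \<le> (s * l2nrm (T u))\<^sup>2" by (intro power_mono) auto
    then show ?thesis by simp
  qed
  also have "\<dots> = s\<^sup>2 * (s\<^sup>2 - (l2nrm (T u))\<^sup>2)" by (simp add: power_mult_distrib algebra_simps)
  also have "\<dots> < s\<^sup>2 * (e/s)\<^sup>2"
  proof -
    have "s\<^sup>2 - (e/s)\<^sup>2 \<le> r\<^sup>2" by (simp add: r_def)
    also have "\<dots> < (l2nrm (T u))\<^sup>2" using ru r(1) by (intro power_strict_mono) auto
    finally show ?thesis using s0 by (intro mult_strict_left_mono) auto
  qed
  also have "\<dots> = e\<^sup>2" using s0 by (simp add: power_divide)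
  finally have "l2nrm (\<lambda>i. T (T u) i - of_real (s\<^sup>2) * u i) < e"
    using e power2_less_imp_less[of _ e] by simp
  then show ?thesis using u s_def by blast
qed

section \<open>Polynomials in a self-adjoint operator\<close>

definition poly_op :: "complex poly \<Rightarrow> (('a \<Rightarrow> complex) \<Rightarrow> ('a \<Rightarrow> complex)) \<Rightarrow> ('a \<Rightarrow> complex) \<Rightarrow> ('a \<Rightarrow> complex)" where
  "poly_op p T f = (\<lambda>i. \<Sum>k\<le>degree p. coeff p k * (T ^^ k) f i)"

lemma poly_op_altdef:
  assumes "degree p \<le> n"
  shows "poly_op p T f = (\<lambda>i. \<Sum>k\<le>n. coeff p k * (T ^^ k) f i)"
  unfolding poly_op_def
  by (intro ext sum.mono_neutral_left) (use assms in \<open>auto simp: coeff_eq_0\<close>)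

lemma poly_op_0 [simp]: "poly_op 0 T f = (\<lambda>i. 0)"
  by (simp add: poly_op_def)

lemma poly_op_pCons: "poly_op (pCons a p) T f = (\<lambda>i. a * f i + poly_op p T (T f) i)"
proof -
  have "degree (pCons a p) \<le> Suc (degree p)" by (simp add: degree_pCons_eq_if)
  from poly_op_altdef[OF this, of T f] show ?thesis
    by (simp add: sum.atMost_Suc_shift poly_op_def funpow_swap1 del: sum.atMost_Suc)
qed

lemma poly_op_add: "poly_op (p + q) T f = (\<lambda>i. poly_op p T f i + poly_op q T f i)"
proof -
  define n where "n = max (degree p) (degree q)"
  have "degree p \<le> n" "degree q \<le> n" "degree (p + q) \<le> n" by (auto simp: n_def degree_add_le)
  then show ?thesis by (simp add: poly_op_altdef[where n = n] algebra_simps sum.distrib)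
qed

lemma poly_op_smult: "poly_op (smult c p) T f = (\<lambda>i. c * poly_op p T f i)"
  using poly_op_altdef[of "smult c p" "degree p" T f] degree_smult_le[of c p]
  by (simp add: poly_op_def sum_distrib_left mult.assoc)

lemma poly_op_bounded:
  assumes T: "bounded_op J T"
  shows "bounded_op J (poly_op p T)"
proof (induction p rule: pCons_induct)
  case 0
  show ?case by (auto simp: bounded_op_def intro: exI[of _ 0])
next
  case (pCons a p)
  obtain K where K: "0 \<le> K" "\<And>f. f \<in> l2 J \<Longrightarrow> l2nrm (T f) \<le> K * l2nrm f" using bounded_op_bound[OF T] by auto
  obtain L where L: "0 \<le> L" "\<And>f. f \<in> l2 J \<Longrightarrow> l2nrm (poly_op p T f) \<le> L * l2nrm f"
    using bounded_op_bound[OF pCons.IH] by auto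
  have b1: "l2nrm (\<lambda>i. a * f i + poly_op p T (T f) i) \<le> (cmod a + L * K) * l2nrm f" if f: "f \<in> l2 J" for f
  proof -
    have "l2nrm (\<lambda>i. a * f i + poly_op p T (T f) i) \<le> l2nrm (\<lambda>i. a * f i) + l2nrm (poly_op p T (T f))"
      by (rule l2nrm_triangle[of _ J])
        (use f bounded_op_l2[OF pCons.IH bounded_op_l2[OF T f]] in auto)
    also have "\<dots> \<le> cmod a * l2nrm f + L * (K * l2nrm f)"
      using order_trans[OF L(2)[OF bounded_op_l2[OF T f]] mult_left_mono[OF K(2)[OF f] L(1)]]
      by (simp add: l2nrm_scale)
    finally show ?thesis by (simp add: algebra_simps)
  qed
  have b2: "(\<lambda>i. a * f i + poly_op p T (T f) i) \<in> l2 J" if "f \<in> l2 J" for f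
    by (intro l2_add l2_scale that bounded_op_l2[OF pCons.IH] bounded_op_l2[OF T])
  have b3: "(\<lambda>i. a * (f i + g i) + poly_op p T (T (\<lambda>i. f i + g i)) i) =
      (\<lambda>i. (a * f i + poly_op p T (T f) i) + (a * g i + poly_op p T (T g) i))"
    if "f \<in> l2 J" "g \<in> l2 J" for f g
    using bounded_op_add[OF pCons.IH bounded_op_l2[OF T that(1)] bounded_op_l2[OF T that(2)]]
    by (simp add: bounded_op_add[OF T that] algebra_simps)
  have b4: "(\<lambda>i. a * (c * f i) + poly_op p T (T (\<lambda>i. c * f i)) i) =
      (\<lambda>i. c * (a * f i + poly_op p T (T f) i))" if "f \<in> l2 J" for f c
    using bounded_op_scale[OF pCons.IH bounded_op_l2[OF T that]]
    by (simp add: bounded_op_scale[OF T that] algebra_simps)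
  show ?case
    unfolding bounded_op_def poly_op_pCons
    by (intro conjI ballI allI exI[of _ "cmod a + L * K"]; (rule b1 b2 b3 b4; assumption))
qed

lemma poly_op_commute:
  assumes T: "bounded_op J T" and f: "f \<in> l2 J"
  shows "poly_op p T (T f) = T (poly_op p T f)"
  using f
proof (induction p arbitrary: f rule: pCons_induct)
  case 0
  then show ?case using bounded_op_scale[OF T l2_zero, of 0] by simp
next
  case (pCons a p)
  have Tf: "T f \<in> l2 J" using pCons.prems bounded_op_l2[OF T] by auto
  have "T (\<lambda>i. a * f i + poly_op p T (T f) i) = (\<lambda>i. T (\<lambda>i. a * f i) i + T (poly_op p T (T f)) i)"
    by (rule bounded_op_add[OF T]) (use pCons.prems bounded_op_l2[OF poly_op_bounded[OF T] Tf] in auto)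
  then show ?case
    using pCons.IH[OF Tf] bounded_op_scale[OF T pCons.prems] by (simp add: poly_op_pCons)
qed

lemma poly_op_mult:
  assumes T: "bounded_op J T" and f: "f \<in> l2 J"
  shows "poly_op (p * q) T f = poly_op p T (poly_op q T f)"
  using f
proof (induction p arbitrary: f rule: pCons_induct)
  case 0
  then show ?case by simp
next
  case (pCons a p)
  have Tf: "T f \<in> l2 J" using pCons.prems bounded_op_l2[OF T] by auto
  show ?case
    using pCons.IH[OF Tf] poly_op_commute[OF T pCons.prems]
    by (simp add: mult_pCons_left poly_op_add poly_op_smult poly_op_pCons)
qed

lemma selfadjoint_poly_op:
  assumes T: "selfadjoint_op J T"
  shows "selfadjoint_op J (poly_op (map_poly complex_of_real p) T)"
proof -
  note B = selfadjoint_opD(1)[OF T]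
  have "l2ip (poly_op (map_poly complex_of_real p) T f) g = l2ip f (poly_op (map_poly complex_of_real p) T g)"
    if "f \<in> l2 J" "g \<in> l2 J" for f g
    using that
  proof (induction p arbitrary: f g rule: pCons_induct)
    case (pCons a p)
    let ?q = "map_poly complex_of_real p"
    note l2s = pCons.prems bounded_op_l2[OF B] bounded_op_l2[OF poly_op_bounded[OF B]]
    have "l2ip (\<lambda>i. of_real a * f i + poly_op ?q T (T f) i) g = of_real a * l2ip f g + l2ip (poly_op ?q T (T f)) g"
      using l2s by (simp add: l2ip_add_left[of _ J _ _ J] l2ip_scale_left l2_scale)
    also have "l2ip (poly_op ?q T (T f)) g = l2ip (T f) (poly_op ?q T g)"
      by (rule pCons.IH) (use l2s in auto)
    also have "\<dots> = l2ip f (poly_op ?q T (T g))"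
      using selfadjoint_opD(2)[OF T] l2s poly_op_commute[OF B] by simp
    also have "of_real a * l2ip f g + \<dots> = l2ip f (\<lambda>i. of_real a * g i + poly_op ?q T (T g) i)"
      using l2s by (simp add: l2ip_add_right[of _ J _ _ J] l2ip_scale_right l2_scale)
    finally show ?case using pCons.hyps by (simp add: map_poly_pCons poly_op_pCons)
  qed simp
  then show ?thesis unfolding selfadjoint_op_def using poly_op_bounded[OF B] by auto
qed

text \<open>For real \<open>z\<close> the triangle inequality suffices. For nonreal \<open>z\<close>
  the quadratic form of \<open>T - Re z\<close> is real, so the cross term with the imaginary part
  drops out and Pythagoras gives the constant \<open>\<bar>Im z\<bar>\<close>.\<close>

lemma linear_factor_bounded_below:
  assumes T: "selfadjoint_op J T" and R: "opnrm J T \<le> R" and z: "\<And>x. \<bar>x\<bar> \<le> R \<Longrightarrow> z \<noteq> complex_of_real x"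
  shows "\<exists>c>0. \<forall>f\<in>l2 J. c * l2nrm f \<le> l2nrm (\<lambda>i. T f i - z * f i)"
proof (cases "Im z = 0")
  case True
  then have zr: "z = of_real (Re z)" by (simp add: complex_eq_iff)
  then have c: "cmod z - R > 0" using z[of "Re z"] by (metis norm_of_real linorder_not_le diff_gt_0_iff_gt)
  have "(cmod z - R) * l2nrm f \<le> l2nrm (\<lambda>i. T f i - z * f i)" if f: "f \<in> l2 J" for f
  proof -
    have "l2nrm (T f) \<le> R * l2nrm f"
      using opnrm_bound[OF selfadjoint_opD(1)[OF T] f] R mult_right_mono[OF R l2nrm_ge0[of f]] by linarith
    moreover have "l2nrm (\<lambda>i. z * f i) \<le> l2nrm (\<lambda>i. z * f i - T f i) + l2nrm (T f)"
      by (rule l2nrm_triangle_diff[of _ J]) (use f bounded_op_l2[OF selfadjoint_opD(1)[OF T] f] in auto)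
    ultimately show ?thesis
      using l2nrm_minus_commute[of "T f" "\<lambda>i. z * f i"] by (simp add: l2nrm_scale algebra_simps)
  qed
  then show ?thesis using c by blast
next
  case False
  have "\<bar>Im z\<bar> * l2nrm f \<le> l2nrm (\<lambda>i. T f i - z * f i)" if f: "f \<in> l2 J" for f
  proof -
    note B = selfadjoint_opD(1)[OF T]
    define h where "h = (\<lambda>i. T f i - of_real (Re z) * f i)"
    have Tf: "T f \<in> l2 J" using bounded_op_l2[OF B f] .
    have h: "h \<in> l2 J" unfolding h_def using f Tf by auto
    have "cnj (l2ip (T f) f) = l2ip (T f) f"
      using selfadjoint_opD(2)[OF T f f] l2ip_cnj[of f "T f"] by simp
    then have "Im (l2ip (T f) f) = 0" by (simp add: complex_eq_iff)
    moreover have "l2ip h f = l2ip (T f) f - of_real (Re z) * l2ip f f"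
      unfolding h_def using l2ip_diff_left[OF Tf _ f, of "\<lambda>i. of_real (Re z) * f i"] f l2ip_scale_left l2_scale by metis
    ultimately have im: "Im (l2ip h f) = 0" by (simp add: l2ip_self)
    have "(\<lambda>i. T f i - z * f i) = (\<lambda>i. h i + (- \<i> * of_real (Im z)) * f i)"
      by (rule ext, subst complex_eq[of z]) (simp add: h_def algebra_simps)
    then have "(l2nrm (\<lambda>i. T f i - z * f i))\<^sup>2 = (l2nrm h)\<^sup>2 + 2 * Re (cnj (- \<i> * of_real (Im z)) * l2ip h f)
        + (cmod (- \<i> * of_real (Im z)))\<^sup>2 * (l2nrm f)\<^sup>2"
      using l2nrm_add_scale_sq[OF h f, of "- \<i> * of_real (Im z)"] by (simp only:)
    also have "\<dots> = (l2nrm h)\<^sup>2 + (\<bar>Im z\<bar> * l2nrm f)\<^sup>2"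
      using im by (simp add: norm_mult power_mult_distrib)
    finally have "(\<bar>Im z\<bar> * l2nrm f)\<^sup>2 \<le> (l2nrm (\<lambda>i. T f i - z * f i))\<^sup>2" by simp
    then show ?thesis by (rule power2_le_imp_le) simp
  qed
  then show ?thesis using False by (intro exI[of _ "\<bar>Im z\<bar>"]) auto
qed

text \<open>The fundamental theorem of algebra splits off linear factors; each is bounded below, and
  the constants multiply.\<close>

lemma poly_op_bounded_below:
  assumes T: "selfadjoint_op J T" and R: "opnrm J T \<le> R"
    and "p \<noteq> 0" and "\<And>x. \<bar>x\<bar> \<le> R \<Longrightarrow> poly p (complex_of_real x) \<noteq> 0"
  shows "\<exists>c>0. \<forall>f\<in>l2 J. c * l2nrm f \<le> l2nrm (poly_op p T f)"
  using assms(3,4)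
proof (induction "degree p" arbitrary: p)
  case 0
  then obtain a where a: "p = [:a:]" "a \<noteq> 0" by (metis degree_eq_zeroE pCons_0_0)
  then show ?case by (intro exI[of _ "cmod a"]) (simp add: poly_op_pCons l2nrm_scale)
next
  case (Suc n)
  note B = selfadjoint_opD(1)[OF T]
  have "\<not> constant (poly p)" using Suc.hyps(2) by (simp add: constant_degree)
  then obtain z where "poly p z = 0" using fundamental_theorem_of_algebra by blast
  then obtain q where q: "p = [:-z, 1:] * q" by (metis poly_eq_0_iff_dvd dvdE)
  have q0: "q \<noteq> 0" using Suc.prems(1) q by auto
  have "degree p = Suc (degree q)" unfolding q using q0 by (subst degree_mult_eq) auto
  then have "n = degree q" using Suc.hyps(2) by simp
  then obtain c where c: "c > 0" "\<forall>f\<in>l2 J. c * l2nrm f \<le> l2nrm (poly_op q T f)"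
    using Suc.hyps(1)[of q] q0 Suc.prems(2) q by auto
  have "z \<noteq> complex_of_real x" if "\<bar>x\<bar> \<le> R" for x
    using Suc.prems(2)[OF that] q by auto
  then obtain d where d: "d > 0" "\<forall>f\<in>l2 J. d * l2nrm f \<le> l2nrm (\<lambda>i. T f i - z * f i)"
    using linear_factor_bounded_below[OF T R] by blast
  have "d * c * l2nrm f \<le> l2nrm (poly_op p T f)" if f: "f \<in> l2 J" for f
  proof -
    let ?g = "poly_op q T f"
    have g: "?g \<in> l2 J" using bounded_op_l2[OF poly_op_bounded[OF B] f] .
    have "poly_op p T f = (\<lambda>i. T ?g i - z * ?g i)"
      unfolding q poly_op_mult[OF B f] by (simp add: poly_op_pCons)
    then have "d * l2nrm ?g \<le> l2nrm (poly_op p T f)" using d(2) g by simp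
    moreover have "d * (c * l2nrm f) \<le> d * l2nrm ?g" using c(2) f d(1) by (intro mult_left_mono) auto
    ultimately show ?thesis by simp
  qed
  then show ?case using c d by (intro exI[of _ "d * c"]) auto
qed

lemma poly_map_poly_of_real: "poly (map_poly complex_of_real p) (complex_of_real x) = of_real (poly p x)"
  by (induction p) (simp_all add: map_poly_pCons)

text \<open>Stands in for the spectral theorem. If the norm \<open>s\<close> of \<open>p(T)\<close>
  exceeded \<open>M\<close>, then \<open>p^2 - s^2\<close> would have no root on
  \<open>[-R, R]\<close>, so its value at \<open>T\<close> would be bounded below, against the
  approximate eigenvectors of \<open>p(T)^2\<close> for \<open>s^2\<close>.\<close>

lemma opnrm_poly_op_le:
  fixes p :: "real poly"
  assumes T: "selfadjoint_op J T" and R: "opnrm J T \<le> R"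
    and M: "\<And>x. \<bar>x\<bar> \<le> R \<Longrightarrow> \<bar>poly p x\<bar> \<le> M"
  shows "opnrm J (poly_op (map_poly complex_of_real p) T) \<le> M"
proof (rule ccontr)
  note B = selfadjoint_opD(1)[OF T]
  let ?P = "map_poly complex_of_real p"
  let ?S = "poly_op ?P T"
  define s where "s = opnrm J ?S"
  assume "\<not> ?thesis"
  then have sM: "M < s" by (simp add: s_def)
  have "0 \<le> R" using R opnrm_ge0[OF B] by linarith
  then have M0: "0 \<le> M" using M[of 0] by simp
  let ?q = "?P * ?P - [:of_real (s\<^sup>2):]"
  have ev: "poly ?q (complex_of_real x) = of_real ((poly p x)\<^sup>2 - s\<^sup>2)" for x
    by (simp add: power2_eq_square poly_map_poly_of_real)
  have q1: "poly ?q (complex_of_real x) \<noteq> 0" if "\<bar>x\<bar> \<le> R" for x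
  proof -
    have "\<bar>poly p x\<bar>\<^sup>2 < s\<^sup>2" using M[OF that] sM by (intro power_strict_mono) auto
    then show ?thesis unfolding ev of_real_eq_0_iff by simp
  qed
  then have "?q \<noteq> 0" using \<open>0 \<le> R\<close> by (metis abs_zero poly_0)
  from poly_op_bounded_below[OF T R this q1]
  obtain c where c: "c > 0" "\<forall>f\<in>l2 J. c * l2nrm f \<le> l2nrm (poly_op ?q T f)" by auto
  obtain f where f: "f \<in> l2 J" "l2nrm f = 1" "l2nrm (\<lambda>i. ?S (?S f) i - of_real (s\<^sup>2) * f i) < c"
    using selfadjoint_approx_eigenvector[OF selfadjoint_poly_op[OF T, of p] _ c(1)] sM M0 s_def by auto
  have "?q = ?P * ?P + [:- of_real (s\<^sup>2):]" by simp
  then have "poly_op ?q T f = (\<lambda>i. ?S (?S f) i - of_real (s\<^sup>2) * f i)"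
    by (simp only: poly_op_add poly_op_mult[OF B f(1)] poly_op_pCons poly_op_0) simp
  then show False using c f by force
qed

section \<open>The spectral radius in a Banach algebra\<close>

lemma cis_pi_div_power: "n > 0 \<Longrightarrow> cis (pi / real n) ^ n = -1"
  by (subst Complex.DeMoivre) simp

text \<open>The algebra is a subset \<open>S\<close> of a ring type, so that ring identities
  simplify without membership conditions, while norm and completeness are required on
  \<open>S\<close> only. Scalars are the central elements \<open>cs c\<close>.\<close>

locale banach_subalgebra =
  fixes S :: "'b::ring_1 set" and cs :: "complex \<Rightarrow> 'b" and N :: "'b \<Rightarrow> real"
  assumes cs_in: "cs c \<in> S" and cs_1: "cs 1 = 1" and cs_add: "cs (c + d) = cs c + cs d"
    and cs_mult: "cs (c * d) = cs c * cs d" and cs_comm: "x * cs c = cs c * x"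
    and S_add: "x \<in> S \<Longrightarrow> y \<in> S \<Longrightarrow> x + y \<in> S" and S_mult: "x \<in> S \<Longrightarrow> y \<in> S \<Longrightarrow> x * y \<in> S"
    and N_eq_0: "x \<in> S \<Longrightarrow> N x = 0 \<longleftrightarrow> x = 0" and N_ge0: "x \<in> S \<Longrightarrow> 0 \<le> N x"
    and N_add: "x \<in> S \<Longrightarrow> y \<in> S \<Longrightarrow> N (x + y) \<le> N x + N y"
    and N_mult: "x \<in> S \<Longrightarrow> y \<in> S \<Longrightarrow> N (x * y) \<le> N x * N y"
    and N_cs: "x \<in> S \<Longrightarrow> N (cs c * x) = cmod c * N x" and N_1: "N 1 \<le> 1"
    and N_complete: "(\<And>n::nat. X n \<in> S) \<Longrightarrow> (\<And>e. e > 0 \<Longrightarrow> \<exists>M. \<forall>m\<ge>M. \<forall>n\<ge>M. N (X m - X n) < e) \<Longrightarrow>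
      \<exists>y\<in>S. (\<lambda>n. N (X n - y)) \<longlonglongrightarrow> 0"
begin

lemma cs_0 [simp]: "cs 0 = 0"
  using cs_add[of 0 0] by simp

lemma cs_minus: "cs (- c) = - cs c"
  using cs_add[of c "- c"] by (simp add: eq_neg_iff_add_eq_0 add.commute)

lemma cs_diff: "cs (c - d) = cs c - cs d"
  using cs_add[of c "- d"] cs_minus by simp

lemma cs_lcomm: "x * (cs c * y) = cs c * (x * y)"
  by (metis cs_comm mult.assoc)

lemma cs_cancel: "c \<noteq> 0 \<Longrightarrow> cs (inverse c) * cs c = 1" "c \<noteq> 0 \<Longrightarrow> cs c * cs (inverse c) = 1"
  by (simp_all flip: cs_mult add: cs_1)

lemma cs_half: "cs (1/2) * (y + y) = y"
proof -
  have "cs (1/2) * (y + y) = (cs (1/2) + cs (1/2)) * y" by (simp add: algebra_simps)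
  also have "\<dots> = y" by (simp flip: cs_add add: cs_1)
  finally show ?thesis .
qed

lemma S_closed [simp, intro]: "0 \<in> S" "1 \<in> S" "cs c \<in> S"
  using cs_in[of 0] cs_in[of 1] cs_in[of c] by (simp_all add: cs_1)

lemma S_minus: "x \<in> S \<Longrightarrow> - x \<in> S"
  using S_mult[OF cs_in[of "-1"], of x] by (simp add: cs_minus cs_1)

lemma S_diff: "x \<in> S \<Longrightarrow> y \<in> S \<Longrightarrow> x - y \<in> S"
  using S_add[of x "- y"] S_minus[of y] by simp

lemma S_power: "x \<in> S \<Longrightarrow> x ^ n \<in> S"
  by (induction n) (auto intro: S_mult)

lemmas S_intros = S_add S_mult S_minus S_diff S_power

lemma N_0 [simp]: "N 0 = 0" using N_eq_0[of 0] by simp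

lemma N_minus: "x \<in> S \<Longrightarrow> N (- x) = N x"
  using N_cs[of x "-1"] by (simp add: cs_minus cs_1)

lemma N_minus_commute: "x \<in> S \<Longrightarrow> y \<in> S \<Longrightarrow> N (x - y) = N (y - x)"
  using N_minus[of "x - y"] S_diff by simp

lemma N_triangle_diff: "x \<in> S \<Longrightarrow> y \<in> S \<Longrightarrow> N x \<le> N (x - y) + N y"
  using N_add[of "x - y" y] S_diff by simp

lemma N_triangle3: "x \<in> S \<Longrightarrow> y \<in> S \<Longrightarrow> z \<in> S \<Longrightarrow> N (x - z) \<le> N (x - y) + N (y - z)"
  using N_add[of "x - y" "y - z"] S_diff by simp

lemma N_mult_le: "x \<in> S \<Longrightarrow> y \<in> S \<Longrightarrow> N x \<le> a \<Longrightarrow> N y \<le> b \<Longrightarrow> N (x * y) \<le> a * b"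
  using N_mult[of x y] mult_mono[of "N x" a "N y" b] N_ge0[of x] N_ge0[of y] by linarith

lemma N_power: "x \<in> S \<Longrightarrow> N (x ^ n) \<le> N x ^ n"
proof (induction n)
  case (Suc n)
  then show ?case using N_mult_le[of x "x ^ n" "N x" "N x ^ n"] S_power by simp
qed (simp add: N_1)

lemma N_limit_unique:
  assumes "\<And>n. X n \<in> S" "y \<in> S" "z \<in> S" "(\<lambda>n. N (X n - y)) \<longlonglongrightarrow> 0" "(\<lambda>n. N (X n - z)) \<longlonglongrightarrow> 0"
  shows "y = z"
proof -
  have "(\<lambda>n. N (X n - y) + N (X n - z)) \<longlonglongrightarrow> 0" using tendsto_add[OF assms(4,5)] by simp
  moreover have "N (y - z) \<le> N (X n - y) + N (X n - z)" for n
    using N_triangle3[of y "X n" z] N_minus_commute[of y "X n"] assms by simp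
  ultimately have "N (y - z) \<le> 0" by (meson LIMSEQ_le_const)
  then show ?thesis using N_eq_0[of "y - z"] N_ge0[of "y - z"] assms S_diff by simp
qed

lemma N_tendsto_mult:
  assumes X: "\<And>n. X n \<in> S" "x \<in> S" "(\<lambda>n. N (X n - x)) \<longlonglongrightarrow> 0"
    and Y: "\<And>n. Y n \<in> S" "y \<in> S" "(\<lambda>n. N (Y n - y)) \<longlonglongrightarrow> 0"
  shows "(\<lambda>n. N (X n * Y n - x * y)) \<longlonglongrightarrow> 0"
proof (rule tendsto_sandwich[OF always_eventually always_eventually tendsto_const])
  show "\<forall>n. 0 \<le> N (X n * Y n - x * y)" using X Y by (auto intro!: N_ge0 S_intros)
  show "\<forall>n. N (X n * Y n - x * y) \<le> N (X n - x) * (N (Y n - y) + N y) + N x * N (Y n - y)"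
  proof
    fix n
    have "X n * Y n - x * y = (X n - x) * Y n + x * (Y n - y)" by (simp add: algebra_simps)
    then have "N (X n * Y n - x * y) \<le> N ((X n - x) * Y n) + N (x * (Y n - y))"
      using N_add X Y by (simp add: S_intros)
    also have "\<dots> \<le> N (X n - x) * (N (Y n - y) + N y) + N x * N (Y n - y)"
      using X Y by (intro add_mono N_mult_le) (auto simp: S_intros N_triangle_diff)
    finally show "N (X n * Y n - x * y) \<le> N (X n - x) * (N (Y n - y) + N y) + N x * N (Y n - y)" .
  qed
  have "(\<lambda>n. N (X n - x) * (N (Y n - y) + N y) + N x * N (Y n - y)) \<longlonglongrightarrow> 0 * (0 + N y) + N x * 0"
    by (intro tendsto_intros X Y)
  then show "(\<lambda>n. N (X n - x) * (N (Y n - y) + N y) + N x * N (Y n - y)) \<longlonglongrightarrow> 0" by simp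
qed

lemma N_tendsto_norm:
  assumes "\<And>n. X n \<in> S" "x \<in> S" "(\<lambda>n. N (X n - x)) \<longlonglongrightarrow> 0"
  shows "(\<lambda>n. N (X n)) \<longlonglongrightarrow> N x"
proof -
  have "(\<lambda>n. N (X n) - N x) \<longlonglongrightarrow> 0"
  proof (rule Lim_null_comparison[OF always_eventually assms(3)], intro allI)
    fix n
    show "norm (N (X n) - N x) \<le> N (X n - x)"
      using N_triangle_diff[of "X n" x] N_triangle_diff[of x "X n"] N_minus_commute[of x "X n"] assms
      by (simp add: abs_le_iff)
  qed
  then show ?thesis using LIM_zero_iff by blast
qed

lemma N_tendsto_power:
  assumes "\<And>n. X n \<in> S" "x \<in> S" "(\<lambda>n. N (X n - x)) \<longlonglongrightarrow> 0"
  shows "(\<lambda>n. N (X n ^ k - x ^ k)) \<longlonglongrightarrow> 0"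
proof (induction k)
  case (Suc k)
  show ?case unfolding power_Suc by (intro N_tendsto_mult assms Suc S_power)
qed simp

section \<open>Invertible elements and the Neumann series\<close>

definition iv :: "'b \<Rightarrow> bool" where
  "iv x \<longleftrightarrow> x \<in> S \<and> (\<exists>y\<in>S. x * y = 1 \<and> y * x = 1)"

lemma ivI: "x \<in> S \<Longrightarrow> y \<in> S \<Longrightarrow> x * y = 1 \<Longrightarrow> y * x = 1 \<Longrightarrow> iv x"
  by (auto simp: iv_def)

lemma iv_left_right:
  assumes "x \<in> S" "l \<in> S" "l * x = 1" "x * r = 1"
  shows "iv x"
proof -
  have "l = r" using assms by (metis mult.assoc mult_1 mult_1_right)
  then show ?thesis using assms ivI by blast
qed

lemma iv_mult: assumes "iv x" "iv y" shows "iv (x * y)"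
proof -
  obtain a b where ab: "a \<in> S" "x * a = 1" "a * x = 1" "b \<in> S" "y * b = 1" "b * y = 1"
    using assms iv_def by blast
  have "(x * y) * (b * a) = x * (y * b) * a" "(b * a) * (x * y) = b * (a * x) * y"
    by (simp_all only: mult.assoc)
  then have "(x * y) * (b * a) = 1" "(b * a) * (x * y) = 1" using ab by simp_all
  moreover have "x * y \<in> S" "b * a \<in> S" using ab assms by (auto simp: iv_def S_mult)
  ultimately show ?thesis using ivI by blast
qed

lemma iv_cs: "c \<noteq> 0 \<Longrightarrow> iv (cs c)"
  by (rule ivI[of _ "cs (inverse c)"]) (auto simp: cs_cancel)

lemma iv_scale: "c \<noteq> 0 \<Longrightarrow> iv x \<Longrightarrow> iv (cs c * x)"
  by (intro iv_mult iv_cs)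

lemma iv_unscale: "c \<noteq> 0 \<Longrightarrow> iv (cs c * x) \<Longrightarrow> iv x"
  using iv_scale[of "inverse c" "cs c * x"] by (simp add: mult.assoc[symmetric] cs_cancel)

lemma iv_minus: "iv x \<Longrightarrow> iv (- x)"
  using iv_scale[of "-1" x] by (simp add: cs_minus cs_1)

text \<open>Commutation turns the inverse of the product into both a left and a right inverse of the
  factor.\<close>

lemma iv_factor:
  assumes "x \<in> S" "y \<in> S" "x * y = y * x" "iv (x * y)"
  shows "iv x"
proof -
  obtain z where z: "z \<in> S" "(x * y) * z = 1" "z * (x * y) = 1" using assms iv_def by blast
  have "x * (y * z) = 1" using z(2) by (simp add: mult.assoc)
  moreover have "(z * y) * x = 1" using z(3) unfolding assms(3) by (simp add: mult.assoc)
  moreover have "z * y \<in> S" using assms z by (auto simp: S_mult)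
  ultimately show ?thesis using iv_left_right assms(1) by blast
qed

text \<open>Jacobson's formula: with \<open>z\<close> the inverse of \<open>1 - x * y\<close>, the
  inverse of \<open>1 - y * x\<close> is \<open>1 + y * z * x\<close>.\<close>

lemma iv_swap:
  assumes xy: "x \<in> S" "y \<in> S" and i: "iv (1 - x * y)"
  shows "iv (1 - y * x)"
proof -
  obtain z where z: "z \<in> S" "(1 - x * y) * z = 1" "z * (1 - x * y) = 1" using i iv_def by blast
  show ?thesis
  proof (rule ivI[of _ "1 + y * z * x"])
    have "(1 - y * x) * (1 + y * z * x) = 1 - y * x + y * ((1 - x * y) * z) * x"
      by (simp add: algebra_simps)
    then show "(1 - y * x) * (1 + y * z * x) = 1" using z by simp
    have "(1 + y * z * x) * (1 - y * x) = 1 - y * x + y * (z * (1 - x * y)) * x"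
      by (simp add: algebra_simps)
    then show "(1 + y * z * x) * (1 - y * x) = 1" using z by simp
  qed (use xy z in \<open>auto intro!: S_intros\<close>)
qed

lemma one_minus_mult_sum_power: "(1 - x) * (\<Sum>k<n. x ^ k) = 1 - x ^ n" "(\<Sum>k<n. x ^ k) * (1 - x) = 1 - x ^ n"
  for x :: "'c::ring_1"
proof (induction n)
  case (Suc n)
  { case 1 show ?case using Suc(1) by (simp add: distrib_left left_diff_distrib) }
  { case 2
    have "(\<Sum>k<Suc n. x ^ k) * (1 - x) = (\<Sum>k<n. x ^ k) * (1 - x) + (x ^ n - x ^ n * x)"
      by (simp add: algebra_simps)
    also have "\<dots> = 1 - x ^ Suc n" unfolding Suc(2) by (simp add: power_commutes)
    finally show ?case . }
qed simp_all

lemma S_sum: "(\<And>k. k \<in> I \<Longrightarrow> X k \<in> S) \<Longrightarrow> sum X I \<in> S"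
  by (induction I rule: infinite_finite_induct) (auto intro: S_add)

lemma N_sum: "finite I \<Longrightarrow> (\<And>k. k \<in> I \<Longrightarrow> X k \<in> S) \<Longrightarrow> N (sum X I) \<le> (\<Sum>k\<in>I. N (X k))"
proof (induction I rule: finite_induct)
  case (insert a I)
  have "N (X a + sum X I) \<le> N (X a) + N (sum X I)" using insert.prems by (intro N_add S_sum) auto
  also have "\<dots> \<le> N (X a) + (\<Sum>k\<in>I. N (X k))" using insert by auto
  finally show ?case using insert by simp
qed simp

lemma Neumann:
  assumes x: "x \<in> S" and n: "N x < 1"
  shows "iv (1 - x)"
proof -
  define X where "X n = (\<Sum>k<n. x ^ k)" for n
  have XS: "X n \<in> S" for n unfolding X_def using x by (intro S_sum S_power)
  have q: "0 \<le> N x" using N_ge0 x by blast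
  have "\<exists>y\<in>S. (\<lambda>n. N (X n - y)) \<longlonglongrightarrow> 0"
  proof (rule N_complete[OF XS])
    fix e :: real assume e: "e > 0"
    have "summable (\<lambda>k. N x ^ k)" using n q by (simp add: summable_geometric)
    then obtain M where M: "\<And>m k. m \<ge> M \<Longrightarrow> norm (\<Sum>i\<in>{m..<k}. N x ^ i) < e"
      using e unfolding summable_Cauchy by blast
    have d: "N (X k - X m) < e" if "M \<le> m" "m \<le> k" for m k
    proof -
      have "{..<k} = {..<m} \<union> {m..<k}" "{..<m} \<inter> {m..<k} = {}" using that by auto
      then have "X k - X m = (\<Sum>i\<in>{m..<k}. x ^ i)"
        unfolding X_def by (simp add: sum.union_disjoint)
      then have "N (X k - X m) \<le> (\<Sum>i\<in>{m..<k}. N (x ^ i))" using x by (simp add: N_sum S_power)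
      also have "\<dots> \<le> (\<Sum>i\<in>{m..<k}. N x ^ i)" by (intro sum_mono N_power x)
      also have "\<dots> < e" using M[OF that(1), of k] by simp
      finally show ?thesis .
    qed
    show "\<exists>M. \<forall>m\<ge>M. \<forall>n\<ge>M. N (X m - X n) < e"
    proof (intro exI allI impI)
      fix m n assume "M \<le> m" "M \<le> n"
      then show "N (X m - X n) < e"
        using d[of m n] d[of n m] N_minus_commute[OF XS[of m] XS[of n]] by (cases "m \<le> n") auto
    qed
  qed
  then obtain y where y: "y \<in> S" "(\<lambda>n. N (X n - y)) \<longlonglongrightarrow> 0" by blast
  have p: "(\<lambda>n. N (x ^ n)) \<longlonglongrightarrow> 0"
  proof (rule tendsto_sandwich[OF always_eventually always_eventually tendsto_const])
    show "\<forall>n. 0 \<le> N (x ^ n)" using x S_power N_ge0 by auto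
    show "\<forall>n. N (x ^ n) \<le> N x ^ n" using N_power x by auto
    show "(\<lambda>n. N x ^ n) \<longlonglongrightarrow> 0" using n q by (intro LIMSEQ_power_zero) auto
  qed
  have c: "(\<lambda>n. N ((1 - x) - (1 - x))) \<longlonglongrightarrow> 0" by simp
  have one: "(\<lambda>n. N ((1 - x ^ n) - 1)) \<longlonglongrightarrow> 0" using p x by (simp add: N_minus S_power)
  have "(\<lambda>n. N ((1 - x) * X n - (1 - x) * y)) \<longlonglongrightarrow> 0"
    by (rule N_tendsto_mult[OF _ _ c XS y]) (use x in \<open>auto intro: S_diff\<close>)
  then have "(1 - x) * y = 1"
    unfolding X_def one_minus_mult_sum_power
    by (rule N_limit_unique[rotated 3, OF _ one]) (use x y in \<open>auto intro!: S_intros\<close>)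
  moreover have "(\<lambda>n. N (X n * (1 - x) - y * (1 - x))) \<longlonglongrightarrow> 0"
    by (rule N_tendsto_mult[OF XS y _ _ c]) (use x in \<open>auto intro: S_diff\<close>)
  then have "y * (1 - x) = 1"
    unfolding X_def one_minus_mult_sum_power
    by (rule N_limit_unique[rotated 3, OF _ one]) (use x y in \<open>auto intro!: S_intros\<close>)
  ultimately show ?thesis using x y by (intro ivI[of _ y]) (auto intro: S_diff)
qed

section \<open>The spectral radius formula\<close>

text \<open>Spectral radius below 1, phrased through invertibility; \<open>pw\<close> phrases it
  through powers. The equivalence of the two (\<open>pw_imp_sr\<close>, \<open>sr_imp_pw\<close>) is
  the spectral radius formula at threshold 1, and scaling makes this threshold sufficient.\<close>

definition sr :: "'b \<Rightarrow> bool" where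
  "sr x \<longleftrightarrow> (\<forall>l. cmod l \<le> 1 \<longrightarrow> iv (1 - cs l * x))"

definition pw :: "'b \<Rightarrow> bool" where
  "pw x \<longleftrightarrow> (\<exists>C q. 0 \<le> q \<and> q < 1 \<and> (\<forall>n. N (x ^ n) \<le> C * q ^ n))"

lemma srD: "sr x \<Longrightarrow> cmod l \<le> 1 \<Longrightarrow> iv (1 - cs l * x)"
  by (simp add: sr_def)

lemma sr_scale: "sr x \<Longrightarrow> cmod c \<le> 1 \<Longrightarrow> sr (cs c * x)"
  unfolding sr_def by (metis cs_mult mult.assoc norm_mult mult_le_one norm_ge_zero)

lemma sr_if_N_less_1: "x \<in> S \<Longrightarrow> N x < 1 \<Longrightarrow> sr x"
  unfolding sr_def
proof (intro allI impI)
  fix l assume x: "x \<in> S" "N x < 1" and l: "cmod l \<le> 1"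
  have "N (cs l * x) \<le> 1 * N x" unfolding N_cs[OF x(1)] by (intro mult_right_mono l N_ge0 x)
  then show "iv (1 - cs l * x)" using x by (intro Neumann) (auto intro: S_mult)
qed

lemma sr_swap: "x \<in> S \<Longrightarrow> y \<in> S \<Longrightarrow> sr (x * y) \<Longrightarrow> sr (y * x)"
  unfolding sr_def
proof (intro allI impI)
  fix l assume x: "x \<in> S" "y \<in> S" and s: "\<forall>l. cmod l \<le> 1 \<longrightarrow> iv (1 - cs l * (x * y))" and l: "cmod l \<le> 1"
  then have "iv (1 - (cs l * x) * y)" by (simp add: mult.assoc)
  then have "iv (1 - y * (cs l * x))" 
    using iv_swap[of "cs l * x" y] x S_mult by simp
  then show "iv (1 - cs l * (y * x))" by (simp add: cs_lcomm)
qed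

lemma power_cs_mult: "(cs l * x) ^ n = cs (l ^ n) * x ^ n"
proof (induction n)
  case (Suc n)
  have "(cs l * x) ^ Suc n = cs l * (x * (cs (l ^ n) * x ^ n))" using Suc by (simp add: mult.assoc)
  also have "\<dots> = cs l * cs (l ^ n) * (x * x ^ n)" by (simp add: cs_lcomm[of x] mult.assoc)
  finally show ?case by (simp add: cs_mult)
qed (simp add: cs_1)

lemma pw_tendsto: assumes "x \<in> S" "pw x" shows "(\<lambda>n. N (x ^ n)) \<longlonglongrightarrow> 0"
proof -
  obtain C q where C: "0 \<le> q" "q < 1" "\<forall>n. N (x ^ n) \<le> C * q ^ n" using assms pw_def by auto
  show ?thesis
  proof (rule tendsto_sandwich[OF always_eventually always_eventually tendsto_const])
    show "\<forall>n. 0 \<le> N (x ^ n)" using assms S_power N_ge0 by auto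
    show "\<forall>n. N (x ^ n) \<le> C * q ^ n" using C by auto
    show "(\<lambda>n. C * q ^ n) \<longlonglongrightarrow> 0" using tendsto_mult_right_zero[OF LIMSEQ_power_zero[of q]] C by auto
  qed
qed

lemma pw_small_power: assumes "x \<in> S" "pw x" "e > 0" obtains M where "\<And>n. n \<ge> M \<Longrightarrow> N (x ^ n) < e"
proof -
  obtain M where "\<forall>n\<ge>M. norm (N (x ^ n) - 0) < e" using pw_tendsto[OF assms(1,2)] assms(3) LIMSEQ_D by blast
  then have "\<And>n. n \<ge> M \<Longrightarrow> N (x ^ n) < e" by auto
  then show thesis using that by blast
qed

text \<open>Write \<open>n = k * a + b\<close>: the powers of \<open>x ^ k\<close> decay, and the
  finitely many remainders \<open>x ^ b\<close> are bounded by \<open>M\<close>.\<close>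

lemma pwI:
  assumes x: "x \<in> S" and k: "k > 0" and n: "N (x ^ k) < 1"
  shows "pw x"
proof -
  \<comment> \<open>At least 1/2, so that division by \<open>r\<close> is possible; \<open>q\<close>
    is its \<open>k\<close>-th root.\<close>
  define r where "r = max (N (x ^ k)) (1/2)"
  have r: "0 < r" "r < 1" "N (x ^ k) \<le> r" using n by (auto simp: r_def)
  define q where "q = root k r"
  have q: "0 < q" "q < 1" "q ^ k = r" using r k by (auto simp: q_def)
  define M where "M = (\<Sum>b<k. N (x ^ b)) + 1"
  have M: "N (x ^ b) \<le> M" if "b < k" for b
    unfolding M_def using that member_le_sum[of b "{..<k}" "\<lambda>b. N (x ^ b)"] x S_power N_ge0 by force
  have M0: "0 \<le> M" unfolding M_def using x S_power N_ge0 by (simp add: sum_nonneg)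
  have "N (x ^ n) \<le> (M / r) * q ^ n" for n
  proof -
    define a b where "a = n div k" and "b = n mod k"
    have ab: "n = k * a + b" "b < k" using k by (auto simp: a_def b_def)
    have "x ^ n = (x ^ k) ^ a * x ^ b" by (simp add: ab power_add power_mult)
    moreover have "N ((x ^ k) ^ a) \<le> r ^ a"
      using N_power[OF S_power[OF x, of k], of a] power_mono[OF r(3), of a] N_ge0[OF S_power[OF x, of k]] by linarith
    ultimately have "N (x ^ n) \<le> r ^ a * M" using x M[OF ab(2)] by (simp add: N_mult_le S_power)
    also have "\<dots> = (M / r) * (q ^ (k * a) * q ^ k)" using r by (simp add: power_mult q)
    also have "\<dots> \<le> (M / r) * (q ^ (k * a) * q ^ b)"
      using ab q r M0 by (intro mult_left_mono power_decreasing) auto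
    finally show ?thesis by (simp add: ab power_add)
  qed
  then show ?thesis unfolding pw_def using q less_imp_le by blast
qed

lemma iv_one_minus_if_power: "x \<in> S \<Longrightarrow> iv (1 - x ^ n) \<Longrightarrow> iv (1 - x)"
  using iv_factor[of "1 - x" "\<Sum>k<n. x ^ k"] by (simp add: one_minus_mult_sum_power S_sum S_intros)

text \<open>Some power of \<open>cs l * x\<close> has norm below 1, and \<open>1 - cs l * x\<close>
  is a factor of one minus that power.\<close>

lemma pw_imp_sr: assumes x: "x \<in> S" and p: "pw x" shows "sr x"
  unfolding sr_def
proof (intro allI impI)
  fix l assume l: "cmod l \<le> 1"
  obtain M where M: "\<And>n. n \<ge> M \<Longrightarrow> N (x ^ n) < 1" using pw_small_power[OF x p, of 1] by auto
  have "N ((cs l * x) ^ M) \<le> 1 * N (x ^ M)"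
    unfolding power_cs_mult N_cs[OF S_power[OF x]] norm_power
    by (intro mult_right_mono power_le_one l N_ge0 S_power x) auto
  then have "iv (1 - (cs l * x) ^ M)" using M[of M] x by (intro Neumann) (auto intro: S_intros)
  then show "iv (1 - cs l * x)" using iv_one_minus_if_power x S_mult by blast
qed

text \<open>The second claim is the resolvent identity. If the norms were unbounded, points with
  large resolvent would accumulate at some \<open>a\<close> in the closed disc; close to
  \<open>a\<close> the identity gives \<open>N (R b) \<le> N (R b) / 2 + N (R a)\<close>, a
  contradiction.\<close>

lemma resolvent_bounded:
  assumes x: "x \<in> S" and R: "\<And>l. cmod l \<le> 1 \<Longrightarrow> R l \<in> S \<and> (1 - cs l * x) * R l = 1 \<and> R l * (1 - cs l * x) = 1"
  shows "\<exists>B. \<forall>l. cmod l \<le> 1 \<longrightarrow> N (R l) \<le> B"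
    and "cmod l \<le> 1 \<Longrightarrow> cmod m \<le> 1 \<Longrightarrow> N (R l - R m) \<le> N (R l) * N x * N (R m) * cmod (l - m)"
proof -
  have id: "N (R l - R m) \<le> N (R l) * N x * N (R m) * cmod (l - m)" if "cmod l \<le> 1" "cmod m \<le> 1" for l m
  proof -
    have "R l - R m = R l * ((1 - cs m * x) * R m) - (R l * (1 - cs l * x)) * R m"
      using R[OF that(1)] R[OF that(2)] by simp
    also have "\<dots> = cs l * (R l * x * R m) - cs m * (R l * x * R m)"
      by (simp add: algebra_simps cs_lcomm[of "R l"])
    also have "\<dots> = cs (l - m) * (R l * x * R m)" by (simp add: cs_diff algebra_simps)
    finally have "N (R l - R m) = cmod (l - m) * N (R l * x * R m)" using R that x by (simp add: N_cs S_mult)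
    also have "\<dots> \<le> cmod (l - m) * (N (R l) * N x * N (R m))"
      using R that x by (intro mult_left_mono N_mult_le) (auto intro: S_mult)
    finally show ?thesis by (simp add: mult.commute)
  qed
  then show "cmod l \<le> 1 \<Longrightarrow> cmod m \<le> 1 \<Longrightarrow> N (R l - R m) \<le> N (R l) * N x * N (R m) * cmod (l - m)" .
  show "\<exists>B. \<forall>l. cmod l \<le> 1 \<longrightarrow> N (R l) \<le> B"
  proof (rule ccontr)
    assume "\<nexists>B. \<forall>l. cmod l \<le> 1 \<longrightarrow> N (R l) \<le> B"
    then have "\<forall>n::nat. \<exists>l. cmod l \<le> 1 \<and> real n < N (R l)" by (meson not_le_imp_less)
    then obtain l where l: "\<And>n. cmod (l n) \<le> 1" "\<And>n. real n < N (R (l n))" by metis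
    have "compact (cball (0::complex) 1)" by simp
    then obtain a r where a: "a \<in> cball 0 1" "strict_mono r" "(l \<circ> r) \<longlonglongrightarrow> a"
      unfolding compact_def using l(1) by (metis dist_0_norm mem_cball)
    have a1: "cmod a \<le> 1" using a by simp
    define D where "D = N (R a) * N x"
    have D: "0 \<le> D" unfolding D_def using R[OF a1] x N_ge0 by simp
    have "\<forall>\<^sub>F n in sequentially. dist ((l \<circ> r) n) a < 1 / (2 * (D + 1))"
      by (rule tendstoD[OF a(3)]) (use D in auto)
    then obtain M where M: "\<And>n. n \<ge> M \<Longrightarrow> cmod (l (r n) - a) < 1 / (2 * (D + 1))"
      by (auto simp: eventually_sequentially dist_norm)
    obtain k where k: "real k > 2 * N (R a)" using reals_Archimedean2 by blast
    define n where "n = max M k"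
    have n: "M \<le> n" "k \<le> r n" using seq_suble[OF a(2), of n] by (auto simp: n_def)
    define b where "b = l (r n)"
    have b: "cmod b \<le> 1" "real k < N (R b)" using l(1) l(2)[of "r n"] n(2) by (auto simp: b_def)
    have "N (R b) \<le> N (R b - R a) + N (R a)" using R[OF a1] R[OF b(1)] by (intro N_triangle_diff) auto
    also have "N (R b - R a) = N (R a - R b)" using R[OF a1] R[OF b(1)] by (intro N_minus_commute) auto
    also have "\<dots> \<le> D * N (R b) * cmod (a - b)" using id[OF a1 b(1)] D_def by simp
    also have "\<dots> = N (R b) * (D * cmod (b - a))" by (simp add: norm_minus_commute)
    also have "\<dots> \<le> N (R b) * (1/2)"
    proof (intro mult_left_mono N_ge0)
      have "D * cmod (b - a) \<le> (D + 1) * (1 / (2 * (D + 1)))"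
        using M[OF n(1)] D by (intro mult_mono) (auto simp: b_def)
      also have "\<dots> = 1/2" using D by (simp add: field_simps)
      finally show "D * cmod (b - a) \<le> 1/2" .
    qed (use R b in auto)
    finally show False using b k by simp
  qed
qed

text \<open>Replaces holomorphy in the spectral radius formula: averaging over square roots of unity keeps
  the Lipschitz constant of the resolvent while passing from \<open>x\<^sup>m\<close> to \<open>x\<^sup>2\<^sup>m\<close>.\<close>
lemma averaged_resolvent:
  assumes x: "x \<in> S" and s: "sr x"
  obtains B K where "0 \<le> B" "0 \<le> K"
    "\<And>m::nat. \<exists>H. \<forall>l. cmod l \<le> 1 \<longrightarrow> H l \<in> S \<and> H l * (1 - (cs l * x) ^ (2^m)) = 1 \<and>
       (1 - (cs l * x) ^ (2^m)) * H l = 1 \<and> N (H l) \<le> B \<and>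
       (\<forall>l'. cmod l' \<le> 1 \<longrightarrow> N (H l - H l') \<le> K * cmod (l - l'))"
proof -
  have "\<forall>l. \<exists>y. cmod l \<le> 1 \<longrightarrow> y \<in> S \<and> (1 - cs l * x) * y = 1 \<and> y * (1 - cs l * x) = 1"
    using s unfolding sr_def iv_def by blast
  then obtain R where R: "\<And>l. cmod l \<le> 1 \<Longrightarrow> R l \<in> S \<and> (1 - cs l * x) * R l = 1 \<and> R l * (1 - cs l * x) = 1"
    by metis
  obtain B where B: "\<And>l. cmod l \<le> 1 \<Longrightarrow> N (R l) \<le> B" using resolvent_bounded(1)[OF x R] by blast
  have B0: "0 \<le> B" using B[of 0] R[of 0] N_ge0[of "R 0"] by simp
  define K where "K = B * N x * B"
  have K0: "0 \<le> K" using B0 N_ge0[OF x] by (simp add: K_def)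
  have lip: "N (R l - R m) \<le> K * cmod (l - m)" if "cmod l \<le> 1" "cmod m \<le> 1" for l m
  proof -
    have "N (R l) * N x * N (R m) \<le> K"
      unfolding K_def using B[OF that(1)] B[OF that(2)] R[OF that(1)] R[OF that(2)] N_ge0 x B0
      by (intro mult_mono) auto
    then show ?thesis using resolvent_bounded(2)[OF x R that] mult_right_mono[of _ K "cmod (l - m)"]
      by (meson norm_ge_zero order_trans)
  qed
  have "\<exists>H. \<forall>l. cmod l \<le> 1 \<longrightarrow> H l \<in> S \<and> H l * (1 - (cs l * x) ^ (2^m)) = 1 \<and>
       (1 - (cs l * x) ^ (2^m)) * H l = 1 \<and> N (H l) \<le> B \<and>
       (\<forall>l'. cmod l' \<le> 1 \<longrightarrow> N (H l - H l') \<le> K * cmod (l - l'))" for m :: nat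
  proof (induction m)
    case 0
    show ?case using R B lip by (intro exI[of _ R]) auto
  next
    case (Suc m)
    then obtain H where H: "\<And>l. cmod l \<le> 1 \<Longrightarrow> H l \<in> S" "\<And>l. cmod l \<le> 1 \<Longrightarrow> H l * (1 - (cs l * x) ^ (2^m)) = 1"
       "\<And>l. cmod l \<le> 1 \<Longrightarrow> (1 - (cs l * x) ^ (2^m)) * H l = 1" "\<And>l. cmod l \<le> 1 \<Longrightarrow> N (H l) \<le> B"
       "\<And>l l'. cmod l \<le> 1 \<Longrightarrow> cmod l' \<le> 1 \<Longrightarrow> N (H l - H l') \<le> K * cmod (l - l')" by blast
    \<comment> \<open>A \<open>2^m\<close>-th root of -1: passing from \<open>l\<close> to
      \<open>w * l\<close> replaces \<open>y = (cs l * x) ^ (2^m)\<close> by \<open>- y\<close>, and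
      the inverses of \<open>1 - y\<close> and \<open>1 + y\<close> average to that of
      \<open>1 - y * y\<close>.\<close>
    define w where "w = cis (pi / 2 ^ m)"
    have w: "cmod w = 1" "w ^ (2^m) = -1" using cis_pi_div_power[of "2^m"] by (simp_all add: w_def)
    have wl: "cmod (w * l) \<le> 1" if "cmod l \<le> 1" for l using that w by (simp add: norm_mult)
    define G where "G l = cs (1/2) * (H l + H (w * l))" for l
    have GS: "G l \<in> S" if "cmod l \<le> 1" for l unfolding G_def using H(1)[OF that] H(1)[OF wl[OF that]] by (intro S_intros) auto
    show ?case
    proof (intro exI[of _ G] allI impI conjI)
      fix l assume l: "cmod l \<le> 1"
      show "G l \<in> S" using GS l .
      define y where "y = (cs l * x) ^ (2^m)"
      have wy: "(cs (w * l) * x) ^ (2^m) = - y"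
        unfolding y_def power_cs_mult power_mult_distrib w(2) by (simp add: cs_minus)
      have yy: "(cs l * x) ^ (2 ^ Suc m) = y * y"
        unfolding y_def by (simp add: mult_2 power_add)
      have a: "H l * (1 - y) = 1" "(1 - y) * H l = 1" using H(2,3)[OF l] by (auto simp: y_def)
      have b: "H (w * l) * (1 + y) = 1" "(1 + y) * H (w * l) = 1" using H(2,3)[OF wl[OF l]] by (auto simp: wy)
      have "G l * (1 - y * y) = cs (1/2) * ((H l * (1 - y)) * (1 + y) + (H (w * l) * (1 + y)) * (1 - y))"
        by (simp add: G_def algebra_simps)
      also have "\<dots> = cs (1/2) * (1 + 1)" using a b by simp
      finally show "G l * (1 - (cs l * x) ^ (2 ^ Suc m)) = 1" unfolding yy cs_half .
      have "(1 - y * y) * G l = cs (1/2) * ((1 - y * y) * (H l + H (w * l)))"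
        unfolding G_def by (rule cs_lcomm)
      also have "\<dots> = cs (1/2) * ((1 + y) * ((1 - y) * H l) + (1 - y) * ((1 + y) * H (w * l)))"
        by (simp add: algebra_simps)
      also have "\<dots> = cs (1/2) * (1 + 1)" using a b by simp
      finally show "(1 - (cs l * x) ^ (2 ^ Suc m)) * G l = 1" unfolding yy cs_half .
      have "N (G l) \<le> 1/2 * (N (H l) + N (H (w * l)))"
        unfolding G_def using H(1)[OF l] H(1)[OF wl[OF l]] by (simp add: N_cs N_add S_add)
      then show "N (G l) \<le> B" using H(4)[OF l] H(4)[OF wl[OF l]] by simp
      fix l' assume l': "cmod l' \<le> 1"
      have "G l - G l' = cs (1/2) * ((H l - H l') + (H (w * l) - H (w * l')))"
        by (simp add: G_def algebra_simps)
      then have "N (G l - G l') \<le> 1/2 * (N (H l - H l') + N (H (w * l) - H (w * l')))"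
        using H(1)[OF l] H(1)[OF wl[OF l]] H(1)[OF l'] H(1)[OF wl[OF l']] by (simp add: N_cs N_add S_intros)
      moreover have "cmod (w * l - w * l') = cmod (l - l')"
        by (metis norm_mult right_diff_distrib w(1) mult_1)
      ultimately show "N (G l - G l') \<le> K * cmod (l - l')"
        using H(5)[OF l l'] H(5)[OF wl[OF l] wl[OF l']] by simp
    qed
  qed
  then show thesis using that B0 K0 by metis
qed

text \<open>Continuation along the points \<open>k / M\<close> from 0 to 1. If the powers of
  \<open>s x\<close> decay, then for a large exponent \<open>2 ^ Q\<close> the averaged resolvent at
  \<open>s\<close> is within 1/8 of 1; the Lipschitz bound, uniform in the exponent, keeps it within
  1/4 of 1 at the next point \<open>t\<close>, and this forces
  \<open>N ((t x) ^ (2 ^ Q)) < 1\<close>.\<close>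

lemma sr_imp_pw:
  assumes x: "x \<in> S" and s: "sr x"
  shows "pw x"
proof -
  obtain B K where BK: "0 \<le> B" "0 \<le> K"
    "\<And>m::nat. \<exists>H. \<forall>l. cmod l \<le> 1 \<longrightarrow> H l \<in> S \<and> H l * (1 - (cs l * x) ^ (2^m)) = 1 \<and>
       (1 - (cs l * x) ^ (2^m)) * H l = 1 \<and> N (H l) \<le> B \<and>
       (\<forall>l'. cmod l' \<le> 1 \<longrightarrow> N (H l - H l') \<le> K * cmod (l - l'))"
    using averaged_resolvent[OF x s] by metis
  \<comment> \<open>Makes the Lipschitz change \<open>K / M\<close> over one step at most
    1/8.\<close>
  obtain M :: nat where M: "real M > 8 * K + 1" using reals_Archimedean2 by blast
  have M0: "real M > 0" using M BK by linarith
  have "pw (cs (of_real (real k / real M)) * x)" if "k \<le> M" for k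
    using that
  proof (induction k)
    case 0
    show ?case by (rule pwI[of _ 1]) auto
  next
    case (Suc k)
    let ?s = "complex_of_real (real k / real M)" and ?t = "complex_of_real (real (Suc k) / real M)"
    have st: "cmod ?s \<le> 1" "cmod ?t \<le> 1" using Suc.prems M0
      by (simp_all del: of_real_divide of_nat_Suc add: norm_of_real)
    have ts: "cmod (?t - ?s) = 1 / real M"
      using M0 by (simp flip: of_real_diff add: diff_divide_distrib[symmetric] del: of_real_divide)
    have sxS: "cs ?s * x \<in> S" "cs ?t * x \<in> S" using x by (auto intro: S_mult)
    have e0: "1 / (8 * (B + 1)) > 0" using BK by simp
    have "pw (cs ?s * x)" using Suc.IH Suc.prems by simp
    then obtain Q where Q: "\<And>n. n \<ge> Q \<Longrightarrow> N ((cs ?s * x) ^ n) < 1 / (8 * (B + 1))"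
      using pw_small_power[OF sxS(1) _ e0] by blast
    have "Q \<le> 2 ^ Q" using less_exp[of Q] less_imp_le by blast
    then have y1: "N ((cs ?s * x) ^ (2 ^ Q)) < 1 / (8 * (B + 1))" using Q by simp
    obtain H where H: "\<And>l. cmod l \<le> 1 \<Longrightarrow> H l \<in> S" "\<And>l. cmod l \<le> 1 \<Longrightarrow> H l * (1 - (cs l * x) ^ (2^Q)) = 1"
       "\<And>l. cmod l \<le> 1 \<Longrightarrow> (1 - (cs l * x) ^ (2^Q)) * H l = 1" "\<And>l. cmod l \<le> 1 \<Longrightarrow> N (H l) \<le> B"
       "\<And>l l'. cmod l \<le> 1 \<Longrightarrow> cmod l' \<le> 1 \<Longrightarrow> N (H l - H l') \<le> K * cmod (l - l')" using BK(3)[of Q] by blast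
    define y where "y = (cs ?t * x) ^ (2 ^ Q)"
    have yS: "y \<in> S" unfolding y_def by (intro S_power sxS)
    have "H ?s - 1 = H ?s * (cs ?s * x) ^ (2 ^ Q)" using H(2)[OF st(1)] by (simp add: algebra_simps)
    then have "N (H ?s - 1) \<le> B * (1 / (8 * (B + 1)))"
      using N_mult_le[OF H(1)[OF st(1)] S_power[OF sxS(1)] H(4)[OF st(1)], of "2^Q" "1 / (8 * (B + 1))"] y1 by simp
    also have "\<dots> \<le> 1/8" using BK by (simp add: field_simps)
    finally have h1: "N (H ?s - 1) \<le> 1/8" .
    have "N (H ?t - H ?s) \<le> K * (1 / real M)" using H(5)[OF st(2,1)] ts by simp
    also have "\<dots> \<le> 1/8" using M M0 by (simp add: field_simps)
    finally have "N (H ?t - H ?s) \<le> 1/8" .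
    then have h2: "N (H ?t - 1) \<le> 1/4" using h1 N_triangle3[OF H(1)[OF st(2)] H(1)[OF st(1)], of 1] by auto
    have "(1 - y) * H ?t = 1" using H(3)[OF st(2)] y_def by simp
    then have "y = - (y * (H ?t - 1)) + (H ?t - 1)" by (simp add: algebra_simps)
    then have "N y \<le> N (y * (H ?t - 1)) + N (H ?t - 1)"
      using N_add[of "- (y * (H ?t - 1))" "H ?t - 1"] N_minus[of "y * (H ?t - 1)"] yS H(1)[OF st(2)]
      by (metis S_closed(2) S_diff S_minus S_mult)
    also have "\<dots> \<le> N y * (1/4) + 1/4"
      using N_mult_le[OF yS S_diff[OF H(1)[OF st(2)] S_closed(2)] order_refl h2] h2 by linarith
    finally have "N y < 1" by linarith
    then show ?case unfolding y_def by (intro pwI[OF sxS(2), of "2 ^ Q"]) auto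
  qed
  from this[of M] show ?thesis using M0 cs_1 by simp
qed

text \<open>The prefix \<open>z ^ i * w ^ j\<close> makes the estimate inductive and avoids the
  binomial expansion of the powers of the mean.\<close>

lemma pw_half_sum:
  assumes z: "z \<in> S" "pw z" and w: "w \<in> S" "pw w" and c: "z * w = w * z"
  shows "pw (cs (1/2) * (z + w))"
proof -
  obtain C q where C: "0 \<le> q" "q < 1" "\<And>n. N (z ^ n) \<le> C * q ^ n" using z pw_def by auto
  obtain D r where D: "0 \<le> r" "r < 1" "\<And>n. N (w ^ n) \<le> D * r ^ n" using w pw_def by auto
  define a where "a = max q r"
  have a: "0 \<le> a" "a < 1" "q \<le> a" "r \<le> a" using C D by (auto simp: a_def)
  have C0: "0 \<le> C" "0 \<le> D" using C(3)[of 0] D(3)[of 0] N_ge0[of 1] by auto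
  let ?x = "cs (1/2) * (z + w)"
  have zw: "z ^ i * w ^ j = w ^ j * z ^ i" for i j
    by (rule power_commuting_commutes[OF power_commuting_commutes[OF c, symmetric], symmetric])
  have "N (z ^ i * w ^ j * ?x ^ n) \<le> C * D * a ^ (i + j + n)" for i j n
  proof (induction n arbitrary: i j)
    case 0
    have "N (z ^ i) \<le> C * a ^ i" "N (w ^ j) \<le> D * a ^ j"
      using order_trans[OF C(3) mult_left_mono[OF power_mono[OF a(3) C(1)] C0(1)]]
        order_trans[OF D(3) mult_left_mono[OF power_mono[OF a(4) D(1)] C0(2)]] by auto
    then have "N (z ^ i * w ^ j) \<le> (C * a ^ i) * (D * a ^ j)" using z w by (intro N_mult_le S_power)
    then show ?case by (simp add: power_add algebra_simps)
  next
    case (Suc n)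
    have S: "z ^ i * w ^ j * ?x ^ n \<in> S" for i j using z w by (intro S_intros) auto
    have wz: "w ^ j * z = z * w ^ j" using zw[of 1 j] by simp
    have "z ^ i * w ^ j * ?x ^ Suc n = cs (1/2) * (z ^ i * (w ^ j * z) * ?x ^ n + z ^ i * (w ^ j * w) * ?x ^ n)"
      by (simp add: algebra_simps cs_lcomm[of "w ^ j"] cs_lcomm[of "z ^ i"])
    also have "\<dots> = cs (1/2) * (z ^ Suc i * w ^ j * ?x ^ n + z ^ i * w ^ Suc j * ?x ^ n)"
      unfolding wz by (simp only: power_Suc2 mult.assoc)
    finally have "N (z ^ i * w ^ j * ?x ^ Suc n) \<le> 1/2 * (N (z ^ Suc i * w ^ j * ?x ^ n) + N (z ^ i * w ^ Suc j * ?x ^ n))"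
      using N_add[OF S S, of "Suc i" j i "Suc j"] N_cs[OF S_add[OF S S], of "1/2" "Suc i" j i "Suc j"] by simp
    also have "\<dots> \<le> 1/2 * (C * D * a ^ (Suc i + j + n) + C * D * a ^ (i + Suc j + n))"
      by (intro mult_left_mono add_mono Suc.IH) auto
    finally show ?case by simp
  qed
  from this[of 0 0] show ?thesis unfolding pw_def using a by (intro exI[of _ "C * D"] exI[of _ a]) simp
qed

end

section \<open>Hermitian Banach *-algebras\<close>

text \<open>No relation between \<open>st\<close> and \<open>N\<close> is assumed, so
  \<open>st\<close> may be discontinuous, and a limit of self-adjoint elements is not self-adjoint
  for free. Properties are carried across \<open>st\<close> through invertibility, not through the
  norm.\<close>

locale hermitian_subalgebra = banach_subalgebra +
  fixes st :: "'a \<Rightarrow> 'a"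
  assumes st_in: "x \<in> S \<Longrightarrow> st x \<in> S" and st_st: "x \<in> S \<Longrightarrow> st (st x) = x"
    and st_add: "x \<in> S \<Longrightarrow> y \<in> S \<Longrightarrow> st (x + y) = st x + st y"
    and st_mult: "x \<in> S \<Longrightarrow> y \<in> S \<Longrightarrow> st (x * y) = st y * st x"
    and st_cs_mult: "x \<in> S \<Longrightarrow> st (cs c * x) = cs (cnj c) * st x"
    and herm: "x \<in> S \<Longrightarrow> st x = x \<Longrightarrow> Im l \<noteq> 0 \<Longrightarrow> iv (x - cs l)"
begin

abbreviation cr :: "real \<Rightarrow> 'a" where "cr t \<equiv> cs (complex_of_real t)"

lemma cr_add: "cr (s + t) = cr s + cr t" by (simp add: cs_add)
lemma cr_mult: "cr (s * t) = cr s * cr t" by (simp add: cs_mult)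

lemma st_1: "st 1 = 1"
  using st_mult[of "st 1" 1] st_st[of 1] st_in[of 1] by simp

lemma st_cs: "st (cs c) = cs (cnj c)"
  using st_cs_mult[of 1 c] st_1 by simp

lemma st_minus: "x \<in> S \<Longrightarrow> st (- x) = - st x"
  using st_cs_mult[of x "-1"] by (simp add: cs_minus cs_1)

lemma st_diff: "x \<in> S \<Longrightarrow> y \<in> S \<Longrightarrow> st (x - y) = st x - st y"
  using st_add[of x "- y"] st_minus[of y] S_minus[of y] by simp

lemma iv_st: assumes "iv x" shows "iv (st x)"
proof -
  obtain y where y: "x \<in> S" "y \<in> S" "x * y = 1" "y * x = 1" using assms iv_def by blast
  show ?thesis
  proof (rule ivI[of _ "st y"])
    show "st x * st y = 1" using st_mult[of y x] y st_1 by simp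
    show "st y * st x = 1" using st_mult[of x y] y st_1 by simp
  qed (use y st_in in auto)
qed

lemma sr_st: assumes x: "x \<in> S" and s: "sr x" shows "sr (st x)"
  unfolding sr_def
proof (intro allI impI)
  fix l assume "cmod l \<le> 1"
  then have "iv (st (1 - cs (cnj l) * x))" using srD[OF s, of "cnj l"] by (intro iv_st) simp
  then show "iv (1 - cs l * st x)" using x by (simp add: st_diff st_1 st_cs_mult S_mult)
qed

section \<open>Self-adjoint elements and their square roots\<close>

definition sa :: "'a \<Rightarrow> bool" where "sa x \<longleftrightarrow> x \<in> S \<and> st x = x"

lemma saD: "sa x \<Longrightarrow> x \<in> S" "sa x \<Longrightarrow> st x = x" by (auto simp: sa_def)

lemma sa_add: "sa x \<Longrightarrow> sa y \<Longrightarrow> sa (x + y)" by (simp add: sa_def S_add st_add)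
lemma sa_diff: "sa x \<Longrightarrow> sa y \<Longrightarrow> sa (x - y)" by (simp add: sa_def S_diff st_diff)
lemma sa_minus: "sa x \<Longrightarrow> sa (- x)" by (simp add: sa_def S_minus st_minus)
lemma sa_1: "sa 1" by (simp add: sa_def st_1)
lemma sa_cr: "sa (cr t)" by (simp add: sa_def st_cs)
lemma sa_scale: "sa x \<Longrightarrow> sa (cr t * x)" by (simp add: sa_def S_mult st_cs_mult)
lemma sa_comm: "sa x \<Longrightarrow> sa y \<Longrightarrow> x * y = y * x \<Longrightarrow> sa (x * y)" by (simp add: sa_def S_mult st_mult)
lemma sa_square: "sa x \<Longrightarrow> sa (x * x)" by (simp add: sa_comm)
lemma sa_star_mult: "x \<in> S \<Longrightarrow> sa (st x * x)" "x \<in> S \<Longrightarrow> sa (x * st x)"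
  by (simp_all add: sa_def S_mult st_mult st_in st_st)

lemma sa_inverse: assumes "sa x" "y \<in> S" "x * y = 1" "y * x = 1" shows "sa y"
proof -
  have "st y * x = 1" using st_mult[of x y] assms st_1 by (simp add: sa_def)
  then have "st y * (x * y) = y" by (simp add: mult.assoc[symmetric])
  then show ?thesis using assms by (simp add: sa_def)
qed

lemma sa_ivE: assumes "sa x" "iv x" obtains y where "sa y" "x * y = 1" "y * x = 1"
  using assms sa_inverse iv_def by metis

lemma cs_cancel_left: assumes "c \<noteq> 0" "cs c * x = cs c * y" shows "x = y"
proof -
  have "cs (inverse c) * (cs c * x) = cs (inverse c) * (cs c * y)" using assms by simp
  then have "cs (inverse c) * cs c * x = cs (inverse c) * cs c * y" by (simp only: mult.assoc)
  then show ?thesis using cs_cancel(1)[OF assms(1)] by simp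
qed

text \<open>Ford's square root lemma. The iteration \<open>z \<mapsto> (h + z * z) / 2\<close>
  converges to a solution of \<open>z + z = h + z * z\<close>, so \<open>1 - z\<close> squares to
  \<open>1 - h\<close>. Self-adjointness of the limit is proved by algebra: \<open>w = st z\<close>
  solves the same equation and commutes with \<open>z\<close>, hence
  \<open>(z - w) * (1 - (z + w) / 2) = 0\<close> with an invertible second factor.\<close>

lemma sa_sqrt_one_minus:
  assumes h: "sa h" and p: "pw h"
  obtains u where "sa u" "u * u = 1 - h" "iv u"
proof -
  have hS: "h \<in> S" "st h = h" using h by (auto simp: sa_def)
  obtain C q where q: "0 \<le> q" "q < 1" "\<And>n. N (h ^ n) \<le> C * q ^ n" using p pw_def by auto
  have C0: "0 \<le> C" using q(3)[of 0] N_ge0[of 1] by auto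
  text \<open>\<open>dom z \<zeta>\<close>: right multiplication by \<open>z\<close> has norm at most \<open>\<zeta>\<close> for the equivalent norm
    \<open>v \<mapsto> sup\<^sub>n N (v h\<^sup>n) / q\<^sup>n\<close>, in which \<open>h\<close> has norm at most \<open>q\<close>.\<close>
  define P where "P A v \<longleftrightarrow> v \<in> S \<and> (\<forall>n. N (v * h ^ n) \<le> A * q ^ n)" for A v
  define dom where "dom z \<zeta> \<longleftrightarrow> z \<in> S \<and> 0 \<le> \<zeta> \<and> (\<forall>v A. 0 \<le> A \<longrightarrow> P A v \<longrightarrow> P (A * \<zeta>) (v * z))" for z \<zeta>
  have dom_mult: "dom (z * w) (\<zeta> * \<omega>)" if "dom z \<zeta>" "dom w \<omega>" for z w \<zeta> \<omega>
    unfolding dom_def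
  proof (intro conjI allI impI)
    fix v A assume "0 \<le> A" "P A v"
    then have "P (A * \<zeta>) (v * z)" using that(1) dom_def by blast
    then have "P (A * \<zeta> * \<omega>) (v * z * w)" using that \<open>0 \<le> A\<close> dom_def by simp
    then show "P (A * (\<zeta> * \<omega>)) (v * (z * w))" by (simp add: mult.assoc)
  qed (use that in \<open>auto simp: dom_def S_mult\<close>)
  have dom_add: "dom (z + w) (\<zeta> + \<omega>)" if "dom z \<zeta>" "dom w \<omega>" for z w \<zeta> \<omega>
    unfolding dom_def
  proof (intro conjI allI impI)
    fix v A assume A: "0 \<le> A" "P A v"
    then have a: "P (A * \<zeta>) (v * z)" and b: "P (A * \<omega>) (v * w)" using that dom_def by auto
    show "P (A * (\<zeta> + \<omega>)) (v * (z + w))"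
      unfolding P_def
    proof (intro conjI allI)
      show "v * (z + w) \<in> S" using A that by (auto simp: P_def dom_def intro!: S_intros)
      fix n
      have "N (v * (z + w) * h ^ n) = N (v * z * h ^ n + v * w * h ^ n)" by (simp add: algebra_simps)
      also have "\<dots> \<le> N (v * z * h ^ n) + N (v * w * h ^ n)"
        using a b S_mult[OF _ S_power[OF hS(1)]] by (intro N_add) (auto simp: P_def)
      also have "\<dots> \<le> A * \<zeta> * q ^ n + A * \<omega> * q ^ n" using a b P_def by (intro add_mono) auto
      finally show "N (v * (z + w) * h ^ n) \<le> A * (\<zeta> + \<omega>) * q ^ n" by (simp add: algebra_simps)
    qed
  qed (use that in \<open>auto simp: dom_def S_add\<close>)
  have dom_half: "dom (cs (1/2) * z) (\<zeta> / 2)" if "dom z \<zeta>" for z \<zeta>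
    unfolding dom_def
  proof (intro conjI allI impI)
    fix v A assume A: "0 \<le> A" "P A v"
    then have a: "P (A * \<zeta>) (v * z)" using that dom_def by auto
    show "P (A * (\<zeta> / 2)) (v * (cs (1/2) * z))"
      unfolding P_def
    proof (intro conjI allI)
      show "v * (cs (1/2) * z) \<in> S" using A that by (auto simp: P_def dom_def intro!: S_intros)
      fix n
      have "v * (cs (1/2) * z) * h ^ n = cs (1/2) * (v * z * h ^ n)" by (simp add: cs_lcomm mult.assoc)
      then have "N (v * (cs (1/2) * z) * h ^ n) = 1/2 * N (v * z * h ^ n)"
        using a hS by (simp add: N_cs P_def S_mult S_power)
      also have "\<dots> \<le> 1/2 * (A * \<zeta> * q ^ n)" using a P_def by (intro mult_left_mono) auto
      finally show "N (v * (cs (1/2) * z) * h ^ n) \<le> A * (\<zeta> / 2) * q ^ n" by simp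
    qed
  qed (use that in \<open>auto simp: dom_def S_mult\<close>)
  have dom_h: "dom h q"
    unfolding dom_def
  proof (intro conjI allI impI)
    fix v A assume A: "0 \<le> A" "P A v"
    show "P (A * q) (v * h)"
      unfolding P_def
    proof (intro conjI allI)
      show "v * h \<in> S" using A hS by (auto simp: P_def intro!: S_intros)
      fix n
      have "N (v * h ^ Suc n) \<le> A * q ^ Suc n" using A P_def by blast
      then show "N (v * h * h ^ n) \<le> A * q * q ^ n" by (simp add: mult.assoc)
    qed
  qed (use hS q in auto)
  have dom_0: "dom 0 0" by (simp add: dom_def P_def)
  have dom_N: "N z \<le> C * \<zeta>" if "dom z \<zeta>" for z \<zeta>
  proof -
    have "P C 1" using q(3) by (simp add: P_def)
    then have "P (C * \<zeta>) (1 * z)" using that C0 dom_def by blast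
    then show ?thesis unfolding P_def by (metis mult_1 mult_1_right power_0)
  qed
  \<comment> \<open>The scalar iteration \<open>\<zeta>s\<close> majorises \<open>zs\<close> in the
    sense of \<open>dom\<close>, and its differences majorise those of \<open>zs\<close>;
    convergence is reduced to a bounded monotone sequence of reals.\<close>
  define zs where "zs n = ((\<lambda>z. cs (1/2) * (h + z * z)) ^^ n) 0" for n
  define \<zeta>s where "\<zeta>s n = ((\<lambda>t. (q + t * t) / 2) ^^ n) 0" for n
  have zs0: "zs 0 = 0" "\<zeta>s 0 = 0" by (simp_all add: zs_def \<zeta>s_def)
  have zsS: "zs (Suc n) = cs (1/2) * (h + zs n * zs n)" "\<zeta>s (Suc n) = (q + \<zeta>s n * \<zeta>s n) / 2" for n
    by (simp_all add: zs_def \<zeta>s_def)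
  have domz: "dom (zs n) (\<zeta>s n)" for n
  proof (induction n)
    case 0 then show ?case unfolding zs0 by (rule dom_0)
  next
    case (Suc n) then show ?case unfolding zsS by (intro dom_half dom_add dom_mult dom_h)
  qed
  have domd: "dom (zs (Suc n) - zs n) (\<zeta>s (Suc n) - \<zeta>s n)" for n
  proof (induction n)
    case 0 then show ?case using dom_half[OF dom_h] by (simp add: zsS zs0)
  next
    case (Suc n)
    define D where "D = zs (Suc n) - zs n"
    define d where "d = \<zeta>s (Suc n) - \<zeta>s n"
    have "zs (Suc (Suc n)) - zs (Suc n) = cs (1/2) * (h + zs (Suc n) * zs (Suc n)) - cs (1/2) * (h + zs n * zs n)"
      by (simp only: zsS)
    also have "\<dots> = cs (1/2) * (D * zs (Suc n) + zs n * D)" by (simp add: D_def algebra_simps)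
    finally have 1: "zs (Suc (Suc n)) - zs (Suc n) = cs (1/2) * (D * zs (Suc n) + zs n * D)" .
    have "\<zeta>s (Suc (Suc n)) - \<zeta>s (Suc n) = (q + \<zeta>s (Suc n) * \<zeta>s (Suc n)) / 2 - (q + \<zeta>s n * \<zeta>s n) / 2"
      by (simp only: zsS)
    also have "\<dots> = (d * \<zeta>s (Suc n) + \<zeta>s n * d) / 2" by (simp add: d_def algebra_simps diff_divide_distrib add_divide_distrib)
    finally have 2: "\<zeta>s (Suc (Suc n)) - \<zeta>s (Suc n) = (d * \<zeta>s (Suc n) + \<zeta>s n * d) / 2" .
    have "dom D d" using Suc by (simp add: D_def d_def)
    then show ?case unfolding 1 2 by (intro dom_half dom_add dom_mult domz)
  qed
  have domk: "dom (zs (n + k) - zs n) (\<zeta>s (n + k) - \<zeta>s n)" for n k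
  proof (induction k)
    case 0 then show ?case using dom_0 by simp
  next
    case (Suc k)
    have "zs (n + Suc k) - zs n = (zs (Suc (n + k)) - zs (n + k)) + (zs (n + k) - zs n)"
      "\<zeta>s (n + Suc k) - \<zeta>s n = (\<zeta>s (Suc (n + k)) - \<zeta>s (n + k)) + (\<zeta>s (n + k) - \<zeta>s n)" by simp_all
    then show ?case using dom_add[OF domd[of "n + k"] Suc] by simp
  qed
  have zS: "zs n \<in> S" for n using domz dom_def by blast
  have mono: "\<zeta>s n \<le> \<zeta>s (n + k)" for n k using domk dom_def by (metis diff_ge_0_iff_ge)
  \<comment> \<open>The smaller fixed point of \<open>t \<mapsto> (q + t * t) / 2\<close>; it bounds
    every \<open>\<zeta>s n\<close> and is below 1.\<close>
  define Q where "Q = 1 - sqrt (1 - q)"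
  have "sqrt (1 - q) * sqrt (1 - q) = 1 - q" using q by simp
  then have Q: "0 \<le> Q" "Q < 1" "(q + Q * Q) / 2 = Q" using q by (auto simp: Q_def field_simps)
  have \<zeta>Q: "0 \<le> \<zeta>s n" "\<zeta>s n \<le> Q" for n
  proof -
    show nn: "0 \<le> \<zeta>s n" for n using domz dom_def by blast
    show "\<zeta>s n \<le> Q"
    proof (induction n)
      case (Suc n)
      have "\<zeta>s n * \<zeta>s n \<le> Q * Q" using Suc nn by (intro mult_mono) (auto simp: Q)
      then have "\<zeta>s (Suc n) \<le> (q + Q * Q) / 2" unfolding zsS by simp
      then show ?case using Q by simp
    qed (simp add: zs0 Q)
  qed
  have "Cauchy \<zeta>s"
  proof (rule convergent_Cauchy, rule Bseq_monoseq_convergent)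
    show "Bseq \<zeta>s" by (rule BseqI'[of _ Q]) (use \<zeta>Q in auto)
    show "monoseq \<zeta>s" using mono by (auto simp: monoseq_def le_iff_add)
  qed
  then have "\<exists>z\<in>S. (\<lambda>n. N (zs n - z)) \<longlonglongrightarrow> 0"
  proof (intro N_complete zS)
    fix e :: real assume C: "Cauchy \<zeta>s" and e: "e > 0"
    have "e / (C + 1) > 0" using e C0 by simp
    then obtain M where M: "\<And>m n. m \<ge> M \<Longrightarrow> n \<ge> M \<Longrightarrow> norm (\<zeta>s m - \<zeta>s n) < e / (C + 1)"
      using CauchyD[OF C] by blast
    have *: "N (zs m - zs n) < e" if "M \<le> n" "n \<le> m" for m n
    proof -
      define k where "k = m - n"
      have k: "m = n + k" using that by (simp add: k_def)
      have "N (zs m - zs n) \<le> C * (\<zeta>s m - \<zeta>s n)" unfolding k by (rule dom_N[OF domk])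
      also have "\<dots> \<le> (C + 1) * norm (\<zeta>s m - \<zeta>s n)" using C0 mono[of n k] k by (intro mult_mono) auto
      also have "\<dots> < (C + 1) * (e / (C + 1))" using M[of m n] that C0 by (intro mult_strict_left_mono) auto
      also have "\<dots> = e" using C0 by simp
      finally show ?thesis .
    qed
    show "\<exists>M. \<forall>m\<ge>M. \<forall>n\<ge>M. N (zs m - zs n) < e"
    proof (intro exI allI impI)
      fix m n assume "M \<le> m" "M \<le> n"
      then show "N (zs m - zs n) < e"
        using *[of n m] *[of m n] N_minus_commute[OF zS[of m] zS[of n]] by (cases "n \<le> m") auto
    qed
  qed
  then obtain z where z: "z \<in> S" and lim: "(\<lambda>n. N (zs n - z)) \<longlonglongrightarrow> 0" by blast
  have "z = cs (1/2) * (h + z * z)"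
  proof (rule N_limit_unique[of "\<lambda>n. zs (Suc n)"])
    show "(\<lambda>n. N (zs (Suc n) - z)) \<longlonglongrightarrow> 0" using LIMSEQ_Suc[OF lim] .
    have e: "N (zs (Suc n) - cs (1/2) * (h + z * z)) = 1/2 * N (zs n * zs n - z * z)" for n
    proof -
      have "zs (Suc n) - cs (1/2) * (h + z * z) = cs (1/2) * (zs n * zs n - z * z)"
        unfolding zsS by (simp add: algebra_simps)
      then show ?thesis using N_cs[of "zs n * zs n - z * z" "1/2"] zS z by (simp add: S_intros)
    qed
    show "(\<lambda>n. N (zs (Suc n) - cs (1/2) * (h + z * z))) \<longlonglongrightarrow> 0"
      unfolding e by (rule tendsto_mult_right_zero[OF N_tendsto_mult[OF zS z lim zS z lim]])
  qed (use zS z hS in \<open>auto intro!: S_intros\<close>)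
  then have "cs (1/2) * (z + z) = cs (1/2) * (h + z * z)" using cs_half by simp
  then have eqz: "z + z = h + z * z" by (rule cs_cancel_left[rotated]) simp
  have pz: "pw z"
    unfolding pw_def
  proof (rule exI[of _ C], rule exI[of _ Q], intro conjI allI Q(1,2))
    fix k
    have dp: "dom (zs n ^ Suc k) (\<zeta>s n ^ Suc k)" for n k
      by (induction k) (use domz[of n] in \<open>auto intro: dom_mult\<close>)
    have "N (zs n ^ k) \<le> C * Q ^ k" for n
    proof (cases k)
      case 0 then show ?thesis using q(3)[of 0] by simp
    next
      case (Suc j)
      have "N (zs n ^ k) \<le> C * \<zeta>s n ^ k" using dom_N[OF dp[of n j]] Suc by simp
      also have "\<dots> \<le> C * Q ^ k" using \<zeta>Q C0 by (intro mult_left_mono power_mono) auto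
      finally show ?thesis .
    qed
    then show "N (z ^ k) \<le> C * Q ^ k"
      using N_tendsto_norm[OF S_power[OF zS] S_power[OF z] N_tendsto_power[OF zS z lim]] by (meson LIMSEQ_le_const2)
  qed
  define w where "w = st z"
  have w: "w \<in> S" using z st_in w_def by blast
  \<comment> \<open>Decay of powers reaches \<open>w\<close> through \<open>sr\<close>, as the norm
    of \<open>w\<close> is not controlled by that of \<open>z\<close>.\<close>
  have pw: "pw w" unfolding w_def by (rule sr_imp_pw[OF _ sr_st[OF z pw_imp_sr[OF z pz]]]) (use z st_in in auto)
  have "st (z + z) = st (h + z * z)" using eqz by simp
  then have eqw: "w + w = h + w * w" using z hS by (simp add: w_def st_add st_mult S_mult)
  have hz: "h = z + z - z * z" using eqz by simp
  have zh: "z * h = h * z" by (subst (1 2) hz) (simp add: distrib_left distrib_right left_diff_distrib right_diff_distrib mult.assoc)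
  have "st (z * h) = st (h * z)" using zh by simp
  then have wh: "w * h = h * w" using z hS by (simp add: w_def st_mult)
  \<comment> \<open>Every iterate is a polynomial in \<open>h\<close>, and \<open>w\<close> commutes
    with \<open>h\<close>; so \<open>w\<close> commutes with the limit \<open>z\<close>.\<close>
  have zw_n: "zs n * w = w * zs n" for n
  proof (induction n)
    case (Suc n)
    have "zs n * zs n * w = w * (zs n * zs n)" by (metis Suc mult.assoc)
    then show ?case unfolding zsS by (simp add: cs_lcomm mult.assoc distrib_left distrib_right wh)
  qed (simp add: zs0)
  have zw: "z * w = w * z"
  proof (rule N_limit_unique[of "\<lambda>n. zs n * w"])
    show "(\<lambda>n. N (zs n * w - z * w)) \<longlonglongrightarrow> 0" by (rule N_tendsto_mult[OF zS z lim]) (use w in auto)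
    show "(\<lambda>n. N (zs n * w - w * z)) \<longlonglongrightarrow> 0" unfolding zw_n by (rule N_tendsto_mult[OF _ _ _ zS z lim]) (use w in auto)
  qed (use zS z w in \<open>auto intro!: S_intros\<close>)
  have i: "iv (1 - cs (1/2) * (z + w))"
    using srD[OF pw_imp_sr[OF _ pw_half_sum[OF z pz w pw zw]], of 1] z w by (simp add: cs_1 S_intros)
  have "(z - w) * (1 - cs (1/2) * (z + w)) = (z - w) * (cs (1/2) * (1 + 1) - cs (1/2) * (z + w))"
    by (simp only: cs_half)
  also have "\<dots> = (z - w) * (cs (1/2) * ((1 + 1) - (z + w)))" by (simp only: right_diff_distrib)
  also have "\<dots> = cs (1/2) * ((z - w) * ((1 + 1) - (z + w)))" by (rule cs_lcomm)
  also have "(z - w) * ((1 + 1) - (z + w)) = (z + z - z * z) - (w + w - w * w) + (w * z - z * w)"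
    by (simp add: algebra_simps del: one_add_one)
  also have "\<dots> = 0" using eqz eqw zw by simp
  finally have "(z - w) * (1 - cs (1/2) * (z + w)) = 0" by simp
  moreover obtain y where "(1 - cs (1/2) * (z + w)) * y = 1" using i iv_def by blast
  ultimately have "z - w = 0" by (metis mult.assoc mult_1_right mult_zero_left)
  then have "st z = z" by (simp add: w_def)
  then have "sa (1 - z)" using z by (intro sa_diff sa_1) (simp add: sa_def)
  moreover have "(1 - z) * (1 - z) = 1 - h" using eqz by (simp add: algebra_simps)
  moreover have "iv (1 - z)" using srD[OF pw_imp_sr[OF z pz], of 1] by (simp add: cs_1)
  ultimately show thesis by (rule that)
qed

section \<open>Strictly positive elements\<close>

text \<open>Positivity with a gap: \<open>t = 0\<close> is included, so \<open>s\<close> itself is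
  invertible. The weaker \<open>ge0\<close> asks for \<open>t > 0\<close> only.\<close>

definition pos :: "'a \<Rightarrow> bool" where
  "pos s \<longleftrightarrow> sa s \<and> (\<forall>t\<ge>0. iv (s + cr t))"

lemma iv_add_cs_large: assumes "s \<in> S" "N s < cmod c" shows "iv (s + cs c)"
proof -
  have c: "c \<noteq> 0" using assms N_ge0[of s] by auto
  have "N (cs (- inverse c) * s) = N s / cmod c" unfolding N_cs[OF assms(1)] by (simp add: norm_inverse divide_inverse mult.commute)
  also have "\<dots> < 1" using assms c by simp
  finally have "iv (1 - cs (- inverse c) * s)" using assms by (intro Neumann) (auto intro: S_mult)
  then have "iv (cs c * (1 - cs (- inverse c) * s))" using iv_scale c by blast
  also have "cs c * (1 - cs (- inverse c) * s) = cs c + (cs c * cs (inverse c)) * s"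
    by (simp add: cs_minus algebra_simps)
  also have "\<dots> = s + cs c" using c by (simp add: cs_cancel add.commute)
  finally show ?thesis .
qed

lemma iv_add_nonreal: "sa s \<Longrightarrow> Im c \<noteq> 0 \<Longrightarrow> iv (s + cs c)"
  using herm[of s "- c"] by (simp add: sa_def cs_minus)

text \<open>After scaling by \<open>k > N s\<close> the element \<open>h = 1 - s / k\<close> has
  spectral radius below 1, and the square root lemma applies to
  \<open>1 - h = s / k\<close>.\<close>

lemma pos_sqrt:
  assumes s: "pos s"
  obtains u where "sa u" "u * u = s" "iv u"
proof -
  have sS: "sa s" "s \<in> S" using s by (auto simp: pos_def sa_def)
  define k where "k = N s + 1"
  have k: "k > 0" "N s < k" using N_ge0[OF sS(2)] by (auto simp: k_def)
  define h where "h = 1 - cr (1/k) * s"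
  have h: "sa h" unfolding h_def by (intro sa_diff sa_1 sa_scale sS)
  have "sr h"
    unfolding sr_def
  proof (intro allI impI)
    fix l assume l: "cmod l \<le> 1"
    show "iv (1 - cs l * h)"
    proof (cases "l = 0")
      case True then show ?thesis using iv_cs[of 1] by (simp add: cs_1)
    next
      case False
      \<comment> \<open>Chosen so that \<open>1 - cs l * h = cs (l / k) * (s + cs c)\<close>. For
        real \<open>c\<close>, either \<open>c\<close> is nonnegative and \<open>pos\<close>
        applies, or its modulus exceeds \<open>N s\<close>.\<close>
      define c where "c = of_real k * (inverse l - 1)"
      have "iv (s + cs c)"
      proof (cases "Im c = 0")
        case False then show ?thesis by (intro iv_add_nonreal sS)
      next
        case True
        then have cr: "c = of_real (Re c)" by (simp add: complex_eq_iff)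
        have im: "Im (inverse l) = 0" using True k by (simp add: c_def)
        define r where "r = Re (inverse l)"
        have r: "inverse l = of_real r" using im by (simp add: r_def complex_eq_iff)
        have "\<bar>r\<bar> = inverse (cmod l)" by (metis norm_inverse norm_of_real r)
        then have r1: "1 \<le> \<bar>r\<bar>" using l False by (simp add: one_le_inverse)
        have Rc: "Re c = k * (r - 1)" by (simp add: c_def r)
        show ?thesis
        proof (cases "0 \<le> Re c")
          case True then show ?thesis using s cr pos_def by metis
        next
          case False
          then have "r < 1" using Rc k by (simp add: mult_less_0_iff not_le)
          then have "r \<le> -1" using r1 by linarith
          then have "k * (r - 1) \<le> k * (- 2)" using k by (intro mult_left_mono) auto
          then have "k < \<bar>Re c\<bar>" using Rc k by linarith
          then have "N s < cmod c" using k abs_Re_le_cmod[of c] by linarith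
          then show ?thesis by (intro iv_add_cs_large sS)
        qed
      qed
      then have "iv (cs (l / of_real k) * (s + cs c))" using False k by (intro iv_scale) auto
      also have "cs (l / of_real k) * (s + cs c) = cs (l / of_real k) * s + cs (l / of_real k * c)"
        by (simp only: distrib_left cs_mult)
      also have "l / of_real k * c = 1 - l" using k False by (simp add: c_def field_simps)
      also have "cs (l / of_real k) * s + cs (1 - l) = 1 - cs l * h"
      proof -
        have "cs l * h = cs l - cs l * cr (1/k) * s" by (simp add: h_def right_diff_distrib mult.assoc)
        also have "cs l * cr (1/k) = cs (l / of_real k)" by (simp flip: cs_mult)
        finally show ?thesis by (simp add: cs_diff cs_1)
      qed
      finally show ?thesis .
    qed
  qed
  then have "pw h" using h by (intro sr_imp_pw) (auto simp: sa_def)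
  then obtain u where u: "sa u" "u * u = 1 - h" "iv u" using sa_sqrt_one_minus[OF h] by blast
  have "cr (sqrt k) * u * (cr (sqrt k) * u) = cr (sqrt k) * cr (sqrt k) * (u * u)"
    by (simp add: cs_lcomm[of u] mult.assoc)
  also have "cr (sqrt k) * cr (sqrt k) = cr k" using k by (simp flip: cr_mult of_real_mult)
  also have "u * u = cr (1/k) * s" using u by (simp add: h_def)
  also have "cr k * (cr (1/k) * s) = s" using k by (simp flip: cr_mult mult.assoc cs_mult add: cs_1)
  finally have "cr (sqrt k) * u * (cr (sqrt k) * u) = s" .
  moreover have "iv (cr (sqrt k) * u)" using u k by (intro iv_scale) auto
  ultimately show thesis using that sa_scale[OF u(1)] by blast
qed

text \<open>With \<open>u\<close> the square root of \<open>s\<close> and \<open>v\<close> its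
  inverse, \<open>s + k = u * (1 + v * k * v) * u\<close>, and \<open>v * k * v\<close> is
  \<open>cs \<i>\<close> times a self-adjoint element.\<close>

lemma iv_pos_plus_skew:
  assumes s: "pos s" and k: "k \<in> S" "st k = - k"
  shows "iv (s + k)"
proof -
  obtain u where u: "sa u" "u * u = s" "iv u" using pos_sqrt[OF s] .
  obtain v where v: "sa v" "u * v = 1" "v * u = 1" using sa_ivE[OF u(1,3)] .
  define m where "m = cs (- \<i>) * (v * k * v)"
  have vS: "v \<in> S" "st v = v" using v by (auto simp: sa_def)
  have "st m = cs (cnj (- \<i>)) * st (v * k * v)" unfolding m_def using vS k by (intro st_cs_mult S_mult)
  also have "st (v * k * v) = - (v * k * v)" using vS k by (simp add: st_mult S_mult mult.assoc)
  also have "cs (cnj (- \<i>)) * (- (v * k * v)) = m" by (simp add: m_def cs_minus)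
  finally have "sa m" using vS k by (auto simp: sa_def m_def intro!: S_mult)
  then have "iv (m + cs (- \<i>))" by (intro iv_add_nonreal) auto
  then have i: "iv (cs \<i> * (m + cs (- \<i>)))" by (intro iv_scale) auto
  have "cs \<i> * (m + cs (- \<i>)) = (cs \<i> * cs (- \<i>)) * (v * k * v) + cs \<i> * cs (- \<i>)"
    by (simp only: m_def distrib_left mult.assoc)
  also have "cs \<i> * cs (- \<i>) = 1" by (simp flip: cs_mult add: cs_1)
  finally have "iv (1 + v * k * v)" using i by (simp add: add.commute)
  then have "iv (u * (1 + v * k * v) * u)" by (intro iv_mult u)
  also have "u * (1 + v * k * v) * u = u * u + (u * v) * k * (v * u)" by (simp add: distrib_left distrib_right mult.assoc)
  finally show ?thesis using u v by simp
qed

section \<open>Ptak's inequality\<close>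

lemma pos_one_minus:
  assumes x: "sa x" "sr x"
  shows "pos (1 - x)"
  unfolding pos_def
proof (intro conjI allI impI)
  show "sa (1 - x)" by (intro sa_diff sa_1 x)
  fix t :: real assume t: "0 \<le> t"
  have "cmod (complex_of_real (1 / (1 + t))) \<le> 1" unfolding norm_of_real using t by simp
  then have "iv (1 - cr (1 / (1 + t)) * x)" by (rule srD[OF x(2)])
  moreover have "complex_of_real (1 + t) \<noteq> 0" unfolding of_real_eq_0_iff using t by simp
  ultimately have "iv (cr (1 + t) * (1 - cr (1 / (1 + t)) * x))" by (intro iv_scale)
  also have "cr (1 + t) * (1 - cr (1 / (1 + t)) * x) = cr (1 + t) - cr ((1 + t) * (1 / (1 + t))) * x"
    by (simp only: cr_mult right_diff_distrib mult_1_right mult.assoc)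
  also have "(1 + t) * (1 / (1 + t)) = 1" using t by simp
  also have "cr (1 + t) - cr 1 * x = 1 - x + cr t" by (simp add: cs_add cs_1)
  finally show "iv (1 - x + cr t)" .
qed

text \<open>\<open>(1 + st x) * (1 - x)\<close> is the strictly positive \<open>1 - st x * x\<close>
  plus the skew element \<open>st x - x\<close>, which yields a left inverse of
  \<open>1 - x\<close>; the reversed product, with \<open>x * st x\<close>, yields a right
  inverse.\<close>

lemma sr_star_imp_iv:
  assumes x: "x \<in> S" and s: "sr (st x * x)"
  shows "iv (1 - x)"
proof -
  have sk: "st (st x - x) = - (st x - x)" using x by (simp add: st_diff st_in st_st)
  have dS: "st x - x \<in> S" using x by (intro S_diff st_in)
  have "iv ((1 - st x * x) + (st x - x))"
    by (rule iv_pos_plus_skew[OF pos_one_minus[OF sa_star_mult(1)[OF x] s] dS sk])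
  also have "(1 - st x * x) + (st x - x) = (1 + st x) * (1 - x)" by (simp add: algebra_simps)
  finally obtain l where l: "l \<in> S" "l * ((1 + st x) * (1 - x)) = 1" by (auto simp: iv_def)
  have "sr (x * st x)" using sr_swap[of "st x" x] x s st_in by blast
  then have "iv ((1 - x * st x) + (st x - x))"
    using iv_pos_plus_skew[OF pos_one_minus[OF sa_star_mult(2)[OF x]] dS sk] by blast
  also have "(1 - x * st x) + (st x - x) = (1 - x) * (1 + st x)" by (simp add: algebra_simps)
  finally obtain r where r: "((1 - x) * (1 + st x)) * r = 1" by (auto simp: iv_def)
  show ?thesis
    by (rule iv_left_right[of _ "l * (1 + st x)" "(1 + st x) * r"])
      (use l r x st_in in \<open>auto simp: mult.assoc intro!: S_intros\<close>)
qed

text \<open>Ptak's inequality between the spectral radii of \<open>x\<close> and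
  \<open>st x * x\<close>, at threshold 1: replacing \<open>x\<close> by \<open>cs l * x\<close>
  reduces it to \<open>sr_star_imp_iv\<close>.\<close>

lemma Ptak: assumes x: "x \<in> S" and s: "sr (st x * x)" shows "sr x"
  unfolding sr_def
proof (intro allI impI)
  fix l assume l: "cmod l \<le> 1"
  have "st (cs l * x) * (cs l * x) = cs (cnj l) * (cs l * (st x * x))"
    using x by (simp add: st_cs_mult cs_lcomm[of "st x"] mult.assoc)
  also have "\<dots> = cs (cnj l * l) * (st x * x)" by (simp add: cs_mult mult.assoc)
  finally have "st (cs l * x) * (cs l * x) = cs (cnj l * l) * (st x * x)" .
  moreover have "cmod (cnj l * l) \<le> 1" using l by (simp add: norm_mult mult_le_one)
  ultimately have "sr (st (cs l * x) * (cs l * x))" using sr_scale[OF s] by simp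
  then show "iv (1 - cs l * x)" using x by (intro sr_star_imp_iv S_mult) auto
qed

text \<open>Ptak's inequality reduces \<open>h * k\<close> to \<open>(h * h) * (k * k)\<close>,
  because \<open>k * h * h * k\<close> has the same nonzero spectrum as the latter. After enough
  squarings both factors have norm below 1.\<close>

lemma sr_mult_sa:
  assumes h: "sa h" "sr h" and k: "sa k" "sr k"
  shows "sr (h * k)"
proof -
  have hS: "h \<in> S" "k \<in> S" "st h = h" "st k = k" using h k by (auto simp: sa_def)
  have step: "sr (h * k)" if "sa h" "sa k" "sr ((h * h) * (k * k))" for h k
  proof -
    have S: "h \<in> S" "k \<in> S" "st h = h" "st k = k" using that by (auto simp: sa_def)
    have "sr ((h * h * k) * k)" using that(3) by (simp add: mult.assoc)
    then have "sr (k * (h * h * k))" using S S_mult sr_swap[of "h * h * k" k] by simp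
    then have "sr (st (h * k) * (h * k))" using S by (simp add: st_mult mult.assoc)
    then show ?thesis by (rule Ptak[OF S_mult[OF S(1,2)]])
  qed
  have down: "sr (h ^ (2 ^ m) * k ^ (2 ^ m)) \<Longrightarrow> sr (h * k)" if "sa h" "sa k" for m h k
    using that
  proof (induction m arbitrary: h k)
    case (Suc m)
    have "h ^ (2 ^ Suc m) = (h * h) ^ (2 ^ m)" for h :: 'a
      by (simp add: power_mult[of h 2] power2_eq_square)
    then have "sr ((h * h) ^ (2 ^ m) * (k * k) ^ (2 ^ m))" using Suc.prems(1) by simp
    then have "sr ((h * h) * (k * k))" by (rule Suc.IH) (intro sa_square Suc.prems)+
    then show ?case by (rule step[rotated 2]) (intro Suc.prems)+
  qed simp
  obtain M1 where M1: "\<And>n. n \<ge> M1 \<Longrightarrow> N (h ^ n) < 1" using pw_small_power[OF hS(1) sr_imp_pw[OF hS(1) h(2)], of 1] by auto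
  obtain M2 where M2: "\<And>n. n \<ge> M2 \<Longrightarrow> N (k ^ n) < 1" using pw_small_power[OF hS(2) sr_imp_pw[OF hS(2) k(2)], of 1] by auto
  define m where "m = max M1 M2"
  have m: "M1 \<le> 2 ^ m" "M2 \<le> 2 ^ m" using less_exp[of m] max.cobounded1[of M1 M2] max.cobounded2[of M2 M1] unfolding m_def[symmetric] by linarith+
  have "N (h ^ (2 ^ m) * k ^ (2 ^ m)) \<le> N (h ^ (2 ^ m)) * N (k ^ (2 ^ m))" using hS by (intro N_mult S_power)
  also have "\<dots> < 1 * 1" using M1[OF m(1)] M2[OF m(2)] hS by (intro mult_strict_mono') (auto intro: N_ge0 S_power)
  finally have "sr (h ^ (2 ^ m) * k ^ (2 ^ m))" using hS by (intro sr_if_N_less_1 S_mult S_power) auto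
  then show ?thesis by (rule down[OF h(1) k(1)])
qed

section \<open>The cone of positive elements\<close>

definition ge0 :: "'a \<Rightarrow> bool" where
  "ge0 h \<longleftrightarrow> sa h \<and> (\<forall>t>0. iv (h + cr t))"

lemma ge0D: "ge0 h \<Longrightarrow> t > 0 \<Longrightarrow> iv (h + cr t)" "ge0 h \<Longrightarrow> sa h"
  by (auto simp: ge0_def)

lemma ge0_iv: assumes "ge0 h" "Im c \<noteq> 0 \<or> Re c > 0" shows "iv (h + cs c)"
proof (cases "Im c = 0")
  case True
  then have "c = of_real (Re c)" by (simp add: complex_eq_iff)
  then show ?thesis using assms True ge0D(1) by metis
qed (use assms ge0D iv_add_nonreal in auto)

lemma ge0_scale: assumes h: "ge0 h" and r: "r \<ge> 0" shows "ge0 (cr r * h)"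
proof (cases "r = 0")
  case True then show ?thesis using iv_cs sa_cr[of 0] by (auto simp: ge0_def)
next
  case False
  then have r: "r > 0" using r by simp
  show ?thesis unfolding ge0_def
  proof (intro conjI allI impI)
    fix t :: real assume t: "t > 0"
    have "iv (cr r * (h + cr (t / r)))" using r t by (intro iv_scale ge0D(1)[OF h]) auto
    also have "cr r * (h + cr (t / r)) = cr r * h + cr (r * (t / r))" by (simp only: distrib_left cr_mult)
    finally show "iv (cr r * h + cr t)" using r by simp
  qed (use h sa_scale ge0D in auto)
qed

text \<open>\<open>h * h + t\<close> is the product of two nonreal shifts of \<open>h\<close>, by
  \<open>i sqrt t\<close> and \<open>- i sqrt t\<close>, and these are invertible.\<close>

lemma ge0_square: assumes h: "sa h" shows "ge0 (h * h)"
  unfolding ge0_def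
proof (intro conjI allI impI)
  show "sa (h * h)" using h by (rule sa_square)
  fix t :: real assume t: "t > 0"
  have e: "(h + cs c) * (h + cs (- c)) = h * h + cs (c * (- c))" for c
    unfolding cs_mult by (simp add: algebra_simps cs_minus cs_comm[of h])
  let ?c = "\<i> * of_real (sqrt t)"
  have "iv (h + cs ?c)" "iv (h + cs (- ?c))" using t by (auto intro!: iv_add_nonreal h)
  then have "iv ((h + cs ?c) * (h + cs (- ?c)))" by (intro iv_mult)
  also have "(h + cs ?c) * (h + cs (- ?c)) = h * h + cs (?c * (- ?c))" by (rule e)
  also have "?c * (- ?c) = of_real t" using t by (simp add: complex_eq_iff)
  finally show "iv (h * h + cr t)" .
qed

lemma ge0_cr: "t \<ge> 0 \<Longrightarrow> ge0 (cr t)"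
  unfolding ge0_def using sa_cr iv_cs by (auto simp flip: cr_add simp del: of_real_add)

text \<open>\<open>y * h\<close> is \<open>h / (1 + h)\<close>, whose spectrum lies in
  \<open>[0, 1)\<close>: for \<open>l \<noteq> 1\<close> the element \<open>1 + (1 - l) * h\<close>
  is a multiple of \<open>h + c\<close> with \<open>Re c > 0\<close>.\<close>

lemma sr_quotient:
  assumes h: "ge0 h" and y: "y \<in> S" "(1 + h) * y = 1" "y * (1 + h) = 1"
  shows "sa (y * h)" "sr (y * h)" "y * h = h * y"
proof -
  have sah: "sa h" "h \<in> S" using ge0D(2)[OF h] by (auto simp: sa_def)
  have "y = y * ((1 + h) * y)" using y by simp
  have "h * y = y * ((1 + h) * h) * y" using y by (simp add: mult.assoc[symmetric])
  also have "\<dots> = y * h * ((1 + h) * y)" by (simp add: algebra_simps)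
  finally show c: "y * h = h * y" using y by simp
  have "sa y" by (rule sa_inverse[OF sa_add[OF sa_1 sah(1)] y])
  then show "sa (y * h)" using sah c by (intro sa_comm)
  show "sr (y * h)"
    unfolding sr_def
  proof (intro allI impI)
    fix l assume l: "cmod l \<le> 1"
    have iy: "iv y" using y sah by (intro ivI[of _ "1 + h"]) (auto intro: S_add)
    have "iv (1 + cs (1 - l) * h)"
    proof (cases "l = 1")
      case True then show ?thesis using iv_cs[of 1] by (simp add: cs_1)
    next
      case False
      define c where "c = inverse (1 - l)"
      have "Re l \<le> 1" "Re l = 1 \<Longrightarrow> Im l = 0"
        using l complex_Re_le_cmod[of l] cmod_power2[of l] power_le_one[of "cmod l" 2] by auto
      then have "Re (1 - l) > 0" using False by (cases "Re l = 1") (auto simp: complex_eq_iff)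
      then have "Re c > 0" unfolding c_def inverse_complex.sel
        by (intro divide_pos_pos) (auto simp: sum_power2_gt_zero_iff)
      then have "iv (cs (1 - l) * (h + cs c))" using False by (intro iv_scale ge0_iv[OF h]) auto
      also have "cs (1 - l) * (h + cs c) = cs (1 - l) * h + cs ((1 - l) * c)" by (simp only: distrib_left cs_mult)
      also have "(1 - l) * c = 1" using False by (simp add: c_def)
      finally show ?thesis by (simp add: cs_1 add.commute)
    qed
    then have "iv (y * (1 + cs (1 - l) * h))" by (intro iv_mult iy)
    also have "y * (1 + cs (1 - l) * h) = y * (1 + h) - cs l * (y * h)"
      by (simp add: cs_diff cs_1 algebra_simps cs_lcomm[of y])
    finally show "iv (1 - cs l * (y * h))" using y by simp
  qed
qed

text \<open>\<open>1 + h + k = (1 + h) * (1 - a * b) * (1 + k)\<close> with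
  \<open>a = h / (1 + h)\<close> and \<open>b = k / (1 + k)\<close>; the middle factor is invertible
  by \<open>sr_mult_sa\<close>. From this the positive elements are closed under addition.\<close>

lemma iv_one_plus_ge0_add:
  assumes h: "ge0 h" and k: "ge0 k"
  shows "iv (1 + h + k)"
proof -
  have hk: "sa h" "sa k" "h \<in> S" "k \<in> S" using ge0D(2)[OF h] ge0D(2)[OF k] by (auto simp: sa_def)
  have i: "iv (1 + h)" "iv (1 + k)" using ge0D(1)[OF h, of 1] ge0D(1)[OF k, of 1] by (auto simp: cs_1 add.commute)
  obtain y where y: "y \<in> S" "(1 + h) * y = 1" "y * (1 + h) = 1" using i iv_def by blast
  obtain x where x: "x \<in> S" "(1 + k) * x = 1" "x * (1 + k) = 1" using i iv_def by blast
  note a = sr_quotient[OF h y] and b = sr_quotient[OF k x]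
  have "iv (1 - (y * h) * (x * k))" using srD[OF sr_mult_sa[OF a(1,2) b(1,2)], of 1] by (simp add: cs_1)
  then have "iv ((1 + h) * (1 - (y * h) * (x * k)) * (1 + k))" by (intro iv_mult i)
  also have "(1 + h) * (1 - (y * h) * (x * k)) * (1 + k) = (1 + h) * (1 + k) - ((1 + h) * y) * h * (x * k) * (1 + k)"
    by (simp only: left_diff_distrib right_diff_distrib mult_1_right mult.assoc)
  also have "\<dots> = (1 + h) * (1 + k) - h * k * (x * (1 + k))" unfolding y(2) by (simp only: b(3) mult.assoc mult_1)
  also have "\<dots> = 1 + h + k" unfolding x(3) by (simp add: algebra_simps)
  finally show ?thesis .
qed

lemma ge0_add: assumes h: "ge0 h" and k: "ge0 k" shows "ge0 (h + k)"
  unfolding ge0_def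
proof (intro conjI allI impI)
  show "sa (h + k)" using h k ge0D by (intro sa_add) auto
  fix t :: real assume t: "t > 0"
  have "iv (1 + cr (1/t) * h + cr (1/t) * k)" using t by (intro iv_one_plus_ge0_add ge0_scale h k) auto
  then have "iv (cr t * (1 + cr (1/t) * h + cr (1/t) * k))" using t by (intro iv_scale) auto
  also have "cr t * (1 + cr (1/t) * h + cr (1/t) * k) = cr t + (cr t * cr (1/t)) * h + (cr t * cr (1/t)) * k"
    by (simp only: distrib_left mult_1_right mult.assoc)
  also have "cr t * cr (1/t) = 1" using t by (simp flip: cs_mult add: cs_1)
  finally show "iv (h + k + cr t)" by (simp add: algebra_simps)
qed

section \<open>The Shirali-Ford theorem and positive functionals\<close>

lemma iv_swap_add_cs:
  assumes xy: "x \<in> S" "y \<in> S" and c: "c \<noteq> 0" and i: "iv (x * y + cs c)"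
  shows "iv (y * x + cs c)"
proof -
  have e: "cs c * (1 - cs (- inverse c) * z) = z + cs c" for z
  proof -
    have "cs c * (1 - cs (- inverse c) * z) = cs c - (cs c * cs (- inverse c)) * z"
      by (simp only: right_diff_distrib mult_1_right mult.assoc)
    also have "cs c * cs (- inverse c) = - 1" using c by (simp add: cs_minus cs_cancel)
    finally show ?thesis by simp
  qed
  have "iv (1 - cs (- inverse c) * (x * y))" using i e[of "x * y"] iv_unscale[OF c] by metis
  then have "iv (1 - (cs (- inverse c) * x) * y)" by (simp only: mult.assoc)
  then have "iv (1 - y * (cs (- inverse c) * x))" by (rule iv_swap[rotated 2]) (use xy in \<open>auto intro: S_mult\<close>)
  then have "iv (1 - cs (- inverse c) * (y * x))" by (simp only: cs_lcomm[of y])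
  then show ?thesis using iv_scale[OF c] e[of "y * x"] by metis
qed

lemma iv_add_cr_if_sr: assumes "sr x" "t \<ge> 1" shows "iv (x + cr t)"
proof -
  have "iv (1 - cr (- inverse t) * x)"
    by (rule srD[OF assms(1)]) (use assms(2) in \<open>simp add: norm_inverse inverse_le_1_iff\<close>)
  then have "iv (cr t * (1 - cr (- inverse t) * x))" using assms by (intro iv_scale) auto
  also have "cr t * (1 - cr (- inverse t) * x) = cr t - (cr t * cr (- inverse t)) * x"
    by (simp only: right_diff_distrib mult_1_right mult.assoc)
  also have "cr t * cr (- inverse t) = - 1" using assms by (simp flip: cs_mult add: cs_minus cs_1)
  finally show ?thesis by (simp add: add.commute)
qed

lemma re_im_decomp:
  assumes b: "b \<in> S"
  obtains p q where "sa p" "sa q" "b = p + cs \<i> * q" "st b = p - cs \<i> * q"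
proof
  let ?p = "cs (1/2) * (b + st b)" and ?q = "cs (- \<i> / 2) * (b - st b)"
  have S: "st b \<in> S" "b + st b \<in> S" "b - st b \<in> S" using b st_in by (auto intro: S_intros)
  show "sa ?p" using b S by (simp add: sa_def S_mult st_cs_mult st_add st_st add.commute)
  have "cs (\<i> / 2) * (st b - b) = cs (- \<i> / 2) * (b - st b)" by (simp add: cs_minus algebra_simps)
  then show "sa ?q" using b S by (simp add: sa_def S_mult st_cs_mult st_diff st_st)
  have q: "cs \<i> * ?q = cs (1/2) * (b - st b)" by (simp flip: cs_mult mult.assoc)
  have "cs (1/2) * (b + st b) + cs (1/2) * (b - st b) = cs (1/2) * (b + b)" by (simp flip: distrib_left)
  then show "b = ?p + cs \<i> * ?q" unfolding q cs_half by simp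
  have "cs (1/2) * (b + st b) - cs (1/2) * (b - st b) = cs (1/2) * (st b + st b)" by (simp flip: right_diff_distrib)
  then show "st b = ?p - cs \<i> * ?q" unfolding q cs_half by simp
qed

text \<open>The function behind the step is
  \<open>\<lambda> \<mapsto> 2 \<lambda> / (1 + \<lambda>)^2\<close>. It is realised by
  \<open>st b' * b'\<close> with \<open>b'\<close> a multiple of \<open>a * y\<close>, where
  \<open>y\<close> is the inverse of \<open>1 + x\<close>; so the hypothesis reproduces itself,
  while a spectral value \<open>- t\<close> moves to \<open>- t'\<close> with
  \<open>t' \<ge> 2 t\<close>. Finitely many doublings would leave the unit disc.\<close>

lemma star_mult_iterate:
  "a \<in> S \<Longrightarrow> sr (st a * a) \<Longrightarrow> t \<ge> (1/2) ^ n \<Longrightarrow> iv (st a * a + cr t)"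
proof (induction n arbitrary: a t)
  case 0
  then show ?case by (intro iv_add_cr_if_sr) auto
next
  case (Suc n)
  show ?case
  proof (cases "t \<ge> 1")
    case True then show ?thesis using Suc.prems by (intro iv_add_cr_if_sr)
  next
    case False
    have t: "0 < t" "t < 1" using False Suc.prems(3) zero_less_power[of "1/2::real" "Suc n"] by linarith+
    define x where "x = st a * a"
    have xS: "sa x" "x \<in> S" using sa_star_mult Suc.prems by (auto simp: x_def sa_def)
    have "iv (1 - cs (-1) * x)" by (rule srD) (use Suc.prems x_def in auto)
    then have "iv (1 + x)" by (simp add: cs_minus cs_1)
    then obtain y where y: "sa y" "(1 + x) * y = 1" "y * (1 + x) = 1" using sa_ivE[OF sa_add[OF sa_1 xS(1)]] by blast
    have yS: "y \<in> S" "st y = y" using y by (auto simp: sa_def)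
    have xy: "x * y = 1 - y" using y(2) by (simp add: algebra_simps eq_diff_eq)
    \<comment> \<open>\<open>E = st b * b\<close> becomes \<open>4 (y - y * y)\<close>, the function
      \<open>4 \<lambda> / (1 + \<lambda>)^2\<close> of \<open>x\<close>.\<close>
    define b where "b = cr 2 * (a * y)"
    have aS: "a \<in> S" "st a \<in> S" "a * y \<in> S" using Suc.prems st_in yS by (auto intro: S_mult)
    have bS: "b \<in> S" using aS by (auto simp: b_def intro: S_mult)
    have stb: "st b = cr 2 * (y * st a)" unfolding b_def st_cs_mult[OF aS(3)] st_mult[OF aS(1) yS(1)] yS(2) by simp
    define E where "E = st b * b"
    have "E = cr 2 * (y * st a) * (cr 2 * (a * y))" unfolding E_def stb by (simp only: b_def)
    also have "\<dots> = cr 2 * (cr 2 * (y * (x * y)))"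
      unfolding x_def by (simp only: cs_lcomm[of y] cs_lcomm[of "st a"] mult.assoc)
    also have "\<dots> = cr 4 * (y * (x * y))" by (simp flip: cs_mult mult.assoc)
    finally have E: "E = cr 4 * (y - y * y)" unfolding xy by (simp add: right_diff_distrib)
    have saE: "sa E" "E \<in> S" using sa_star_mult bS by (auto simp: E_def sa_def)
    \<comment> \<open>\<open>c * c = 1 - E\<close> with \<open>c\<close> self-adjoint, so the
      spectrum of \<open>E\<close> has no value above 1.\<close>
    define c where "c = y + y - 1"
    have sac: "sa c" unfolding c_def by (intro sa_diff sa_add sa_1 y)
    have cr4: "cr 4 = 1 + 1 + 1 + 1" using cs_add[of 1 1] cs_add[of 2 1] cs_add[of 3 1] by (simp add: cs_1)
    have cc: "c * c = 1 - E" unfolding E cr4 c_def by (simp add: distrib_left distrib_right left_diff_distrib right_diff_distrib del: one_add_one)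
    have low: "iv (E + cr (- r))" if "r > 1" for r
    proof -
      have "iv (c * c + cr (r - 1))" using that by (intro ge0D(1)[OF ge0_square[OF sac]]) auto
      then have "iv (- (c * c + cr (r - 1)))" by (rule iv_minus)
      also have "- (c * c + cr (r - 1)) = E + cr (- r)" unfolding cc by (simp add: cs_diff cs_minus cs_1)
      finally show ?thesis .
    qed
    \<comment> \<open>\<open>st b * b + b * st b\<close> is twice a sum of two squares, so
      \<open>b * st b + 1\<close> is a sum of squares as well; hence the spectrum of
      \<open>b * st b\<close>, and by swapping factors that of \<open>E\<close>, has no value below
      -1.\<close>
    have up: "iv (E + cr r)" if r: "r > 1" for r
    proof -
      obtain p q where pq: "sa p" "sa q" "b = p + cs \<i> * q" "st b = p - cs \<i> * q" using re_im_decomp[OF bS] .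
      have cpq: "p * (cs \<i> * z) = cs \<i> * (p * z)" "q * (cs \<i> * z) = cs \<i> * (q * z)" for z
        by (rule cs_lcomm)+
      have "E + b * st b = (p - cs \<i> * q) * (p + cs \<i> * q) + (p + cs \<i> * q) * (p - cs \<i> * q)"
        unfolding E_def pq(4) by (simp only: pq(3)[symmetric])
      also have "\<dots> = (p * p + p * p) + (cs (- (\<i> * \<i>)) * (q * q) + cs (- (\<i> * \<i>)) * (q * q))"
        by (simp only: cs_minus cs_mult) (simp add: algebra_simps cpq)
      also have "- (\<i> * \<i>) = 1" by simp
      finally have "b * st b + 1 = (p * p + p * p) + (q * q + q * q) + c * c" unfolding cc by (simp add: cs_1 algebra_simps)
      moreover have "ge0 ((p * p + p * p) + (q * q + q * q) + c * c)"
        by (intro ge0_add ge0_square pq sac)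
      ultimately have "iv (b * st b + 1 + cr (r - 1))" using r by (intro ge0D(1)) auto
      then have "iv (b * st b + cr r)" by (simp add: cs_diff cs_1)
      then show ?thesis unfolding E_def using bS st_in r by (intro iv_swap_add_cs[of b "st b"]) auto
    qed
    have srE: "sr (cr (1/2) * E)"
      unfolding sr_def
    proof (intro allI impI)
      fix l assume l: "cmod l \<le> 1"
      show "iv (1 - cs l * (cr (1/2) * E))"
      proof (cases "l = 0")
        case True then show ?thesis using iv_cs[of 1] by (simp add: cs_1)
      next
        case False
        define d where "d = - 2 / l"
        have "iv (E + cs d)"
        proof (cases "Im d = 0")
          case False then show ?thesis by (intro iv_add_nonreal saE)
        next
          case True
          then have d: "d = of_real (Re d)" by (simp add: complex_eq_iff)
          have "2 * cmod l \<le> 2" using l by simp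
          then have "2 \<le> cmod d" using \<open>l \<noteq> 0\<close> by (simp add: d_def norm_divide field_simps)
          then have "2 \<le> \<bar>Re d\<bar>" using d by (metis norm_of_real)
          then show ?thesis using low[of "- Re d"] up[of "Re d"] d by (cases "Re d \<ge> 0") auto
        qed
        then have "iv (cs (- l / 2) * (E + cs d))" using False by (intro iv_scale) auto
        also have "cs (- l / 2) * (E + cs d) = cs (- l / 2) * E + cs (- l / 2 * d)" by (simp only: distrib_left cs_mult)
        also have "- l / 2 * d = 1" using False by (simp add: d_def)
        also have "- l / 2 = - (l * of_real (1/2))" by simp
        also have "cs (- (l * of_real (1/2))) * E = - (cs l * (cr (1/2) * E))" by (simp only: cs_minus cs_mult mult.assoc minus_mult_left)
        finally show ?thesis by (simp add: cs_1)
      qed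
    qed
    define b' where "b' = cr (sqrt (1/2)) * b"
    have b'S: "b' \<in> S" unfolding b'_def using bS by (auto intro: S_mult)
    have "st b' = cr (sqrt (1/2)) * st b" unfolding b'_def using bS by (simp add: st_cs_mult)
    then have "st b' * b' = cr (sqrt (1/2)) * (cr (sqrt (1/2)) * E)"
      unfolding b'_def E_def by (simp only: cs_lcomm[of "st b"] mult.assoc)
    also have "\<dots> = (cr (sqrt (1/2)) * cr (sqrt (1/2))) * E" by (simp only: mult.assoc)
    also have "cr (sqrt (1/2)) * cr (sqrt (1/2)) = cr (1/2)" unfolding cr_mult[symmetric] by (simp flip: real_sqrt_mult)
    finally have b'b: "st b' * b' = cr (1/2) * E" .
    \<comment> \<open>The image of \<open>t\<close> under the doubling map. With it
      \<open>cr (1/2) * E + cr t'\<close> is, up to a scalar,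
      \<open>(1 - (1 - t) y) * (t + (1 - t) y)\<close>, whose first factor is
      \<open>(x + t) * y\<close>.\<close>
    define t' where "t' = 2 * t / (1 - t)\<^sup>2"
    have "(1 - t)\<^sup>2 \<le> 1" using t by (intro power_le_one) auto
    then have "2 * t * (1 - t)\<^sup>2 \<le> 2 * t * 1" using t by (intro mult_left_mono) auto
    then have "2 * t \<le> t'" using t by (simp add: t'_def field_simps)
    then have "(1/2) ^ n \<le> t'" using Suc.prems(3) by simp
    then have "iv (cr (1/2) * E + cr t')" using Suc.IH[OF b'S] srE b'b by simp
    moreover have "(1 - t)\<^sup>2 / 2 \<noteq> 0" using t by simp
    ultimately have "iv (cr ((1 - t)\<^sup>2 / 2) * (cr (1/2) * E + cr t'))"
      by (intro iv_scale) (simp only: of_real_eq_0_iff not_False_eq_True)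
    also have "cr ((1 - t)\<^sup>2 / 2) * (cr (1/2) * E + cr t') =
        (cr ((1 - t)\<^sup>2 / 2) * cr (1/2) * cr 4) * (y - y * y) + cr ((1 - t)\<^sup>2 / 2) * cr t'"
      unfolding E by (simp only: distrib_left mult.assoc)
    also have "cr ((1 - t)\<^sup>2 / 2) * cr (1/2) * cr 4 = cr (1 - t) * cr (1 - t)"
      unfolding cr_mult[symmetric] by (simp add: power2_eq_square)
    also have "cr ((1 - t)\<^sup>2 / 2) * cr t' = cr t"
      unfolding cr_mult[symmetric] using t by (simp add: t'_def)
    also have "cr (1 - t) * cr (1 - t) * (y - y * y) + cr t = (1 - cr (1 - t) * y) * (cr t + cr (1 - t) * y)"
    proof -
      define d where "d = cr (1 - t)"
      have d: "cr t = 1 - d" by (simp add: d_def cs_diff cs_1)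
      have yd: "y * (d * z) = d * (y * z)" "y * d = d * y" for z unfolding d_def by (rule cs_lcomm, rule cs_comm)
      show ?thesis unfolding d_def[symmetric] d by (simp add: algebra_simps yd)
    qed
    finally have i: "iv ((1 - cr (1 - t) * y) * (cr t + cr (1 - t) * y))" .
    have "iv (1 - cr (1 - t) * y)"
    proof (rule iv_factor[OF _ _ _ i])
      define d where "d = cr (1 - t)"
      have d: "cr t = 1 - d" by (simp add: d_def cs_diff cs_1)
      have yd: "y * (d * z) = d * (y * z)" "y * d = d * y" for z unfolding d_def by (rule cs_lcomm, rule cs_comm)
      show "(1 - cr (1 - t) * y) * (cr t + cr (1 - t) * y) = (cr t + cr (1 - t) * y) * (1 - cr (1 - t) * y)"
        unfolding d_def[symmetric] d by (simp add: algebra_simps yd)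
    qed (use yS in \<open>auto intro!: S_intros\<close>)
    also have "1 - cr (1 - t) * y = (x + cr t) * y"
      by (simp add: distrib_right xy cs_diff cs_1 algebra_simps)
    finally have "iv ((x + cr t) * y * (1 + x))" using \<open>iv (1 + x)\<close> by (rule iv_mult)
    then show ?thesis using y(3) by (simp add: x_def[symmetric] mult.assoc)
  qed
qed

text \<open>Normalise \<open>a\<close> so that \<open>st a * a\<close> has norm below 1; every
  \<open>t > 0\<close> exceeds some \<open>(1/2) ^ n\<close>, and \<open>star_mult_iterate\<close>
  applies.\<close>

theorem Shirali_Ford:
  assumes a: "a \<in> S"
  shows "ge0 (st a * a)"
proof -
  define x where "x = st a * a"
  have x: "sa x" "x \<in> S" using sa_star_mult a by (auto simp: x_def sa_def)
  define c where "c = 1 / sqrt (N x + 1)"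
  have c: "c > 0" "c * c = 1 / (N x + 1)" using N_ge0[OF x(2)] by (auto simp: c_def simp flip: real_sqrt_mult)
  define b where "b = cr c * a"
  have bS: "b \<in> S" using a by (auto simp: b_def intro: S_mult)
  have "st b = cr c * st a" using a by (simp add: b_def st_cs_mult)
  then have "st b * b = (cr c * cr c) * x" unfolding b_def x_def by (simp only: cs_lcomm[of "st a"] mult.assoc)
  then have bb: "st b * b = cr (c * c) * x" by (simp only: cr_mult)
  have "0 \<le> c * c" by simp
  then have "N (cr (c * c) * x) = (c * c) * N x" by (simp only: N_cs[OF x(2)] norm_of_real abs_of_nonneg)
  also have "\<dots> < 1" using N_ge0[OF x(2)] c by simp
  finally have "sr (st b * b)" using bb x by (intro sr_if_N_less_1) (auto intro: S_mult)
  then have i: "iv (st b * b + cr t)" if t: "t > 0" for t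
  proof -
    obtain n where "(1/2) ^ n < t" using real_arch_pow_inv[OF t, of "1/2"] by auto
    then show ?thesis using star_mult_iterate[OF bS \<open>sr (st b * b)\<close>, of n t] by simp
  qed
  show ?thesis
    unfolding ge0_def x_def[symmetric]
  proof (intro conjI allI impI x)
    fix t :: real assume t: "t > 0"
    have "c * c * t > 0" using t c(1) by simp
    then have "iv (cr (c * c) * x + cr (c * c * t))" unfolding bb[symmetric] by (rule i)
    also have "cr (c * c) * x + cr (c * c * t) = cr (c * c) * (x + cr t)" by (simp only: distrib_left cr_mult)
    finally have "iv (cr (c * c) * (x + cr t))" .
    moreover have "complex_of_real (c * c) \<noteq> 0" unfolding of_real_eq_0_iff using c(1) by simp
    ultimately show "iv (x + cr t)" using iv_unscale by blast
  qed
qed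

lemma ge0_N_minus: assumes h: "sa h" "N h \<le> t" shows "ge0 (cr t - h)"
  unfolding ge0_def
proof (intro conjI allI impI)
  show "sa (cr t - h)" by (intro sa_diff sa_cr h)
  fix s :: real assume s: "s > 0"
  have "N (- h) < cmod (complex_of_real (t + s))"
    using h s N_minus N_ge0[of h] by (simp only: sa_def norm_of_real)
  then have "iv (- h + cr (t + s))" using h by (intro iv_add_cs_large S_minus) (auto simp: sa_def)
  then show "iv (cr t - h + cr s)" by (simp add: cs_add algebra_simps)
qed

section \<open>Cones and states\<close>

text \<open>The form of Hahn-Banach that is needed: a cone maximal among those avoiding
  \<open>- 1\<close> is total, so it compares any two self-adjoint elements and a state can be read
  off as a cut.\<close>

lemma cone_total_preorder:
  assumes K0: "K0 \<subseteq> {x. sa x}" "\<And>x y. x \<in> K0 \<Longrightarrow> y \<in> K0 \<Longrightarrow> x + y \<in> K0"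
      "\<And>x r. x \<in> K0 \<Longrightarrow> r \<ge> 0 \<Longrightarrow> cr r * x \<in> K0" "- 1 \<notin> K0" "0 \<in> K0"
  shows "\<exists>K. K0 \<subseteq> K \<and> K \<subseteq> {x. sa x} \<and> (\<forall>x\<in>K. \<forall>y\<in>K. x + y \<in> K) \<and>
      (\<forall>x\<in>K. \<forall>r\<ge>0. cr r * x \<in> K) \<and> - 1 \<notin> K \<and> (\<forall>h. sa h \<longrightarrow> h \<in> K \<or> - h \<in> K)"
proof -
  define C where "C = {K. K0 \<subseteq> K \<and> K \<subseteq> {x. sa x} \<and> (\<forall>x\<in>K. \<forall>y\<in>K. x + y \<in> K) \<and>
      (\<forall>x\<in>K. \<forall>r\<ge>0. cr r * x \<in> K) \<and> - 1 \<notin> K}"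
  have "\<exists>K\<in>C. \<forall>X\<in>C. K \<subseteq> X \<longrightarrow> X = K"
  proof (rule subset_Zorn_nonempty)
    show "C \<noteq> {}" using K0 by (auto simp: C_def intro!: exI[of _ K0])
    fix c assume c: "c \<noteq> {}" "subset.chain C c"
    then have cC: "c \<subseteq> C" and ch: "\<And>X Y. X \<in> c \<Longrightarrow> Y \<in> c \<Longrightarrow> X \<subseteq> Y \<or> Y \<subseteq> X"
      by (auto simp: subset_chain_def)
    have "x + y \<in> \<Union> c" if "x \<in> \<Union> c" "y \<in> \<Union> c" for x y
    proof -
      obtain X Y where XY: "X \<in> c" "x \<in> X" "Y \<in> c" "y \<in> Y" using \<open>x \<in> \<Union> c\<close> \<open>y \<in> \<Union> c\<close> by blast
      then obtain Z where Z: "Z \<in> c" "x \<in> Z" "y \<in> Z" using ch[of X Y] by blast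
      then have "x + y \<in> Z" using cC unfolding C_def by blast
      then show ?thesis using Z by blast
    qed
    moreover have "cr r * x \<in> \<Union> c" if "x \<in> \<Union> c" "r \<ge> 0" for x r
      using that cC unfolding C_def by blast
    moreover have "K0 \<subseteq> \<Union> c" using c(1) cC unfolding C_def by blast
    moreover have "\<Union> c \<subseteq> {x. sa x}" "- 1 \<notin> \<Union> c" using cC unfolding C_def by blast+
    ultimately show "\<Union> c \<in> C" unfolding C_def by blast
  qed
  then obtain K where KC: "K \<in> C" and max: "\<And>X. X \<in> C \<Longrightarrow> K \<subseteq> X \<Longrightarrow> X = K" by blast
  have K: "K0 \<subseteq> K" "K \<subseteq> {x. sa x}" "- 1 \<notin> K" using KC by (auto simp: C_def)
  have Kadd: "\<And>x y. x \<in> K \<Longrightarrow> y \<in> K \<Longrightarrow> x + y \<in> K" and Ksc: "\<And>x r. x \<in> K \<Longrightarrow> r \<ge> 0 \<Longrightarrow> cr r * x \<in> K"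
    using KC by (auto simp: C_def)
  have ext: "\<exists>k\<in>K. \<exists>r>0. - 1 = k + cr r * h" if h: "sa h" "h \<notin> K" for h
  proof (rule ccontr)
    assume neg: "\<not> (\<exists>k\<in>K. \<exists>r>0. - 1 = k + cr r * h)"
    define X where "X = {k + cr r * h | k r. k \<in> K \<and> r \<ge> 0}"
    have XI: "k + cr r * h \<in> X" if "k \<in> K" "r \<ge> 0" for k r
      unfolding X_def using that by blast
    have KX: "K \<subseteq> X"
    proof
      fix k assume "k \<in> K"
      then have "k + cr 0 * h \<in> X" by (rule XI) simp
      then show "k \<in> X" by simp
    qed
    have "0 + cr 1 * h \<in> X" using K0 K by (intro XI) auto
    then have hX: "h \<in> X" by (simp add: cs_1)
    have "X \<in> C"
      unfolding C_def
    proof (intro CollectI conjI ballI allI impI)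
      show "K0 \<subseteq> X" using K KX by blast
      show "X \<subseteq> {x. sa x}" using K h unfolding X_def by (auto intro: sa_add sa_scale)
      show "- 1 \<notin> X"
      proof
        assume "- 1 \<in> X"
        then obtain k r where kr: "k \<in> K" "r \<ge> 0" "- 1 = k + cr r * h" unfolding X_def by blast
        show False
        proof (cases "r = 0")
          case True then show False using kr K by simp
        next
          case False then show False using neg kr by (metis less_eq_real_def)
        qed
      qed
      fix x assume "x \<in> X"
      then obtain k r where kr: "k \<in> K" "r \<ge> 0" "x = k + cr r * h" unfolding X_def by blast
      {
        fix s :: real assume s: "s \<ge> 0"
        have "cr s * x = cr s * k + cr (s * r) * h" unfolding kr(3) by (simp only: distrib_left cr_mult mult.assoc)
        then show "cr s * x \<in> X" using XI[OF Ksc[OF kr(1) s], of "s * r"] s kr(2) by simp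
      }
      fix y assume "y \<in> X"
      then obtain k' r' where kr': "k' \<in> K" "r' \<ge> 0" "y = k' + cr r' * h" unfolding X_def by blast
      have "x + y = (k + k') + cr (r + r') * h" unfolding kr(3) kr'(3) cr_add by (simp add: algebra_simps cs_add)
      then show "x + y \<in> X" using XI[OF Kadd[OF kr(1) kr'(1)], of "r + r'"] kr(2) kr'(2) by simp
    qed
    then have "X = K" using max KX by blast
    then show False using hX h by blast
  qed
  have "h \<in> K \<or> - h \<in> K" if h: "sa h" for h
  proof (rule ccontr)
    assume n: "\<not> (h \<in> K \<or> - h \<in> K)"
    obtain k r where kr: "k \<in> K" "r > 0" "- 1 = k + cr r * h" using ext[OF h] n by blast
    obtain k' s where ks: "k' \<in> K" "s > 0" "- 1 = k' + cr s * (- h)" using ext[OF sa_minus[OF h]] n by blast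
    \<comment> \<open>From \<open>- 1 = k + r h\<close> and \<open>- 1 = k' - s h\<close> the
      combination \<open>s * k + r * k' = - (s + r)\<close> eliminates \<open>h\<close> and puts a
      negative scalar into \<open>K\<close>.\<close>
    have "cr s * k + cr r * k' = cr s * (- 1 - cr r * h) + cr r * (- 1 + cr s * h)"
      using kr(3) ks(3) by (simp add: algebra_simps eq_diff_eq)
    also have "\<dots> = - cr (s + r) + (cr r * cr s - cr s * cr r) * h"
      by (simp add: cs_add algebra_simps)
    also have "cr r * cr s = cr s * cr r" by (rule cs_comm)
    finally have e: "cr s * k + cr r * k' = - cr (s + r)" by simp
    have "cr (1 / (s + r)) * (cr s * k + cr r * k') \<in> K" using kr ks by (intro Ksc Kadd) auto
    also have "cr (1 / (s + r)) * (cr s * k + cr r * k') = - (cr (1 / (s + r)) * cr (s + r))" unfolding e by simp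
    also have "cr (1 / (s + r)) * cr (s + r) = 1" unfolding cr_mult[symmetric] using kr ks by (simp add: cs_1)
    finally show False using K by simp
  qed
  then show ?thesis using KC unfolding C_def by blast
qed

text \<open>\<open>f h\<close> is the supremum of the \<open>t\<close> with \<open>h - t\<close> in
  \<open>K\<close>. This set is nonempty and bounded because \<open>N h - h\<close> and
  \<open>N h + h\<close> lie in \<open>K\<close>; totality places \<open>t - h\<close> in
  \<open>K\<close> for every \<open>t\<close> above the supremum, so both sides of the cut add up
  and \<open>f\<close> is additive.\<close>

lemma real_state_of_cone:
  assumes K: "K \<subseteq> {x. sa x}" "\<And>x y. x \<in> K \<Longrightarrow> y \<in> K \<Longrightarrow> x + y \<in> K"
      "\<And>x r. x \<in> K \<Longrightarrow> r \<ge> 0 \<Longrightarrow> cr r * x \<in> K" "- 1 \<notin> K" "\<And>h. sa h \<Longrightarrow> h \<in> K \<or> - h \<in> K"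
    and pos: "\<And>h. ge0 h \<Longrightarrow> h \<in> K"
  obtains f :: "'a \<Rightarrow> real" where "\<And>h k. sa h \<Longrightarrow> sa k \<Longrightarrow> f (h + k) = f h + f k"
    "\<And>r h. sa h \<Longrightarrow> f (cr r * h) = r * f h" "f 1 = 1" "\<And>k. k \<in> K \<Longrightarrow> 0 \<le> f k"
proof -
  have neg: "cr t \<notin> K" if "t < 0" for t
  proof
    assume "cr t \<in> K"
    then have "cr (- 1 / t) * cr t \<in> K" using that by (intro K(3)) (auto simp: divide_nonneg_neg)
    also have "cr (- 1 / t) * cr t = - 1" unfolding cr_mult[symmetric] using that by (simp add: cs_minus cs_1)
    finally show False using K(4) by simp
  qed
  have crK: "cr t \<in> K" if "t \<ge> 0" for t using ge0_cr[OF that] pos by blast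
  define A where "A h = {t. h - cr t \<in> K}" for h
  define f where "f h = Sup (A h)" for h
  have ord: "t \<le> s" if "h - cr t \<in> K" "cr s - h \<in> K" for h t s
  proof (rule ccontr)
    assume "\<not> t \<le> s"
    moreover have "(h - cr t) + (cr s - h) \<in> K" using that by (intro K(2))
    then have "cr (s - t) \<in> K" by (simp add: cs_diff)
    ultimately show False using neg[of "s - t"] by simp
  qed
  have NK: "cr (N h) - h \<in> K" "h - cr (- N h) \<in> K" if "sa h" for h
  proof -
    show "cr (N h) - h \<in> K" using ge0_N_minus[OF that, of "N h"] pos by blast
    have "cr (N h) - (- h) \<in> K" using ge0_N_minus[OF sa_minus[OF that], of "N h"] that pos N_minus by (auto simp: sa_def)
    then show "h - cr (- N h) \<in> K" by (simp add: cs_minus add.commute)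
  qed
  have bdd: "bdd_above (A h)" and ne: "A h \<noteq> {}" if "sa h" for h
  proof -
    show "bdd_above (A h)" using ord[OF _ NK(1)[OF that]] by (intro bdd_aboveI[of _ "N h"]) (auto simp: A_def)
    have "- N h \<in> A h" using NK(2)[OF that] by (simp add: A_def)
    then show "A h \<noteq> {}" by blast
  qed
  have lo: "h - cr t \<in> K" if h: "sa h" and t: "t < f h" for h t
  proof -
    obtain s where s: "s \<in> A h" "t < s" using less_cSupD[OF ne[OF h]] t unfolding f_def by blast
    have "(h - cr s) + cr (s - t) \<in> K" using s by (intro K(2) crK) (auto simp: A_def)
    then show ?thesis by (simp add: cs_diff)
  qed
  have hi: "cr t - h \<in> K" if h: "sa h" and t: "f h < t" for h t
  proof -
    have "h - cr t \<notin> K" using cSup_upper[OF _ bdd[OF h], of t] t unfolding f_def A_def by fastforce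
    then have "- (h - cr t) \<in> K" using K(5)[OF sa_diff[OF h sa_cr]] by blast
    then show ?thesis by simp
  qed
  have eqI: "f h = v" if h: "sa h" and l: "\<And>e. e > 0 \<Longrightarrow> h - cr (v - e) \<in> K" and u: "\<And>e. e > 0 \<Longrightarrow> cr (v + e) - h \<in> K" for h v
  proof (rule antisym)
    show "f h \<le> v"
    proof (rule field_le_epsilon)
      fix e :: real assume e: "e > 0"
      show "f h \<le> v + e" unfolding f_def
        by (rule cSup_least[OF ne[OF h]]) (use ord u[OF e] in \<open>auto simp: A_def\<close>)
    qed
    show "v \<le> f h"
    proof (rule field_le_epsilon)
      fix e :: real assume e: "e > 0"
      have "v - e \<le> f h" unfolding f_def by (rule cSup_upper[OF _ bdd[OF h]]) (use l[OF e] in \<open>auto simp: A_def\<close>)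
      then show "v \<le> f h + e" by simp
    qed
  qed
  have f_add: "f (h + k) = f h + f k" if "sa h" "sa k" for h k
  proof (rule eqI)
    show "sa (h + k)" using that by (rule sa_add)
    fix e :: real assume e: "e > 0"
    have "(h - cr (f h - e/2)) + (k - cr (f k - e/2)) \<in> K" using e that by (intro K(2) lo) auto
    also have "(h - cr (f h - e/2)) + (k - cr (f k - e/2)) = h + k - cr ((f h - e/2) + (f k - e/2))"
      unfolding cr_add by simp
    also have "(f h - e/2) + (f k - e/2) = f h + f k - e" by simp
    finally show "h + k - cr (f h + f k - e) \<in> K" .
    have "(cr (f h + e/2) - h) + (cr (f k + e/2) - k) \<in> K" using e that by (intro K(2) hi) auto
    also have "(cr (f h + e/2) - h) + (cr (f k + e/2) - k) = cr ((f h + e/2) + (f k + e/2)) - (h + k)"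
      unfolding cr_add by simp
    also have "(f h + e/2) + (f k + e/2) = f h + f k + e" by simp
    finally show "cr (f h + f k + e) - (h + k) \<in> K" .
  qed
  have f0: "f 0 = 0" using f_add[of 0 0] sa_cr[of 0] by simp
  have f_pos_scale: "f (cr r * h) = r * f h" if "r > 0" "sa h" for r h
  proof (rule eqI)
    show "sa (cr r * h)" using that by (intro sa_scale)
    fix e :: real assume e: "e > 0"
    have "cr r * (h - cr (f h - e/r)) \<in> K" using e that by (intro K(3) lo) auto
    also have "cr r * (h - cr (f h - e/r)) = cr r * h - cr (r * (f h - e/r))" unfolding cr_mult by (rule right_diff_distrib)
    also have "r * (f h - e/r) = r * f h - e" using that by (simp add: right_diff_distrib)
    finally show "cr r * h - cr (r * f h - e) \<in> K" .
    have "cr r * (cr (f h + e/r) - h) \<in> K" using e that by (intro K(3) hi) auto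
    also have "cr r * (cr (f h + e/r) - h) = cr (r * (f h + e/r)) - cr r * h" unfolding cr_mult by (rule right_diff_distrib)
    also have "r * (f h + e/r) = r * f h + e" using that by (simp add: distrib_left)
    finally show "cr (r * f h + e) - cr r * h \<in> K" .
  qed
  have f_scale: "f (cr r * h) = r * f h" if "sa h" for r h
  proof (cases r "0::real" rule: linorder_cases)
    case less
    have "f (cr r * h) + f (cr (- r) * h) = f (cr r * h + cr (- r) * h)" using that by (intro f_add[symmetric] sa_scale)
    also have "cr r * h + cr (- r) * h = 0" by (simp add: cs_minus)
    finally show ?thesis using f_pos_scale[of "- r" h] that less f0 by simp
  next
    case equal then show ?thesis using f0 by simp
  next
    case greater then show ?thesis using f_pos_scale that by blast
  qed
  have f1: "f 1 = 1"
  proof (rule eqI[OF sa_1])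
    fix e :: real assume e: "e > 0"
    show "1 - cr (1 - e) \<in> K" "cr (1 + e) - 1 \<in> K"
      using crK[of e] e by (simp_all add: cs_diff cs_add cs_1)
  qed
  have fK: "0 \<le> f k" if "k \<in> K" for k
    unfolding f_def by (rule cSup_upper[OF _ bdd]) (use that K(1) in \<open>auto simp: A_def\<close>)
  show thesis by (rule that[OF f_add f_scale f1 fK])
qed

text \<open>Start from the positive elements plus the self-adjoint part of \<open>L\<close>. This
  cone avoids \<open>- 1\<close>: from \<open>- 1 = k + u\<close> the invertible
  \<open>k + 1\<close> would equal \<open>- u\<close> and force \<open>1 \<in> L\<close>. For
  \<open>x \<in> L\<close> both \<open>st x * x\<close> and its negative lie in the cone, so the
  state vanishes there.\<close>

theorem positive_functional_vanishing_on_left_ideal: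
  assumes L: "L \<subseteq> S" "0 \<in> L" "\<And>x y. x \<in> L \<Longrightarrow> y \<in> L \<Longrightarrow> x + y \<in> L"
      "\<And>s x. s \<in> S \<Longrightarrow> x \<in> L \<Longrightarrow> s * x \<in> L" "1 \<notin> L"
  obtains F :: "'a \<Rightarrow> complex" where "\<And>x y. x \<in> S \<Longrightarrow> y \<in> S \<Longrightarrow> F (x + y) = F x + F y"
    "\<And>c x. x \<in> S \<Longrightarrow> F (cs c * x) = c * F x" "\<And>x. x \<in> S \<Longrightarrow> F (st x) = cnj (F x)" "F 1 = 1"
    "\<And>h. ge0 h \<Longrightarrow> 0 \<le> Re (F h)" "\<And>x. x \<in> L \<Longrightarrow> F (st x * x) = 0"
proof -
  define K0 where "K0 = {k + x | k x. ge0 k \<and> x \<in> L \<and> sa x}"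
  have g0: "ge0 0" using ge0_cr[of 0] by simp
  have s0: "sa 0" using sa_cr[of 0] by simp
  have k1: "K0 \<subseteq> {x. sa x}" unfolding K0_def by (auto intro: sa_add ge0D(2))
  have k2: "x + y \<in> K0" if "x \<in> K0" "y \<in> K0" for x y
  proof -
    obtain k u l v where *: "ge0 k" "u \<in> L" "sa u" "x = k + u" "ge0 l" "v \<in> L" "sa v" "y = l + v"
      using \<open>x \<in> K0\<close> \<open>y \<in> K0\<close> unfolding K0_def by blast
    have "x + y = (k + l) + (u + v)" using * by simp
    then show ?thesis unfolding K0_def using * ge0_add[of k l] L(3)[of u v] sa_add[of u v] by blast
  qed
  have k3: "cr r * x \<in> K0" if "x \<in> K0" "r \<ge> 0" for x r
  proof -
    obtain k u where *: "ge0 k" "u \<in> L" "sa u" "x = k + u" using \<open>x \<in> K0\<close> unfolding K0_def by blast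
    have "cr r * x = cr r * k + cr r * u" using * by (simp add: distrib_left)
    then show ?thesis unfolding K0_def using * ge0_scale[OF *(1) that(2)] L(4)[of "cr r" u] sa_scale[OF *(3)] by blast
  qed
  have k4: "- 1 \<notin> K0"
  proof
    assume "- 1 \<in> K0"
    then obtain k u where *: "ge0 k" "u \<in> L" "- 1 = k + u" unfolding K0_def by blast
    have "iv (k + 1)" using ge0D(1)[OF *(1), of 1] by (simp add: cs_1)
    then obtain z where z: "z \<in> S" "z * (k + 1) = 1" by (auto simp: iv_def)
    have "k + u + 1 = - 1 + 1" by (simp only: *(3)[symmetric])
    then have "k + 1 = - u" by (simp add: eq_neg_iff_add_eq_0 algebra_simps)
    then have "(- z) * u = 1" using z(2) by simp
    then show False using L(4)[OF S_minus[OF z(1)] *(2)] L(5) by simp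
  qed
  have "0 + 0 \<in> K0" unfolding K0_def using g0 L(2) s0 by blast
  then have k5: "0 \<in> K0" by simp
  have "\<exists>K. K0 \<subseteq> K \<and> K \<subseteq> {x. sa x} \<and> (\<forall>x\<in>K. \<forall>y\<in>K. x + y \<in> K) \<and>
      (\<forall>x\<in>K. \<forall>r\<ge>0. cr r * x \<in> K) \<and> - 1 \<notin> K \<and> (\<forall>h. sa h \<longrightarrow> h \<in> K \<or> - h \<in> K)"
    by (rule cone_total_preorder[OF k1 k2 k3 k4 k5])
  then obtain K where "K0 \<subseteq> K \<and> K \<subseteq> {x. sa x} \<and> (\<forall>x\<in>K. \<forall>y\<in>K. x + y \<in> K) \<and>
      (\<forall>x\<in>K. \<forall>r\<ge>0. cr r * x \<in> K) \<and> - 1 \<notin> K \<and> (\<forall>h. sa h \<longrightarrow> h \<in> K \<or> - h \<in> K)" ..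
  then have K: "K0 \<subseteq> K" "K \<subseteq> {x. sa x}" "\<And>x y. x \<in> K \<Longrightarrow> y \<in> K \<Longrightarrow> x + y \<in> K"
      "\<And>x r. x \<in> K \<Longrightarrow> r \<ge> 0 \<Longrightarrow> cr r * x \<in> K" "- 1 \<notin> K" "\<And>h. sa h \<Longrightarrow> h \<in> K \<or> - h \<in> K"
    by blast+
  have pos: "h \<in> K" if "ge0 h" for h
  proof -
    have "h + 0 \<in> K0" unfolding K0_def using that L(2) s0 by blast
    then show ?thesis using K(1) by auto
  qed
  have KL: "x \<in> K" if "x \<in> L" "sa x" for x
  proof -
    have "0 + x \<in> K0" unfolding K0_def using that g0 by blast
    then show ?thesis using K(1) by auto
  qed
  obtain f :: "'a \<Rightarrow> real" where f: "\<And>h k. sa h \<Longrightarrow> sa k \<Longrightarrow> f (h + k) = f h + f k"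
    "\<And>r h. sa h \<Longrightarrow> f (cr r * h) = r * f h" "f 1 = 1" "\<And>k. k \<in> K \<Longrightarrow> 0 \<le> f k"
    using real_state_of_cone[OF K(2-6) pos] by blast
  define re where "re x = cs (1/2) * (x + st x)" for x
  define im where "im x = cs (- \<i> / 2) * (x - st x)" for x
  have sare: "sa (re x)" "sa (im x)" if "x \<in> S" for x
  proof -
    show "sa (re x)" using that st_in[OF that] by (simp add: re_def sa_def S_mult S_add st_cs_mult st_add st_st add.commute)
    have "cs (\<i> / 2) * (st x - x) = cs (- \<i> / 2) * (x - st x)" by (simp add: cs_minus algebra_simps)
    then show "sa (im x)" using that st_in[OF that] by (simp add: im_def sa_def S_mult S_diff st_cs_mult st_diff st_st)
  qed
  define F where "F x = Complex (f (re x)) (f (im x))" for x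
  have F_add: "F (x + y) = F x + F y" if "x \<in> S" "y \<in> S" for x y
  proof -
    have "re (x + y) = re x + re y" "im (x + y) = im x + im y"
      using that by (simp_all add: re_def im_def st_add algebra_simps)
    then show ?thesis using f(1) sare that by (simp add: F_def complex_eq_iff)
  qed
  have F_scale: "F (cs c * x) = c * F x" if x: "x \<in> S" for c x
  proof -
    have c: "cs c = cr (Re c) + cs \<i> * cr (Im c)" "cs (cnj c) = cr (Re c) - cs \<i> * cr (Im c)"
      unfolding cs_mult[symmetric] cs_add[symmetric] cs_diff[symmetric]
      by (rule arg_cong[of _ _ cs], simp add: complex_eq_iff)+
    have i: "cs \<i> * (cs (- \<i> / 2) * z) = cs (1/2) * z" "cs (- \<i> / 2) * (cs \<i> * z) = cs (1/2) * z"
      "cs \<i> * (cs (1/2) * z) = - (cs (- \<i> / 2) * z)" "cs (1/2) * (cs \<i> * z) = - (cs (- \<i> / 2) * z)" for z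
      by (simp_all flip: cs_mult mult.assoc add: cs_minus)
    have i': "cs (\<i> / 2) * (cs \<i> * z) = - (cs (1/2) * z)" for z
    proof -
      have "cs (\<i> / 2) * (cs \<i> * z) = cs (\<i> / 2 * \<i>) * z" by (simp only: cs_mult mult.assoc)
      also have "\<i> / 2 * \<i> = - (1/2)" by simp
      finally show ?thesis by (simp only: cs_minus minus_mult_left)
    qed
    have cm: "cs d * (cr t * z) = cr t * (cs d * z)" for d t z by (rule cs_lcomm)
    have st: "st (cs c * x) = cs (cnj c) * st x" using x by (rule st_cs_mult)
    have r: "re (cs c * x) = cs (1/2) * (cs c * x + cs (cnj c) * st x)"
      "im (cs c * x) = cs (- \<i> / 2) * (cs c * x - cs (cnj c) * st x)"
      by (simp_all only: re_def im_def st)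
    have "re (cs c * x) = cr (Re c) * re x + cr (- Im c) * im x"
      unfolding r unfolding re_def im_def c by (simp add: algebra_simps cs_minus cm i)
    moreover have "im (cs c * x) = cr (Re c) * im x + cr (Im c) * re x"
      unfolding r unfolding re_def im_def c by (simp add: algebra_simps cs_minus cm i i')
    moreover have fl: "f (cr a * u + cr b * v) = a * f u + b * f v" if "sa u" "sa v" for a b u v
      using f(1)[OF sa_scale[OF that(1)] sa_scale[OF that(2)]] f(2)[OF that(1)] f(2)[OF that(2)] by simp
    ultimately have "f (re (cs c * x)) = Re c * f (re x) + (- Im c) * f (im x)"
      "f (im (cs c * x)) = Re c * f (im x) + Im c * f (re x)"
      using fl[OF sare[OF x], of "Re c" "- Im c"] fl[OF sare(2)[OF x] sare(1)[OF x], of "Re c" "Im c"] by (simp_all only:)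
    then show ?thesis by (simp add: F_def complex_eq_iff)
  qed
  have F_st: "F (st x) = cnj (F x)" if x: "x \<in> S" for x
  proof -
    have "re (st x) = re x" using x by (simp add: re_def st_st add.commute)
    moreover have "im (st x) = cr (- 1) * im x" using x by (simp add: im_def st_st cs_minus cs_1 algebra_simps)
    ultimately show ?thesis using f(2)[OF sare(2)[OF x], of "- 1"] by (simp add: F_def complex_eq_iff)
  qed
  have F_sa: "F h = of_real (f h)" if h: "sa h" for h
  proof -
    have "re h = h" "im h = 0" using h cs_half by (simp_all add: re_def im_def sa_def)
    then show ?thesis using f(2)[OF h, of 0] by (simp add: F_def complex_eq_iff)
  qed
  have F_pos: "0 \<le> Re (F h)" if "ge0 h" for h
    using F_sa[OF ge0D(2)[OF that]] f(4)[OF pos[OF that]] by simp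
  have F_L: "F (st x * x) = 0" if x: "x \<in> L" for x
  proof -
    have xS: "x \<in> S" using x L by blast
    have sax: "sa (st x * x)" using xS by (rule sa_star_mult)
    have xL: "st x * x \<in> L" using x xS st_in L by blast
    then have mL: "cr (- 1) * (st x * x) \<in> L" by (rule L(4)[OF cs_in])
    have "0 \<le> f (st x * x)" using f(4)[OF KL[OF xL sax]] .
    moreover have "0 \<le> f (cr (- 1) * (st x * x))" using f(4)[OF KL[OF mL sa_scale[OF sax]]] .
    ultimately show ?thesis using f(2)[OF sax, of "- 1"] F_sa[OF sax] by simp
  qed
  have F_1: "F 1 = 1" using F_sa[OF sa_1] f(3) by simp
  show thesis by (rule that[OF F_add F_scale F_st F_1 F_pos F_L])
qed

end

section \<open>Primitive ideals and the hull-kernel topology\<close>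

locale cvspace =
  fixes V :: "'v set" and z :: 'v and p :: "'v \<Rightarrow> 'v \<Rightarrow> 'v" and s :: "complex \<Rightarrow> 'v \<Rightarrow> 'v"
  assumes cvs: "cvs V z p s"
begin

lemma closed [simp]: "z \<in> V" "x \<in> V \<Longrightarrow> y \<in> V \<Longrightarrow> p x y \<in> V" "x \<in> V \<Longrightarrow> s c x \<in> V"
  using cvs unfolding cvs_def by auto

lemma assoc: "x \<in> V \<Longrightarrow> y \<in> V \<Longrightarrow> w \<in> V \<Longrightarrow> p (p x y) w = p x (p y w)"
  using cvs unfolding cvs_def by blast

lemma comm: "x \<in> V \<Longrightarrow> y \<in> V \<Longrightarrow> p x y = p y x"
  using cvs unfolding cvs_def by blast

lemma lcomm: "x \<in> V \<Longrightarrow> y \<in> V \<Longrightarrow> w \<in> V \<Longrightarrow> p x (p y w) = p y (p x w)"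
  by (metis assoc comm)

lemma zero_left [simp]: "x \<in> V \<Longrightarrow> p z x = x"
  using cvs unfolding cvs_def by blast

lemma zero_right [simp]: "x \<in> V \<Longrightarrow> p x z = x"
  using comm[of x z] by simp

lemma scale_add: "x \<in> V \<Longrightarrow> y \<in> V \<Longrightarrow> s c (p x y) = p (s c x) (s c y)"
  and add_scale: "x \<in> V \<Longrightarrow> s (c + d) x = p (s c x) (s d x)"
  and scale_scale: "x \<in> V \<Longrightarrow> s c (s d x) = s (c * d) x"
  and scale_one [simp]: "x \<in> V \<Longrightarrow> s 1 x = x"
  using cvs unfolding cvs_def by metis+

lemma ex_inverse: "x \<in> V \<Longrightarrow> \<exists>y\<in>V. p x y = z"
  using cvs unfolding cvs_def by blast

lemma cancel_left: assumes "x \<in> V" "y \<in> V" "w \<in> V" "p x y = p x w" shows "y = w"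
proof -
  obtain u where u: "u \<in> V" "p x u = z" using ex_inverse assms by blast
  have ux: "p u x = z" using comm[of u x] u assms by simp
  have "p u (p x y) = y" "p u (p x w) = w"
    using assoc[of u x y] assoc[of u x w] ux u assms(1-3) by simp_all
  then show ?thesis using assms(4) by metis
qed

lemma scale_0 [simp]: assumes "x \<in> V" shows "s 0 x = z"
proof -
  have "p (s 0 x) (s 0 x) = p (s 0 x) z" using add_scale[OF assms, of 0 0] assms by simp
  then show ?thesis using assms cancel_left[of "s 0 x" "s 0 x" z] by simp
qed

lemma scale_zero [simp]: "s c z = z"
  using scale_scale[of z c 0] by simp

lemma right_inverse: "x \<in> V \<Longrightarrow> p x (s (-1) x) = z"
  using add_scale[of x 1 "-1"] by simp

lemma add_minus_eq_zero: assumes "x \<in> V" "y \<in> V" "p x (s (-1) y) = z" shows "x = y"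
proof -
  have "p x (p y (s (-1) y)) = p y (p x (s (-1) y))" by (rule lcomm) (use assms in auto)
  then show ?thesis using assms right_inverse[of y] by simp
qed

end

locale calg =
  fixes A :: "('a, 'z) alg_scheme"
  assumes ax: "alg_ax A"
begin

sublocale cvspace "car A" "zer A" "ad A" "sm A"
  using ax unfolding alg_ax_def by unfold_locales blast

lemma mu_in [simp]: "x \<in> car A \<Longrightarrow> y \<in> car A \<Longrightarrow> mu A x y \<in> car A"
  using ax unfolding alg_ax_def by blast

lemma mu_assoc: "x \<in> car A \<Longrightarrow> y \<in> car A \<Longrightarrow> w \<in> car A \<Longrightarrow> mu A (mu A x y) w = mu A x (mu A y w)"
  using ax unfolding alg_ax_def by blast

lemma mu_add_left: "x \<in> car A \<Longrightarrow> y \<in> car A \<Longrightarrow> w \<in> car A \<Longrightarrow> mu A (ad A x y) w = ad A (mu A x w) (mu A y w)"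
  and mu_add_right: "x \<in> car A \<Longrightarrow> y \<in> car A \<Longrightarrow> w \<in> car A \<Longrightarrow> mu A w (ad A x y) = ad A (mu A w x) (mu A w y)"
  and mu_scale_left: "x \<in> car A \<Longrightarrow> y \<in> car A \<Longrightarrow> mu A (sm A c x) y = sm A c (mu A x y)"
  and mu_scale_right: "x \<in> car A \<Longrightarrow> y \<in> car A \<Longrightarrow> mu A x (sm A c y) = sm A c (mu A x y)"
  using ax unfolding alg_ax_def by blast+

lemma mu_zero [simp]: "x \<in> car A \<Longrightarrow> mu A (zer A) x = zer A" "x \<in> car A \<Longrightarrow> mu A x (zer A) = zer A"
  using mu_scale_left[of "zer A" x 0] mu_scale_right[of x "zer A" 0] by simp_all

lemma sub_in [simp]: "x \<in> car A \<Longrightarrow> y \<in> car A \<Longrightarrow> sub A x y \<in> car A"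
  by (simp add: sub_def)

lemma sub_self [simp]: "x \<in> car A \<Longrightarrow> sub A x x = zer A"
  by (simp add: sub_def right_inverse)

lemma sub_zero [simp]: "x \<in> car A \<Longrightarrow> sub A x (zer A) = x"
  by (simp add: sub_def)

lemma eq_if_sub_zero: "x \<in> car A \<Longrightarrow> y \<in> car A \<Longrightarrow> sub A x y = zer A \<Longrightarrow> x = y"
  using add_minus_eq_zero by (simp add: sub_def)

lemma sub_add_cancel [simp]: "x \<in> car A \<Longrightarrow> y \<in> car A \<Longrightarrow> ad A (sub A x y) y = x"
  by (simp add: sub_def assoc comm[of "sm A (-1) y" y] right_inverse)

lemma add_sub_cancel: assumes "x \<in> car A" "y \<in> car A" shows "sub A (ad A x y) x = y"
proof -
  have "sub A (ad A x y) x = ad A (ad A y x) (sm A (-1) x)" using comm[OF assms] by (simp add: sub_def)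
  also have "\<dots> = ad A y (ad A x (sm A (-1) x))" using assms by (simp add: assoc)
  finally show ?thesis using assms by (simp add: right_inverse)
qed

lemma sub_swap: "x \<in> car A \<Longrightarrow> y \<in> car A \<Longrightarrow> sub A y x = sm A (-1) (sub A x y)"
  by (simp add: sub_def scale_add scale_scale comm)

lemma sub_trans: "x \<in> car A \<Longrightarrow> y \<in> car A \<Longrightarrow> w \<in> car A \<Longrightarrow> ad A (sub A x y) (sub A y w) = sub A x w"
  using sub_add_cancel[of x y] by (metis assoc closed(3) sub_def sub_in)

lemma sub_add_add: "x \<in> car A \<Longrightarrow> y \<in> car A \<Longrightarrow> u \<in> car A \<Longrightarrow> v \<in> car A \<Longrightarrow>
    sub A (ad A x y) (ad A u v) = ad A (sub A x u) (sub A y v)"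
  by (simp add: sub_def scale_add assoc lcomm)

lemma sub_scale: "x \<in> car A \<Longrightarrow> y \<in> car A \<Longrightarrow> sub A (sm A c x) (sm A c y) = sm A c (sub A x y)"
  by (simp add: sub_def scale_add scale_scale mult.commute)

lemma mu_sub_right: "x \<in> car A \<Longrightarrow> y \<in> car A \<Longrightarrow> w \<in> car A \<Longrightarrow> mu A w (sub A x y) = sub A (mu A w x) (mu A w y)"
  by (simp_all add: sub_def mu_add_left mu_add_right mu_scale_left mu_scale_right)

lemma ideal_subset: "ideal A I \<Longrightarrow> x \<in> I \<Longrightarrow> x \<in> car A" by (auto simp: ideal_def)
lemma ideal_add: "ideal A I \<Longrightarrow> x \<in> I \<Longrightarrow> y \<in> I \<Longrightarrow> ad A x y \<in> I" by (auto simp: ideal_def)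
lemma ideal_scale: "ideal A I \<Longrightarrow> x \<in> I \<Longrightarrow> sm A c x \<in> I" by (auto simp: ideal_def)
lemma ideal_mult: "ideal A I \<Longrightarrow> x \<in> I \<Longrightarrow> a \<in> car A \<Longrightarrow> mu A a x \<in> I" "ideal A I \<Longrightarrow> x \<in> I \<Longrightarrow> a \<in> car A \<Longrightarrow> mu A x a \<in> I"
  by (auto simp: ideal_def)
lemma ideal_zero: "ideal A I \<Longrightarrow> zer A \<in> I" by (auto simp: ideal_def)
lemma ideal_sub: "ideal A I \<Longrightarrow> x \<in> I \<Longrightarrow> y \<in> I \<Longrightarrow> sub A x y \<in> I"
  unfolding sub_def by (intro ideal_add ideal_scale)

lemma ideal_car: "ideal A (car A)" by (simp add: ideal_def)

lemma ideal_Inter: "S \<noteq> {} \<Longrightarrow> (\<And>I. I \<in> S \<Longrightarrow> ideal A I) \<Longrightarrow> ideal A (\<Inter>S)"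
  unfolding ideal_def by blast

section \<open>Left quasi-invertibility and primitive ideals\<close>

text \<open>Unit-free form of \<open>(1 - y) * (1 - x) = 1\<close> modulo \<open>K\<close>.\<close>

definition lqi :: "'a set \<Rightarrow> 'a \<Rightarrow> bool" where
  "lqi K x \<longleftrightarrow> (\<exists>y\<in>car A. sub A (ad A x y) (mu A y x) \<in> K)"

definition left_ideal :: "'a set \<Rightarrow> bool" where
  "left_ideal L \<longleftrightarrow> L \<subseteq> car A \<and> zer A \<in> L \<and> (\<forall>x\<in>L. \<forall>y\<in>L. ad A x y \<in> L) \<and>
     (\<forall>c. \<forall>x\<in>L. sm A c x \<in> L) \<and> (\<forall>a\<in>car A. \<forall>x\<in>L. mu A a x \<in> L)"

lemma left_idealD:
  assumes "left_ideal L"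
  shows "x \<in> L \<Longrightarrow> x \<in> car A" "zer A \<in> L" "x \<in> L \<Longrightarrow> y \<in> L \<Longrightarrow> ad A x y \<in> L" "x \<in> L \<Longrightarrow> sm A c x \<in> L"
    "a \<in> car A \<Longrightarrow> x \<in> L \<Longrightarrow> mu A a x \<in> L" "x \<in> L \<Longrightarrow> y \<in> L \<Longrightarrow> sub A x y \<in> L"
  using assms unfolding left_ideal_def sub_def by blast+

lemma left_ideal_diff_mem:
  assumes "left_ideal L" "x \<in> car A" "y \<in> L" "sub A x y \<in> L" shows "x \<in> L"
  using left_idealD(3)[OF assms(1,4,3)] left_idealD(1)[OF assms(1,3)] assms(2) by simp

text \<open>\<open>L0 = A (1 - x) + K\<close> contains \<open>x\<close> only if \<open>x\<close> is
  left quasi-invertible modulo \<open>K\<close>. Since \<open>a - a x \<in> L0\<close> for all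
  \<open>a\<close>, a left ideal above \<open>L0\<close> is proper exactly when it misses
  \<open>x\<close>; so maximality among those missing \<open>x\<close> is maximality among proper
  left ideals.\<close>

lemma maximal_modular_left_ideal:
  assumes K: "ideal A K" and x: "x \<in> car A" and n: "\<not> lqi K x"
  shows "\<exists>L. left_ideal L \<and> K \<subseteq> L \<and> (\<forall>a\<in>car A. sub A a (mu A a x) \<in> L) \<and> x \<notin> L \<and>
      (\<forall>L'. left_ideal L' \<and> L \<subseteq> L' \<longrightarrow> L' = L \<or> L' = car A)"
proof -
  define L0 where "L0 = {ad A (sub A a (mu A a x)) k | a k. a \<in> car A \<and> k \<in> K}"
  have L0I: "ad A (sub A a (mu A a x)) k \<in> L0" if "a \<in> car A" "k \<in> K" for a k
    unfolding L0_def using that by blast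
  have Kc: "k \<in> K \<Longrightarrow> k \<in> car A" for k using K ideal_subset by blast
  have L0: "left_ideal L0"
    unfolding left_ideal_def
  proof (intro conjI ballI allI)
    show "L0 \<subseteq> car A" using x Kc unfolding L0_def by auto
    show "zer A \<in> L0" using L0I[OF closed(1) ideal_zero[OF K]] x by simp
    fix u assume "u \<in> L0"
    then obtain a k where u: "a \<in> car A" "k \<in> K" "u = ad A (sub A a (mu A a x)) k" unfolding L0_def by blast
    note kc = Kc[OF u(2)]
    {
      fix w assume "w \<in> L0"
      then obtain b l where w: "b \<in> car A" "l \<in> K" "w = ad A (sub A b (mu A b x)) l" unfolding L0_def by blast
      have "ad A u w = ad A (ad A (sub A a (mu A a x)) (sub A b (mu A b x))) (ad A k l)"
        using u w kc Kc[OF w(2)] x by (simp add: assoc lcomm)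
      also have "\<dots> = ad A (sub A (ad A a b) (mu A (ad A a b) x)) (ad A k l)"
        using u w x by (simp add: sub_add_add mu_add_left)
      finally show "ad A u w \<in> L0" using L0I[of "ad A a b" "ad A k l"] u w ideal_add[OF K] by simp
    next
      fix c
      have "sm A c u = ad A (sub A (sm A c a) (mu A (sm A c a) x)) (sm A c k)"
        using u kc x by (simp add: scale_add sub_scale mu_scale_left)
      then show "sm A c u \<in> L0" using L0I[of "sm A c a" "sm A c k"] u ideal_scale[OF K] by simp
    next
      fix b assume b: "b \<in> car A"
      have "mu A b u = ad A (sub A (mu A b a) (mu A (mu A b a) x)) (mu A b k)"
        using u kc x b by (simp add: mu_add_right mu_sub_right mu_assoc)
      then show "mu A b u \<in> L0" using L0I[of "mu A b a" "mu A b k"] u b ideal_mult[OF K] by simp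
    }
  qed
  have KL0: "K \<subseteq> L0"
  proof
    fix k assume k: "k \<in> K"
    then show "k \<in> L0" using L0I[OF closed(1) k] x Kc by simp
  qed
  have modL0: "sub A a (mu A a x) \<in> L0" if "a \<in> car A" for a
    using L0I[OF that ideal_zero[OF K]] x that by simp
  have xL0: "x \<notin> L0"
  proof
    assume "x \<in> L0"
    then obtain a k where u: "a \<in> car A" "k \<in> K" "x = ad A (sub A a (mu A a x)) k" unfolding L0_def by blast
    \<comment> \<open>From \<open>x = a - a x + k\<close> the left quasi-inverse is
      \<open>- a\<close>.\<close>
    define y where "y = sm A (-1) a"
    have y: "y \<in> car A" using u by (simp add: y_def)
    have ya: "sub A (ad A x y) (mu A y x) = ad A (sub A x a) (mu A a x)"
      using u x by (simp add: y_def sub_def mu_scale_left scale_scale)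
    have "sub A x (sub A a (mu A a x)) = k"
    proof -
      let ?w = "sub A a (mu A a x)"
      have "sub A (ad A ?w k) ?w = k" by (rule add_sub_cancel) (use u x Kc in auto)
      then show ?thesis using u(3) by simp
    qed
    moreover have "sub A x (sub A a (mu A a x)) = ad A (sub A x a) (mu A a x)"
      using u x by (simp add: sub_def scale_add scale_scale assoc)
    ultimately have "lqi K x" unfolding lqi_def using y ya u(2) by metis
    then show False using n by simp
  qed
  define C where "C = {L. L0 \<subseteq> L \<and> left_ideal L \<and> x \<notin> L}"
  have "\<exists>L\<in>C. \<forall>X\<in>C. L \<subseteq> X \<longrightarrow> X = L"
  proof (rule subset_Zorn_nonempty)
    show "C \<noteq> {}" using L0 xL0 unfolding C_def by blast
    fix c assume c: "c \<noteq> {}" "subset.chain C c"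
    then have cC: "c \<subseteq> C" and ch: "\<And>X Y. X \<in> c \<Longrightarrow> Y \<in> c \<Longrightarrow> X \<subseteq> Y \<or> Y \<subseteq> X"
      by (auto simp: subset_chain_def)
    have li: "left_ideal X" if "X \<in> c" for X using that cC unfolding C_def by blast
    have "left_ideal (\<Union>c)"
      unfolding left_ideal_def
    proof (intro conjI ballI allI)
      show "\<Union>c \<subseteq> car A" using li unfolding left_ideal_def by blast
      show "zer A \<in> \<Union>c" using c(1) li left_idealD(2) by blast
      fix u assume "u \<in> \<Union>c"
      then obtain X where X: "X \<in> c" "u \<in> X" by blast
      { fix w assume "w \<in> \<Union>c"
        then obtain Y where Y: "Y \<in> c" "w \<in> Y" by blast
        show "ad A u w \<in> \<Union>c"
          using ch[OF X(1) Y(1)] X Y left_idealD(3)[OF li[OF X(1)]] left_idealD(3)[OF li[OF Y(1)]] by blast }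
      { fix k show "sm A k u \<in> \<Union>c" using X left_idealD(4)[OF li[OF X(1)]] by blast }
      { fix a assume "a \<in> car A" then show "mu A a u \<in> \<Union>c" using X left_idealD(5)[OF li[OF X(1)]] by blast }
    qed
    then show "\<Union>c \<in> C" using c(1) cC unfolding C_def by blast
  qed
  then obtain L where LC: "L \<in> C" and max: "\<And>X. X \<in> C \<Longrightarrow> L \<subseteq> X \<Longrightarrow> X = L" by blast
  have L: "L0 \<subseteq> L" "left_ideal L" "x \<notin> L" using LC by (auto simp: C_def)
  have "L' = L \<or> L' = car A" if "left_ideal L'" "L \<subseteq> L'" for L'
  proof (cases "x \<in> L'")
    case False
    then have "L' \<in> C" using that L unfolding C_def by blast
    then show ?thesis using max that by blast
  next
    case True
    have "a \<in> L'" if a: "a \<in> car A" for a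
    proof (rule left_ideal_diff_mem[OF \<open>left_ideal L'\<close> a])
      show "mu A a x \<in> L'" using left_idealD(5)[OF \<open>left_ideal L'\<close> a True] .
      show "sub A a (mu A a x) \<in> L'" using modL0[OF a] L(1) \<open>L \<subseteq> L'\<close> by blast
    qed
    then show ?thesis using left_idealD(1)[OF \<open>left_ideal L'\<close>] by blast
  qed
  then show ?thesis using L KL0 modL0 by (intro exI[of _ L]) blast
qed

definition coset :: "'a set \<Rightarrow> 'a \<Rightarrow> 'a set" where
  "coset L a = {b \<in> car A. sub A b a \<in> L}"

text \<open>Elements are cosets, as the carrier type in \<open>Prim\<close> requires; the operations
  act on representatives picked by \<open>SOME\<close>, and \<open>quotient_module_simps\<close>
  shows the choice to be immaterial for a left ideal.\<close>

definition quotient_module :: "'a set \<Rightarrow> ('a, 'a set) amod" where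
  "quotient_module L = \<lparr>vcar = coset L ` car A, vz = coset L (zer A),
     vadd = (\<lambda>X Y. coset L (ad A (SOME x. x \<in> X) (SOME y. y \<in> Y))),
     vsm = (\<lambda>c X. coset L (sm A c (SOME x. x \<in> X))),
     act = (\<lambda>a X. coset L (mu A a (SOME x. x \<in> X)))\<rparr>"

context
  fixes L assumes L: "left_ideal L"
begin

lemma coset_eq_iff: assumes a: "a \<in> car A" and b: "b \<in> car A" shows "coset L a = coset L b \<longleftrightarrow> sub A a b \<in> L"
proof
  assume "coset L a = coset L b"
  moreover have "a \<in> coset L a" using a left_idealD(2)[OF L] by (simp add: coset_def)
  ultimately show "sub A a b \<in> L" by (simp add: coset_def)
next
  assume ab: "sub A a b \<in> L"
  then have ba: "sub A b a \<in> L" using sub_swap[OF a b] left_idealD(4)[OF L] by simp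
  show "coset L a = coset L b"
  proof (intro equalityI subsetI)
    fix u assume "u \<in> coset L a"
    then show "u \<in> coset L b" using left_idealD(3)[OF L _ ab] sub_trans[OF _ a b] by (auto simp: coset_def) metis
  next
    fix u assume "u \<in> coset L b"
    then show "u \<in> coset L a" using left_idealD(3)[OF L _ ba] sub_trans[OF _ b a] by (auto simp: coset_def) metis
  qed
qed

lemma coset_some: assumes a: "a \<in> car A"
  shows "(SOME x. x \<in> coset L a) \<in> car A" "sub A (SOME x. x \<in> coset L a) a \<in> L"
proof -
  have "a \<in> coset L a" using a left_idealD(2)[OF L] by (simp add: coset_def)
  then have "(SOME x. x \<in> coset L a) \<in> coset L a" by (rule someI)
  then show "(SOME x. x \<in> coset L a) \<in> car A" "sub A (SOME x. x \<in> coset L a) a \<in> L" by (auto simp: coset_def)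
qed

lemma quotient_module_simps:
  "vcar (quotient_module L) = coset L ` car A" "vz (quotient_module L) = coset L (zer A)"
  "a \<in> car A \<Longrightarrow> b \<in> car A \<Longrightarrow> vadd (quotient_module L) (coset L a) (coset L b) = coset L (ad A a b)"
  "a \<in> car A \<Longrightarrow> vsm (quotient_module L) c (coset L a) = coset L (sm A c a)"
  "a \<in> car A \<Longrightarrow> b \<in> car A \<Longrightarrow> act (quotient_module L) a (coset L b) = coset L (mu A a b)"
proof -
  show "vadd (quotient_module L) (coset L a) (coset L b) = coset L (ad A a b)" if "a \<in> car A" "b \<in> car A"
    using coset_some[OF that(1)] coset_some[OF that(2)] that left_idealD(3)[OF L]
    by (simp add: quotient_module_def coset_eq_iff sub_add_add)
  show "vsm (quotient_module L) c (coset L a) = coset L (sm A c a)" if "a \<in> car A"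
    using coset_some[OF that] that left_idealD(4)[OF L] by (simp add: quotient_module_def coset_eq_iff sub_scale)
  show "act (quotient_module L) a (coset L b) = coset L (mu A a b)" if "a \<in> car A" "b \<in> car A"
    using coset_some[OF that(2)] that left_idealD(5)[OF L]
    by (simp add: quotient_module_def coset_eq_iff mu_sub_right[symmetric])
qed (simp_all add: quotient_module_def)

lemma quotient_module_irred:
  assumes max: "\<And>L'. left_ideal L' \<Longrightarrow> L \<subseteq> L' \<Longrightarrow> L' = L \<or> L' = car A"
    and nt: "a \<in> car A" "b \<in> car A" "mu A a b \<notin> L"
  shows "alg_irred_rep A (quotient_module L)"
proof -
  note qs = quotient_module_simps
  have cv: "cvs (vcar (quotient_module L)) (vz (quotient_module L)) (vadd (quotient_module L)) (vsm (quotient_module L))"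
  proof -
    have inv: "\<exists>y\<in>coset L ` car A. vadd (quotient_module L) (coset L a) y = coset L (zer A)" if "a \<in> car A" for a
      using that by (intro bexI[of _ "coset L (sm A (-1) a)"]) (auto simp: qs right_inverse)
    show ?thesis
      unfolding cvs_def qs(1,2) using inv
      by (auto simp: qs(3,4) scale_add add_scale scale_scale) (simp_all add: assoc comm lcomm)
  qed
  have sub: "W = {vz (quotient_module L)} \<or> W = vcar (quotient_module L)"
    if W: "W \<subseteq> vcar (quotient_module L) \<and> vz (quotient_module L) \<in> W \<and> (\<forall>v\<in>W. \<forall>w\<in>W. vadd (quotient_module L) v w \<in> W) \<and>
      (\<forall>c. \<forall>v\<in>W. vsm (quotient_module L) c v \<in> W) \<and> (\<forall>a\<in>car A. \<forall>v\<in>W. act (quotient_module L) a v \<in> W)" for W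
  proof -
    define L' where "L' = {a \<in> car A. coset L a \<in> W}"
    have "left_ideal L'"
      unfolding left_ideal_def L'_def using W by (auto simp: qs) (metis qs(3), metis qs(4), metis qs(5))
    moreover have "L \<subseteq> L'"
    proof
      fix l assume l: "l \<in> L"
      then have "coset L l = coset L (zer A)" using coset_eq_iff left_idealD(1)[OF L] by simp
      then show "l \<in> L'" using W l left_idealD(1)[OF L] by (simp add: L'_def qs)
    qed
    ultimately have LL: "L' = L \<or> L' = car A" by (intro max)
    have Wc: "W \<subseteq> coset L ` car A" and Wz: "coset L (zer A) \<in> W" using W by (simp_all add: qs(1,2))
    from LL consider "L' = L" | "L' = car A" by (rule disjE)
    then show ?thesis
    proof cases
      case 1
      have "W \<subseteq> {coset L (zer A)}"
      proof
        fix v assume v: "v \<in> W"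
        obtain a where a: "a \<in> car A" "v = coset L a" using v Wc by auto
        then have "a \<in> L" using v 1 by (auto simp: L'_def)
        then show "v \<in> {coset L (zer A)}" using a coset_eq_iff by simp
      qed
      then have "W = {coset L (zer A)}" using Wz by auto
      then show ?thesis by (simp add: qs(2))
    next
      case 2
      then have "coset L ` car A \<subseteq> W" by (auto simp: L'_def)
      then have "W = coset L ` car A" using Wc by auto
      then show ?thesis by (simp add: qs(1))
    qed
  qed
  have ntv: "\<exists>a\<in>car A. \<exists>v\<in>vcar (quotient_module L). act (quotient_module L) a v \<noteq> vz (quotient_module L)"
    using nt by (intro bexI[of _ a] bexI[of _ "coset L b"]) (auto simp: qs coset_eq_iff)
  show ?thesis
    unfolding alg_irred_rep_def
    using cv sub ntv
    by (auto simp: qs mu_add_right mu_scale_right mu_add_left mu_scale_left mu_assoc)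
qed

lemma quotient_module_ker: "amod_ker A (quotient_module L) = {a \<in> car A. \<forall>b\<in>car A. mu A a b \<in> L}"
proof -
  have "act (quotient_module L) a (coset L b) = vz (quotient_module L) \<longleftrightarrow> mu A a b \<in> L"
    if "a \<in> car A" "b \<in> car A" for a b
    using that by (simp add: quotient_module_simps coset_eq_iff)
  then show ?thesis unfolding amod_ker_def quotient_module_simps(1) by auto
qed

end

text \<open>\<open>Q\<close> is the annihilator of \<open>A / L\<close> for the maximal
  \<open>L\<close>. As \<open>x - x x \<in> L\<close> but \<open>x \<notin> L\<close>,
  \<open>x\<close> does not kill its own coset. A left quasi-inverse \<open>y\<close> modulo
  \<open>Q\<close> would give \<open>q = x + y - y x \<in> L\<close>, and \<open>x\<close> differs
  from \<open>q\<close> by \<open>y - y x \<in> L\<close>.\<close>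

lemma ex_Prim_not_lqi:
  assumes K: "ideal A K" and x: "x \<in> car A" and n: "\<not> lqi K x"
  shows "\<exists>Q\<in>Prim A. K \<subseteq> Q \<and> x \<notin> Q \<and> \<not> lqi Q x"
proof -
  obtain L where L: "left_ideal L" "K \<subseteq> L" "\<And>a. a \<in> car A \<Longrightarrow> sub A a (mu A a x) \<in> L" "x \<notin> L"
     and max: "\<And>L'. left_ideal L' \<Longrightarrow> L \<subseteq> L' \<Longrightarrow> L' = L \<or> L' = car A"
    using maximal_modular_left_ideal[OF K x n] by metis
  have xx: "mu A x x \<notin> L"
    using left_ideal_diff_mem[OF L(1) x _ L(3)[OF x]] L(4) by blast
  define Q where "Q = amod_ker A (quotient_module L)"
  have Q: "Q = {a \<in> car A. \<forall>b\<in>car A. mu A a b \<in> L}" unfolding Q_def by (rule quotient_module_ker[OF L(1)])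
  have "Q \<in> Prim A"
    unfolding Prim_def Q_def using quotient_module_irred[OF L(1) max x x xx] by blast
  moreover have "K \<subseteq> Q" unfolding Q using K L(2) ideal_subset[OF K] ideal_mult[OF K] by blast
  moreover have "x \<notin> Q" unfolding Q using xx x by blast
  moreover have "\<not> lqi Q x"
  proof
    assume "lqi Q x"
    then obtain y where y: "y \<in> car A" "sub A (ad A x y) (mu A y x) \<in> Q" by (auto simp: lqi_def)
    let ?q = "sub A (ad A x y) (mu A y x)"
    have q: "?q \<in> car A" "mu A ?q x \<in> L" using y(2) x unfolding Q by auto
    have qL: "?q \<in> L" by (rule left_ideal_diff_mem[OF L(1) q(1) q(2) L(3)[OF q(1)]])
    have "sub A x (sm A (-1) (sub A y (mu A y x))) = ?q"
      using x y(1) by (simp add: sub_def scale_add scale_scale assoc)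
    then have "x \<in> L"
      using left_ideal_diff_mem[OF L(1) x, of "sm A (-1) (sub A y (mu A y x))"] qL left_idealD(4)[OF L(1) L(3)[OF y(1)]] by simp
    then show False using L(4) by simp
  qed
  ultimately show ?thesis by blast
qed

section \<open>Irreducible modules and primeness\<close>

lemma alg_irred_repD:
  assumes "alg_irred_rep A M"
  shows "cvspace (vcar M) (vz M) (vadd M) (vsm M)"
    "a \<in> car A \<Longrightarrow> v \<in> vcar M \<Longrightarrow> act M a v \<in> vcar M"
    "a \<in> car A \<Longrightarrow> v \<in> vcar M \<Longrightarrow> w \<in> vcar M \<Longrightarrow> act M a (vadd M v w) = vadd M (act M a v) (act M a w)"
    "a \<in> car A \<Longrightarrow> v \<in> vcar M \<Longrightarrow> act M a (vsm M c v) = vsm M c (act M a v)"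
    "a \<in> car A \<Longrightarrow> b \<in> car A \<Longrightarrow> v \<in> vcar M \<Longrightarrow> act M (ad A a b) v = vadd M (act M a v) (act M b v)"
    "a \<in> car A \<Longrightarrow> v \<in> vcar M \<Longrightarrow> act M (sm A c a) v = vsm M c (act M a v)"
    "a \<in> car A \<Longrightarrow> b \<in> car A \<Longrightarrow> v \<in> vcar M \<Longrightarrow> act M (mu A a b) v = act M a (act M b v)"
    "\<exists>a\<in>car A. \<exists>v\<in>vcar M. act M a v \<noteq> vz M"
    "W \<subseteq> vcar M \<Longrightarrow> vz M \<in> W \<Longrightarrow> (\<And>v w. v \<in> W \<Longrightarrow> w \<in> W \<Longrightarrow> vadd M v w \<in> W) \<Longrightarrow>
          (\<And>c v. v \<in> W \<Longrightarrow> vsm M c v \<in> W) \<Longrightarrow> (\<And>a v. a \<in> car A \<Longrightarrow> v \<in> W \<Longrightarrow> act M a v \<in> W)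
          \<Longrightarrow> W = {vz M} \<or> W = vcar M"
proof -
  have "\<forall>W. W \<subseteq> vcar M \<and> vz M \<in> W \<and> (\<forall>v\<in>W. \<forall>w\<in>W. vadd M v w \<in> W) \<and>
          (\<forall>c. \<forall>v\<in>W. vsm M c v \<in> W) \<and> (\<forall>a\<in>car A. \<forall>v\<in>W. act M a v \<in> W)
          \<longrightarrow> W = {vz M} \<or> W = vcar M"
    using assms unfolding alg_irred_rep_def by (elim conjE)
  from this[rule_format, of W] show "W \<subseteq> vcar M \<Longrightarrow> vz M \<in> W \<Longrightarrow> (\<And>v w. v \<in> W \<Longrightarrow> w \<in> W \<Longrightarrow> vadd M v w \<in> W) \<Longrightarrow>
          (\<And>c v. v \<in> W \<Longrightarrow> vsm M c v \<in> W) \<Longrightarrow> (\<And>a v. a \<in> car A \<Longrightarrow> v \<in> W \<Longrightarrow> act M a v \<in> W)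
          \<Longrightarrow> W = {vz M} \<or> W = vcar M" by simp
qed (use assms in \<open>simp_all add: alg_irred_rep_def cvspace_def\<close>)

lemma act_zero:
  assumes M: "alg_irred_rep A M"
  shows "a \<in> car A \<Longrightarrow> act M a (vz M) = vz M" "v \<in> vcar M \<Longrightarrow> act M (zer A) v = vz M"
proof -
  interpret M: cvspace "vcar M" "vz M" "vadd M" "vsm M" by (rule alg_irred_repD(1)[OF M])
  show "act M a (vz M) = vz M" if "a \<in> car A"
    using alg_irred_repD(4)[OF M that M.closed(1), of 0] alg_irred_repD(2)[OF M that M.closed(1)] by simp
  show "act M (zer A) v = vz M" if "v \<in> vcar M"
    using alg_irred_repD(6)[OF M closed(1) that, of 0] alg_irred_repD(2)[OF M closed(1) that] by simp
qed

lemma irred_cyclic: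
  assumes M: "alg_irred_rep A M" and w: "w \<in> vcar M" "w \<noteq> vz M" and u: "u \<in> vcar M"
  shows "\<exists>c\<in>car A. act M c w = u"
proof -
  note D = alg_irred_repD[OF M]
  interpret M: cvspace "vcar M" "vz M" "vadd M" "vsm M" by (rule D(1))
  define W where "W = (\<lambda>c. act M c w) ` car A"
  have WI: "c \<in> car A \<Longrightarrow> act M c w \<in> W" for c by (simp add: W_def)
  have "W = {vz M} \<or> W = vcar M"
  proof (rule D(9))
    show "W \<subseteq> vcar M" using D(2) w by (auto simp: W_def)
    show "vz M \<in> W" using WI[of "zer A"] act_zero(2)[OF M w(1)] by simp
    fix v assume "v \<in> W"
    then obtain a where a: "a \<in> car A" "v = act M a w" by (auto simp: W_def)
    { fix y assume "y \<in> W"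
      then obtain b where b: "b \<in> car A" "y = act M b w" by (auto simp: W_def)
      show "vadd M v y \<in> W" using WI[of "ad A a b"] a b D(5) w by simp }
    { fix c show "vsm M c v \<in> W" using WI[of "sm A c a"] a D(6) w by simp }
    { fix b assume "b \<in> car A" then show "act M b v \<in> W" using WI[of "mu A b a"] a D(7) w by simp }
  qed
  moreover have "W \<noteq> {vz M}"
  proof
    assume W0: "W = {vz M}"
    \<comment> \<open>The vectors killed by all of \<open>A\<close> form a submodule; containing
      \<open>w\<close>, it would be everything, against the nontriviality of the action.\<close>
    define Z where "Z = {v \<in> vcar M. \<forall>a\<in>car A. act M a v = vz M}"
    have "Z = {vz M} \<or> Z = vcar M"
    proof (rule D(9))
      show "Z \<subseteq> vcar M" "vz M \<in> Z" using act_zero(1)[OF M] by (auto simp: Z_def)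
      fix v assume v: "v \<in> Z"
      show "vadd M v y \<in> Z" if "y \<in> Z" for y using v that D(3) by (simp add: Z_def)
      show "vsm M c v \<in> Z" for c using v D(4) by (simp add: Z_def)
      show "act M a v \<in> Z" if "a \<in> car A" for a using v that act_zero(1)[OF M] by (simp add: Z_def)
    qed
    moreover have "w \<in> Z" using W0 w WI by (auto simp: Z_def)
    ultimately have "Z = vcar M" using w by auto
    then show False using D(8) by (auto simp: Z_def)
  qed
  ultimately have "u \<in> W" using u by simp
  then show ?thesis by (auto simp: W_def)
qed

lemma amod_ker_prime:
  assumes M: "alg_irred_rep A M"
  shows "prime_ideal A (amod_ker A M)"
proof -
  note D = alg_irred_repD[OF M]
  interpret M: cvspace "vcar M" "vz M" "vadd M" "vsm M" by (rule D(1))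
  have "ideal A (amod_ker A M)"
    unfolding ideal_def amod_ker_def using D(2,5,6,7) act_zero[OF M] by auto
  moreover have "amod_ker A M \<noteq> car A" using D(8) by (auto simp: amod_ker_def)
  moreover have "I \<subseteq> amod_ker A M \<or> J \<subseteq> amod_ker A M"
    if I: "ideal A I" and J: "ideal A J" and IJ: "\<forall>a\<in>I. \<forall>b\<in>J. mu A a b \<in> amod_ker A M" for I J
  proof (rule ccontr)
    assume "\<not> ?thesis"
    then obtain a b where a: "a \<in> I" "a \<notin> amod_ker A M" and b: "b \<in> J" "b \<notin> amod_ker A M" by blast
    have ab: "a \<in> car A" "b \<in> car A" using a b I J ideal_subset by auto
    obtain u where u: "u \<in> vcar M" "act M a u \<noteq> vz M" using a ab by (auto simp: amod_ker_def)
    obtain v where v: "v \<in> vcar M" "act M b v \<noteq> vz M" using b ab by (auto simp: amod_ker_def)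
    obtain c where c: "c \<in> car A" "act M c (act M b v) = u"
      using irred_cyclic[OF M D(2)[OF ab(2) v(1)] v(2) u(1)] by blast
    have "mu A (mu A a c) b \<in> amod_ker A M" using IJ ideal_mult(2)[OF I a(1) c(1)] b by blast
    then have "act M (mu A (mu A a c) b) v = vz M" using v by (auto simp: amod_ker_def)
    then show False using D(7) D(2) ab c v u by simp
  qed
  ultimately show ?thesis unfolding prime_ideal_def by blast
qed

lemma Prim_prime: "P \<in> Prim A \<Longrightarrow> prime_ideal A P"
  unfolding Prim_def using amod_ker_prime by blast

end

section \<open>The hull-kernel topology\<close>

lemma prime_idealD:
  assumes "prime_ideal A P" shows "ideal A P" "P \<noteq> car A" "P \<subseteq> car A"
  using assms by (auto simp: prime_ideal_def ideal_def)

text \<open>The set system in \<open>hk_top\<close> is a topology because the ideals are prime: an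
  ideal product inside \<open>P\<close> puts one of the two kernels inside \<open>P\<close>, which
  is what intersections of two open sets require.\<close>

lemma openin_hk_top:
  assumes X: "\<forall>P\<in>X. prime_ideal A P" and A: "alg_ax A"
  shows "openin (hk_top X) U \<longleftrightarrow> U \<subseteq> X \<and> (\<forall>P\<in>X. \<Inter>(X - U) \<subseteq> P \<longrightarrow> P \<in> X - U)"
proof -
  interpret calg A using A by unfold_locales
  have "istopology (\<lambda>U. U \<subseteq> X \<and> (\<forall>P\<in>X. \<Inter>(X - U) \<subseteq> P \<longrightarrow> P \<in> X - U))"
    unfolding istopology_def
  proof (rule conjI; intro allI impI)
    fix U V assume U: "U \<subseteq> X \<and> (\<forall>P\<in>X. \<Inter>(X - U) \<subseteq> P \<longrightarrow> P \<in> X - U)"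
      and V: "V \<subseteq> X \<and> (\<forall>P\<in>X. \<Inter>(X - V) \<subseteq> P \<longrightarrow> P \<in> X - V)"
    show "U \<inter> V \<subseteq> X \<and> (\<forall>P\<in>X. \<Inter>(X - U \<inter> V) \<subseteq> P \<longrightarrow> P \<in> X - U \<inter> V)"
    proof (intro conjI ballI impI)
      show "U \<inter> V \<subseteq> X" using U by blast
      fix P assume P: "P \<in> X" "\<Inter>(X - U \<inter> V) \<subseteq> P"
      note pP = bspec[OF X P(1)]
      show "P \<in> X - U \<inter> V"
      \<comment> \<open>The kernel of an empty complement is \<open>UNIV\<close>, which need not be
        an ideal; hence a separate case.\<close>
      proof (cases "X - U = {} \<or> X - V = {}")
        case True
        then have "X - U \<inter> V = X - V \<or> X - U \<inter> V = X - U" by blast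
        then show ?thesis using P U V by auto
      next
        case False
        have I: "ideal A (\<Inter>(X - U))" "ideal A (\<Inter>(X - V))"
          using False X prime_idealD(1) by (auto intro!: ideal_Inter)
        have "mu A a b \<in> P" if "a \<in> \<Inter>(X - U)" "b \<in> \<Inter>(X - V)" for a b
        proof -
          have "mu A a b \<in> \<Inter>(X - U)" "mu A a b \<in> \<Inter>(X - V)"
            using that I ideal_mult ideal_subset by blast+
          then have "mu A a b \<in> \<Inter>(X - U \<inter> V)" by blast
          then show ?thesis using P(2) by blast
        qed
        then have "\<Inter>(X - U) \<subseteq> P \<or> \<Inter>(X - V) \<subseteq> P" using pP I unfolding prime_ideal_def by blast
        then show ?thesis using U V P by blast
      qed
    qed
  next
    fix \<K> assume K: "\<forall>K\<in>\<K>. K \<subseteq> X \<and> (\<forall>P\<in>X. \<Inter>(X - K) \<subseteq> P \<longrightarrow> P \<in> X - K)"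
    show "\<Union>\<K> \<subseteq> X \<and> (\<forall>P\<in>X. \<Inter>(X - \<Union>\<K>) \<subseteq> P \<longrightarrow> P \<in> X - \<Union>\<K>)"
    proof (intro conjI ballI impI)
      show "\<Union>\<K> \<subseteq> X" using K by blast
      fix P assume P: "P \<in> X" "\<Inter>(X - \<Union>\<K>) \<subseteq> P"
      have "P \<in> X - K" if "K \<in> \<K>" for K
      proof -
        have "\<Inter>(X - K) \<subseteq> \<Inter>(X - \<Union>\<K>)" using that by blast
        then have "\<Inter>(X - K) \<subseteq> P" using P(2) by (rule subset_trans)
        moreover have "\<forall>P\<in>X. \<Inter>(X - K) \<subseteq> P \<longrightarrow> P \<in> X - K"
          using bspec[OF K that] by (rule conjunct2)
        ultimately show ?thesis using P(1) by (metis (no_types))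
      qed
      then show "P \<in> X - \<Union>\<K>" using P by blast
    qed
  qed
  then show ?thesis unfolding hk_top_def by (simp add: topology_inverse')
qed

lemma topspace_hk_top:
  assumes X: "\<forall>P\<in>X. prime_ideal A P" and A: "alg_ax A"
  shows "topspace (hk_top X) = X"
proof -
  \<comment> \<open>The complement of \<open>X\<close> in itself is empty, and its kernel
    \<open>\<Inter>{} = UNIV\<close> lies in no proper ideal.\<close>
  have "\<not> UNIV \<subseteq> P" if "P \<in> X" for P using prime_idealD(2,3)[OF bspec[OF X that]] by blast
  then have "openin (hk_top X) X" unfolding openin_hk_top[OF X A] by auto
  moreover have "U \<subseteq> X" if "openin (hk_top X) U" for U using that openin_hk_top[OF X A] by blast
  ultimately show ?thesis unfolding topspace_def by blast
qed

lemma closedin_hk_top: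
  assumes X: "\<forall>P\<in>X. prime_ideal A P" and A: "alg_ax A"
  shows "closedin (hk_top X) C \<longleftrightarrow> C \<subseteq> X \<and> (\<forall>P\<in>X. \<Inter>C \<subseteq> P \<longrightarrow> P \<in> C)"
proof (cases "C \<subseteq> X")
  case True
  then have "X - (X - C) = C" by blast
  then show ?thesis unfolding closedin_def topspace_hk_top[OF X A] openin_hk_top[OF X A] using True by auto
next
  case False
  then show ?thesis unfolding closedin_def topspace_hk_top[OF X A] by simp
qed

lemma closedin_hull:
  assumes X: "\<forall>P\<in>X. prime_ideal A P" and A: "alg_ax A"
  shows "closedin (hk_top X) {P \<in> X. Z \<subseteq> P}"
  unfolding closedin_hk_top[OF X A] by blast

section \<open>The unitization as an algebra of endomorphisms\<close>

text \<open>The algebra lives on a subset of its type and so carries no ring class; linear operators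
  on a full function space do. They form the ring that the locale \<open>banach_subalgebra\<close>
  asks for.\<close>

typedef 'x endo = "{T :: ('x \<Rightarrow> complex) \<Rightarrow> ('x \<Rightarrow> complex).
    (\<forall>f g. T (f + g) = T f + T g) \<and> (\<forall>c f. T (\<lambda>x. c * f x) = (\<lambda>x. c * T f x))}"
  by (rule exI[of _ "\<lambda>f. f"]) simp

setup_lifting type_definition_endo

lift_definition endo_apply :: "'x endo \<Rightarrow> ('x \<Rightarrow> complex) \<Rightarrow> ('x \<Rightarrow> complex)" is "\<lambda>T. T" .

lemma endo_eqI: "(\<And>f. endo_apply S f = endo_apply T f) \<Longrightarrow> S = T"
  by transfer auto

instantiation endo :: (type) ring_1
begin

lift_definition zero_endo :: "'a endo" is "\<lambda>f. 0" by (auto simp: fun_eq_iff)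
lift_definition one_endo :: "'a endo" is "\<lambda>f. f" by simp
lift_definition plus_endo :: "'a endo \<Rightarrow> 'a endo \<Rightarrow> 'a endo" is "\<lambda>S T f. S f + T f"
  by (auto simp: fun_eq_iff algebra_simps)
lift_definition uminus_endo :: "'a endo \<Rightarrow> 'a endo" is "\<lambda>S f. - S f"
  by (auto simp: fun_eq_iff algebra_simps)
lift_definition minus_endo :: "'a endo \<Rightarrow> 'a endo \<Rightarrow> 'a endo" is "\<lambda>S T f. S f - T f"
  by (auto simp: fun_eq_iff algebra_simps)
lift_definition times_endo :: "'a endo \<Rightarrow> 'a endo \<Rightarrow> 'a endo" is "\<lambda>S T f. S (T f)"
  by simp

instance
proof
  fix a b c :: "'a endo"
  show "a + b + c = a + (b + c)" "a + b = b + a" "0 + a = a" "- a + a = 0" "a - b = a + - b"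
    by (transfer; auto simp: fun_eq_iff algebra_simps)+
  show "a * b * c = a * (b * c)" "1 * a = a" "a * 1 = a" "(a + b) * c = a * c + b * c" "a * (b + c) = a * b + a * c"
    by (transfer; auto simp: fun_eq_iff algebra_simps)+
  have "endo_apply (0 :: 'a endo) (\<lambda>x. 1) \<noteq> endo_apply 1 (\<lambda>x. 1)"
    by transfer (auto simp: fun_eq_iff)
  then show "(0 :: 'a endo) \<noteq> 1" by metis
qed

end

lift_definition scalar_endo :: "complex \<Rightarrow> 'x endo" is "\<lambda>c f x. c * f x"
  by (auto simp: fun_eq_iff algebra_simps)

lemma endo_apply_simps:
  "endo_apply (0 :: 'x endo) f = 0" "endo_apply (S + T) f = endo_apply S f + endo_apply T f"
  "endo_apply (S * T) f = endo_apply S (endo_apply T f)" "endo_apply (scalar_endo c) f = (\<lambda>x. c * f x)"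
  by (transfer; simp)+

lemma scalar_endo_simps:
  "scalar_endo 1 = (1 :: 'x endo)" "scalar_endo (c + d) = (scalar_endo c + scalar_endo d :: 'x endo)"
  "scalar_endo (c * d) = (scalar_endo c * scalar_endo d :: 'x endo)"
  "(T :: 'x endo) * scalar_endo c = scalar_endo c * T"
  by (transfer; auto simp: fun_eq_iff algebra_simps)+

text \<open>The representations act on a subspace of the function space; composing with a purely
  algebraic projection extends them to linear operators on the whole space.\<close>

lemma ex_linear_projection:
  assumes z: "0 \<in> V" and add: "\<And>f g. f \<in> V \<Longrightarrow> g \<in> V \<Longrightarrow> f + g \<in> V"
    and sc: "\<And>c f. f \<in> V \<Longrightarrow> (\<lambda>x. c * f x) \<in> V"
  shows "\<exists>p :: ('x \<Rightarrow> complex) \<Rightarrow> ('x \<Rightarrow> complex). (\<forall>f. p f \<in> V) \<and> (\<forall>f\<in>V. p f = f) \<and>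
     (\<forall>f g. p (f + g) = p f + p g) \<and> (\<forall>c f. p (\<lambda>x. c * f x) = (\<lambda>x. c * p f x))"
proof -
  interpret vs: vector_space "\<lambda>c (f :: 'x \<Rightarrow> complex) x. c * f x"
    by unfold_locales (auto simp: fun_eq_iff algebra_simps)
  interpret vector_space_pair "\<lambda>c (f :: 'x \<Rightarrow> complex) x. c * f x" "\<lambda>c (f :: 'x \<Rightarrow> complex) x. c * f x"
    by unfold_locales
  have "vs.subspace V" using assms by (auto simp: vs.subspace_def)
  moreover have "Vector_Spaces.linear (\<lambda>c (f :: 'x \<Rightarrow> complex) x. c * f x) (\<lambda>c f x. c * f x) (\<lambda>f. f)"
    by unfold_locales auto
  ultimately obtain g where g: "g ` UNIV \<subseteq> V" "\<forall>v\<in>V. g v = v"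
      "Vector_Spaces.linear (\<lambda>c (f :: 'x \<Rightarrow> complex) x. c * f x) (\<lambda>c f x. c * f x) g"
    using linear_exists_left_inverse_on[of "\<lambda>f. f" V] by (auto simp: inj_on_def)
  interpret g: Vector_Spaces.linear "\<lambda>c (f :: 'x \<Rightarrow> complex) x. c * f x" "\<lambda>c f x. c * f x" g by (rule g(3))
  show ?thesis using g(1,2) g.add g.scale by (intro exI[of _ g]) auto
qed

section \<open>Banach *-algebras and the unitization\<close>

lemma star_repD:
  assumes "star_rep A J \<pi>"
  shows "a \<in> car A \<Longrightarrow> bounded_op J (\<pi> a)"
    "a \<in> car A \<Longrightarrow> b \<in> car A \<Longrightarrow> f \<in> l2 J \<Longrightarrow> \<pi> (ad A a b) f = (\<lambda>i. \<pi> a f i + \<pi> b f i)"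
    "a \<in> car A \<Longrightarrow> f \<in> l2 J \<Longrightarrow> \<pi> (sm A c a) f = (\<lambda>i. c * \<pi> a f i)"
    "a \<in> car A \<Longrightarrow> b \<in> car A \<Longrightarrow> f \<in> l2 J \<Longrightarrow> \<pi> (mu A a b) f = \<pi> a (\<pi> b f)"
    "a \<in> car A \<Longrightarrow> f \<in> l2 J \<Longrightarrow> g \<in> l2 J \<Longrightarrow> l2ip (\<pi> a f) g = l2ip f (\<pi> (st A a) g)"
  using assms by (simp_all add: star_rep_def)

locale bstar =
  fixes A :: "('a, 'z) bsalg_scheme"
  assumes bsa: "banach_star_algebra A"
begin

sublocale calg A
  using bsa by unfold_locales (simp add: banach_star_algebra_def)

lemma star_in [simp]: "x \<in> car A \<Longrightarrow> st A x \<in> car A"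
  and star_star: "x \<in> car A \<Longrightarrow> st A (st A x) = x"
  and star_add: "x \<in> car A \<Longrightarrow> y \<in> car A \<Longrightarrow> st A (ad A x y) = ad A (st A x) (st A y)"
  and star_scale: "x \<in> car A \<Longrightarrow> st A (sm A c x) = sm A (cnj c) (st A x)"
  and star_mult: "x \<in> car A \<Longrightarrow> y \<in> car A \<Longrightarrow> st A (mu A x y) = mu A (st A y) (st A x)"
  and nm_ge0: "x \<in> car A \<Longrightarrow> 0 \<le> nm A x"
  and nm_eq_0: "x \<in> car A \<Longrightarrow> nm A x = 0 \<longleftrightarrow> x = zer A"
  and nm_add: "x \<in> car A \<Longrightarrow> y \<in> car A \<Longrightarrow> nm A (ad A x y) \<le> nm A x + nm A y"
  and nm_scale: "x \<in> car A \<Longrightarrow> nm A (sm A c x) = cmod c * nm A x"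
  and nm_mult: "x \<in> car A \<Longrightarrow> y \<in> car A \<Longrightarrow> nm A (mu A x y) \<le> nm A x * nm A y"
  using bsa by (simp_all add: banach_star_algebra_def)

lemma nm_complete:
  assumes "\<And>n. x n \<in> car A" "\<And>e. e > 0 \<Longrightarrow> \<exists>N. \<forall>m\<ge>N. \<forall>n\<ge>N. nm A (sub A (x m) (x n)) < e"
  shows "\<exists>y\<in>car A. nconv A x y"
  using assms bsa unfolding banach_star_algebra_def by metis

lemma star_zero [simp]: "st A (zer A) = zer A"
  using star_scale[of "zer A" 0] by simp

lemma star_sub: "x \<in> car A \<Longrightarrow> y \<in> car A \<Longrightarrow> st A (sub A x y) = sub A (st A x) (st A y)"
  by (simp add: sub_def star_add star_scale)

lemma nm_sub_commute: "x \<in> car A \<Longrightarrow> y \<in> car A \<Longrightarrow> nm A (sub A x y) = nm A (sub A y x)"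
  using sub_swap[of x y] nm_scale[of "sub A x y" "-1"] by simp

end

type_synonym 'b rep_index = "('b set \<times> ('b \<Rightarrow> ('b \<Rightarrow> complex) \<Rightarrow> ('b \<Rightarrow> complex))) \<times> 'b"

locale bstar_ss = bstar +
  assumes ss: "star_semisimple A"
begin

text \<open>The space on which the product of all *-representations acts. It is extended by zero
  coordinates (pairs \<open>(J, \<pi>)\<close> that are not *-representations), so that the identity operator is
  not in the image of the algebra.\<close>
definition rep_space :: "('a rep_index \<Rightarrow> complex) set" where
  "rep_space = {f. \<forall>J \<pi>. if star_rep A J \<pi> then (\<lambda>i. f ((J, \<pi>), i)) \<in> l2 J else (\<forall>i. f ((J, \<pi>), i) = 0)}"

definition rep_proj :: "('a rep_index \<Rightarrow> complex) \<Rightarrow> ('a rep_index \<Rightarrow> complex)" where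
  "rep_proj = (SOME p. (\<forall>f. p f \<in> rep_space) \<and> (\<forall>f\<in>rep_space. p f = f) \<and>
     (\<forall>f g. p (f + g) = p f + p g) \<and> (\<forall>c f. p (\<lambda>x. c * f x) = (\<lambda>x. c * p f x)))"

lemma rep_proj: "rep_proj f \<in> rep_space" "f \<in> rep_space \<Longrightarrow> rep_proj f = f"
    "rep_proj (f + g) = rep_proj f + rep_proj g" "rep_proj (\<lambda>x. c * f x) = (\<lambda>x. c * rep_proj f x)"
proof -
  have "\<exists>p :: ('a rep_index \<Rightarrow> complex) \<Rightarrow> ('a rep_index \<Rightarrow> complex). (\<forall>f. p f \<in> rep_space) \<and> (\<forall>f\<in>rep_space. p f = f) \<and>
     (\<forall>f g. p (f + g) = p f + p g) \<and> (\<forall>c f. p (\<lambda>x. c * f x) = (\<lambda>x. c * p f x))"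
    by (rule ex_linear_projection) (auto simp: rep_space_def)
  then have "(\<forall>f. rep_proj f \<in> rep_space) \<and> (\<forall>f\<in>rep_space. rep_proj f = f) \<and>
     (\<forall>f g. rep_proj (f + g) = rep_proj f + rep_proj g) \<and> (\<forall>c f. rep_proj (\<lambda>x. c * f x) = (\<lambda>x. c * rep_proj f x))"
    unfolding rep_proj_def by (rule someI_ex)
  then show "rep_proj f \<in> rep_space" "f \<in> rep_space \<Longrightarrow> rep_proj f = f"
    "rep_proj (f + g) = rep_proj f + rep_proj g" "rep_proj (\<lambda>x. c * f x) = (\<lambda>x. c * rep_proj f x)" by auto
qed

definition rep_op :: "'a \<Rightarrow> ('a rep_index \<Rightarrow> complex) \<Rightarrow> ('a rep_index \<Rightarrow> complex)" where
  "rep_op a f = (\<lambda>((J, \<pi>), i). if star_rep A J \<pi> then \<pi> a (\<lambda>i. f ((J, \<pi>), i)) i else 0)"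

lemma rep_spaceD: "f \<in> rep_space \<Longrightarrow> star_rep A J \<pi> \<Longrightarrow> (\<lambda>i. f ((J, \<pi>), i)) \<in> l2 J"
  unfolding rep_space_def by (simp split: if_splits)

lemma rep_op_in: assumes a: "a \<in> car A" and f: "f \<in> rep_space" shows "rep_op a f \<in> rep_space"
  unfolding rep_space_def
proof (intro CollectI allI)
  fix J \<pi>
  show "if star_rep A J \<pi> then (\<lambda>i. rep_op a f ((J, \<pi>), i)) \<in> l2 J else (\<forall>i. rep_op a f ((J, \<pi>), i) = 0)"
    using bounded_op_l2[OF star_repD(1)[OF _ a] rep_spaceD[OF f]] by (simp add: rep_op_def)
qed

definition emb :: "'a \<Rightarrow> 'a rep_index endo" where
  "emb a = Abs_endo (\<lambda>f. rep_op a (rep_proj f))"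

lemma emb_apply: assumes a: "a \<in> car A" shows "endo_apply (emb a) f = rep_op a (rep_proj f)"
proof -
  have "rep_op a (rep_proj (f + g)) = rep_op a (rep_proj f) + rep_op a (rep_proj g)" for f g
    using bounded_op_add[OF star_repD(1)[OF _ a] rep_spaceD[OF rep_proj(1)[of f]] rep_spaceD[OF rep_proj(1)[of g]]]
    by (auto simp: rep_op_def rep_proj(3) fun_eq_iff)
  moreover have "rep_op a (rep_proj (\<lambda>x. c * f x)) = (\<lambda>x. c * rep_op a (rep_proj f) x)" for f c
    using bounded_op_scale[OF star_repD(1)[OF _ a] rep_spaceD[OF rep_proj(1)[of f]]]
    by (auto simp: rep_op_def rep_proj(4) fun_eq_iff)
  ultimately have "Rep_endo (emb a) = (\<lambda>f. rep_op a (rep_proj f))"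
    unfolding emb_def by (intro Abs_endo_inverse) blast
  then show ?thesis by (simp add: endo_apply.rep_eq)
qed

lemma emb_add: assumes "a \<in> car A" "b \<in> car A" shows "emb (ad A a b) = emb a + emb b"
proof (rule endo_eqI)
  fix f
  show "endo_apply (emb (ad A a b)) f = endo_apply (emb a + emb b) f"
    using assms star_repD(2)[OF _ assms rep_spaceD[OF rep_proj(1)[of f]]]
    by (auto simp: emb_apply endo_apply_simps rep_op_def fun_eq_iff)
qed

lemma emb_scale: assumes "a \<in> car A" shows "emb (sm A c a) = scalar_endo c * emb a"
proof (rule endo_eqI)
  fix f
  show "endo_apply (emb (sm A c a)) f = endo_apply (scalar_endo c * emb a) f"
    using assms star_repD(3)[OF _ assms rep_spaceD[OF rep_proj(1)[of f]]]
    by (auto simp: emb_apply endo_apply_simps rep_op_def fun_eq_iff)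
qed

lemma emb_mult: assumes "a \<in> car A" "b \<in> car A" shows "emb (mu A a b) = emb a * emb b"
proof (rule endo_eqI)
  fix f
  have "rep_op (mu A a b) g = rep_op a (rep_op b g)" if g: "g \<in> rep_space" for g
    using star_repD(4)[OF _ assms rep_spaceD[OF g]] by (auto simp: rep_op_def fun_eq_iff)
  then show "endo_apply (emb (mu A a b)) f = endo_apply (emb a * emb b) f"
    using assms rep_proj(1) rep_op_in by (simp add: emb_apply endo_apply_simps rep_proj(2))
qed

text \<open>Provides a coordinate on which the product representation is zero: \<open>l2 {}\<close>
  contains only 0, while the constant 1 is not 0.\<close>

lemma ex_not_star_rep: "\<not> star_rep A {} (\<lambda>a f i. 1)"
proof
  assume "star_rep A {} (\<lambda>a f i. 1)"
  from bounded_op_l2[OF star_repD(1)[OF this closed(1)] l2_zero]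
  show False by (simp add: l2_def)
qed

text \<open>On the coordinate of a pair that is not a *-representation \<open>emb a\<close> vanishes
  and the scalar survives, so \<open>c = 0\<close>; then every *-representation kills
  \<open>a\<close>, and *-semisimplicity gives \<open>a = 0\<close>. Thus a new unit is adjoined
  even when \<open>A\<close> already has one.\<close>

lemma emb_plus_scalar_eq_0: assumes a: "a \<in> car A" and e: "emb a + scalar_endo c = 0" shows "a = zer A" "c = 0"
proof -
  define k :: "'a rep_index" where "k = (({}, \<lambda>a f i. 1), undefined)"
  have "endo_apply (emb a + scalar_endo c) (\<lambda>x. 1) k = 0" unfolding e by (simp add: endo_apply_simps)
  then show c: "c = 0"
    using a ex_not_star_rep by (simp add: endo_apply_simps emb_apply rep_op_def k_def)
  have "a \<in> rep_ker A J \<pi>" if \<pi>: "star_rep A J \<pi>" for J \<pi>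
    unfolding rep_ker_def
  proof (intro CollectI conjI ballI a)
    fix g assume g: "g \<in> l2 J"
    \<comment> \<open>The vector \<open>g\<close> placed in the single summand of
      \<open>(J, \<pi>)\<close>.\<close>
    define f :: "'a rep_index \<Rightarrow> complex" where "f = (\<lambda>(k, i). if k = (J, \<pi>) then g i else 0)"
    have "f \<in> rep_space"
      unfolding rep_space_def
    proof (intro CollectI allI)
      fix K \<rho>
      show "if star_rep A K \<rho> then (\<lambda>i. f ((K, \<rho>), i)) \<in> l2 K else (\<forall>i. f ((K, \<rho>), i) = 0)"
      proof (cases "K = J \<and> \<rho> = \<pi>")
        case True
        then show ?thesis using g \<pi> by (simp add: f_def)
      next
        case False
        then have "f ((K, \<rho>), i) = 0" for i by (auto simp: f_def)
        then show ?thesis by simp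
      qed
    qed
    then have "rep_op a f = endo_apply (emb a + scalar_endo c) f"
      using a c by (simp add: endo_apply_simps emb_apply rep_proj(2) fun_eq_iff)
    then have "rep_op a f ((J, \<pi>), i) = 0" for i unfolding e by (simp add: endo_apply_simps)
    then show "\<pi> a g = (\<lambda>i. 0)" using \<pi> by (simp add: rep_op_def f_def fun_eq_iff)
  qed
  then have "a \<in> \<Inter>{rep_ker A J \<pi> | J \<pi>. star_rep A J \<pi>}" by blast
  also have "\<dots> = {zer A}" using ss unfolding star_semisimple_def .
  finally show "a = zer A" by simp
qed

lemma emb_zero: "emb (zer A) = 0"
  using emb_scale[of "zer A" 0] by (simp add: endo_eqI endo_apply_simps(4) fun_eq_iff) (metis add_cancel_right_left closed(1) emb_add zero_left)

lemma scalar_endo_minus: "scalar_endo (- c) = - (scalar_endo c :: 'x endo)"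
  by transfer (auto simp: fun_eq_iff)

lemma scalar_endo_diff: "scalar_endo (c - d) = (scalar_endo c - scalar_endo d :: 'x endo)"
  by transfer (auto simp: fun_eq_iff algebra_simps)

lemma emb_sub: "a \<in> car A \<Longrightarrow> b \<in> car A \<Longrightarrow> emb (sub A a b) = emb a - emb b"
  by (simp add: sub_def emb_add emb_scale scalar_endo_minus scalar_endo_simps)

lemma emb_plus_scalar_inj:
  assumes ab: "a \<in> car A" "b \<in> car A" and e: "emb a + scalar_endo c = emb b + scalar_endo d"
  shows "a = b" "c = d"
proof -
  have "emb (sub A a b) + scalar_endo (c + - d) = (emb a + scalar_endo c) - (emb b + scalar_endo d)"
    unfolding scalar_endo_simps(2) scalar_endo_minus emb_sub[OF ab] by (simp add: algebra_simps)
  then have "emb (sub A a b) + scalar_endo (c + - d) = 0" unfolding e by simp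
  from emb_plus_scalar_eq_0[OF _ this] ab
  have "sub A a b = zer A" "c + - d = 0" by auto
  then show "a = b" "c = d" using eq_if_sub_zero ab by (auto simp: add_eq_0_iff)
qed

definition un :: "('a rep_index endo) set" where
  "un = {emb a + scalar_endo c | a c. a \<in> car A}"

definition dec :: "'a rep_index endo \<Rightarrow> 'a \<times> complex" where
  "dec x = (SOME (a, c). a \<in> car A \<and> x = emb a + scalar_endo c)"

definition unnorm :: "'a rep_index endo \<Rightarrow> real" where
  "unnorm x = nm A (fst (dec x)) + cmod (snd (dec x))"

definition unstar :: "'a rep_index endo \<Rightarrow> 'a rep_index endo" where
  "unstar x = emb (st A (fst (dec x))) + scalar_endo (cnj (snd (dec x)))"

lemma dec_eq: assumes a: "a \<in> car A" shows "dec (emb a + scalar_endo c) = (a, c)"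
proof -
  have "(case dec (emb a + scalar_endo c) of (b, d) \<Rightarrow> b \<in> car A \<and> emb a + scalar_endo c = emb b + scalar_endo d)"
    unfolding dec_def by (rule someI[of _ "(a, c)"]) (use a in simp)
  then obtain b d where bd: "dec (emb a + scalar_endo c) = (b, d)" "b \<in> car A" "emb a + scalar_endo c = emb b + scalar_endo d"
    by (cases "dec (emb a + scalar_endo c)") auto
  then show ?thesis using emb_plus_scalar_inj[OF a bd(2,3)] by simp
qed

lemma unI: "a \<in> car A \<Longrightarrow> emb a + scalar_endo c \<in> un" by (auto simp: un_def)

lemma unE: assumes "x \<in> un" obtains a c where "a \<in> car A" "x = emb a + scalar_endo c"
  using assms un_def by auto

lemma unnorm_eq: "a \<in> car A \<Longrightarrow> unnorm (emb a + scalar_endo c) = nm A a + cmod c"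
  by (simp add: unnorm_def dec_eq)

lemma unstar_eq: "a \<in> car A \<Longrightarrow> unstar (emb a + scalar_endo c) = emb (st A a) + scalar_endo (cnj c)"
  by (simp add: unstar_def dec_eq)

lemma un_add: "emb a + scalar_endo c + (emb b + scalar_endo d) = emb (ad A a b) + scalar_endo (c + d)"
  if "a \<in> car A" "b \<in> car A" using that by (simp add: emb_add scalar_endo_simps algebra_simps)

lemma un_scale: "scalar_endo k * (emb a + scalar_endo c) = emb (sm A k a) + scalar_endo (k * c)"
  if "a \<in> car A" using that by (simp add: emb_scale scalar_endo_simps(3) distrib_left mult.assoc)

lemma un_mult: "(emb a + scalar_endo c) * (emb b + scalar_endo d) =
    emb (ad A (mu A a b) (ad A (sm A c b) (sm A d a))) + scalar_endo (c * d)"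
  if "a \<in> car A" "b \<in> car A"
  using that by (simp add: emb_add emb_mult emb_scale scalar_endo_simps(3) scalar_endo_simps(4)[of "emb a" d] algebra_simps)

lemma nm_zero [simp]: "nm A (zer A) = 0" using nm_eq_0[of "zer A"] by simp

lemma scalar_endo_0: "scalar_endo 0 = (0 :: 'x endo)"
  by transfer (auto simp: fun_eq_iff)

lemma scalar_un: "scalar_endo c = emb (zer A) + scalar_endo c" by (simp add: emb_zero)
lemma emb_un: "emb a = emb a + scalar_endo 0" by (simp add: scalar_endo_0)

lemma emb_in: "a \<in> car A \<Longrightarrow> emb a \<in> un" by (subst emb_un) (rule unI)

lemma un_diff: "emb a + scalar_endo c - (emb b + scalar_endo d) = emb (sub A a b) + scalar_endo (c - d)"
  if "a \<in> car A" "b \<in> car A"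
  using that by (simp add: emb_sub scalar_endo_diff algebra_simps)

lemma unnorm_complete:
  fixes X :: "nat \<Rightarrow> 'a rep_index endo"
  assumes X: "\<And>n. X n \<in> un" and C: "\<And>e. e > 0 \<Longrightarrow> \<exists>M. \<forall>m\<ge>M. \<forall>n\<ge>M. unnorm (X m - X n) < e"
  shows "\<exists>y\<in>un. (\<lambda>n. unnorm (X n - y)) \<longlonglongrightarrow> 0"
proof -
  have "\<forall>n. \<exists>a c. a \<in> car A \<and> X n = emb a + scalar_endo c" using X unE by metis
  then obtain a c where ac: "\<And>n. a n \<in> car A" "\<And>n. X n = emb (a n) + scalar_endo (c n)" by metis
  have d: "unnorm (X m - (emb b + scalar_endo k)) = nm A (sub A (a m) b) + cmod (c m - k)" if "b \<in> car A" for m b k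
    using ac that by (simp add: un_diff unnorm_eq)
  have "\<exists>y\<in>car A. nconv A a y"
  proof (rule nm_complete[OF ac(1)])
    fix e :: real assume "e > 0"
    then obtain M where M: "\<forall>m\<ge>M. \<forall>n\<ge>M. unnorm (X m - X n) < e" using C by blast
    have "nm A (sub A (a m) (a n)) < e" if "m \<ge> M" "n \<ge> M" for m n
    proof -
      have "unnorm (X m - X n) < e" using M that by blast
      then show ?thesis using d[OF ac(1)[of n], of m "c n"] norm_ge_zero[of "c m - c n"] unfolding ac(2)[of n] by linarith
    qed
    then show "\<exists>N. \<forall>m\<ge>N. \<forall>n\<ge>N. nm A (sub A (a m) (a n)) < e" by blast
  qed
  then obtain b where b: "b \<in> car A" "(\<lambda>n. nm A (sub A (a n) b)) \<longlonglongrightarrow> 0" by (auto simp: nconv_def)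
  have "Cauchy c"
    unfolding Cauchy_def dist_norm
  proof (intro allI impI)
    fix e :: real assume "e > 0"
    then obtain M where M: "\<forall>m\<ge>M. \<forall>n\<ge>M. unnorm (X m - X n) < e" using C by blast
    have "cmod (c m - c n) < e" if "m \<ge> M" "n \<ge> M" for m n
    proof -
      have "unnorm (X m - X n) < e" using M that by blast
      then show ?thesis using d[OF ac(1)[of n], of m "c n"] nm_ge0[OF sub_in[OF ac(1)[of m] ac(1)[of n]]] unfolding ac(2)[of n] by linarith
    qed
    then show "\<exists>M. \<forall>m\<ge>M. \<forall>n\<ge>M. cmod (c m - c n) < e" by blast
  qed
  then obtain k where "c \<longlonglongrightarrow> k" using Cauchy_convergent convergent_def by blast
  then have k: "(\<lambda>n. cmod (c n - k)) \<longlonglongrightarrow> 0" using LIM_zero tendsto_norm_zero by blast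
  have "(\<lambda>n. unnorm (X n - (emb b + scalar_endo k))) \<longlonglongrightarrow> 0"
    unfolding d[OF b(1)] using tendsto_add[OF b(2) k] by simp
  then show ?thesis using unI[OF b(1)] by blast
qed

sublocale B: banach_subalgebra un scalar_endo unnorm
proof
  show "scalar_endo c \<in> un" for c by (subst scalar_un) (rule unI, simp)
  show "scalar_endo 1 = (1 :: 'a rep_index endo)" "scalar_endo (c + d) = (scalar_endo c + scalar_endo d :: 'a rep_index endo)"
    "scalar_endo (c * d) = (scalar_endo c * scalar_endo d :: 'a rep_index endo)"
    "T * scalar_endo c = scalar_endo c * T" for c d and T :: "'a rep_index endo" by (rule scalar_endo_simps)+
  fix x :: "'a rep_index endo" assume "x \<in> un"
  then obtain a c where x: "a \<in> car A" "x = emb a + scalar_endo c" by (rule unE)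
  show "unnorm x = 0 \<longleftrightarrow> x = 0"
  proof
    assume "unnorm x = 0"
    then have "nm A a = 0" "cmod c = 0" using x unnorm_eq nm_ge0[OF x(1)] by (auto simp: add_nonneg_eq_0_iff)
    then show "x = 0" using x nm_eq_0 by (simp add: emb_zero scalar_endo_0)
  next
    assume "x = 0"
    then have "a = zer A" "c = 0" using emb_plus_scalar_eq_0[OF x(1)] x(2) by auto
    then show "unnorm x = 0" using x unnorm_eq by simp
  qed
  show "0 \<le> unnorm x" using x unnorm_eq nm_ge0[OF x(1)] by simp
  show "unnorm (scalar_endo k * x) = cmod k * unnorm x" for k
    unfolding x(2) un_scale[OF x(1)] unnorm_eq[OF x(1)] unnorm_eq[OF closed(3)[OF x(1)]] nm_scale[OF x(1)] norm_mult
    by (simp add: distrib_left)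
  fix y :: "'a rep_index endo" assume "y \<in> un"
  then obtain b d where y: "b \<in> car A" "y = emb b + scalar_endo d" by (rule unE)
  show "x + y \<in> un" unfolding x(2) y(2) un_add[OF x(1) y(1)] by (rule unI) (use x y in simp)
  show "x * y \<in> un" unfolding x(2) y(2) un_mult[OF x(1) y(1)] by (rule unI) (use x y in simp)
  show "unnorm (x + y) \<le> unnorm x + unnorm y"
    using nm_add[OF x(1) y(1)] norm_triangle_ineq[of c d] x y by (simp add: un_add unnorm_eq)
  have m: "ad A (mu A a b) (ad A (sm A c b) (sm A d a)) \<in> car A" using x y by simp
  have "nm A (ad A (mu A a b) (ad A (sm A c b) (sm A d a))) \<le> nm A (mu A a b) + (nm A (sm A c b) + nm A (sm A d a))"
    using nm_add[of "mu A a b" "ad A (sm A c b) (sm A d a)"] nm_add[of "sm A c b" "sm A d a"] x y by simp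
  also have "\<dots> \<le> nm A a * nm A b + (cmod c * nm A b + cmod d * nm A a)"
    using nm_mult[OF x(1) y(1)] x y by (simp add: nm_scale)
  finally show "unnorm (x * y) \<le> unnorm x * unnorm y"
    unfolding x(2) y(2) un_mult[OF x(1) y(1)] unnorm_eq[OF x(1)] unnorm_eq[OF y(1)] unnorm_eq[OF m] norm_mult
    by (simp add: algebra_simps)
next
  show "unnorm 1 \<le> 1" using unnorm_eq[of "zer A" 1] by (simp add: emb_zero scalar_endo_simps)
qed (rule unnorm_complete)

text \<open>The inverse of \<open>1 - emb a\<close> has scalar part 1, say \<open>1 + emb b\<close>;
  then \<open>- b\<close> is a left quasi-inverse of \<open>a\<close>.\<close>

lemma B_Neumann:
  assumes a: "a \<in> car A" and n: "nm A a < 1"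
  shows "\<exists>b\<in>car A. sub A (ad A a b) (mu A b a) = zer A"
proof -
  have "unnorm (emb a) < 1" using unnorm_eq[OF a, of 0] n by (simp add: scalar_endo_0)
  then have "B.iv (1 - emb a)" by (rule B.Neumann[OF emb_in[OF a]])
  then obtain z where z: "z \<in> un" "z * (1 - emb a) = 1" unfolding B.iv_def by blast
  obtain b c where b: "b \<in> car A" "z = emb b + scalar_endo c" using z(1) by (rule unE)
  have m: "1 - emb a = emb (sm A (-1) a) + scalar_endo 1"
    using a by (simp add: emb_scale scalar_endo_simps scalar_endo_minus)
  have one: "emb (zer A) + scalar_endo 1 = (1 :: 'a rep_index endo)" by (simp add: emb_zero scalar_endo_simps)
  have ma: "sm A (-1) a \<in> car A" using a by simp
  have e: "emb (ad A (mu A b (sm A (-1) a)) (ad A (sm A c (sm A (-1) a)) (sm A 1 b))) + scalar_endo (c * 1) =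
      emb (zer A) + scalar_endo 1"
    using z(2) unfolding b(2) m un_mult[OF b(1) ma] one .
  have "ad A (mu A b (sm A (-1) a)) (ad A (sm A c (sm A (-1) a)) (sm A 1 b)) \<in> car A" using a b by simp
  from emb_plus_scalar_inj[OF this closed(1) e]
  have "ad A (mu A b (sm A (-1) a)) (ad A (sm A 1 (sm A (-1) a)) (sm A 1 b)) = zer A" by simp
  then have e2: "ad A (sm A (-1) (mu A b a)) (ad A (sm A (-1) a) b) = zer A" using a b by (simp add: mu_scale_right)
  let ?d = "sm A (-1) b"
  have "sub A (ad A a ?d) (mu A ?d a) = sm A (-1) (ad A (sm A (-1) (mu A b a)) (ad A (sm A (-1) a) b))"
    using a b by (simp add: sub_def scale_add scale_scale mu_scale_left) (simp add: assoc comm lcomm)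
  also have "\<dots> = zer A" unfolding e2 by simp
  finally show ?thesis using b by (intro bexI[of _ ?d]) auto
qed

end

locale bstar_herm = bstar_ss +
  assumes herm_alg: "hermitian A"
begin

sublocale H: hermitian_subalgebra un scalar_endo unnorm unstar
proof
  fix x :: "'a rep_index endo" assume "x \<in> un"
  then obtain a c where x: "a \<in> car A" "x = emb a + scalar_endo c" by (rule unE)
  show "unstar x \<in> un" using x by (simp add: unstar_eq unI)
  show "unstar (unstar x) = x" using x by (simp add: unstar_eq star_star)
  show "unstar (scalar_endo k * x) = scalar_endo (cnj k) * unstar x" for k
    using x by (simp add: un_scale unstar_eq star_scale)
  { fix y :: "'a rep_index endo" assume "y \<in> un"
    then obtain b d where y: "b \<in> car A" "y = emb b + scalar_endo d" by (rule unE)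
    show "unstar (x + y) = unstar x + unstar y" using x y by (simp add: un_add unstar_eq star_add)
    show "unstar (x * y) = unstar y * unstar x"
      using x y by (simp add: un_mult unstar_eq star_add star_mult star_scale comm mult.commute[of "cnj c"]) }
  fix l assume sa: "unstar x = x" and l: "Im l \<noteq> 0"
  have e: "emb (st A a) + scalar_endo (cnj c) = emb a + scalar_endo c" using sa x by (simp add: unstar_eq)
  have sta: "st A a = a" and c: "cnj c = c" using emb_plus_scalar_inj[OF star_in[OF x(1)] x(1) e] by auto
  then have "Im c = 0" by (simp add: complex_eq_iff)
  \<comment> \<open>With \<open>x = a + c\<close> and real \<open>c\<close>,
    \<open>x - l = - m (1 - a / m)\<close>; \<open>m\<close> is nonreal, so the hypothesis on
    spectra supplies a quasi-inverse of \<open>a / m\<close>.\<close>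
  define m where "m = l - c"
  have "Im m \<noteq> 0" using l \<open>Im c = 0\<close> by (simp add: m_def)
  then have m: "m \<noteq> 0" "m \<notin> \<real>" by (auto simp: complex_is_Real_iff)
  have "spectrum A a \<subseteq> \<real>" using herm_alg sta x by (simp add: hermitian_def)
  then have "qinv A (sm A (inverse m) a)" using m unfolding spectrum_def by blast
  then obtain b where b: "b \<in> car A" "sub A (ad A (sm A (inverse m) a) b) (mu A (sm A (inverse m) a) b) = zer A"
     "sub A (ad A (sm A (inverse m) a) b) (mu A b (sm A (inverse m) a)) = zer A" unfolding qinv_def by blast
  define y where "y = emb (sm A (inverse m) a)"
  have ya: "sm A (inverse m) a \<in> car A" using x by simp
  have "y + emb b - y * emb b = 0" "y + emb b - emb b * y = 0"
    unfolding y_def using b ya by (simp_all flip: emb_add emb_mult emb_sub add: emb_zero)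
  then have "(1 - y) * (1 - emb b) = 1" "(1 - emb b) * (1 - y) = 1" by (simp_all add: algebra_simps)
  moreover have "1 - y \<in> un" "1 - emb b \<in> un" unfolding y_def using ya b emb_in by (auto intro: B.S_diff)
  ultimately have "B.iv (1 - y)" by (intro B.ivI)
  then have "B.iv (scalar_endo (- m) * (1 - y))" using m by (intro B.iv_scale) auto
  also have "scalar_endo (- m) * (1 - y) = x - scalar_endo l"
  proof -
    have "scalar_endo m * y = (scalar_endo m * scalar_endo (inverse m)) * emb a"
      using x by (simp add: y_def emb_scale mult.assoc)
    also have "\<dots> = emb a" using m by (simp add: B.cs_cancel)
    finally show ?thesis unfolding x(2) using x B.cs_diff[of l c] by (simp add: m_def[symmetric] scalar_endo_minus algebra_simps)
  qed
  finally show "B.iv (x - scalar_endo l)" .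
qed

end

section \<open>The GNS construction\<close>

context cvspace
begin

definition psd_form :: "('v \<Rightarrow> 'v \<Rightarrow> complex) \<Rightarrow> bool" where
  "psd_form K \<longleftrightarrow> (\<forall>x\<in>V. \<forall>y\<in>V. \<forall>w\<in>V. K (p x y) w = K x w + K y w) \<and>
     (\<forall>c. \<forall>x\<in>V. \<forall>w\<in>V. K (s c x) w = c * K x w) \<and> (\<forall>x\<in>V. \<forall>y\<in>V. K y x = cnj (K x y)) \<and>
     (\<forall>x\<in>V. 0 \<le> Re (K x x))"

lemma psd_formD:
  assumes "psd_form K"
  shows "x \<in> V \<Longrightarrow> y \<in> V \<Longrightarrow> w \<in> V \<Longrightarrow> K (p x y) w = K x w + K y w"
    "x \<in> V \<Longrightarrow> w \<in> V \<Longrightarrow> K (s c x) w = c * K x w"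
    "x \<in> V \<Longrightarrow> y \<in> V \<Longrightarrow> w \<in> V \<Longrightarrow> K w (p x y) = K w x + K w y"
    "x \<in> V \<Longrightarrow> w \<in> V \<Longrightarrow> K w (s c x) = cnj c * K w x"
    "x \<in> V \<Longrightarrow> 0 \<le> Re (K x x)" "x \<in> V \<Longrightarrow> K x x = of_real (Re (K x x))"
    "x \<in> V \<Longrightarrow> y \<in> V \<Longrightarrow> K y x = cnj (K x y)"
proof -
  note D0 = assms[unfolded psd_form_def]
  note D = conjunct1[OF D0] conjunct1[OF conjunct2[OF D0]] conjunct2[OF conjunct2[OF conjunct2[OF D0]]]
    and H = conjunct1[OF conjunct2[OF conjunct2[OF D0]]]
  show a: "x \<in> V \<Longrightarrow> y \<in> V \<Longrightarrow> w \<in> V \<Longrightarrow> K (p x y) w = K x w + K y w" for x y w using D(1) by simp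
  show b: "x \<in> V \<Longrightarrow> w \<in> V \<Longrightarrow> K (s c x) w = c * K x w" for x w c using D(2) by simp
  show h: "x \<in> V \<Longrightarrow> y \<in> V \<Longrightarrow> K y x = cnj (K x y)" for x y by (rule bspec[OF bspec[OF H]])
  show "x \<in> V \<Longrightarrow> y \<in> V \<Longrightarrow> w \<in> V \<Longrightarrow> K w (p x y) = K w x + K w y"
    using a[of x y w] h[of "p x y" w] h[of x w] h[of y w] by simp
  show "x \<in> V \<Longrightarrow> w \<in> V \<Longrightarrow> K w (s c x) = cnj c * K w x"
    using b[of x w c] h[of "s c x" w] h[of x w] by simp
  show "x \<in> V \<Longrightarrow> 0 \<le> Re (K x x)" using D(3) by simp
  show "K x x = of_real (Re (K x x))" if "x \<in> V"
  proof -
    have "Im (K x x) = - Im (K x x)" using h[OF that that] by (metis complex_cnj(1) cnj.simps(2))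
    then show ?thesis by (simp add: complex_eq_iff)
  qed
qed

lemma psd_form_CS:
  assumes K: "psd_form K" and x: "x \<in> V" and y: "y \<in> V"
  shows "(cmod (K x y))\<^sup>2 \<le> Re (K x x) * Re (K y y)"
proof (rule nonneg_quadratic_imp_cmod_le)
  note D = psd_formD[OF K]
  fix t :: complex
  let ?w = "p x (s (cnj t) y)"
  have "K ?w ?w = K x x + (t * K x y + cnj (t * K x y)) + (t * cnj t) * K y y"
    using x y D(1,2,3,4) D(7)[OF x y] by (simp add: algebra_simps)
  then have "Re (K ?w ?w) = Re (K x x) + 2 * Re (t * K x y) + Re ((t * cnj t) * K y y)"
    by (simp only: plus_complex.sel cnj.sel)
  also have "t * cnj t = of_real ((cmod t)\<^sup>2)" by (rule complex_norm_square[symmetric])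
  also have "Re (of_real ((cmod t)\<^sup>2) * K y y) = (cmod t)\<^sup>2 * Re (K y y)" by (simp del: of_real_power)
  finally show "0 \<le> Re (K x x) + 2 * Re (t * K x y) + (cmod t)\<^sup>2 * Re (K y y)"
    using D(5)[of ?w] x y by simp
qed (rule psd_formD(5)[OF K x], rule psd_formD(5)[OF K y])

end

definition delta :: "'a \<Rightarrow> 'a \<Rightarrow> complex" where
  "delta a = (\<lambda>i. if i = a then 1 else 0)"

lemma delta_l2: "a \<in> J \<Longrightarrow> delta a \<in> l2 J"
proof -
  assume a: "a \<in> J"
  have "(\<lambda>i. (cmod (delta a i))\<^sup>2) summable_on UNIV \<longleftrightarrow> (\<lambda>i. (cmod (delta a i))\<^sup>2) summable_on {a}"
    by (rule summable_on_cong_neutral) (auto simp: delta_def)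
  then show ?thesis using a by (auto simp: l2_iff delta_def)
qed

lemma l2ip_delta: "l2ip (delta a) f = cnj (f a)"
proof -
  have "l2ip (delta a) f = (\<Sum>\<^sub>\<infinity>i\<in>{a}. delta a i * cnj (f i))"
    unfolding l2ip_def by (rule infsum_cong_neutral) (auto simp: delta_def)
  then show ?thesis by (simp add: delta_def)
qed

text \<open>Zorn's lemma is applied to linear isometries \<open>G\<close> defined on a subspace \<open>Domain G\<close> and taking
  values in \<open>l2 (Domain G)\<close>: a new vector \<open>a\<close> is sent to its orthogonal projection plus a
  multiple of the fresh basis vector \<open>delta a\<close>.\<close>
lemma (in cvspace) Kolmogorov_decomposition:
  fixes K :: "'v \<Rightarrow> 'v \<Rightarrow> complex"
  assumes K: "psd_form K"
  shows "\<exists>v :: 'v \<Rightarrow> 'v \<Rightarrow> complex. (\<forall>x\<in>V. v x \<in> l2 UNIV) \<and> (\<forall>x\<in>V. \<forall>y\<in>V. l2ip (v x) (v y) = K x y)"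
proof -
  note D = psd_formD[OF K]
  define C where "C = {G :: ('v \<times> ('v \<Rightarrow> complex)) set. Domain G \<subseteq> V \<and> (z, \<lambda>i. 0) \<in> G \<and>
    (\<forall>x f. (x, f) \<in> G \<longrightarrow> f \<in> l2 (Domain G)) \<and>
    (\<forall>x f y g. (x, f) \<in> G \<longrightarrow> (y, g) \<in> G \<longrightarrow> (p x y, \<lambda>i. f i + g i) \<in> G \<and> l2ip f g = K x y) \<and>
    (\<forall>c x f. (x, f) \<in> G \<longrightarrow> (s c x, \<lambda>i. c * f i) \<in> G)}"
  have Kz: "K z z = 0" using D(2)[of z z 0] by simp
  have "\<exists>G\<in>C. \<forall>X\<in>C. G \<subseteq> X \<longrightarrow> X = G"
  proof (rule subset_Zorn_nonempty)
    have "{(z, \<lambda>i. 0)} \<in> C" using Kz by (auto simp: C_def)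
    then show "C \<noteq> {}" by blast
    fix c assume c: "c \<noteq> {}" "subset.chain C c"
    then have cC: "c \<subseteq> C" and ch: "\<And>X Y. X \<in> c \<Longrightarrow> Y \<in> c \<Longrightarrow> X \<subseteq> Y \<or> Y \<subseteq> X"
      by (auto simp: subset_chain_def)
    have XC: "X \<in> C" if "X \<in> c" for X using that cC by auto
    have m1: "Domain X \<subseteq> V" "(z, \<lambda>i. 0) \<in> X" if "X \<in> c" for X
      using XC[OF that] unfolding C_def by simp_all
    have m2: "f \<in> l2 (Domain X)" "(s k x, \<lambda>i. k * f i) \<in> X" if "X \<in> c" "(x, f) \<in> X" for X x f k
      using XC[OF that(1)] that(2) unfolding C_def by simp_all
    have m3: "(p x y, \<lambda>i. f i + g i) \<in> X" "l2ip f g = K x y" if "X \<in> c" "(x, f) \<in> X" "(y, g) \<in> X" for X x y f g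
      using XC[OF that(1)] that(2,3) unfolding C_def by simp_all
    have pr: "\<exists>Z\<in>c. (x, f) \<in> Z \<and> (y, g) \<in> Z" if xy: "(x, f) \<in> \<Union>c" "(y, g) \<in> \<Union>c" for x y f g
    proof -
      obtain X Y where XY: "X \<in> c" "(x, f) \<in> X" "Y \<in> c" "(y, g) \<in> Y" using xy by auto
      show ?thesis
      proof (cases "X \<subseteq> Y")
        case True then show ?thesis using XY by auto
      next
        case False
        then have "Y \<subseteq> X" using ch XY by auto
        then show ?thesis using XY by auto
      qed
    qed
    show "\<Union>c \<in> C"
      unfolding C_def
    proof (intro CollectI conjI allI impI)
      show "Domain (\<Union>c) \<subseteq> V" using m1(1) by blast
      show "(z, \<lambda>i. 0) \<in> \<Union>c" using m1(2) c(1) by auto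
      fix x f assume xf: "(x, f) \<in> \<Union>c"
      then obtain X where X: "X \<in> c" "(x, f) \<in> X" by auto
      have "Domain X \<subseteq> Domain (\<Union>c)" using X(1) by auto
      then have "l2 (Domain X) \<subseteq> l2 (Domain (\<Union>c))" by (rule l2_mono)
      then show "f \<in> l2 (Domain (\<Union>c))" using m2(1)[OF X] by (rule subsetD)
      show "(s k x, \<lambda>i. k * f i) \<in> \<Union>c" for k using m2(2)[OF X] X(1) by auto
      fix y g assume yg: "(y, g) \<in> \<Union>c"
      from pr[OF xf yg] obtain Z where Z: "Z \<in> c" "(x, f) \<in> Z" "(y, g) \<in> Z" by auto
      show "(p x y, \<lambda>i. f i + g i) \<in> \<Union>c" using m3(1)[OF Z] Z(1) by auto
      show "l2ip f g = K x y" using m3(2)[OF Z] .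
    qed
  qed
  then obtain G where GC: "G \<in> C" and max: "\<And>X. X \<in> C \<Longrightarrow> G \<subseteq> X \<Longrightarrow> X = G" by auto
  have GV: "Domain G \<subseteq> V" and Gz: "(z, \<lambda>i. 0) \<in> G" using GC by (auto simp: C_def)
  have Gl2: "f \<in> l2 (Domain G)" if "(x, f) \<in> G" for x f using GC that by (auto simp: C_def)
  have Gadd: "(p x y, \<lambda>i. f i + g i) \<in> G" and Gip: "l2ip f g = K x y" if "(x, f) \<in> G" "(y, g) \<in> G" for x y f g
    using GC that by (auto simp: C_def)
  have Gsc: "(s c x, \<lambda>i. c * f i) \<in> G" if "(x, f) \<in> G" for x f c using GC that by (auto simp: C_def)
  have xV: "x \<in> V" if "(x, f) \<in> G" for x f using GV that by auto
  have "V \<subseteq> Domain G"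
  proof (rule ccontr)
    assume "\<not> V \<subseteq> Domain G"
    then obtain a where a: "a \<in> V" "a \<notin> Domain G" by auto
    define J where "J = Domain G"
    \<comment> \<open>\<open>f\<close> may have several preimages, but they differ by a null vector
      of \<open>K\<close>, on which \<open>K a\<close> vanishes; so \<open>\<psi>\<close> is well
      defined on the range.\<close>
    define \<psi> where "\<psi> f = K a (SOME x. (x, f) \<in> G)" for f
    have K0: "K a x = 0" if "x \<in> V" "K x x = 0" for x
    proof -
      have "(cmod (K a x))\<^sup>2 \<le> Re (K a a) * Re (K x x)" by (rule psd_form_CS[OF K a(1) that(1)])
      then show ?thesis using that by simp
    qed
    have \<psi>: "\<psi> f = K a x" if xf: "(x, f) \<in> G" for x f
    proof -
      define y where "y = (SOME x. (x, f) \<in> G)"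
      have yf: "(y, f) \<in> G" unfolding y_def using xf by (rule someI)
      have d: "(p x (s (-1) y), \<lambda>i. f i + (-1) * f i) \<in> G" by (intro Gadd Gsc xf yf)
      then have "K (p x (s (-1) y)) (p x (s (-1) y)) = 0" using Gip[OF d d] by simp
      then have "K a (p x (s (-1) y)) = 0" by (intro K0) (use xV[OF d] in auto)
      then have "K a x - K a y = 0" using D(3,4) a xV[OF xf] xV[OF yf] by simp
      then show ?thesis by (simp add: \<psi>_def y_def)
    qed
    have nf: "(l2nrm f)\<^sup>2 = Re (K x x)" if "(x, f) \<in> G" for x f
      using Gip[OF that that] l2ip_self[of f] by (metis Re_complex_of_real)
    obtain w xs where w: "w \<in> l2 J" "\<And>f. f \<in> Range G \<Longrightarrow> l2ip w f = \<psi> f" "l2nrm w \<le> sqrt (Re (K a a))"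
    proof (rule l2_subspace_Riesz[of "Range G" J \<psi> "sqrt (Re (K a a))"])
      show "Range G \<subseteq> l2 J" using Gl2 by (auto simp: J_def)
      show "Range G \<noteq> {}" using Gz by auto
      show "0 \<le> sqrt (Re (K a a))" using D(5) a by simp
      fix f assume "f \<in> Range G"
      then obtain x where xf: "(x, f) \<in> G" by auto
      show "(\<lambda>i. c * f i) \<in> Range G" for c using Gsc[OF xf] by auto
      show "\<psi> (\<lambda>i. c * f i) = cnj c * \<psi> f" for c using \<psi>[OF Gsc[OF xf]] \<psi>[OF xf] D(4) xV[OF xf] a by simp
      have "(cmod (K a x))\<^sup>2 \<le> (sqrt (Re (K a a)) * l2nrm f)\<^sup>2"
        unfolding power_mult_distrib nf[OF xf] using psd_form_CS[OF K a(1) xV[OF xf]] D(5) a by simp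
      then show "cmod (\<psi> f) \<le> sqrt (Re (K a a)) * l2nrm f"
        unfolding \<psi>[OF xf] by (rule power2_le_imp_le) (use D(5) a in simp)
      fix g assume "g \<in> Range G"
      then obtain y where yg: "(y, g) \<in> G" by auto
      show "(\<lambda>i. f i + g i) \<in> Range G" using Gadd[OF xf yg] by auto
      show "\<psi> (\<lambda>i. f i + g i) = \<psi> f + \<psi> g" using \<psi>[OF Gadd[OF xf yg]] \<psi>[OF xf] \<psi>[OF yg] D(3) xV[OF xf] xV[OF yg] a by simp
    qed auto
    have aJ: "a \<notin> J" using a by (simp add: J_def)
    \<comment> \<open>The part of the new vector orthogonal to the range has squared norm
      \<open>K a a - (l2nrm w)^2\<close>, nonnegative by the Riesz bound. As \<open>a\<close> is not
      in \<open>J\<close>, \<open>delta a\<close> is orthogonal to everything constructed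
      before.\<close>
    define c where "c = complex_of_real (sqrt (Re (K a a) - (l2nrm w)\<^sup>2))"
    define u where "u = (\<lambda>i. w i + c * delta a i)"
    have wa: "w a = 0" using w(1) aJ by (simp add: l2_def)
    have w': "w \<in> l2 (insert a J)" using w(1) l2_mono[of J "insert a J"] by auto
    have da: "delta a \<in> l2 (insert a J)" by (rule delta_l2) simp
    have u: "u \<in> l2 (insert a J)" unfolding u_def by (intro l2_add l2_scale w' da)
    have uf: "l2ip u f = K a x" if xf: "(x, f) \<in> G" for x f
    proof -
      have fl: "f \<in> l2 (insert a J)" using Gl2[OF xf] l2_mono[of J "insert a J"] by (auto simp: J_def)
      have "f a = 0" using Gl2[OF xf] aJ by (simp add: l2_def J_def)
      then have "l2ip u f = l2ip w f"
        unfolding u_def using l2ip_add_left[OF w' l2_scale[OF da] fl] by (simp add: l2ip_scale_left l2ip_delta)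
      also have "\<dots> = K a x" using w(2)[OF RangeI[OF xf]] \<psi>[OF xf] by simp
      finally show ?thesis .
    qed
    have fu: "l2ip f u = K x a" if xf: "(x, f) \<in> G" for x f
      using uf[OF xf] l2ip_cnj[of f u] D(7)[OF a(1) xV[OF xf]] by simp
    have "l2ip w (delta a) = 0" using l2ip_cnj[of w "delta a"] wa by (simp add: l2ip_delta)
    moreover have "(l2nrm (delta a))\<^sup>2 = 1" using l2ip_self[of "delta a"] l2ip_delta[of a "delta a"] by (simp add: delta_def) (metis of_real_1 of_real_eq_iff of_real_power)
    moreover have "(l2nrm w)\<^sup>2 \<le> Re (K a a)"
      using w(3) power_mono[OF w(3) l2nrm_ge0, of 2] D(5) a by simp
    ultimately have "(l2nrm u)\<^sup>2 = Re (K a a)"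
      unfolding u_def l2nrm_add_scale_sq[OF w' da] by (simp add: c_def)
    then have uu: "l2ip u u = K a a" using D(6)[OF a(1)] l2ip_self[of u] by simp
    define G' where "G' = {(p x (s k a), \<lambda>i. f i + k * u i) | x f k. (x, f) \<in> G}"
    have G'I: "(p x (s k a), \<lambda>i. f i + k * u i) \<in> G'" if "(x, f) \<in> G" for x f k unfolding G'_def using that by auto
    have G'E: "\<exists>y g k. (y, g) \<in> G \<and> x = p y (s k a) \<and> f = (\<lambda>i. g i + k * u i)" if "(x, f) \<in> G'" for x f
      using that unfolding G'_def by auto
    have GG': "G \<subseteq> G'"
    proof
      fix q assume q: "q \<in> G"
      obtain x f where xf: "q = (x, f)" by (cases q)
      show "q \<in> G'" using G'I[of x f 0] q xV[of x f] a by (simp add: xf)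
    qed
    have au: "(a, u) \<in> G'" using G'I[OF Gz, of 1] a by simp
    have JG': "insert a J \<subseteq> Domain G'" using GG' au by (auto simp: J_def)
    have "G' \<in> C"
      unfolding C_def
    proof (intro CollectI conjI allI impI)
      show "Domain G' \<subseteq> V" unfolding G'_def using xV a by auto
      show "(z, \<lambda>i. 0) \<in> G'" using Gz GG' by auto
      fix x f assume "(x, f) \<in> G'"
      from G'E[OF this] obtain y g k where yg: "(y, g) \<in> G" "x = p y (s k a)" "f = (\<lambda>i. g i + k * u i)" by auto
      have gl: "g \<in> l2 (insert a J)" using Gl2[OF yg(1)] l2_mono[of J "insert a J"] by (auto simp: J_def)
      have "f \<in> l2 (insert a J)" unfolding yg(3) by (intro l2_add l2_scale gl u)
      then show "f \<in> l2 (Domain G')" using l2_mono[OF JG'] by auto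
      show "(s m x, \<lambda>i. m * f i) \<in> G'" for m
        using G'I[OF Gsc[OF yg(1), of m], of "m * k"] yg xV[OF yg(1)] a by (simp add: scale_add scale_scale algebra_simps)
      fix x' f' assume "(x', f') \<in> G'"
      from G'E[OF this] obtain y' g' k' where yg': "(y', g') \<in> G" "x' = p y' (s k' a)" "f' = (\<lambda>i. g' i + k' * u i)" by auto
      have e: "p x x' = p (p y y') (s (k + k') a)"
        using yg(2) yg'(2) xV[OF yg(1)] xV[OF yg'(1)] a by (simp add: add_scale assoc lcomm)
      show "(p x x', \<lambda>i. f i + f' i) \<in> G'"
        using G'I[OF Gadd[OF yg(1) yg'(1)], of "k + k'"] unfolding e yg(3) yg'(3) by (simp add: algebra_simps)
      have gl': "g' \<in> l2 (insert a J)" using Gl2[OF yg'(1)] l2_mono[of J "insert a J"] by (auto simp: J_def)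
      have "l2ip f f' = l2ip g g' + cnj k' * l2ip g u + k * l2ip u g' + k * cnj k' * l2ip u u"
        unfolding yg(3) yg'(3)
        using gl gl' u l2ip_add_left[OF gl l2_scale[OF u] l2_add[OF gl' l2_scale[OF u]], of k k']
          l2ip_add_right[OF gl' l2_scale[OF u] gl, of k'] l2ip_add_right[OF gl' l2_scale[OF u] u, of k']
        by (simp add: l2ip_scale_left l2ip_scale_right algebra_simps)
      also have "\<dots> = K x x'"
        unfolding Gip[OF yg(1) yg'(1)] uf[OF yg'(1)] fu[OF yg(1)] uu yg(2) yg'(2)
        using D(1,2,3,4) xV[OF yg(1)] xV[OF yg'(1)] a by (simp add: algebra_simps)
      finally show "l2ip f f' = K x x'" .
    qed
    then have "G' = G" using max GG' by auto
    then show False using au a by auto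
  qed
  then have ex: "\<forall>x\<in>V. \<exists>f. (x, f) \<in> G" by auto
  define v where "v x = (SOME f. (x, f) \<in> G)" for x
  have v: "(x, v x) \<in> G" if "x \<in> V" for x unfolding v_def using ex that someI_ex by metis
  have v1: "v x \<in> l2 UNIV" if "x \<in> V" for x using Gl2[OF v[OF that]] l2_mono[of "Domain G" UNIV] by auto
  have v2: "l2ip (v x) (v y) = K x y" if "x \<in> V" "y \<in> V" for x y
    by (rule Gip[OF v[OF that(1)] v[OF that(2)]])
  show ?thesis by (rule exI[of _ v]) (intro conjI ballI v1 v2)
qed

section \<open>Limits and closures of subspaces in l2\<close>

lemma l2ip_tendsto_right:
  assumes "\<And>n. x n \<in> l2 J" "y \<in> l2 J" "g \<in> l2 J" "(\<lambda>n. l2nrm (\<lambda>i. x n i - y i)) \<longlonglongrightarrow> 0"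
  shows "(\<lambda>n. l2ip g (x n)) \<longlonglongrightarrow> l2ip g y"
  unfolding l2ip_cnj[of g] using tendsto_cnj[OF l2ip_tendsto_left[OF assms]] .

definition l2_closure :: "'i set \<Rightarrow> ('i \<Rightarrow> complex) set \<Rightarrow> ('i \<Rightarrow> complex) set" where
  "l2_closure J R = {w \<in> l2 J. \<exists>x. (\<forall>n::nat. x n \<in> R) \<and> (\<lambda>n. l2nrm (\<lambda>i. x n i - w i)) \<longlonglongrightarrow> 0}"

lemma l2_closureI:
  "w \<in> l2 J \<Longrightarrow> (\<And>n::nat. x n \<in> R) \<Longrightarrow> (\<lambda>n. l2nrm (\<lambda>i. x n i - w i)) \<longlonglongrightarrow> 0 \<Longrightarrow> w \<in> l2_closure J R"
  unfolding l2_closure_def by auto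

lemma l2_closure_subset: "R \<subseteq> l2 J \<Longrightarrow> R \<subseteq> l2_closure J R"
proof
  fix w assume "R \<subseteq> l2 J" "w \<in> R"
  then show "w \<in> l2_closure J R" by (intro l2_closureI[of _ _ "\<lambda>n. w"]) auto
qed

lemma squeeze_null:
  fixes f g :: "'i \<Rightarrow> real"
  assumes "\<And>n. f n \<le> g n" "\<And>n. 0 \<le> f n" "(g \<longlongrightarrow> 0) F"
  shows "(f \<longlongrightarrow> 0) F"
  by (rule tendsto_sandwich[OF always_eventually always_eventually tendsto_const assms(3)]) (use assms in auto)

lemma l2_closure_add:
  assumes R: "R \<subseteq> l2 J" "\<And>f g. f \<in> R \<Longrightarrow> g \<in> R \<Longrightarrow> (\<lambda>i. f i + g i) \<in> R"
    and v: "v \<in> l2_closure J R" and w: "w \<in> l2_closure J R"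
  shows "(\<lambda>i. v i + w i) \<in> l2_closure J R"
proof -
  obtain x where x: "v \<in> l2 J" "\<And>n::nat. x n \<in> R" "(\<lambda>n. l2nrm (\<lambda>i. x n i - v i)) \<longlonglongrightarrow> 0" using v unfolding l2_closure_def by auto
  obtain y where y: "w \<in> l2 J" "\<And>n::nat. y n \<in> R" "(\<lambda>n. l2nrm (\<lambda>i. y n i - w i)) \<longlonglongrightarrow> 0" using w unfolding l2_closure_def by auto
  show ?thesis
  proof (rule l2_closureI[of _ _ "\<lambda>n i. x n i + y n i"])
    show "(\<lambda>i. v i + w i) \<in> l2 J" using x y by (intro l2_add)
    show "(\<lambda>i. x n i + y n i) \<in> R" for n using x y R by auto
    have "l2nrm (\<lambda>i. (x n i + y n i) - (v i + w i)) \<le> l2nrm (\<lambda>i. x n i - v i) + l2nrm (\<lambda>i. y n i - w i)" for n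
    proof -
      have "(\<lambda>i. x n i - v i) \<in> l2 J" "(\<lambda>i. y n i - w i) \<in> l2 J"
        by (rule l2_diff; use x y R in auto)+
      from l2nrm_triangle[OF this] show ?thesis by (simp add: algebra_simps)
    qed
    then show "(\<lambda>n. l2nrm (\<lambda>i. (x n i + y n i) - (v i + w i))) \<longlonglongrightarrow> 0"
      by (rule squeeze_null) (rule l2nrm_ge0, rule tendsto_add_zero[OF x(3) y(3)])
  qed
qed

lemma l2_closure_scale:
  assumes R: "\<And>f. f \<in> R \<Longrightarrow> (\<lambda>i. c * f i) \<in> R" and v: "v \<in> l2_closure J R"
  shows "(\<lambda>i. c * v i) \<in> l2_closure J R"
proof -
  obtain x where x: "v \<in> l2 J" "\<And>n::nat. x n \<in> R" "(\<lambda>n. l2nrm (\<lambda>i. x n i - v i)) \<longlonglongrightarrow> 0" using v unfolding l2_closure_def by auto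
  have "(\<lambda>n. cmod c * l2nrm (\<lambda>i. x n i - v i)) \<longlonglongrightarrow> 0" using tendsto_mult_right_zero[OF x(3)] .
  then have "(\<lambda>n. l2nrm (\<lambda>i. c * x n i - c * v i)) \<longlonglongrightarrow> 0"
    by (simp only: l2nrm_scale[symmetric] right_diff_distrib)
  then show ?thesis using x R by (intro l2_closureI[of _ _ "\<lambda>n i. c * x n i"]) auto
qed

text \<open>The difference is orthogonal to \<open>R\<close>, hence to both limits, hence to
  itself.\<close>

lemma l2_closure_eqI:
  assumes R: "R \<subseteq> l2 J" and v: "v \<in> l2_closure J R" and w: "w \<in> l2_closure J R"
    and e: "\<And>f. f \<in> R \<Longrightarrow> l2ip v f = l2ip w f"
  shows "v = w"
proof -
  obtain x where x: "v \<in> l2 J" "\<And>n::nat. x n \<in> R" "(\<lambda>n. l2nrm (\<lambda>i. x n i - v i)) \<longlonglongrightarrow> 0" using v unfolding l2_closure_def by auto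
  obtain y where y: "w \<in> l2 J" "\<And>n::nat. y n \<in> R" "(\<lambda>n. l2nrm (\<lambda>i. y n i - w i)) \<longlonglongrightarrow> 0" using w unfolding l2_closure_def by auto
  define d where "d = (\<lambda>i. v i - w i)"
  have dl: "d \<in> l2 J" unfolding d_def using x y by (intro l2_diff)
  have d0: "l2ip d f = 0" if "f \<in> R" for f
    unfolding d_def using l2ip_diff_left[OF x(1) y(1), of f J] e[OF that] that R by auto
  have "l2ip d v = 0"
    by (rule LIMSEQ_unique[OF l2ip_tendsto_right[OF _ x(1) dl x(3)]]) (use d0 x R in auto)
  moreover have "l2ip d w = 0"
    by (rule LIMSEQ_unique[OF l2ip_tendsto_right[OF _ y(1) dl y(3)]]) (use d0 y R in auto)
  ultimately have "l2ip d d = 0" using l2ip_diff_right[OF x(1) y(1) dl] by (simp add: d_def)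
  then have "d = (\<lambda>i. 0)" using l2nrm_eq_0[OF dl] by (simp add: l2ip_self)
  then have "v i = w i" for i unfolding d_def by (metis eq_iff_diff_eq_0)
  then show ?thesis by auto
qed

context bstar
begin

text \<open>The space is all of \<open>l2 UNIV\<close>, with \<open>\<pi> a\<close> zero on the
  orthogonal complement of the closure of \<open>R\<close>. Instead of extending
  \<open>v x \<mapsto> v (a x)\<close> by continuity, \<open>\<pi> a g\<close> is defined weakly for
  every \<open>g\<close>, as the vector \<open>w\<close> of the closure with
  \<open>l2ip w (v b) = l2ip g (v (st a b))\<close> for all \<open>b\<close>.\<close>

theorem GNS:
  assumes K: "psd_form K"
    and adj: "\<And>a x y. a \<in> car A \<Longrightarrow> x \<in> car A \<Longrightarrow> y \<in> car A \<Longrightarrow> K (mu A a x) y = K x (mu A (st A a) y)"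
    and bd: "\<And>a. a \<in> car A \<Longrightarrow> \<exists>C\<ge>0. \<forall>x\<in>car A. Re (K (mu A a x) (mu A a x)) \<le> C\<^sup>2 * Re (K x x)"
  shows "\<exists>\<pi>. star_rep A (UNIV :: 'a set) \<pi> \<and>
     rep_ker A UNIV \<pi> = {a \<in> car A. \<forall>b\<in>car A. K (mu A a b) (mu A a b) = 0}"
proof -
  note D = psd_formD[OF K]
  obtain v where v: "\<And>x. x \<in> car A \<Longrightarrow> v x \<in> l2 (UNIV :: 'a set)"
      "\<And>x y. x \<in> car A \<Longrightarrow> y \<in> car A \<Longrightarrow> l2ip (v x) (v y) = K x y"
    using Kolmogorov_decomposition[OF K] by auto
  define R where "R = v ` car A"
  have R: "R \<subseteq> l2 UNIV" using v by (auto simp: R_def)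
  have RI: "v x \<in> R" if "x \<in> car A" for x using that by (simp add: R_def)
  \<comment> \<open>Equality of the three inner products makes \<open>f - g\<close> null; in this
    way \<open>v\<close> inherits linearity from \<open>K\<close>.\<close>
  have v_eqI: "f = g" if "f \<in> l2 UNIV" "g \<in> l2 UNIV" "l2ip f f = c" "l2ip g g = c" "l2ip f g = c" for f g :: "'a \<Rightarrow> complex" and c
  proof -
    have d: "(\<lambda>i. f i - g i) \<in> l2 UNIV" using that by (intro l2_diff)
    have "l2ip g f = cnj (l2ip g g)" using that l2ip_cnj[of g f] by simp
    also have "\<dots> = c" using that(4) by (simp add: l2ip_self)  (metis complex_cnj_complex_of_real l2ip_self that(4))
    finally have "l2ip (\<lambda>i. f i - g i) (\<lambda>i. f i - g i) = 0"
      using that l2ip_diff_left[OF that(1,2) d] l2ip_diff_right[OF that(1,2) that(1)] l2ip_diff_right[OF that(1,2) that(2)] by simp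
    then have "(\<lambda>i. f i - g i) = (\<lambda>i. 0)" using l2nrm_eq_0[OF d] by (simp add: l2ip_self)
    then have "f i = g i" for i by (metis eq_iff_diff_eq_0)
    then show "f = g" by auto
  qed
  have v_add: "v (ad A x y) = (\<lambda>i. v x i + v y i)" if "x \<in> car A" "y \<in> car A" for x y
  proof (rule v_eqI)
    show "v (ad A x y) \<in> l2 UNIV" "(\<lambda>i. v x i + v y i) \<in> l2 UNIV" using that v by (auto intro: l2_add)
    have l: "l2ip (\<lambda>i. v x i + v y i) (v w) = K (ad A x y) w" if "w \<in> car A" for w
      using l2ip_add_left[OF v(1)[OF \<open>x \<in> car A\<close>] v(1)[OF \<open>y \<in> car A\<close>] v(1)[OF that]] v(2) D(1) that \<open>x \<in> car A\<close> \<open>y \<in> car A\<close> by simp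
    show "l2ip (v (ad A x y)) (v (ad A x y)) = K (ad A x y) (ad A x y)" using that v(2) by simp
    show "l2ip (\<lambda>i. v x i + v y i) (\<lambda>i. v x i + v y i) = K (ad A x y) (ad A x y)"
      using l2ip_add_right[OF v(1)[OF that(1)] v(1)[OF that(2)], of "\<lambda>i. v x i + v y i" UNIV] l that D(3) v(1) by (simp add: l2_add)
    show "l2ip (v (ad A x y)) (\<lambda>i. v x i + v y i) = K (ad A x y) (ad A x y)"
      using l2ip_add_right[OF v(1)[OF that(1)] v(1)[OF that(2)] v(1)[of "ad A x y"]] that D(3) v(2) by simp
  qed
  have v_scale: "v (sm A c x) = (\<lambda>i. c * v x i)" if "x \<in> car A" for x c
  proof (rule v_eqI)
    show "v (sm A c x) \<in> l2 UNIV" "(\<lambda>i. c * v x i) \<in> l2 UNIV" using that v by (auto intro: l2_scale)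
    show "l2ip (v (sm A c x)) (v (sm A c x)) = K (sm A c x) (sm A c x)" using that v(2) by simp
    show "l2ip (\<lambda>i. c * v x i) (\<lambda>i. c * v x i) = K (sm A c x) (sm A c x)"
      using that v(2) D(2,4) by (simp add: l2ip_scale_left l2ip_scale_right)
    show "l2ip (v (sm A c x)) (\<lambda>i. c * v x i) = K (sm A c x) (sm A c x)"
      using that v(2) D(2,4) by (simp add: l2ip_scale_right)
  qed
  have R_add: "(\<lambda>i. f i + g i) \<in> R" if fg: "f \<in> R" "g \<in> R" for f g
  proof -
    obtain x y where xy: "x \<in> car A" "f = v x" "y \<in> car A" "g = v y" using fg by (auto simp: R_def)
    show ?thesis unfolding xy(2,4) v_add[OF xy(1,3), symmetric] by (rule RI) (use xy in simp)
  qed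
  have R_scale: "(\<lambda>i. c * f i) \<in> R" if f: "f \<in> R" for f c
  proof -
    obtain x where x: "x \<in> car A" "f = v x" using f by (auto simp: R_def)
    show ?thesis unfolding x(2) v_scale[OF x(1), symmetric] by (rule RI) (use x in simp)
  qed
  have vsq: "(l2nrm (v x))\<^sup>2 = Re (K x x)" if "x \<in> car A" for x
    using v(2)[OF that that] l2ip_self[of "v x"] by (metis Re_complex_of_real)
  have vbd: "\<exists>C\<ge>0. \<forall>x\<in>car A. l2nrm (v (mu A a x)) \<le> C * l2nrm (v x)" if a: "a \<in> car A" for a
  proof -
    obtain C where C: "C \<ge> 0" "\<forall>x\<in>car A. Re (K (mu A a x) (mu A a x)) \<le> C\<^sup>2 * Re (K x x)" using bd[OF a] by auto
    have "l2nrm (v (mu A a x)) \<le> C * l2nrm (v x)" if "x \<in> car A" for x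
    proof (rule power2_le_imp_le)
      show "(l2nrm (v (mu A a x)))\<^sup>2 \<le> (C * l2nrm (v x))\<^sup>2"
        unfolding power_mult_distrib vsq[OF that] vsq[OF mu_in[OF a that]] using C(2) that by simp
    qed (use C in simp)
    then show ?thesis using C by auto
  qed
  let ?cl = "l2_closure (UNIV :: 'a set) R"
  define Q where "Q a g w \<longleftrightarrow> w \<in> ?cl \<and> (\<forall>b\<in>car A. l2ip w (v b) = l2ip g (v (mu A (st A a) b)))" for a g w
  have Quniq: "w = w'" if "Q a g w" "Q a g w'" for a g w w'
    by (rule l2_closure_eqI[OF R]) (use that in \<open>auto simp: Q_def R_def\<close>)
  have Qex: "\<exists>C\<ge>0. \<forall>g\<in>l2 UNIV. \<exists>w. Q a g w \<and> l2nrm w \<le> C * l2nrm g" if a: "a \<in> car A" for a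
  proof -
    obtain C where C: "C \<ge> 0" "\<forall>x\<in>car A. l2nrm (v (mu A (st A a) x)) \<le> C * l2nrm (v x)" using vbd[of "st A a"] a by auto
    have "\<exists>w. Q a g w \<and> l2nrm w \<le> C * l2nrm g" if g: "g \<in> l2 UNIV" for g
    proof -
      define \<psi> where "\<psi> f = l2ip g (v (mu A (st A a) (SOME b. b \<in> car A \<and> v b = f)))" for f
      have \<psi>: "\<psi> (v b) = l2ip g (v (mu A (st A a) b))" if b: "b \<in> car A" for b
      proof -
        define b' where "b' = (SOME b'. b' \<in> car A \<and> v b' = v b)"
        have b': "b' \<in> car A \<and> v b' = v b" unfolding b'_def by (rule someI[of _ b]) (use b in simp)
        let ?d = "ad A b' (sm A (-1) b)"
        have "v ?d = (\<lambda>i. 0)" using v_add[of b' "sm A (-1) b"] v_scale[of b "-1"] b b' by simp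
        then have "l2nrm (v (mu A (st A a) ?d)) \<le> C * 0" using C(2) b b' by (metis closed(2) closed(3) l2nrm_zero)
        then have "l2nrm (v (mu A (st A a) ?d)) = 0" using l2nrm_ge0[of "v (mu A (st A a) ?d)"] by linarith
        then have z: "v (mu A (st A a) ?d) = (\<lambda>i. 0)" using l2nrm_eq_0[OF v(1)[of "mu A (st A a) ?d"]] a b b' by simp
        have e: "mu A (st A a) ?d = ad A (mu A (st A a) b') (sm A (-1) (mu A (st A a) b))"
          using a b b' by (simp add: mu_add_right mu_scale_right)
        have "v (mu A (st A a) b') i = v (mu A (st A a) b) i" for i
          using fun_cong[OF z, of i] a b b' unfolding e by (simp add: v_add v_scale)
        then have "v (mu A (st A a) b') = v (mu A (st A a) b)" by auto
        then show ?thesis by (simp add: \<psi>_def b'_def)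
      qed
      obtain w x where w: "w \<in> l2 UNIV" "\<And>n::nat. x n \<in> R" "(\<lambda>n. l2nrm (\<lambda>i. x n i - w i)) \<longlonglongrightarrow> 0"
          "\<And>f. f \<in> R \<Longrightarrow> l2ip w f = \<psi> f" "l2nrm w \<le> C * l2nrm g"
      proof (rule l2_subspace_Riesz[of R UNIV \<psi> "C * l2nrm g"])
        show "R \<subseteq> l2 UNIV" by (rule R)
        show "R \<noteq> {}" using RI[OF closed(1)] by auto
        show "0 \<le> C * l2nrm g" using C by simp
        fix f assume "f \<in> R"
        then obtain b where b: "b \<in> car A" "f = v b" by (auto simp: R_def)
        show "(\<lambda>i. c * f i) \<in> R" for c by (rule R_scale[OF \<open>f \<in> R\<close>])
        show "\<psi> (\<lambda>i. c * f i) = cnj c * \<psi> f" for c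
          using \<psi>[OF b(1)] \<psi>[of "sm A c b"] a b by (simp add: v_scale mu_scale_right l2ip_scale_right)
        have "cmod (\<psi> f) \<le> l2nrm g * l2nrm (v (mu A (st A a) b))"
          unfolding b(2) \<psi>[OF b(1)] by (rule l2ip_Cauchy_Schwarz[OF g]) (use v a b in auto)
        also have "\<dots> \<le> l2nrm g * (C * l2nrm (v b))" using C(2) b by (intro mult_left_mono) auto
        finally show "cmod (\<psi> f) \<le> C * l2nrm g * l2nrm f" by (simp add: b(2) mult_ac)
        fix h assume "h \<in> R"
        then obtain c where c: "c \<in> car A" "h = v c" by (auto simp: R_def)
        show "(\<lambda>i. f i + h i) \<in> R" by (rule R_add[OF \<open>f \<in> R\<close> \<open>h \<in> R\<close>])
        show "\<psi> (\<lambda>i. f i + h i) = \<psi> f + \<psi> h"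
          using \<psi>[OF b(1)] \<psi>[OF c(1)] \<psi>[of "ad A b c"] a b c
            l2ip_add_right[OF v(1)[of "mu A (st A a) b"] v(1)[of "mu A (st A a) c"] g] by (simp add: v_add mu_add_right)
      qed auto
      have "Q a g w" unfolding Q_def using l2_closureI[OF w(1-3)] w(4) \<psi> RI by simp
      then show ?thesis using w(5) by auto
    qed
    then show ?thesis using C(1) by auto
  qed
  define \<pi> where "\<pi> a g = (SOME w. Q a g w)" for a g
  have \<pi>Q: "Q a g (\<pi> a g)" if "a \<in> car A" "g \<in> l2 UNIV" for a g
    unfolding \<pi>_def using Qex[OF that(1)] that(2) by (metis someI_ex)
  have \<pi>eq: "\<pi> a g = w" if "a \<in> car A" "g \<in> l2 UNIV" "Q a g w" for a g w
    using Quniq[OF \<pi>Q[OF that(1,2)] that(3)] .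
  have \<pi>l2: "\<pi> a g \<in> l2 UNIV" if "a \<in> car A" "g \<in> l2 UNIV" for a g
    using \<pi>Q[OF that] by (simp add: Q_def l2_closure_def)
  have \<pi>ip: "l2ip (\<pi> a g) (v b) = l2ip g (v (mu A (st A a) b))" if "a \<in> car A" "g \<in> l2 UNIV" "b \<in> car A" for a g b
    using \<pi>Q[OF that(1,2)] that(3) by (simp add: Q_def)
  have \<pi>cl: "\<pi> a g \<in> ?cl" if "a \<in> car A" "g \<in> l2 UNIV" for a g
    using \<pi>Q[OF that] by (simp add: Q_def)
  have cl_add: "(\<lambda>i. f i + g i) \<in> ?cl" if "f \<in> ?cl" "g \<in> ?cl" for f g
    by (rule l2_closure_add[OF R R_add that])
  have cl_scale: "(\<lambda>i. c * f i) \<in> ?cl" if "f \<in> ?cl" for f c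
    by (rule l2_closure_scale[OF R_scale that])
  have \<pi>_add: "\<pi> a (\<lambda>i. f i + g i) = (\<lambda>i. \<pi> a f i + \<pi> a g i)" if "a \<in> car A" "f \<in> l2 UNIV" "g \<in> l2 UNIV" for a f g
  proof (rule \<pi>eq[OF that(1) l2_add[OF that(2,3)]])
    show "Q a (\<lambda>i. f i + g i) (\<lambda>i. \<pi> a f i + \<pi> a g i)"
      unfolding Q_def
    proof (intro conjI ballI)
      show "(\<lambda>i. \<pi> a f i + \<pi> a g i) \<in> ?cl" by (intro cl_add \<pi>cl that)
      fix b assume b: "b \<in> car A"
      have s: "mu A (st A a) b \<in> car A" using that b by simp
      show "l2ip (\<lambda>i. \<pi> a f i + \<pi> a g i) (v b) = l2ip (\<lambda>i. f i + g i) (v (mu A (st A a) b))"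
        using l2ip_add_left[OF \<pi>l2[OF that(1,2)] \<pi>l2[OF that(1,3)] v(1)[OF b]] l2ip_add_left[OF that(2,3) v(1)[OF s]]
          \<pi>ip[OF that(1,2) b] \<pi>ip[OF that(1,3) b] by simp
    qed
  qed
  have \<pi>_scale: "\<pi> a (\<lambda>i. c * f i) = (\<lambda>i. c * \<pi> a f i)" if "a \<in> car A" "f \<in> l2 UNIV" for a f c
    by (rule \<pi>eq[OF that(1) l2_scale[OF that(2)]])
      (use that cl_scale \<pi>cl \<pi>ip in \<open>auto simp: Q_def l2ip_scale_left\<close>)
  have \<pi>_bounded: "bounded_op UNIV (\<pi> a)" if a: "a \<in> car A" for a
  proof -
    obtain C where C: "\<forall>g\<in>l2 UNIV. \<exists>w. Q a g w \<and> l2nrm w \<le> C * l2nrm g" using Qex[OF a] by auto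
    have "l2nrm (\<pi> a g) \<le> C * l2nrm g" if "g \<in> l2 UNIV" for g using C \<pi>eq[OF a that] that by auto
    then show ?thesis unfolding bounded_op_def using \<pi>l2[OF a] \<pi>_add[OF a] \<pi>_scale[OF a] by (intro conjI ballI allI exI[of _ C])
  qed
  have \<pi>v: "\<pi> a (v b) = v (mu A a b)" if "a \<in> car A" "b \<in> car A" for a b
  proof (rule \<pi>eq[OF that(1) v(1)[OF that(2)]])
    show "Q a (v b) (v (mu A a b))"
      unfolding Q_def using that RI[of "mu A a b"] l2_closure_subset[OF R] v(2) adj by auto
  qed
  \<comment> \<open>\<open>h\<close> is the orthogonal projection of \<open>g\<close> onto the
    closure, given together with a sequence in \<open>R\<close> approximating it.\<close>
  have proj: "\<exists>y h. h \<in> ?cl \<and> (\<forall>n::nat. y n \<in> car A) \<and> (\<lambda>n. l2nrm (\<lambda>i. v (y n) i - h i)) \<longlonglongrightarrow> 0 \<and>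
      (\<forall>f\<in>?cl. l2ip h f = l2ip g f)" if g: "g \<in> l2 UNIV" for g
  proof -
    obtain h x where h: "h \<in> l2 UNIV" "\<And>n::nat. x n \<in> R" "(\<lambda>n. l2nrm (\<lambda>i. x n i - h i)) \<longlonglongrightarrow> 0"
          "\<And>f. f \<in> R \<Longrightarrow> l2ip h f = l2ip g f" "l2nrm h \<le> l2nrm g"
    proof (rule l2_subspace_Riesz[of R UNIV "\<lambda>f. l2ip g f" "l2nrm g"])
      show "R \<subseteq> l2 UNIV" by (rule R)
      show "R \<noteq> {}" using RI[OF closed(1)] by auto
      fix f assume f: "f \<in> R"
      show "(\<lambda>i. c * f i) \<in> R" for c by (rule R_scale[OF f])
      show "cmod (l2ip g f) \<le> l2nrm g * l2nrm f" by (rule l2ip_Cauchy_Schwarz[OF g]) (use f R in auto)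
      fix k assume k: "k \<in> R"
      show "(\<lambda>i. f i + k i) \<in> R" by (rule R_add[OF f k])
      show "l2ip g (\<lambda>i. f i + k i) = l2ip g f + l2ip g k" by (rule l2ip_add_right[OF _ _ g]) (use f k R in auto)
    qed (auto simp: l2ip_scale_right)
    have "\<forall>n. \<exists>b. b \<in> car A \<and> x n = v b" using h(2) by (auto simp: R_def)
    then obtain y where y: "\<And>n. y n \<in> car A" "\<And>n. x n = v (y n)" by metis
    have "l2ip h f = l2ip g f" if f: "f \<in> ?cl" for f
    proof -
      obtain u where u: "f \<in> l2 UNIV" "\<And>n::nat. u n \<in> R" "(\<lambda>n. l2nrm (\<lambda>i. u n i - f i)) \<longlonglongrightarrow> 0" using f unfolding l2_closure_def by auto
      have ul: "u n \<in> l2 UNIV" for n using u(2) R by auto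
      have "(\<lambda>n. l2ip h (u n)) \<longlonglongrightarrow> l2ip h f" by (rule l2ip_tendsto_right[OF ul u(1) h(1) u(3)])
      moreover have "(\<lambda>n. l2ip h (u n)) \<longlonglongrightarrow> l2ip g f"
        unfolding h(4)[OF u(2)] by (rule l2ip_tendsto_right[OF ul u(1) g u(3)])
      ultimately show ?thesis by (rule LIMSEQ_unique)
    qed
    moreover have "h \<in> ?cl" by (rule l2_closureI[OF h(1,2,3)])
    ultimately show ?thesis using y h(3) unfolding y(2) by (intro exI[of _ y] exI[of _ h]) auto
  qed
  \<comment> \<open>\<open>\<pi> a g\<close> depends only on the projection of \<open>g\<close> and
    is a limit of vectors \<open>v (a y)\<close>; this carries the adjoint relation and the kernel
    from \<open>R\<close> to all of \<open>l2\<close>.\<close>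
  have \<pi>lim: "(\<lambda>n. l2nrm (\<lambda>i. v (mu A a (y n)) i - \<pi> a g i)) \<longlonglongrightarrow> 0"
    if a: "a \<in> car A" and g: "g \<in> l2 UNIV" and h: "h \<in> ?cl" "\<And>n::nat. y n \<in> car A" "(\<lambda>n. l2nrm (\<lambda>i. v (y n) i - h i)) \<longlonglongrightarrow> 0"
      "\<And>f. f \<in> ?cl \<Longrightarrow> l2ip h f = l2ip g f" for a g h y
  proof -
    have hl: "h \<in> l2 UNIV" using h(1) by (simp add: l2_closure_def)
    have "Q a g (\<pi> a h)"
      unfolding Q_def
    proof (intro conjI ballI)
      show "\<pi> a h \<in> ?cl" by (rule \<pi>cl[OF a hl])
      fix b assume b: "b \<in> car A"
      have "v (mu A (st A a) b) \<in> ?cl"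
        by (rule subsetD[OF l2_closure_subset[OF R] RI[OF mu_in[OF star_in[OF a] b]]])
      from h(4)[OF this] show "l2ip (\<pi> a h) (v b) = l2ip g (v (mu A (st A a) b))"
        unfolding \<pi>ip[OF a hl b] .
    qed
    then have e: "\<pi> a g = \<pi> a h" by (rule \<pi>eq[OF a g])
    obtain C where C: "0 \<le> C" "\<And>f. f \<in> l2 UNIV \<Longrightarrow> l2nrm (\<pi> a f) \<le> C * l2nrm f"
      using bounded_op_bound[OF \<pi>_bounded[OF a]] by auto
    have "l2nrm (\<lambda>i. v (mu A a (y n)) i - \<pi> a g i) \<le> C * l2nrm (\<lambda>i. v (y n) i - h i)" for n
    proof -
      have "(\<lambda>i. v (mu A a (y n)) i - \<pi> a g i) = \<pi> a (\<lambda>i. v (y n) i - h i)"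
        unfolding e \<pi>v[OF a h(2), symmetric] by (rule bounded_op_diff[OF \<pi>_bounded[OF a] v(1)[OF h(2)] hl, symmetric])
      then show ?thesis using C(2)[OF l2_diff[OF v(1)[OF h(2)] hl]] by simp
    qed
    then show ?thesis
      by (rule squeeze_null) (rule l2nrm_ge0, rule tendsto_mult_right_zero[OF h(3)])
  qed
  have rep: "star_rep A UNIV \<pi>"
    unfolding star_rep_def
  proof (intro conjI ballI allI)
    fix a assume a: "a \<in> car A"
    show "bounded_op UNIV (\<pi> a)" by (rule \<pi>_bounded[OF a])
    fix f :: "'a \<Rightarrow> complex" assume f: "f \<in> l2 UNIV"
    { fix b assume b: "b \<in> car A"
      show "\<pi> (ad A a b) f = (\<lambda>i. \<pi> a f i + \<pi> b f i)"
      proof (rule \<pi>eq[OF closed(2)[OF a b] f])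
        show "Q (ad A a b) f (\<lambda>i. \<pi> a f i + \<pi> b f i)"
          unfolding Q_def
        proof (intro conjI ballI)
          show "(\<lambda>i. \<pi> a f i + \<pi> b f i) \<in> ?cl" by (intro cl_add \<pi>cl a b f)
          fix c assume c: "c \<in> car A"
          have s: "mu A (st A a) c \<in> car A" "mu A (st A b) c \<in> car A" using a b c by auto
          show "l2ip (\<lambda>i. \<pi> a f i + \<pi> b f i) (v c) = l2ip f (v (mu A (st A (ad A a b)) c))"
            using l2ip_add_left[OF \<pi>l2[OF a f] \<pi>l2[OF b f] v(1)[OF c]] \<pi>ip[OF a f c] \<pi>ip[OF b f c]
              l2ip_add_right[OF v(1)[OF s(1)] v(1)[OF s(2)] f] a b c s by (simp add: star_add mu_add_left v_add)
        qed
      qed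
      show "\<pi> (mu A a b) f = \<pi> a (\<pi> b f)"
      proof (rule \<pi>eq[OF mu_in[OF a b] f])
        show "Q (mu A a b) f (\<pi> a (\<pi> b f))"
          unfolding Q_def
        proof (intro conjI ballI)
          show "\<pi> a (\<pi> b f) \<in> ?cl" by (rule \<pi>cl[OF a \<pi>l2[OF b f]])
          fix c assume c: "c \<in> car A"
          have "l2ip (\<pi> a (\<pi> b f)) (v c) = l2ip (\<pi> b f) (v (mu A (st A a) c))" by (rule \<pi>ip[OF a \<pi>l2[OF b f] c])
          also have "\<dots> = l2ip f (v (mu A (st A b) (mu A (st A a) c)))" by (rule \<pi>ip[OF b f]) (use a c in simp)
          finally show "l2ip (\<pi> a (\<pi> b f)) (v c) = l2ip f (v (mu A (st A (mu A a b)) c))"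
            using a b c by (simp add: star_mult mu_assoc)
        qed
      qed }
    { fix c
      show "\<pi> (sm A c a) f = (\<lambda>i. c * \<pi> a f i)"
      proof (rule \<pi>eq[OF closed(3)[OF a] f])
        show "Q (sm A c a) f (\<lambda>i. c * \<pi> a f i)"
          unfolding Q_def using cl_scale[OF \<pi>cl[OF a f]] \<pi>ip[OF a f] a
          by (simp add: l2ip_scale_left star_scale mu_scale_left v_scale l2ip_scale_right)
      qed }
    fix g :: "'a \<Rightarrow> complex" assume g: "g \<in> l2 UNIV"
    obtain y h where h: "h \<in> ?cl" "\<And>n::nat. y n \<in> car A" "(\<lambda>n. l2nrm (\<lambda>i. v (y n) i - h i)) \<longlonglongrightarrow> 0"
      "\<And>k. k \<in> ?cl \<Longrightarrow> l2ip h k = l2ip g k" using proj[OF g] by auto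
    have hl: "h \<in> l2 UNIV" using h(1) by (simp add: l2_closure_def)
    have sa: "st A a \<in> car A" using a by simp
    have "l2ip (\<pi> a f) g = cnj (l2ip g (\<pi> a f))" by (rule l2ip_cnj)
    also have "\<dots> = l2ip (\<pi> a f) h" using h(4)[OF \<pi>cl[OF a f]] l2ip_cnj[of "\<pi> a f" h] by simp
    finally have e: "l2ip (\<pi> a f) g = l2ip (\<pi> a f) h" .
    have "(\<lambda>n. l2ip (\<pi> a f) (v (y n))) \<longlonglongrightarrow> l2ip (\<pi> a f) h"
      by (rule l2ip_tendsto_right[OF v(1)[OF h(2)] hl \<pi>l2[OF a f] h(3)])
    moreover have "(\<lambda>n. l2ip (\<pi> a f) (v (y n))) \<longlonglongrightarrow> l2ip f (\<pi> (st A a) g)"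
      unfolding \<pi>ip[OF a f h(2)]
      by (rule l2ip_tendsto_right[OF v(1)[OF mu_in[OF sa h(2)]] \<pi>l2[OF sa g] f \<pi>lim[OF sa g h]])
    ultimately show "l2ip (\<pi> a f) g = l2ip f (\<pi> (st A a) g)" unfolding e by (rule LIMSEQ_unique)
  qed
  have ker: "rep_ker A UNIV \<pi> = {a \<in> car A. \<forall>b\<in>car A. K (mu A a b) (mu A a b) = 0}"
  proof (intro equalityI subsetI)
    fix a assume "a \<in> rep_ker A UNIV \<pi>"
    then have a: "a \<in> car A" "\<And>f. f \<in> l2 UNIV \<Longrightarrow> \<pi> a f = (\<lambda>i. 0)" by (auto simp: rep_ker_def)
    have "K (mu A a b) (mu A a b) = 0" if b: "b \<in> car A" for b
    proof -
      have "v (mu A a b) = (\<lambda>i. 0)" using \<pi>v[OF a(1) b] a(2)[OF v(1)[OF b]] by simp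
      then show ?thesis using v(2)[OF mu_in[OF a(1) b] mu_in[OF a(1) b]] by (metis l2ip_zero(1))
    qed
    then show "a \<in> {a \<in> car A. \<forall>b\<in>car A. K (mu A a b) (mu A a b) = 0}" using a by simp
  next
    fix a assume "a \<in> {a \<in> car A. \<forall>b\<in>car A. K (mu A a b) (mu A a b) = 0}"
    then have a: "a \<in> car A" "\<And>b. b \<in> car A \<Longrightarrow> K (mu A a b) (mu A a b) = 0" by auto
    have v0: "v (mu A a b) = (\<lambda>i. 0)" if b: "b \<in> car A" for b
      using vsq[of "mu A a b"] a b l2nrm_eq_0[OF v(1)[of "mu A a b"]] by simp
    have "\<pi> a g = (\<lambda>i. 0)" if g: "g \<in> l2 UNIV" for g
    proof -
      obtain y h where h: "h \<in> ?cl" "\<And>n::nat. y n \<in> car A" "(\<lambda>n. l2nrm (\<lambda>i. v (y n) i - h i)) \<longlonglongrightarrow> 0"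
        "\<And>k. k \<in> ?cl \<Longrightarrow> l2ip h k = l2ip g k" using proj[OF g] by auto
      have "(\<lambda>n::nat. l2nrm (\<lambda>i. (0::complex) - \<pi> a g i)) \<longlonglongrightarrow> 0"
        using \<pi>lim[OF a(1) g h] unfolding v0[OF h(2)] .
      then have "l2nrm (\<lambda>i. 0 - \<pi> a g i) = 0" by (simp only: LIMSEQ_const_iff)
      then have "l2nrm (\<lambda>i. \<pi> a g i - 0) = 0" by (subst l2nrm_minus_commute)
      then show ?thesis using l2nrm_eq_0[OF \<pi>l2[OF a(1) g]] by simp
    qed
    then show "a \<in> rep_ker A UNIV \<pi>" using a by (simp add: rep_ker_def)
  qed
  show ?thesis using rep ker by auto
qed

end

section \<open>Primitive ideals of a hermitian algebra\<close>

context bstar_ss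
begin

lemma unstar_emb: "a \<in> car A \<Longrightarrow> unstar (emb a) = emb (st A a)"
  using unstar_eq[of a 0] by (simp add: scalar_endo_0)

definition ext_act :: "('a, 'v) amod \<Rightarrow> 'a rep_index endo \<Rightarrow> 'v \<Rightarrow> 'v" where
  "ext_act M x v = vadd M (act M (fst (dec x)) v) (vsm M (snd (dec x)) v)"

lemma ext_act_eq: "a \<in> car A \<Longrightarrow> ext_act M (emb a + scalar_endo c) v = vadd M (act M a v) (vsm M c v)"
  by (simp add: ext_act_def dec_eq)

lemma ext_act_simps:
  assumes M: "alg_irred_rep A M" and v: "v \<in> vcar M"
  shows "ext_act M 1 v = v" "ext_act M 0 v = vz M"
    "a \<in> car A \<Longrightarrow> ext_act M (emb a) v = act M a v"
    "x \<in> un \<Longrightarrow> ext_act M x v \<in> vcar M"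
    "x \<in> un \<Longrightarrow> y \<in> un \<Longrightarrow> ext_act M (x + y) v = vadd M (ext_act M x v) (ext_act M y v)"
    "x \<in> un \<Longrightarrow> y \<in> un \<Longrightarrow> ext_act M (x * y) v = ext_act M x (ext_act M y v)"
    "x \<in> un \<Longrightarrow> ext_act M x (vz M) = vz M"
proof -
  note D = alg_irred_repD[OF M]
  interpret M: cvspace "vcar M" "vz M" "vadd M" "vsm M" by (rule D(1))
  have "(1 :: 'a rep_index endo) = emb (zer A) + scalar_endo 1" by (simp add: emb_zero scalar_endo_simps)
  then show "ext_act M 1 v = v" using v ext_act_eq[OF closed(1), of M 1 v] act_zero(2)[OF M v] by simp
  show emb: "ext_act M (emb a) v = act M a v" if "a \<in> car A" for a
    using ext_act_eq[OF that, of M 0 v] D(2)[OF that v] v by (simp add: scalar_endo_0)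
  show "ext_act M 0 v = vz M" using emb[OF closed(1)] act_zero(2)[OF M v] by (simp add: emb_zero)
  { assume "x \<in> un"
    then obtain a c where x: "a \<in> car A" "x = emb a + scalar_endo c" by (rule unE)
    show xv: "ext_act M x v \<in> vcar M" using x v D(2) by (simp add: ext_act_eq)
    show "ext_act M x (vz M) = vz M" using x act_zero(1)[OF M] by (simp add: ext_act_eq)
    { assume "y \<in> un"
      then obtain b d where y: "b \<in> car A" "y = emb b + scalar_endo d" by (rule unE)
      have s: "ad A a b \<in> car A" using x y by simp
      show "ext_act M (x + y) v = vadd M (ext_act M x v) (ext_act M y v)"
        unfolding x(2) y(2) un_add[OF x(1) y(1)] ext_act_eq[OF s] ext_act_eq[OF x(1)] ext_act_eq[OF y(1)]
        using v x(1) y(1) D(2,5) by (simp add: M.add_scale M.assoc M.lcomm)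
      have m: "ad A (mu A a b) (ad A (sm A c b) (sm A d a)) \<in> car A" using x y by simp
      have "ext_act M x (ext_act M y v) =
          vadd M (vadd M (act M a (act M b v)) (vsm M d (act M a v))) (vadd M (vsm M c (act M b v)) (vsm M (c * d) v))"
        unfolding x(2) y(2) ext_act_eq[OF x(1)] ext_act_eq[OF y(1)]
        using v x(1) y(1) D(2,3,4) by (simp add: M.scale_add M.scale_scale)
      also have "\<dots> = ext_act M (x * y) v"
        unfolding x(2) y(2) un_mult[OF x(1) y(1)] ext_act_eq[OF m]
        using v x(1) y(1) D(2,5,6,7) by (simp add: M.assoc M.lcomm)
      finally show "ext_act M (x * y) v = ext_act M x (ext_act M y v)" by simp } }
qed

end

context bstar_herm
begin

text \<open>Positivity of the form is where the Shirali-Ford theorem enters: \<open>F\<close> is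
  nonnegative on \<open>ge0\<close>, and every \<open>unstar x * x\<close> is
  \<open>ge0\<close>.\<close>

lemma psd_form_of_functional:
  assumes F: "\<And>x y. x \<in> un \<Longrightarrow> y \<in> un \<Longrightarrow> F (x + y) = F x + F y"
    "\<And>c x. x \<in> un \<Longrightarrow> F (scalar_endo c * x) = c * F x" "\<And>x. x \<in> un \<Longrightarrow> F (unstar x) = cnj (F x)"
    "\<And>h. H.ge0 h \<Longrightarrow> 0 \<le> Re (F h)"
  shows "cvspace un 0 (+) (\<lambda>c x. scalar_endo c * x)"
    "cvspace.psd_form un (+) (\<lambda>c x. scalar_endo c * x) (\<lambda>x y. F (unstar y * x))"
proof -
  have inv: "\<exists>y\<in>un. x + y = 0" if "x \<in> un" for x
    by (rule bexI[of _ "- x"]) (use that B.S_minus in auto)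
  show cv: "cvspace un 0 (+) (\<lambda>c x. scalar_endo c * x)"
    unfolding cvspace_def cvs_def
    using inv by (auto simp: B.S_add B.S_mult scalar_endo_simps(1,2,3) distrib_left distrib_right mult.assoc add.assoc add.commute)
  interpret U: cvspace un 0 "(+)" "\<lambda>c x. scalar_endo c * x" by (rule cv)
  show "U.psd_form (\<lambda>x y. F (unstar y * x))"
    unfolding U.psd_form_def
  proof (intro conjI ballI allI)
    fix x w assume x: "x \<in> un" and w: "w \<in> un"
    note sw = H.st_in[OF w]
    { fix y assume y: "y \<in> un"
      show "F (unstar w * (x + y)) = F (unstar w * x) + F (unstar w * y)"
        unfolding distrib_left by (rule F(1)[OF B.S_mult[OF sw x] B.S_mult[OF sw y]]) }
    { fix c show "F (unstar w * (scalar_endo c * x)) = c * F (unstar w * x)"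
        unfolding B.cs_lcomm[of "unstar w"] by (rule F(2)[OF B.S_mult[OF sw x]]) }
    have "unstar (unstar w * x) = unstar x * w" unfolding H.st_mult[OF sw x] H.st_st[OF w] ..
    then show "F (unstar x * w) = cnj (F (unstar w * x))" using F(3)[OF B.S_mult[OF sw x]] by simp
  next
    fix x assume x: "x \<in> un"
    show "0 \<le> Re (F (unstar x * x))" by (rule F(4)[OF H.Shirali_Ford[OF x]])
  qed
qed

text \<open>The state vanishes on \<open>st x * x\<close> for \<open>x\<close> in the annihilator
  \<open>L\<close> of \<open>v0\<close>. Conversely an \<open>x\<close> in \<open>A\<close> with
  \<open>K x x = 0\<close> kills \<open>v0\<close>, so on \<open>A\<close> the null space of the
  state is exactly the annihilator of \<open>v0\<close>. The GNS kernel then consists of the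
  \<open>a\<close> with \<open>a b v0 = 0\<close> for all \<open>b\<close>, which is
  \<open>Q\<close> since \<open>v0\<close> is cyclic.\<close>

theorem Prim_star_rep:
  assumes Q: "Q \<in> Prim A"
  shows "\<exists>\<pi>. star_rep A (UNIV :: 'a set) \<pi> \<and> rep_ker A UNIV \<pi> = Q"
proof -
  obtain M :: "('a, 'a set) amod" where M: "alg_irred_rep A M" and QM: "Q = amod_ker A M"
    using Q by (auto simp: Prim_def)
  note D = alg_irred_repD[OF M]
  interpret M: cvspace "vcar M" "vz M" "vadd M" "vsm M" by (rule D(1))
  obtain v0 where v0: "v0 \<in> vcar M" "v0 \<noteq> vz M" using D(8) act_zero(1)[OF M] by metis
  note E = ext_act_simps[OF M v0(1)]
  define L where "L = {x \<in> un. ext_act M x v0 = vz M}"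
  obtain F where F: "\<And>x y. x \<in> un \<Longrightarrow> y \<in> un \<Longrightarrow> F (x + y) = F x + F y"
    "\<And>c x. x \<in> un \<Longrightarrow> F (scalar_endo c * x) = c * F x" "\<And>x. x \<in> un \<Longrightarrow> F (unstar x) = cnj (F x)" "F 1 = 1"
    "\<And>h. H.ge0 h \<Longrightarrow> 0 \<le> Re (F h)" "\<And>x. x \<in> L \<Longrightarrow> F (unstar x * x) = 0"
  proof (rule H.positive_functional_vanishing_on_left_ideal[of L])
    show "L \<subseteq> un" "0 \<in> L" using E(2) by (auto simp: L_def)
    show "1 \<notin> L" using E(1) v0 by (simp add: L_def)
    fix x assume x: "x \<in> L"
    { fix y assume "y \<in> L" then show "x + y \<in> L" using x E(5) by (simp add: L_def B.S_add) }
    { fix s assume "s \<in> un" then show "s * x \<in> L" using x E(6)[of s x] E(7)[of s] by (simp add: L_def B.S_mult) }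
  next
    fix F :: "'a rep_index endo \<Rightarrow> complex"
    assume a: "\<And>x y. x \<in> un \<Longrightarrow> y \<in> un \<Longrightarrow> F (x + y) = F x + F y"
    assume b: "\<And>c x. x \<in> un \<Longrightarrow> F (scalar_endo c * x) = c * F x"
    assume c: "\<And>x. x \<in> un \<Longrightarrow> F (unstar x) = cnj (F x)"
    assume d: "F 1 = 1"
    assume e: "\<And>h. H.ge0 h \<Longrightarrow> 0 \<le> Re (F h)"
    assume f: "\<And>x. x \<in> L \<Longrightarrow> F (unstar x * x) = 0"
    show thesis by (rule that[OF a b c d e f])
  qed
  interpret U: cvspace un 0 "(+)" "\<lambda>c x. scalar_endo c * x" by (rule psd_form_of_functional(1)[OF F(1,2,3,5)])
  define G where "G x y = F (unstar y * x)" for x y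
  have G: "U.psd_form G" using psd_form_of_functional(2)[OF F(1,2,3,5)] unfolding G_def[abs_def] .
  note GD = U.psd_formD[OF G]
  have G0: "G x y = 0" "G y x = 0" if "x \<in> un" "G x x = 0" "y \<in> un" for x y
  proof -
    have "(cmod (G x y))\<^sup>2 \<le> 0" using U.psd_form_CS[OF G that(1,3)] that(2) by simp
    then show "G x y = 0" by simp
    then show "G y x = 0" using GD(7)[OF that(1,3)] by simp
  qed
  have GL: "G x x = 0" if "x \<in> L" for x unfolding G_def by (rule F(6)[OF that])
  have Gadj: "G (s * x) y = G x (unstar s * y)" if "s \<in> un" "x \<in> un" "y \<in> un" for s x y
    unfolding G_def H.st_mult[OF H.st_in[OF that(1)] that(3)] H.st_st[OF that(1)] mult.assoc ..
  have Gmult0: "G (s * x) (s * x) = 0" if "s \<in> un" "x \<in> un" "G x x = 0" for s x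
    unfolding Gadj[OF that(1,2) B.S_mult[OF that(1,2)]]
    by (rule G0(1)[OF that(2,3)]) (use that H.st_in B.S_mult in auto)
  \<comment> \<open>\<open>t + 1 - st s * s\<close> is strictly positive, hence the square of a
    self-adjoint \<open>u\<close>, and \<open>G (u x) (u x) \<ge> 0\<close> is the bound. The
    summand 1 provides the gap that \<open>pos_sqrt\<close> needs.\<close>
  have Gbd: "\<exists>C\<ge>0. \<forall>x\<in>un. Re (G (s * x) (s * x)) \<le> C\<^sup>2 * Re (G x x)" if s: "s \<in> un" for s
  proof -
    define h where "h = unstar s * s"
    have h: "H.sa h" "h \<in> un" unfolding h_def by (rule H.sa_star_mult[OF s], rule B.S_mult[OF H.st_in[OF s] s])
    define t where "t = unnorm h"
    have t: "0 \<le> t" unfolding t_def by (rule B.N_ge0[OF h(2)])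
    have g: "H.ge0 (H.cr t - h)" by (rule H.ge0_N_minus[OF h(1)]) (simp add: t_def)
    have "H.pos (H.cr (t + 1) - h)"
      unfolding H.pos_def
    proof (intro conjI allI impI)
      show "H.sa (H.cr (t + 1) - h)" by (rule H.sa_diff[OF H.sa_cr h(1)])
      fix r :: real assume r: "0 \<le> r"
      have "H.cr (t + 1) - h + H.cr r = H.cr t - h + H.cr (r + 1)"
        unfolding H.cr_add by (simp add: algebra_simps)
      then show "B.iv (H.cr (t + 1) - h + H.cr r)" using H.ge0D(1)[OF g, of "r + 1", OF add_nonneg_pos[OF r zero_less_one]] by (simp only:)
    qed
    then obtain u where u: "H.sa u" "u * u = H.cr (t + 1) - h" by (rule H.pos_sqrt)
    note uS = H.saD[OF u(1)]
    have "Re (G (s * x) (s * x)) \<le> (sqrt (t + 1))\<^sup>2 * Re (G x x)" if x: "x \<in> un" for x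
    proof -
      have "G (u * x) (u * x) = F (unstar x * (H.cr (t + 1) * x) - unstar x * (h * x))"
        unfolding G_def H.st_mult[OF uS(1) x] uS(2)
        by (simp only: mult.assoc[symmetric] mult.assoc[of "unstar x" u u] u(2)) (simp only: algebra_simps mult.assoc)
      also have "\<dots> = F (unstar x * (H.cr (t + 1) * x) + scalar_endo (- 1) * (unstar x * (h * x)))"
        by (simp add: scalar_endo_minus scalar_endo_simps(1))
      also have "\<dots> = F (unstar x * (H.cr (t + 1) * x)) + - 1 * F (unstar x * (h * x))"
        unfolding F(2)[OF B.S_mult[OF H.st_in[OF x] B.S_mult[OF h(2) x]], symmetric]
        by (rule F(1)) (use x h in \<open>auto intro!: B.S_mult H.st_in\<close>)
      also have "F (unstar x * (H.cr (t + 1) * x)) = of_real (t + 1) * G x x"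
        unfolding B.cs_lcomm[of "unstar x"] G_def by (rule F(2)[OF B.S_mult[OF H.st_in[OF x] x]])
      also have "F (unstar x * (h * x)) = G (s * x) (s * x)"
        unfolding G_def H.st_mult[OF s x] h_def mult.assoc ..
      finally have "Re (G (u * x) (u * x)) = (t + 1) * Re (G x x) - Re (G (s * x) (s * x))"
        by (simp del: of_real_add)
      moreover have "0 \<le> Re (G (u * x) (u * x))" by (rule GD(5)[OF B.S_mult[OF uS(1) x]])
      ultimately show ?thesis using t by simp
    qed
    moreover have "0 \<le> sqrt (t + 1)" using t by simp
    ultimately show ?thesis by (intro exI[of _ "sqrt (t + 1)"] conjI ballI)
  qed
  define K where "K a b = G (emb a) (emb b)" for a b
  have K: "psd_form K"
    unfolding psd_form_def
  proof (intro conjI ballI allI)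
    fix x w assume x: "x \<in> car A" and w: "w \<in> car A"
    note xe = emb_in[OF x] and we = emb_in[OF w]
    show "K (ad A x y) w = K x w + K y w" if y: "y \<in> car A" for y
      unfolding K_def emb_add[OF x y] by (rule GD(1)[OF xe emb_in[OF y] we])
    show "K (sm A c x) w = c * K x w" for c unfolding K_def emb_scale[OF x] by (rule GD(2)[OF xe we])
    show "K w x = cnj (K x w)" unfolding K_def by (rule GD(7)[OF xe we])
  next
    fix x assume x: "x \<in> car A"
    show "0 \<le> Re (K x x)" unfolding K_def by (rule GD(5)[OF emb_in[OF x]])
  qed
  have "\<exists>\<pi>. star_rep A (UNIV :: 'a set) \<pi> \<and> rep_ker A UNIV \<pi> = {a \<in> car A. \<forall>b\<in>car A. K (mu A a b) (mu A a b) = 0}"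
  proof (rule GNS[OF K])
    fix a x y assume a: "a \<in> car A" "x \<in> car A" "y \<in> car A"
    show "K (mu A a x) y = K x (mu A (st A a) y)"
      unfolding K_def emb_mult[OF a(1,2)] emb_mult[OF star_in[OF a(1)] a(3)] unstar_emb[OF a(1), symmetric]
      by (rule Gadj[OF emb_in emb_in emb_in]) (rule a)+
  next
    fix a assume a: "a \<in> car A"
    obtain C where C: "0 \<le> C" "\<forall>x\<in>un. Re (G (emb a * x) (emb a * x)) \<le> C\<^sup>2 * Re (G x x)"
      using Gbd[OF emb_in[OF a]] by auto
    show "\<exists>C\<ge>0. \<forall>x\<in>car A. Re (K (mu A a x) (mu A a x)) \<le> C\<^sup>2 * Re (K x x)"
      using C(1) bspec[OF C(2) emb_in] by (intro exI[of _ C]) (simp add: K_def emb_mult[OF a])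
  qed
  moreover have "{a \<in> car A. \<forall>b\<in>car A. K (mu A a b) (mu A a b) = 0} = Q"
  proof (intro equalityI subsetI)
    fix a assume a: "a \<in> Q"
    then have ac: "a \<in> car A" by (simp add: QM amod_ker_def)
    have "K (mu A a b) (mu A a b) = 0" if b: "b \<in> car A" for b
    proof -
      have "act M (mu A a b) v0 = vz M" using a D(7)[OF ac b v0(1)] D(2)[OF b v0(1)] by (simp add: QM amod_ker_def)
      then have "emb (mu A a b) \<in> L" using ac b E(3) by (simp add: L_def emb_in)
      then show ?thesis unfolding K_def by (rule GL)
    qed
    then show "a \<in> {a \<in> car A. \<forall>b\<in>car A. K (mu A a b) (mu A a b) = 0}" using ac by simp
  next
    fix a assume "a \<in> {a \<in> car A. \<forall>b\<in>car A. K (mu A a b) (mu A a b) = 0}"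
    then have a: "a \<in> car A" "\<And>b. b \<in> car A \<Longrightarrow> K (mu A a b) (mu A a b) = 0" by auto
    have z: "act M x v0 = vz M" if x: "x \<in> car A" "K x x = 0" for x
    proof (rule ccontr)
      assume n: "act M x v0 \<noteq> vz M"
      obtain c where c: "c \<in> car A" "act M c (act M x v0) = v0"
        using irred_cyclic[OF M D(2)[OF x(1) v0(1)] n v0(1)] by auto
      \<comment> \<open>\<open>c x\<close> fixes \<open>v0\<close>, so \<open>y - 1\<close> lies in
        \<open>L\<close> and is null; \<open>y\<close> is null as a left multiple of a null vector.
        Then 1 would be null, against \<open>F 1 = 1\<close>.\<close>
      define y where "y = emb c * emb x"
      have y: "y \<in> un" unfolding y_def by (intro B.S_mult emb_in c x)
      have yy: "G y y = 0" unfolding y_def by (rule Gmult0[OF emb_in[OF c(1)] emb_in[OF x(1)]]) (use x K_def in simp)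
      define d where "d = y + scalar_endo (- 1)"
      have du: "d \<in> un" unfolding d_def by (rule B.S_add[OF y]) simp
      have "ext_act M d v0 = vz M"
        unfolding d_def y_def emb_mult[OF c(1) x(1), symmetric]
        using ext_act_eq[OF mu_in[OF c(1) x(1)], of M "-1" v0] D(7)[OF c(1) x(1) v0(1)] c(2) M.right_inverse[OF v0(1)] by simp
      then have dd: "G d d = 0" using du by (intro GL) (simp add: L_def)
      have one: "1 = y + scalar_endo (- 1) * d"
        by (simp add: d_def scalar_endo_minus scalar_endo_simps(1))
      have d1: "scalar_endo (- 1) * d \<in> un" by (rule B.S_mult[OF _ du]) simp
      have "G 1 1 = G y 1 + G (scalar_endo (- 1) * d) 1"
        by (subst one) (rule GD(1)[OF y d1 B.S_closed(2)])
      also have "\<dots> = 0" using G0(1)[OF y yy B.S_closed(2)] GD(2)[OF du B.S_closed(2), of "-1"] G0(1)[OF du dd B.S_closed(2)] by simp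
      finally have "F 1 = 0" by (simp add: G_def H.st_1)
      then show False using F(4) by simp
    qed
    have "act M a w = vz M" if w: "w \<in> vcar M" for w
    proof -
      obtain b where b: "b \<in> car A" "act M b v0 = w" using irred_cyclic[OF M v0 w] by auto
      show ?thesis using z[OF mu_in[OF a(1) b(1)] a(2)[OF b(1)]] D(7)[OF a(1) b(1) v0(1)] b(2) by simp
    qed
    then show "a \<in> Q" using a(1) by (simp add: QM amod_ker_def)
  qed
  ultimately show ?thesis by simp
qed

end

section \<open>Norms of *-representations\<close>

context bstar
begin

context
  fixes J :: "'a set" and \<pi>
  assumes \<pi>: "star_rep A J \<pi>"
begin

lemma rep_sub: "a \<in> car A \<Longrightarrow> b \<in> car A \<Longrightarrow> f \<in> l2 J \<Longrightarrow> \<pi> (sub A a b) f = (\<lambda>i. \<pi> a f i - \<pi> b f i)"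
  using star_repD(2)[OF \<pi>, of a "sm A (-1) b" f] star_repD(3)[OF \<pi>, of b f "-1"] by (simp add: sub_def)

lemma rep_l2: "a \<in> car A \<Longrightarrow> f \<in> l2 J \<Longrightarrow> \<pi> a f \<in> l2 J"
  by (rule bounded_op_l2[OF star_repD(1)[OF \<pi>]])

lemma rep_selfadjoint: "h \<in> car A \<Longrightarrow> st A h = h \<Longrightarrow> selfadjoint_op J (\<pi> h)"
  using star_repD(1,5)[OF \<pi>] by (simp add: selfadjoint_op_def)

lemma rep_zero: "a \<in> car A \<Longrightarrow> \<pi> a (\<lambda>i. 0) = (\<lambda>i. 0)"
  using bounded_op_scale[OF star_repD(1)[OF \<pi>] l2_zero, of a 0] by simp

lemma rep_opnrm: "a \<in> car A \<Longrightarrow> f \<in> l2 J \<Longrightarrow> l2nrm (\<pi> a f) \<le> opnrm J (\<pi> a) * l2nrm f"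
  by (rule opnrm_bound[OF star_repD(1)[OF \<pi>]])

lemma rep_opnrm_ge0: "a \<in> car A \<Longrightarrow> 0 \<le> opnrm J (\<pi> a)"
  by (rule opnrm_ge0[OF star_repD(1)[OF \<pi>]])

lemma rep_opnrm_add:
  assumes "a \<in> car A" "b \<in> car A" shows "opnrm J (\<pi> (ad A a b)) \<le> opnrm J (\<pi> a) + opnrm J (\<pi> b)"
proof (rule opnrm_le)
  fix f assume f: "f \<in> l2 J"
  show "l2nrm (\<pi> (ad A a b) f) \<le> (opnrm J (\<pi> a) + opnrm J (\<pi> b)) * l2nrm f"
    using l2nrm_triangle[OF rep_l2[OF assms(1) f] rep_l2[OF assms(2) f]] rep_opnrm[OF assms(1) f] rep_opnrm[OF assms(2) f]
    unfolding star_repD(2)[OF \<pi> assms f] distrib_right by linarith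
qed (use rep_opnrm_ge0 assms in auto)

lemma rep_opnrm_mult:
  assumes "a \<in> car A" "b \<in> car A" shows "opnrm J (\<pi> (mu A a b)) \<le> opnrm J (\<pi> a) * opnrm J (\<pi> b)"
proof (rule opnrm_le)
  fix f assume f: "f \<in> l2 J"
  have "l2nrm (\<pi> (mu A a b) f) \<le> opnrm J (\<pi> a) * l2nrm (\<pi> b f)"
    unfolding star_repD(4)[OF \<pi> assms f] by (rule rep_opnrm[OF assms(1) rep_l2[OF assms(2) f]])
  also have "\<dots> \<le> opnrm J (\<pi> a) * (opnrm J (\<pi> b) * l2nrm f)"
    by (rule mult_left_mono[OF rep_opnrm[OF assms(2) f] rep_opnrm_ge0[OF assms(1)]])
  finally show "l2nrm (\<pi> (mu A a b) f) \<le> opnrm J (\<pi> a) * opnrm J (\<pi> b) * l2nrm f" by (simp add: mult.assoc)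
qed (use rep_opnrm_ge0 assms in auto)

lemma rep_opnrm_scale_le:
  assumes "a \<in> car A" shows "opnrm J (\<pi> (sm A c a)) \<le> cmod c * opnrm J (\<pi> a)"
proof (rule opnrm_le)
  fix f assume f: "f \<in> l2 J"
  show "l2nrm (\<pi> (sm A c a) f) \<le> cmod c * opnrm J (\<pi> a) * l2nrm f"
    unfolding star_repD(3)[OF \<pi> assms f] l2nrm_scale mult.assoc by (rule mult_left_mono[OF rep_opnrm[OF assms f]]) simp
qed (use rep_opnrm_ge0 assms in auto)

lemma rep_opnrm_diff:
  assumes "a \<in> car A" "b \<in> car A" shows "opnrm J (\<pi> a) \<le> opnrm J (\<pi> (sub A a b)) + opnrm J (\<pi> b)"
  using rep_opnrm_add[of "sub A a b" b] assms by simp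

lemma rep_opnrm_star_mult:
  assumes a: "a \<in> car A" shows "(opnrm J (\<pi> a))\<^sup>2 \<le> opnrm J (\<pi> (mu A (st A a) a))"
proof -
  let ?n = "opnrm J (\<pi> (mu A (st A a) a))"
  have n0: "0 \<le> ?n" using rep_opnrm_ge0[of "mu A (st A a) a"] a by simp
  have "opnrm J (\<pi> a) \<le> sqrt ?n"
  proof (rule opnrm_le)
    fix f assume f: "f \<in> l2 J"
    have m: "mu A (st A a) a \<in> car A" using a by simp
    have "complex_of_real ((l2nrm (\<pi> a f))\<^sup>2) = l2ip f (\<pi> (mu A (st A a) a) f)"
      unfolding l2ip_self[symmetric] star_repD(4)[OF \<pi> star_in[OF a] a f]
      by (rule star_repD(5)[OF \<pi> a f rep_l2[OF a f]])
    then have "(l2nrm (\<pi> a f))\<^sup>2 = cmod (l2ip f (\<pi> (mu A (st A a) a) f))"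
      by (metis norm_of_real abs_of_nonneg zero_le_power2)
    also have "\<dots> \<le> l2nrm f * l2nrm (\<pi> (mu A (st A a) a) f)" by (rule l2ip_Cauchy_Schwarz[OF f rep_l2[OF m f]])
    also have "\<dots> \<le> l2nrm f * (?n * l2nrm f)" by (rule mult_left_mono[OF rep_opnrm[OF m f] l2nrm_ge0])
    also have "\<dots> = (sqrt ?n * l2nrm f)\<^sup>2" using n0 by (simp add: power_mult_distrib power2_eq_square)
    finally show "l2nrm (\<pi> a f) \<le> sqrt ?n * l2nrm f"
      by (rule power2_le_imp_le) (use n0 in simp)
  qed (use n0 in simp)
  then show ?thesis using power_mono[of "opnrm J (\<pi> a)" "sqrt ?n" 2] n0 rep_opnrm_ge0[OF a] by simp
qed

lemma rep_opnrm_star_le: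
  assumes a: "a \<in> car A" shows "opnrm J (\<pi> a) \<le> opnrm J (\<pi> (st A a))"
proof -
  have "(opnrm J (\<pi> a))\<^sup>2 \<le> opnrm J (\<pi> (st A a)) * opnrm J (\<pi> a)"
    using rep_opnrm_star_mult[OF a] rep_opnrm_mult[OF star_in[OF a] a] by linarith
  then show ?thesis using rep_opnrm_ge0[OF a] rep_opnrm_ge0[OF star_in[OF a]]
    by (cases "opnrm J (\<pi> a) = 0") (auto simp: power2_eq_square)
qed

lemma rep_ker_iff: "a \<in> rep_ker A J \<pi> \<longleftrightarrow> a \<in> car A \<and> opnrm J (\<pi> a) = 0"
proof
  assume "a \<in> rep_ker A J \<pi>"
  then have a: "a \<in> car A" "\<And>f. f \<in> l2 J \<Longrightarrow> \<pi> a f = (\<lambda>i. 0)" by (auto simp: rep_ker_def)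
  have "opnrm J (\<pi> a) \<le> 0" by (rule opnrm_le) (use a in simp_all)
  then show "a \<in> car A \<and> opnrm J (\<pi> a) = 0" using a rep_opnrm_ge0[OF a(1)] by simp
next
  assume "a \<in> car A \<and> opnrm J (\<pi> a) = 0"
  then show "a \<in> rep_ker A J \<pi>" using opnrm_eq_0[OF star_repD(1)[OF \<pi>]] by (auto simp: rep_ker_def)
qed

lemma rep_opnrm_zero: "opnrm J (\<pi> (zer A)) = 0"
  using rep_opnrm_scale_le[of "zer A" 0] rep_opnrm_ge0[of "zer A"] by simp

lemma rep_ker_ideal: "ideal A (rep_ker A J \<pi>)"
  unfolding ideal_def
proof (intro conjI ballI allI)
  show "rep_ker A J \<pi> \<subseteq> car A" by (auto simp: rep_ker_def)
  show "zer A \<in> rep_ker A J \<pi>" unfolding rep_ker_iff using rep_opnrm_zero by simp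
  fix x assume "x \<in> rep_ker A J \<pi>"
  then have x: "x \<in> car A" "opnrm J (\<pi> x) = 0" unfolding rep_ker_iff by auto
  { fix y assume "y \<in> rep_ker A J \<pi>"
    then have y: "y \<in> car A" "opnrm J (\<pi> y) = 0" unfolding rep_ker_iff by auto
    show "ad A x y \<in> rep_ker A J \<pi>" unfolding rep_ker_iff
      using x y rep_opnrm_add[OF x(1) y(1)] rep_opnrm_ge0[OF closed(2)[OF x(1) y(1)]] by simp }
  { fix c show "sm A c x \<in> rep_ker A J \<pi>" unfolding rep_ker_iff
      using x rep_opnrm_scale_le[OF x(1), of c] rep_opnrm_ge0[OF closed(3)[OF x(1)], of c] by simp }
  { fix a assume a: "a \<in> car A"
    show "mu A a x \<in> rep_ker A J \<pi>" unfolding rep_ker_iff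
      using x a rep_opnrm_mult[OF a x(1)] rep_opnrm_ge0[OF mu_in[OF a x(1)]] by simp
    show "mu A x a \<in> rep_ker A J \<pi>" unfolding rep_ker_iff
      using x a rep_opnrm_mult[OF x(1) a] rep_opnrm_ge0[OF mu_in[OF x(1) a]] by simp }
qed

lemma rep_ker_star_mult: "a \<in> car A \<Longrightarrow> mu A (st A a) a \<in> rep_ker A J \<pi> \<Longrightarrow> a \<in> rep_ker A J \<pi>"
  using rep_opnrm_star_mult[of a] by (simp add: rep_ker_iff)

text \<open>If \<open>(1 - y)(1 - h\<^sup>2/t\<^sup>2) = 1 - k\<close>, then \<open>k\<close> cannot be small when \<open>t\<close> is close to the norm of \<open>h\<close>,
  as an approximate eigenvector of \<open>h\<^sup>2\<close> shows.\<close>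
lemma quasi_inverse_remainder_ge:
  assumes h: "h \<in> car A" "st A h = h" and s: "0 < opnrm J (\<pi> h)" and t: "0 < t" and y: "y \<in> car A"
  defines "x \<equiv> sm A (of_real (1 / t\<^sup>2)) (mu A h h)"
  shows "1 \<le> (1 + opnrm J (\<pi> y)) * \<bar>1 - (opnrm J (\<pi> h))\<^sup>2 / t\<^sup>2\<bar> + opnrm J (\<pi> (sub A (ad A x y) (mu A y x)))"
proof (rule field_le_epsilon)
  fix e :: real assume e: "0 < e"
  define s where "s = opnrm J (\<pi> h)"
  define B where "B = opnrm J (\<pi> y)"
  have B: "0 \<le> B" unfolding B_def by (rule rep_opnrm_ge0[OF y])
  define k where "k = sub A (ad A x y) (mu A y x)"
  have x: "x \<in> car A" unfolding x_def using h by simp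
  have k: "k \<in> car A" unfolding k_def using x y by simp
  \<comment> \<open>Calibrated so that the eigenvector error, divided by \<open>t^2\<close> and
    amplified by \<open>1 + B\<close>, is \<open>e\<close>.\<close>
  define d where "d = e * t\<^sup>2 / (1 + B)"
  have "d > 0" using e t B by (simp add: d_def)
  then obtain f where f: "f \<in> l2 J" "l2nrm f = 1" "l2nrm (\<lambda>i. \<pi> h (\<pi> h f) i - of_real (s\<^sup>2) * f i) < d"
    using selfadjoint_approx_eigenvector[OF rep_selfadjoint[OF h] \<open>0 < opnrm J (\<pi> h)\<close>] unfolding s_def by auto
  define g where "g = \<pi> h (\<pi> h f)"
  have g: "g \<in> l2 J" unfolding g_def by (intro rep_l2 h f)
  have px: "\<pi> x f = (\<lambda>i. of_real (1 / t\<^sup>2) * g i)"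
    unfolding x_def star_repD(3)[OF \<pi> mu_in[OF h(1) h(1)] f(1)] star_repD(4)[OF \<pi> h(1) h(1) f(1)] g_def ..
  \<comment> \<open>\<open>u\<close> is \<open>(1 - x) f\<close>; applying
    \<open>(1 - y) (1 - x) = 1 - k\<close> to \<open>f\<close> gives
    \<open>f = k f + u - y u\<close>.\<close>
  define u where "u = (\<lambda>i. f i - \<pi> x f i)"
  have u: "u \<in> l2 J" unfolding u_def by (rule l2_diff[OF f(1) rep_l2[OF x f(1)]])
  have gl: "(\<lambda>i. g i - of_real (s\<^sup>2) * f i) \<in> l2 J" by (intro l2_diff g l2_scale f)
  have "u = (\<lambda>i. of_real (1 - s\<^sup>2 / t\<^sup>2) * f i + of_real (- (1 / t\<^sup>2)) * (g i - of_real (s\<^sup>2) * f i))"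
    unfolding u_def px by (auto simp: algebra_simps)
  then have "l2nrm u \<le> \<bar>1 - s\<^sup>2 / t\<^sup>2\<bar> * l2nrm f + \<bar>- (1 / t\<^sup>2)\<bar> * l2nrm (\<lambda>i. g i - of_real (s\<^sup>2) * f i)"
    using l2nrm_triangle[OF l2_scale[OF f(1), of "of_real (1 - s\<^sup>2 / t\<^sup>2)"] l2_scale[OF gl, of "of_real (- (1 / t\<^sup>2))"]]
    unfolding l2nrm_scale norm_of_real by simp
  also have "\<dots> \<le> \<bar>1 - s\<^sup>2 / t\<^sup>2\<bar> * 1 + \<bar>- (1 / t\<^sup>2)\<bar> * d"
    using f(2,3) by (intro add_mono mult_left_mono) (auto simp: g_def)
  also have "\<dots> = \<bar>1 - s\<^sup>2 / t\<^sup>2\<bar> + e / (1 + B)" using t by (simp add: d_def)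
  finally have un: "l2nrm u \<le> \<bar>1 - s\<^sup>2 / t\<^sup>2\<bar> + e / (1 + B)" .
  have pu: "\<pi> y u \<in> l2 J" by (rule rep_l2[OF y u])
  have "\<pi> k f = (\<lambda>i. (\<pi> x f i + \<pi> y f i) - \<pi> y (\<pi> x f) i)"
    unfolding k_def rep_sub[OF closed(2)[OF x y] mu_in[OF y x] f(1)] star_repD(2)[OF \<pi> x y f(1)] star_repD(4)[OF \<pi> y x f(1)] ..
  moreover have "\<pi> y u = (\<lambda>i. \<pi> y f i - \<pi> y (\<pi> x f) i)"
    unfolding u_def by (rule bounded_op_diff[OF star_repD(1)[OF \<pi> y] f(1) rep_l2[OF x f(1)]])
  ultimately have fe: "f = (\<lambda>i. (\<pi> k f i + u i) + (- 1) * \<pi> y u i)" by (auto simp: u_def)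
  have "l2nrm f \<le> (l2nrm (\<pi> k f) + l2nrm u) + l2nrm (\<pi> y u)"
    using l2nrm_triangle[OF l2_add[OF rep_l2[OF k f(1)] u] l2_scale[OF pu, of "-1"]]
      l2nrm_triangle[OF rep_l2[OF k f(1)] u] unfolding fe[symmetric] l2nrm_scale by simp
  also have "l2nrm (\<pi> y u) \<le> B * l2nrm u" unfolding B_def by (rule rep_opnrm[OF y u])
  also have "l2nrm (\<pi> k f) \<le> opnrm J (\<pi> k)" using rep_opnrm[OF k f(1)] f(2) by simp
  finally have "1 \<le> opnrm J (\<pi> k) + (1 + B) * l2nrm u" using f(2) by (simp add: algebra_simps)
  also have "\<dots> \<le> opnrm J (\<pi> k) + (1 + B) * (\<bar>1 - s\<^sup>2 / t\<^sup>2\<bar> + e / (1 + B))"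
    using un B by (intro add_mono mult_left_mono) auto
  also have "\<dots> = (1 + B) * \<bar>1 - s\<^sup>2 / t\<^sup>2\<bar> + opnrm J (\<pi> k) + e" using B by (simp add: distrib_left)
  finally show "1 \<le> (1 + opnrm J (\<pi> y)) * \<bar>1 - (opnrm J (\<pi> h))\<^sup>2 / t\<^sup>2\<bar> + opnrm J (\<pi> (sub A (ad A x y) (mu A y x))) + e"
    by (simp add: B_def s_def k_def)
qed

text \<open>Taking \<open>t\<close> equal to the norm kills the first term in
  \<open>quasi_inverse_remainder_ge\<close>, and a remainder in the kernel kills the second.\<close>

lemma not_lqi_rep_ker:
  assumes h: "h \<in> car A" "st A h = h" and s: "0 < opnrm J (\<pi> h)"
  shows "\<not> lqi (rep_ker A J \<pi>) (sm A (of_real (1 / (opnrm J (\<pi> h))\<^sup>2)) (mu A h h))"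
proof
  assume "lqi (rep_ker A J \<pi>) (sm A (of_real (1 / (opnrm J (\<pi> h))\<^sup>2)) (mu A h h))"
  then obtain y where y: "y \<in> car A" "opnrm J (\<pi> (sub A (ad A (sm A (of_real (1 / (opnrm J (\<pi> h))\<^sup>2)) (mu A h h)) y)
       (mu A y (sm A (of_real (1 / (opnrm J (\<pi> h))\<^sup>2)) (mu A h h))))) = 0"
    unfolding lqi_def rep_ker_iff by auto
  show False using quasi_inverse_remainder_ge[OF h s s y(1)] s unfolding y(2) by simp
qed

lemma rep_ker_eq_Inter_Prim:
  assumes a: "a \<in> car A" "a \<notin> rep_ker A J \<pi>"
  shows "\<exists>Q\<in>Prim A. rep_ker A J \<pi> \<subseteq> Q \<and> a \<notin> Q"
proof -
  define h where "h = mu A (st A a) a"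
  have h: "h \<in> car A" "st A h = h" unfolding h_def using a by (simp_all add: star_mult star_star)
  have "h \<notin> rep_ker A J \<pi>" using rep_ker_star_mult[OF a(1)] a(2) unfolding h_def by auto
  then have s: "0 < opnrm J (\<pi> h)" unfolding rep_ker_iff using h rep_opnrm_ge0[OF h(1)] by simp
  define x where "x = sm A (of_real (1 / (opnrm J (\<pi> h))\<^sup>2)) (mu A h h)"
  have x: "x \<in> car A" unfolding x_def using h by simp
  obtain Q where Q: "Q \<in> Prim A" "rep_ker A J \<pi> \<subseteq> Q" "x \<notin> Q"
    using ex_Prim_not_lqi[OF rep_ker_ideal x not_lqi_rep_ker[OF h s, folded x_def]] by auto
  note iQ = prime_idealD(1)[OF Prim_prime[OF Q(1)]]
  have "a \<notin> Q"
  proof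
    assume "a \<in> Q"
    then have "h \<in> Q" unfolding h_def by (rule ideal_mult(1)[OF iQ]) (use a in simp)
    then have "x \<in> Q" unfolding x_def by (intro ideal_scale[OF iQ] ideal_mult(1)[OF iQ] h)
    then show False using Q by simp
  qed
  then show ?thesis using Q by auto
qed

end

lemma lqi_mono: "K \<subseteq> L \<Longrightarrow> lqi K x \<Longrightarrow> lqi L x"
  by (auto simp: lqi_def)

lemma Prim_star_rep_ker:
  assumes "P \<in> Prim_star A" obtains J \<pi> where "irred_star_rep A J \<pi>" "star_rep A J \<pi>" "P = rep_ker A J \<pi>"
  using assms unfolding Prim_star_def irred_star_rep_def by auto

text \<open>If \<open>\<pi> b g \<noteq> 0\<close> for some \<open>b\<close> in the second ideal,
  this vector lies in the closed invariant subspace annihilated by the first ideal, and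
  irreducibility makes that subspace everything.\<close>

lemma Prim_star_prime:
  assumes P: "P \<in> Prim_star A" shows "prime_ideal A P"
proof -
  obtain J \<pi> where ir: "irred_star_rep A J \<pi>" and \<pi>: "star_rep A J \<pi>" and PJ: "P = rep_ker A J \<pi>"
    using P by (rule Prim_star_rep_ker)
  have nz: "\<exists>a\<in>car A. \<exists>f\<in>l2 J. \<pi> a f \<noteq> (\<lambda>i. 0)" and
    inv: "\<And>S. closed_subspace J S \<Longrightarrow> (\<forall>a\<in>car A. \<forall>f\<in>S. \<pi> a f \<in> S) \<Longrightarrow> S = {\<lambda>i. 0} \<or> S = l2 J"
    using ir unfolding irred_star_rep_def by auto
  have "P \<noteq> car A" using nz unfolding PJ rep_ker_def by auto
  moreover have "I1 \<subseteq> P \<or> I2 \<subseteq> P" if I: "ideal A I1" "ideal A I2" and m: "\<forall>a\<in>I1. \<forall>b\<in>I2. mu A a b \<in> P" for I1 I2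
  proof (cases "I2 \<subseteq> P")
    case False
    then obtain b where b: "b \<in> I2" "b \<notin> P" by auto
    have bc: "b \<in> car A" using ideal_subset[OF I(2)] b by auto
    then obtain g where g: "g \<in> l2 J" "\<pi> b g \<noteq> (\<lambda>i. 0)" using b by (auto simp: PJ rep_ker_def)
    define S where "S = {f \<in> l2 J. \<forall>a\<in>I1. \<pi> a f = (\<lambda>i. 0)}"
    have I1c: "a \<in> car A" if "a \<in> I1" for a using ideal_subset[OF I(1) that] .
    have "closed_subspace J S"
      unfolding closed_subspace_def
    proof (intro conjI ballI allI impI)
      show "S \<subseteq> l2 J" "(\<lambda>i. 0) \<in> S" using rep_zero[OF \<pi>] I1c by (auto simp: S_def)
      fix f assume f: "f \<in> S"
      { fix g assume g: "g \<in> S"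
        show "(\<lambda>i. f i + g i) \<in> S"
          using f g bounded_op_add[OF star_repD(1)[OF \<pi> I1c]] by (auto simp: S_def) }
      { fix c show "(\<lambda>i. c * f i) \<in> S"
          using f bounded_op_scale[OF star_repD(1)[OF \<pi> I1c]] by (auto simp: S_def) }
    next
      fix x y assume xy: "(\<forall>n. x n \<in> S) \<and> y \<in> l2 J \<and> (\<lambda>n. l2nrm (\<lambda>i. x n i - y i)) \<longlonglongrightarrow> 0"
      then have xl: "x n \<in> l2 J" and x0: "a \<in> I1 \<Longrightarrow> \<pi> a (x n) = (\<lambda>i. 0)" and y: "y \<in> l2 J" for n a by (auto simp: S_def)
      have "\<pi> a y = (\<lambda>i. 0)" if a: "a \<in> I1" for a
      proof -
        have "l2nrm (\<pi> a y) \<le> opnrm J (\<pi> a) * l2nrm (\<lambda>i. x n i - y i)" for n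
        proof -
          have "\<pi> a (\<lambda>i. x n i - y i) = (\<lambda>i. 0 - \<pi> a y i)"
            using bounded_op_diff[OF star_repD(1)[OF \<pi> I1c[OF a]] xl[of n] y] x0[OF a, of n] by simp
          then have "l2nrm (\<pi> a (\<lambda>i. x n i - y i)) = l2nrm (\<lambda>i. \<pi> a y i - 0)" by (simp only: l2nrm_minus_commute)
          then show ?thesis using rep_opnrm[OF \<pi> I1c[OF a] l2_diff[OF xl[of n] y]] by simp
        qed
        moreover have "(\<lambda>n. opnrm J (\<pi> a) * l2nrm (\<lambda>i. x n i - y i)) \<longlonglongrightarrow> 0"
          by (rule tendsto_mult_right_zero[OF conjunct2[OF conjunct2[OF xy]]])
        ultimately have "(\<lambda>n::nat. l2nrm (\<pi> a y)) \<longlonglongrightarrow> 0"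
          by (rule squeeze_null[OF _ l2nrm_ge0])
        then have "l2nrm (\<pi> a y) = 0" by (simp only: LIMSEQ_const_iff)
        then show ?thesis using l2nrm_eq_0[OF rep_l2[OF \<pi> I1c[OF a] y]] by simp
      qed
      then show "y \<in> S" using y by (simp add: S_def)
    qed
    moreover have "\<forall>c\<in>car A. \<forall>f\<in>S. \<pi> c f \<in> S"
    proof (intro ballI)
      fix c f assume c: "c \<in> car A" and f: "f \<in> S"
      have fl: "f \<in> l2 J" using f by (simp add: S_def)
      have "\<pi> a (\<pi> c f) = (\<lambda>i. 0)" if a: "a \<in> I1" for a
        using star_repD(4)[OF \<pi> I1c[OF a] c fl] f ideal_mult(2)[OF I(1) a c] by (simp add: S_def)
      then show "\<pi> c f \<in> S" using rep_l2[OF \<pi> c fl] by (simp add: S_def)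
    qed
    ultimately have "S = {\<lambda>i. 0} \<or> S = l2 J" by (rule inv)
    moreover have "\<pi> b g \<in> S"
    proof -
      have "\<pi> a (\<pi> b g) = (\<lambda>i. 0)" if a: "a \<in> I1" for a
        using star_repD(4)[OF \<pi> I1c[OF a] bc g(1)] m a b g(1) by (auto simp: PJ rep_ker_def)
      then show ?thesis using rep_l2[OF \<pi> bc g(1)] by (simp add: S_def)
    qed
    ultimately have "S = l2 J" using g(2) by auto
    then have "I1 \<subseteq> P" using I1c by (auto simp: PJ rep_ker_def S_def)
    then show ?thesis ..
  qed simp
  moreover have "ideal A P" unfolding PJ by (rule rep_ker_ideal[OF \<pi>])
  ultimately show ?thesis unfolding prime_ideal_def by auto
qed

text \<open>There is no constant term, since \<open>A\<close> may lack a unit. One \<open>x\<close>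
  serves all *-representations at once, so that its size can be measured by
  \<open>gamma\<close>.\<close>

lemma ex_poly_element:
  assumes h: "h \<in> car A"
  shows "\<exists>x\<in>car A. \<forall>J \<pi>. star_rep A J \<pi> \<longrightarrow> (\<forall>f\<in>l2 J. \<pi> x f = poly_op (pCons 0 q) (\<pi> h) f)"
proof (induction q rule: pCons_induct)
  case 0
  have "\<pi> (zer A) f = (\<lambda>i. 0)" if "star_rep A J \<pi>" "f \<in> l2 J" for J \<pi> f
    using star_repD(3)[OF that(1) closed(1) that(2), of 0] by simp
  then show ?case by (intro bexI[of _ "zer A"]) auto
next
  case (pCons c q)
  obtain x where x: "x \<in> car A" "\<And>J \<pi> f. star_rep A J \<pi> \<Longrightarrow> f \<in> l2 J \<Longrightarrow> \<pi> x f = poly_op (pCons 0 q) (\<pi> h) f"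
    using pCons.IH by auto
  show ?case
  proof (intro bexI[of _ "ad A (sm A c h) (mu A x h)"] allI impI ballI)
    fix J \<pi> f assume \<pi>: "star_rep A J \<pi>" and f: "f \<in> l2 J"
    show "\<pi> (ad A (sm A c h) (mu A x h)) f = poly_op (pCons 0 (pCons c q)) (\<pi> h) f"
      unfolding star_repD(2)[OF \<pi> closed(3)[OF h] mu_in[OF x(1) h] f] star_repD(3)[OF \<pi> h f] star_repD(4)[OF \<pi> x(1) h f]
        x(2)[OF \<pi> rep_l2[OF \<pi> h f]] poly_op_pCons by simp
  qed (use x h in simp)
qed

end

context bstar_ss
begin

lemma emb_inj: "a \<in> car A \<Longrightarrow> b \<in> car A \<Longrightarrow> emb a = emb b \<Longrightarrow> a = b"
  using emb_plus_scalar_inj(1)[of a b 0 0] by simp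

text \<open>\<open>(1 - y) * (1 - x') = 1 - k - d\<close> with \<open>k \<in> K\<close> and
  \<open>d\<close> small; multiplying by the left inverse \<open>1 - b\<close> of
  \<open>1 - d\<close> gives \<open>1 - (k - b * k)\<close>, so \<open>y' = b + y - b * y\<close>
  works.\<close>

lemma lqi_perturb:
  assumes K: "ideal A K" and c: "x \<in> car A" "x' \<in> car A" "y \<in> car A" and k: "sub A (ad A x y) (mu A y x) \<in> K"
    and d: "nm A (sub A (sub A x' x) (mu A y (sub A x' x))) < 1"
  shows "lqi K x'"
proof -
  define d where "d = sub A (sub A x' x) (mu A y (sub A x' x))"
  define k where "k = sub A (ad A x y) (mu A y x)"
  have dc: "d \<in> car A" "k \<in> car A" unfolding d_def k_def using c by simp_all
  obtain b where b: "b \<in> car A" "sub A (ad A d b) (mu A b d) = zer A"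
    using B_Neumann[OF dc(1)] assms(6) unfolding d_def by auto
  define y' where "y' = sub A (ad A b y) (mu A b y)"
  have y': "y' \<in> car A" unfolding y'_def using b c by simp
  have e0: "emb d + emb b - emb b * emb d = 0"
    using arg_cong[OF b(2), of emb] b(1) dc by (simp add: emb_sub emb_add emb_mult emb_zero)
  have "sub A (ad A x' y') (mu A y' x') = sub A k (mu A b k)"
  proof (rule emb_inj)
    have "emb (sub A (ad A x' y') (mu A y' x')) - emb (sub A k (mu A b k)) = emb d + emb b - emb b * emb d"
      unfolding y'_def k_def d_def using b(1) c by (simp add: emb_sub emb_add emb_mult algebra_simps)
    then show "emb (sub A (ad A x' y') (mu A y' x')) = emb (sub A k (mu A b k))" unfolding e0 by simp
  qed (use b c y' dc in simp_all)
  moreover have "sub A k (mu A b k) \<in> K"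
    using ideal_sub[OF K _ ideal_mult(1)[OF K _ b(1)]] k unfolding k_def by simp
  ultimately show ?thesis unfolding lqi_def by (intro bexI[OF _ y']) simp
qed

lemma lqi_cong:
  assumes K: "ideal A K" and c: "x \<in> car A" "x' \<in> car A" and d: "sub A x' x \<in> K" and l: "lqi K x"
  shows "lqi K x'"
proof -
  obtain y where y: "y \<in> car A" "sub A (ad A x y) (mu A y x) \<in> K" using l by (auto simp: lqi_def)
  have "sub A (ad A x' y) (mu A y x') = ad A (sub A (ad A x y) (mu A y x)) (sub A (sub A x' x) (mu A y (sub A x' x)))"
    by (rule emb_inj) (use c y(1) in \<open>simp_all add: emb_sub emb_add emb_mult algebra_simps\<close>)
  also have "\<dots> \<in> K" by (intro ideal_add[OF K] ideal_sub[OF K] y(2) d ideal_mult(1)[OF K d y(1)])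
  finally show ?thesis using y(1) by (auto simp: lqi_def)
qed

text \<open>Automatic contractivity modulo the kernel. If \<open>nm A y < s\<close>, the Neumann
  series makes \<open>y^2 / s^2\<close> left quasi-invertible; as \<open>h\<close> and
  \<open>y\<close> agree modulo the kernel, so is \<open>h^2 / s^2\<close> modulo the kernel,
  against \<open>not_lqi_rep_ker\<close>. Letting \<open>y\<close> vary, the quotient norm dominates
  the operator norm.\<close>

theorem rep_opnrm_le_nm:
  assumes \<pi>: "star_rep A J \<pi>" and h: "h \<in> car A" "st A h = h" and y: "y \<in> car A" "sub A h y \<in> rep_ker A J \<pi>"
  shows "opnrm J (\<pi> h) \<le> nm A y"
proof (rule ccontr)
  note iK = rep_ker_ideal[OF \<pi>]
  define s where "s = opnrm J (\<pi> h)"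
  assume "\<not> ?thesis"
  then have s: "nm A y < s" "0 < s" unfolding s_def using nm_ge0[OF y(1)] by linarith+
  define c where "c = complex_of_real (1 / s\<^sup>2)"
  define w where "w = sm A c (mu A y y)"
  have w: "w \<in> car A" unfolding w_def using y by simp
  have "nm A w = (1 / s\<^sup>2) * nm A (mu A y y)"
    unfolding w_def c_def nm_scale[OF mu_in[OF y(1) y(1)]] norm_of_real by simp
  also have "\<dots> \<le> (1 / s\<^sup>2) * (nm A y * nm A y)" by (rule mult_left_mono[OF nm_mult[OF y(1) y(1)]]) simp
  also have "\<dots> < (1 / s\<^sup>2) * (s * s)"
    using s nm_ge0[OF y(1)] by (intro mult_strict_left_mono mult_strict_mono) auto
  also have "\<dots> = 1" using s by (simp add: power2_eq_square)
  finally obtain b where b: "b \<in> car A" "sub A (ad A w b) (mu A b w) = zer A" using B_Neumann[OF w] by auto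
  have l: "lqi (rep_ker A J \<pi>) w" unfolding lqi_def by (rule bexI[OF _ b(1)]) (use b(2) ideal_zero[OF iK] in simp)
  have x: "sm A c (mu A h h) \<in> car A" using h by simp
  have "sub A (sm A c (mu A h h)) w = sm A c (ad A (mu A (sub A h y) h) (mu A y (sub A h y)))"
    unfolding w_def
    by (rule emb_inj) (use h y(1) in \<open>simp_all add: emb_sub emb_add emb_mult emb_scale algebra_simps\<close>)
  also have "\<dots> \<in> rep_ker A J \<pi>"
    by (intro ideal_scale[OF iK] ideal_add[OF iK] ideal_mult[OF iK] y h)
  finally have "lqi (rep_ker A J \<pi>) (sm A c (mu A h h))" by (rule lqi_cong[OF iK w x _ l])
  then show False using not_lqi_rep_ker[OF \<pi> h] s unfolding c_def s_def by simp
qed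

text \<open>The bound uses \<open>st a * a\<close> because \<open>nm A (st A a)\<close> is not tied
  to \<open>nm A a\<close>; being independent of \<open>\<pi>\<close>, it makes the supremum in
  \<open>gamma\<close> finite.\<close>

lemma rep_opnrm_le:
  assumes \<pi>: "star_rep A J \<pi>" and a: "a \<in> car A"
  shows "opnrm J (\<pi> a) \<le> sqrt (nm A (mu A (st A a) a))"
proof -
  have h: "mu A (st A a) a \<in> car A" "st A (mu A (st A a) a) = mu A (st A a) a" using a by (simp_all add: star_mult star_star)
  have "sub A (mu A (st A a) a) (mu A (st A a) a) \<in> rep_ker A J \<pi>" using h ideal_zero[OF rep_ker_ideal[OF \<pi>]] by simp
  from rep_opnrm_le_nm[OF \<pi> h h(1) this] have "(opnrm J (\<pi> a))\<^sup>2 \<le> nm A (mu A (st A a) a)"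
    using rep_opnrm_star_mult[OF \<pi> a] by linarith
  then show ?thesis by (rule real_le_rsqrt)
qed

section \<open>The maximal C*-seminorm\<close>

text \<open>Keeps the supremum in \<open>gamma\<close> over a nonempty set.\<close>

lemma star_rep_zero: "star_rep A J (\<lambda>a f i. 0)"
  by (auto simp: star_rep_def bounded_op_def intro: exI[of _ 0])

lemma gamma_upper:
  assumes "star_rep A J \<pi>" "a \<in> car A" shows "opnrm J (\<pi> a) \<le> gamma A a"
  unfolding gamma_def
proof (rule cSup_upper)
  show "opnrm J (\<pi> a) \<in> {opnrm J (\<pi> a) | J \<pi>. star_rep A J \<pi>}" using assms by auto
  show "bdd_above {opnrm J (\<pi> a) | J \<pi>. star_rep A J \<pi>}"
  proof (rule bdd_aboveI[of _ "sqrt (nm A (mu A (st A a) a))"])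
    fix r assume "r \<in> {opnrm J (\<pi> a) | J \<pi>. star_rep A J \<pi>}"
    then obtain J \<pi> where "star_rep A J \<pi>" "r = opnrm J (\<pi> a)" by auto
    then show "r \<le> sqrt (nm A (mu A (st A a) a))" using rep_opnrm_le[OF _ assms(2)] by simp
  qed
qed

lemma gamma_least:
  assumes "\<And>J \<pi>. star_rep A J \<pi> \<Longrightarrow> opnrm J (\<pi> a) \<le> M" shows "gamma A a \<le> M"
  unfolding gamma_def
proof (rule cSup_least)
  show "{opnrm J (\<pi> a) | J \<pi>. star_rep A J \<pi>} \<noteq> {}" using star_rep_zero by blast
  fix r assume "r \<in> {opnrm J (\<pi> a) | J \<pi>. star_rep A J \<pi>}"
  then show "r \<le> M" using assms by auto
qed

lemma gamma_ge0: "a \<in> car A \<Longrightarrow> 0 \<le> gamma A a"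
  by (rule order_trans[OF rep_opnrm_ge0[OF star_rep_zero] gamma_upper[OF star_rep_zero]])

lemma gamma_add:
  assumes "a \<in> car A" "b \<in> car A" shows "gamma A (ad A a b) \<le> gamma A a + gamma A b"
  by (rule gamma_least)
    (rule order_trans[OF rep_opnrm_add[OF _ assms] add_mono[OF gamma_upper[OF _ assms(1)] gamma_upper[OF _ assms(2)]]])

lemma gamma_mult:
  assumes "a \<in> car A" "b \<in> car A" shows "gamma A (mu A a b) \<le> gamma A a * gamma A b"
proof (rule gamma_least)
  fix J \<pi> assume \<pi>: "star_rep A J \<pi>"
  have "opnrm J (\<pi> (mu A a b)) \<le> opnrm J (\<pi> a) * opnrm J (\<pi> b)" by (rule rep_opnrm_mult[OF \<pi> assms])
  also have "\<dots> \<le> gamma A a * gamma A b"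
    by (intro mult_mono gamma_upper[OF \<pi>] assms gamma_ge0 rep_opnrm_ge0[OF \<pi>])
  finally show "opnrm J (\<pi> (mu A a b)) \<le> gamma A a * gamma A b" .
qed

lemma gamma_scale: assumes "a \<in> car A" shows "gamma A (sm A c a) \<le> cmod c * gamma A a"
proof (rule gamma_least)
  fix J \<pi> assume \<pi>: "star_rep A J \<pi>"
  show "opnrm J (\<pi> (sm A c a)) \<le> cmod c * gamma A a"
    using rep_opnrm_scale_le[OF \<pi> assms, of c] mult_left_mono[OF gamma_upper[OF \<pi> assms], of "cmod c"] by simp
qed

lemma gamma_star: assumes "a \<in> car A" shows "gamma A (st A a) \<le> gamma A a"
proof (rule gamma_least)
  fix J \<pi> assume \<pi>: "star_rep A J \<pi>"
  show "opnrm J (\<pi> (st A a)) \<le> gamma A a"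
    using rep_opnrm_star_le[OF \<pi> star_in[OF assms]] gamma_upper[OF \<pi> assms] assms by (simp add: star_star)
qed

lemma gamma_zero: "gamma A (zer A) = 0"
proof (rule antisym[OF gamma_least gamma_ge0])
  show "opnrm J (\<pi> (zer A)) \<le> 0" if "star_rep A J \<pi>" for J \<pi> using rep_opnrm_zero[OF that] by simp
qed simp

lemma gamma_sub_commute: assumes "a \<in> car A" "b \<in> car A" shows "gamma A (sub A a b) = gamma A (sub A b a)"
proof (rule antisym)
  have le: "gamma A (sub A a b) \<le> gamma A (sub A b a)" if "a \<in> car A" "b \<in> car A" for a b
    unfolding sub_swap[OF that(2,1)] using gamma_scale[of "sub A b a" "-1"] that by simp
  show "gamma A (sub A a b) \<le> gamma A (sub A b a)" "gamma A (sub A b a) \<le> gamma A (sub A a b)"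
    by (rule le[OF assms], rule le[OF assms(2,1)])
qed

lemma gamma_triangle: 
  assumes "a \<in> car A" "b \<in> car A" "c \<in> car A" shows "gamma A (sub A a c) \<le> gamma A (sub A a b) + gamma A (sub A b c)"
  using gamma_add[of "sub A a b" "sub A b c"] sub_trans[OF assms] assms by simp

text \<open>For \<open>h = st y * y\<close>, the difference of \<open>h\<close> and
  \<open>st y * (y - x n)\<close> is \<open>st y * x n\<close>, which lies in the kernel;
  contractivity modulo the kernel bounds the norm of \<open>\<pi> h\<close> by
  \<open>nm (st y) * nm (y - x n)\<close>, hence by 0.\<close>

lemma rep_ker_closed:
  assumes \<pi>: "star_rep A J \<pi>" and x: "\<And>n. x n \<in> rep_ker A J \<pi>" and y: "y \<in> car A" and l: "nconv A x y"
  shows "y \<in> rep_ker A J \<pi>"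
proof -
  note iK = rep_ker_ideal[OF \<pi>]
  have xc: "x n \<in> car A" for n using ideal_subset[OF iK x] .
  define h where "h = mu A (st A y) y"
  have h: "h \<in> car A" "st A h = h" unfolding h_def using y by (simp_all add: star_mult star_star)
  have "opnrm J (\<pi> h) \<le> nm A (st A y) * nm A (sub A (x n) y)" for n
  proof -
    define z where "z = mu A (st A y) (sub A y (x n))"
    have z: "z \<in> car A" unfolding z_def using y xc by simp
    have "sub A h z = mu A (st A y) (x n)"
      unfolding h_def z_def by (rule emb_inj) (use y xc in \<open>simp_all add: emb_sub emb_mult algebra_simps\<close>)
    also have "\<dots> \<in> rep_ker A J \<pi>" by (rule ideal_mult(1)[OF iK x]) (use y in simp)
    finally have "opnrm J (\<pi> h) \<le> nm A z" by (rule rep_opnrm_le_nm[OF \<pi> h z])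
    also have "\<dots> \<le> nm A (st A y) * nm A (sub A y (x n))" unfolding z_def by (rule nm_mult) (use y xc in simp_all)
    finally show ?thesis using nm_sub_commute[OF y xc] by simp
  qed
  moreover have "(\<lambda>n. nm A (st A y) * nm A (sub A (x n) y)) \<longlonglongrightarrow> 0"
    by (rule tendsto_mult_right_zero[OF l[unfolded nconv_def]])
  ultimately have "(\<lambda>n::nat. opnrm J (\<pi> h)) \<longlonglongrightarrow> 0"
    by (rule squeeze_null[OF _ rep_opnrm_ge0[OF \<pi> h(1)]])
  then have "opnrm J (\<pi> h) = 0" by (simp only: LIMSEQ_const_iff)
  then have "h \<in> rep_ker A J \<pi>" using h(1) by (simp add: rep_ker_iff[OF \<pi>])
  then show ?thesis unfolding h_def by (rule rep_ker_star_mult[OF \<pi> y])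
qed

section \<open>The C*-envelope\<close>

text \<open>Stated for a general filter, so that the same lemmas serve both equality of classes
  (\<open>sequentially\<close>) and the Cauchy condition (pairs of indices with the product
  filter).\<close>

definition close :: "'i filter \<Rightarrow> ('i \<Rightarrow> 'a) \<Rightarrow> ('i \<Rightarrow> 'a) \<Rightarrow> bool" where
  "close F a b \<longleftrightarrow> ((\<lambda>i. gamma A (sub A (a i) (b i))) \<longlongrightarrow> 0) F"

lemma close_refl: "(\<And>i. a i \<in> car A) \<Longrightarrow> close F a a"
  by (simp add: close_def gamma_zero)

context
  fixes F :: "'i filter" and a a' b b' :: "'i \<Rightarrow> 'a"
  assumes c: "\<And>i. a i \<in> car A" "\<And>i. a' i \<in> car A" "\<And>i. b i \<in> car A" "\<And>i. b' i \<in> car A"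
begin

lemma close_trans: assumes "close F a a'" "close F a' b" shows "close F a b"
  unfolding close_def
  by (rule squeeze_null[OF gamma_triangle gamma_ge0 tendsto_add_zero[OF assms[unfolded close_def]]]) (use c in simp_all)

lemma close_sym: assumes "close F a b" shows "close F b a"
proof -
  have "gamma A (sub A (b i) (a i)) = gamma A (sub A (a i) (b i))" for i by (rule gamma_sub_commute[OF c(3,1)])
  then show ?thesis using assms unfolding close_def by simp
qed

lemma close_add: assumes "close F a a'" "close F b b'" shows "close F (\<lambda>i. ad A (a i) (b i)) (\<lambda>i. ad A (a' i) (b' i))"
  unfolding close_def sub_add_add[OF c(1,3,2,4)]
  by (rule squeeze_null[OF gamma_add gamma_ge0 tendsto_add_zero[OF assms[unfolded close_def]]]) (use c in simp_all)

lemma close_scale: assumes "close F a a'" shows "close F (\<lambda>i. sm A k (a i)) (\<lambda>i. sm A k (a' i))"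
  unfolding close_def sub_scale[OF c(1,2)]
  by (rule squeeze_null[OF gamma_scale gamma_ge0 tendsto_mult_right_zero[OF assms[unfolded close_def]]]) (use c in simp_all)

lemma close_star: assumes "close F a a'" shows "close F (\<lambda>i. st A (a i)) (\<lambda>i. st A (a' i))"
  unfolding close_def star_sub[OF c(1,2), symmetric]
  by (rule squeeze_null[OF gamma_star gamma_ge0 assms[unfolded close_def]]) (use c in simp_all)

lemma close_mult:
  assumes "close F a a'" "close F b b'" and B: "\<And>i. gamma A (a i) \<le> B" "\<And>i. gamma A (b' i) \<le> B'"
  shows "close F (\<lambda>i. mu A (a i) (b i)) (\<lambda>i. mu A (a' i) (b' i))"
  unfolding close_def
proof (rule squeeze_null)
  fix i
  have "sub A (mu A (a i) (b i)) (mu A (a' i) (b' i)) = ad A (mu A (a i) (sub A (b i) (b' i))) (mu A (sub A (a i) (a' i)) (b' i))"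
    by (rule emb_inj) (use c in \<open>simp_all add: emb_sub emb_add emb_mult algebra_simps\<close>)
  then have "gamma A (sub A (mu A (a i) (b i)) (mu A (a' i) (b' i))) \<le>
      gamma A (mu A (a i) (sub A (b i) (b' i))) + gamma A (mu A (sub A (a i) (a' i)) (b' i))"
    using c by (simp add: gamma_add)
  also have "\<dots> \<le> gamma A (a i) * gamma A (sub A (b i) (b' i)) + gamma A (sub A (a i) (a' i)) * gamma A (b' i)"
    using c by (intro add_mono gamma_mult) simp_all
  also have "\<dots> \<le> B * gamma A (sub A (b i) (b' i)) + gamma A (sub A (a i) (a' i)) * B'"
    using c B by (intro add_mono mult_right_mono mult_left_mono gamma_ge0) simp_all
  finally show "gamma A (sub A (mu A (a i) (b i)) (mu A (a' i) (b' i))) \<le>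
      B * gamma A (sub A (b i) (b' i)) + gamma A (sub A (a i) (a' i)) * B'" .
  show "0 \<le> gamma A (sub A (mu A (a i) (b i)) (mu A (a' i) (b' i)))" using c by (intro gamma_ge0) simp
next
  show "((\<lambda>i. B * gamma A (sub A (b i) (b' i)) + gamma A (sub A (a i) (a' i)) * B') \<longlongrightarrow> 0) F"
    by (intro tendsto_add_zero tendsto_mult_right_zero tendsto_mult_left_zero assms[unfolded close_def])
qed

end

section \<open>Cauchy sequences and the operations of the envelope\<close>

lemma gcauchy_iff: "gcauchy A x \<longleftrightarrow> (\<forall>n. x n \<in> car A) \<and>
    close (sequentially \<times>\<^sub>F sequentially) (\<lambda>p. x (fst p)) (\<lambda>p. x (snd p))"
proof (cases "\<forall>n. x n \<in> car A")
  case True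
  then have g0: "0 \<le> gamma A (sub A (x m) (x n))" for m n by (simp add: gamma_ge0)
  have s: "gamma A (sub A (x m) (x n)) = gamma A (sub A (x n) (x m))" for m n using True by (simp add: gamma_sub_commute)
  show ?thesis
    unfolding gcauchy_def close_def tendsto_iff eventually_prod_sequentially dist_real_def fst_conv snd_conv
    using True g0 s by (auto simp: abs_of_nonneg)
qed (auto simp: gcauchy_def)

lemma gcauchy_car [simp]: "gcauchy A x \<Longrightarrow> x n \<in> car A" by (simp add: gcauchy_def)

lemma gcauchy_close: "gcauchy A x \<Longrightarrow> close (sequentially \<times>\<^sub>F sequentially) (\<lambda>p. x (fst p)) (\<lambda>p. x (snd p))"
  by (simp add: gcauchy_iff)

text \<open>The hypothesis on \<open>q\<close> covers \<open>gamma\<close> itself as well as the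
  operator norm in a single representation.\<close>

lemma gcauchy_seminorm_convergent:
  fixes q :: "'a \<Rightarrow> real"
  assumes x: "gcauchy A x" and q: "\<And>a b. a \<in> car A \<Longrightarrow> b \<in> car A \<Longrightarrow> q a \<le> gamma A (sub A a b) + q b"
  shows "\<exists>l. (\<lambda>n. q (x n)) \<longlonglongrightarrow> l"
proof -
  have "Cauchy (\<lambda>n. q (x n))"
    unfolding Cauchy_def dist_real_def
  proof (intro allI impI)
    fix e :: real assume "e > 0"
    then obtain N where N: "\<forall>m\<ge>N. \<forall>n\<ge>N. gamma A (sub A (x m) (x n)) < e" using x unfolding gcauchy_def by blast
    have "\<bar>q (x m) - q (x n)\<bar> < e" if "m \<ge> N" "n \<ge> N" for m n
      using N[rule_format, OF that] N[rule_format, OF that(2,1)] q[of "x m" "x n"] q[of "x n" "x m"] x by (simp add: abs_less_iff)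
    then show "\<exists>M. \<forall>m\<ge>M. \<forall>n\<ge>M. \<bar>q (x m) - q (x n)\<bar> < e" by blast
  qed
  then show ?thesis by (simp add: Cauchy_convergent_iff convergent_def)
qed

lemma gcauchy_bounded: assumes x: "gcauchy A x" obtains B where "\<And>n. gamma A (x n) \<le> B"
proof -
  have "gamma A a \<le> gamma A (sub A a b) + gamma A b" if "a \<in> car A" "b \<in> car A" for a b
    using gamma_add[of "sub A a b" b] that by simp
  then obtain l where "(\<lambda>n. gamma A (x n)) \<longlonglongrightarrow> l" using gcauchy_seminorm_convergent[OF x, of "gamma A"] by auto
  then have "Bseq (\<lambda>n. gamma A (x n))" by (intro convergent_imp_Bseq convergentI)
  then obtain K where "\<forall>n. norm (gamma A (x n)) \<le> K" by (auto simp: Bseq_def)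
  then have "gamma A (x n) \<le> K" for n using abs_le_D1[of "gamma A (x n)" K] by simp
  then show thesis by (rule that)
qed

lemma gcauchy_const [simp]: "a \<in> car A \<Longrightarrow> gcauchy A (\<lambda>n. a)"
  by (simp add: gcauchy_def gamma_zero)

lemma gcauchy_add [simp]: "gcauchy A x \<Longrightarrow> gcauchy A y \<Longrightarrow> gcauchy A (\<lambda>n. ad A (x n) (y n))"
  unfolding gcauchy_iff[of "\<lambda>n. ad A (x n) (y n)"] by (intro conjI close_add gcauchy_close) simp_all

lemma gcauchy_scale [simp]: "gcauchy A x \<Longrightarrow> gcauchy A (\<lambda>n. sm A c (x n))"
  unfolding gcauchy_iff[of "\<lambda>n. sm A c (x n)"]
  by (intro conjI close_scale[where b = "\<lambda>_. zer A" and b' = "\<lambda>_. zer A"] gcauchy_close) simp_all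

lemma gcauchy_star [simp]: "gcauchy A x \<Longrightarrow> gcauchy A (\<lambda>n. st A (x n))"
  unfolding gcauchy_iff[of "\<lambda>n. st A (x n)"]
  by (intro conjI close_star[where b = "\<lambda>_. zer A" and b' = "\<lambda>_. zer A"] gcauchy_close) simp_all

lemma gcauchy_mult [simp]: assumes x: "gcauchy A x" and y: "gcauchy A y" shows "gcauchy A (\<lambda>n. mu A (x n) (y n))"
proof -
  obtain B where B: "\<And>n. gamma A (x n) \<le> B" using gcauchy_bounded[OF x] by auto
  obtain B' where B': "\<And>n. gamma A (y n) \<le> B'" using gcauchy_bounded[OF y] by auto
  show ?thesis
    unfolding gcauchy_iff[of "\<lambda>n. mu A (x n) (y n)"]
    by (intro conjI close_mult[OF _ _ _ _ gcauchy_close[OF x] gcauchy_close[OF y] B B']) (use x y in simp_all)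
qed

lemma gcauchy_sub [simp]: "gcauchy A x \<Longrightarrow> gcauchy A y \<Longrightarrow> gcauchy A (\<lambda>n. sub A (x n) (y n))"
  unfolding sub_def by simp

lemma gcls_iff: "gcauchy A x \<Longrightarrow> y \<in> gcls A x \<longleftrightarrow> gcauchy A y \<and> close sequentially x y"
  by (simp add: gcls_def close_def)

lemma gcls_self: "gcauchy A x \<Longrightarrow> x \<in> gcls A x"
  by (simp add: gcls_iff close_refl)

lemma gcls_eqI:
  assumes x: "gcauchy A x" and y: "gcauchy A y" and xy: "close sequentially x y"
  shows "gcls A x = gcls A y"
proof -
  have yx: "close sequentially y x" by (rule close_sym[where a' = x and b' = x, OF _ _ _ _ xy]) (use x y in simp_all)
  have "close sequentially x w \<longleftrightarrow> close sequentially y w" if w: "gcauchy A w" for w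
  proof
    show "close sequentially y w" if "close sequentially x w"
      by (rule close_trans[where b' = x, OF _ _ _ _ yx that]) (use x y w in simp_all)
    show "close sequentially x w" if "close sequentially y w"
      by (rule close_trans[where b' = x, OF _ _ _ _ xy that]) (use x y w in simp_all)
  qed
  then show ?thesis using gcls_iff[OF x] gcls_iff[OF y] by blast
qed

lemma grep_gcls: assumes x: "gcauchy A x" shows "gcauchy A (grep (gcls A x))" "close sequentially (grep (gcls A x)) x"
proof -
  have "grep (gcls A x) \<in> gcls A x" unfolding grep_def by (rule someI[where P = "\<lambda>y. y \<in> gcls A x", OF gcls_self[OF x]])
  then have g: "gcauchy A (grep (gcls A x))" "close sequentially x (grep (gcls A x))" using gcls_iff[OF x] by auto
  show "gcauchy A (grep (gcls A x))" by (rule g)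
  show "close sequentially (grep (gcls A x)) x"
    by (rule close_sym[where a' = x and b' = x, OF _ _ _ _ g(2)]) (use x g(1) in simp_all)
qed

lemma gcls_in [simp]: "gcauchy A x \<Longrightarrow> gcls A x \<in> car (Cstar A)"
  by (auto simp: Cstar_def)

lemma Cstar_cases: assumes "X \<in> car (Cstar A)" obtains x where "gcauchy A x" "X = gcls A x"
  using assms by (auto simp: Cstar_def)

lemma Cstar_ball: "(\<forall>X\<in>car (Cstar A). P X) \<longleftrightarrow> (\<forall>x. gcauchy A x \<longrightarrow> P (gcls A x))"
  by (auto simp: Cstar_def)

lemma Cstar_zero: "zer (Cstar A) = gcls A (\<lambda>n. zer A)"
  by (simp add: Cstar_def)

lemma Cstar_add [simp]: assumes x: "gcauchy A x" and y: "gcauchy A y"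
  shows "ad (Cstar A) (gcls A x) (gcls A y) = gcls A (\<lambda>n. ad A (x n) (y n))"
proof -
  note g = grep_gcls[OF x] grep_gcls[OF y]
  have "gcls A (\<lambda>n. ad A (grep (gcls A x) n) (grep (gcls A y) n)) = gcls A (\<lambda>n. ad A (x n) (y n))"
    by (rule gcls_eqI[OF _ _ close_add[OF _ _ _ _ g(2,4)]]) (use x y g in simp_all)
  then show ?thesis by (simp add: Cstar_def)
qed

lemma Cstar_scale [simp]: assumes x: "gcauchy A x"
  shows "sm (Cstar A) c (gcls A x) = gcls A (\<lambda>n. sm A c (x n))"
proof -
  note g = grep_gcls[OF x]
  have "gcls A (\<lambda>n. sm A c (grep (gcls A x) n)) = gcls A (\<lambda>n. sm A c (x n))"
    by (rule gcls_eqI[OF _ _ close_scale[where b = x and b' = x, OF _ _ _ _ g(2)]]) (use x g in simp_all)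
  then show ?thesis by (simp add: Cstar_def)
qed

lemma Cstar_mult [simp]: assumes x: "gcauchy A x" and y: "gcauchy A y"
  shows "mu (Cstar A) (gcls A x) (gcls A y) = gcls A (\<lambda>n. mu A (x n) (y n))"
proof -
  note g = grep_gcls[OF x] grep_gcls[OF y]
  obtain B where B: "\<And>n. gamma A (grep (gcls A x) n) \<le> B" using gcauchy_bounded[OF g(1)] by auto
  obtain B' where B': "\<And>n. gamma A (y n) \<le> B'" using gcauchy_bounded[OF y] by auto
  have "gcls A (\<lambda>n. mu A (grep (gcls A x) n) (grep (gcls A y) n)) = gcls A (\<lambda>n. mu A (x n) (y n))"
    by (rule gcls_eqI[OF _ _ close_mult[OF _ _ _ _ g(2,4) B B']]) (use x y g in simp_all)
  then show ?thesis by (simp add: Cstar_def)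
qed

lemma Cstar_sub [simp]: "gcauchy A x \<Longrightarrow> gcauchy A y \<Longrightarrow> sub (Cstar A) (gcls A x) (gcls A y) = gcls A (\<lambda>n. sub A (x n) (y n))"
  by (simp add: sub_def)

lemma Cstar_alg_ax: "alg_ax (Cstar A)"
proof -
  have inv: "\<exists>Y\<in>car (Cstar A). ad (Cstar A) (gcls A x) Y = zer (Cstar A)" if x: "gcauchy A x" for x
    by (rule bexI[of _ "gcls A (\<lambda>n. sm A (-1) (x n))"]) (use x in \<open>simp_all add: Cstar_zero right_inverse\<close>)
  have com: "gcls A (\<lambda>n. ad A (x n) (y n)) = gcls A (\<lambda>n. ad A (y n) (x n))"
    if "gcauchy A x" "gcauchy A y" for x y
  proof -
    have "ad A (x n) (y n) = ad A (y n) (x n)" for n by (rule comm) (use that in simp_all)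
    then show ?thesis by simp
  qed
  show ?thesis
    unfolding alg_ax_def cvs_def Cstar_ball
    by (intro conjI allI impI)
      (simp_all add: Cstar_zero[symmetric] inv assoc scale_add add_scale scale_scale mu_assoc mu_add_left mu_add_right mu_scale_left mu_scale_right,
       (simp_all add: Cstar_zero)?, (rule com, assumption+)?)
qed

sublocale C: calg "Cstar A"
  by unfold_locales (rule Cstar_alg_ax)

text \<open>The kernel of the extension of a *-representation to the C*-envelope.\<close>
definition Cker :: "'a set \<Rightarrow> ('a \<Rightarrow> ('a \<Rightarrow> complex) \<Rightarrow> ('a \<Rightarrow> complex)) \<Rightarrow> (nat \<Rightarrow> 'a) set set" where
  "Cker J \<pi> = {gcls A x | x. gcauchy A x \<and> (\<lambda>n. opnrm J (\<pi> (x n))) \<longlonglongrightarrow> 0}"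

context
  fixes J :: "'a set" and \<pi>
  assumes \<pi>: "star_rep A J \<pi>"
begin

lemma opnrm_gamma_diff:
  "a \<in> car A \<Longrightarrow> b \<in> car A \<Longrightarrow> opnrm J (\<pi> a) \<le> gamma A (sub A a b) + opnrm J (\<pi> b)"
  using rep_opnrm_diff[OF \<pi>, of a b] gamma_upper[OF \<pi>, of "sub A a b"] by simp

lemma Cker_iff: assumes x: "gcauchy A x" shows "gcls A x \<in> Cker J \<pi> \<longleftrightarrow> (\<lambda>n. opnrm J (\<pi> (x n))) \<longlonglongrightarrow> 0"
proof
  assume "gcls A x \<in> Cker J \<pi>"
  then obtain y where y: "gcls A x = gcls A y" "gcauchy A y" "(\<lambda>n. opnrm J (\<pi> (y n))) \<longlonglongrightarrow> 0" by (auto simp: Cker_def)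
  then have "close sequentially x y" using gcls_self[OF y(2)] gcls_iff[OF x] by auto
  then show "(\<lambda>n. opnrm J (\<pi> (x n))) \<longlonglongrightarrow> 0"
    by (intro squeeze_null[OF opnrm_gamma_diff rep_opnrm_ge0[OF \<pi>] tendsto_add_zero[OF _ y(3)]])
      (use x y(2) in \<open>simp_all add: close_def\<close>)
qed (use x in \<open>auto simp: Cker_def\<close>)

lemma Cker_ideal: "ideal (Cstar A) (Cker J \<pi>)"
  unfolding ideal_def
proof (intro conjI ballI allI)
  show "Cker J \<pi> \<subseteq> car (Cstar A)" by (auto simp: Cker_def)
  show "zer (Cstar A) \<in> Cker J \<pi>" unfolding Cstar_zero Cker_iff[OF gcauchy_const[OF closed(1)]] rep_opnrm_zero[OF \<pi>] by simp
  fix X assume "X \<in> Cker J \<pi>"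
  then obtain x where x: "X = gcls A x" "gcauchy A x" "(\<lambda>n. opnrm J (\<pi> (x n))) \<longlonglongrightarrow> 0" by (auto simp: Cker_def)
  { fix Y assume "Y \<in> Cker J \<pi>"
    then obtain y where y: "Y = gcls A y" "gcauchy A y" "(\<lambda>n. opnrm J (\<pi> (y n))) \<longlonglongrightarrow> 0" by (auto simp: Cker_def)
    show "ad (Cstar A) X Y \<in> Cker J \<pi>"
      unfolding x(1) y(1) Cstar_add[OF x(2) y(2)] Cker_iff[OF gcauchy_add[OF x(2) y(2)]]
      by (rule squeeze_null[OF rep_opnrm_add[OF \<pi>] rep_opnrm_ge0[OF \<pi>] tendsto_add_zero[OF x(3) y(3)]]) (use x y in simp_all) }
  { fix c show "sm (Cstar A) c X \<in> Cker J \<pi>"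
      unfolding x(1) Cstar_scale[OF x(2)] Cker_iff[OF gcauchy_scale[OF x(2)]]
      by (rule squeeze_null[OF rep_opnrm_scale_le[OF \<pi>] rep_opnrm_ge0[OF \<pi>] tendsto_mult_right_zero[OF x(3)]]) (use x in simp_all) }
  { fix Y assume "Y \<in> car (Cstar A)"
    then obtain y where y: "gcauchy A y" "Y = gcls A y" by (rule Cstar_cases)
    obtain B where B: "\<And>n. gamma A (y n) \<le> B" using gcauchy_bounded[OF y(1)] by auto
    have B': "opnrm J (\<pi> (y n)) \<le> B" for n using gamma_upper[OF \<pi> gcauchy_car[OF y(1)], of n] B[of n] by simp
    have n0: "0 \<le> opnrm J (\<pi> (x n))" "x n \<in> car A" "y n \<in> car A" for n using rep_opnrm_ge0[OF \<pi>] x y by simp_all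
    have "opnrm J (\<pi> (mu A (y n) (x n))) \<le> B * opnrm J (\<pi> (x n))" for n
      using rep_opnrm_mult[OF \<pi> n0(3) n0(2), of n n] mult_right_mono[OF B'[of n] n0(1)[of n]] by simp
    then show "mu (Cstar A) Y X \<in> Cker J \<pi>"
      unfolding x(1) y(2) Cstar_mult[OF y(1) x(2)] Cker_iff[OF gcauchy_mult[OF y(1) x(2)]]
      by (rule squeeze_null[OF _ rep_opnrm_ge0[OF \<pi>] tendsto_mult_right_zero[OF x(3)]]) (use n0 in simp)
    have "opnrm J (\<pi> (mu A (x n) (y n))) \<le> B * opnrm J (\<pi> (x n))" for n
      using rep_opnrm_mult[OF \<pi> n0(2) n0(3), of n n] mult_right_mono[OF B'[of n] n0(1)[of n]] by (simp add: mult.commute)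
    then show "mu (Cstar A) X Y \<in> Cker J \<pi>"
      unfolding x(1) y(2) Cstar_mult[OF x(2) y(1)] Cker_iff[OF gcauchy_mult[OF x(2) y(1)]]
      by (rule squeeze_null[OF _ rep_opnrm_ge0[OF \<pi>] tendsto_mult_right_zero[OF x(3)]]) (use n0 in simp) }
qed

text \<open>The argument of \<open>rep_ker_eq_Inter_Prim\<close> for classes of sequences. Here
  \<open>t\<close> is only the limit of the norms of \<open>\<pi> (h n)\<close>; this is why
  \<open>quasi_inverse_remainder_ge\<close> keeps \<open>t\<close> apart from the norm and allows a
  remainder: both errors tend to 0.\<close>

theorem Cker_eq_Inter_Prim:
  assumes x: "gcauchy A x" and n: "gcls A x \<notin> Cker J \<pi>"
  shows "\<exists>Q\<in>Prim (Cstar A). Cker J \<pi> \<subseteq> Q \<and> gcls A x \<notin> Q"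
proof -
  define h where "h n = mu A (st A (x n)) (x n)" for n
  have h: "gcauchy A h" unfolding h_def using x by simp
  have hs: "h n \<in> car A" "st A (h n) = h n" for n unfolding h_def using x by (simp_all add: star_mult star_star)
  obtain t where t: "(\<lambda>n. opnrm J (\<pi> (h n))) \<longlonglongrightarrow> t"
    using gcauchy_seminorm_convergent[OF h, of "\<lambda>a. opnrm J (\<pi> a)"] opnrm_gamma_diff by auto
  have "0 \<le> t" by (rule LIMSEQ_le_const[OF t]) (use rep_opnrm_ge0[OF \<pi> hs(1)] in auto)
  moreover have "t \<noteq> 0"
  proof
    assume "t = 0"
    then have "(\<lambda>n. (opnrm J (\<pi> (x n)))\<^sup>2) \<longlonglongrightarrow> 0"
      using t unfolding h_def by (intro squeeze_null[OF rep_opnrm_star_mult[OF \<pi>]]) (use x in simp_all)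
    from tendsto_real_sqrt[OF this] have "(\<lambda>n. opnrm J (\<pi> (x n))) \<longlonglongrightarrow> 0"
      using rep_opnrm_ge0[OF \<pi> gcauchy_car[OF x]] by simp
    then show False using n Cker_iff[OF x] by simp
  qed
  ultimately have t0: "0 < t" by simp
  define z where "z n = sm A (of_real (1 / t\<^sup>2)) (mu A (h n) (h n))" for n
  have z: "gcauchy A z" unfolding z_def using h by simp
  have "\<not> C.lqi (Cker J \<pi>) (gcls A z)"
  proof
    assume "C.lqi (Cker J \<pi>) (gcls A z)"
    then obtain Y where Y: "Y \<in> car (Cstar A)" "sub (Cstar A) (ad (Cstar A) (gcls A z) Y) (mu (Cstar A) Y (gcls A z)) \<in> Cker J \<pi>"
      by (auto simp: C.lqi_def)
    obtain y where y: "gcauchy A y" "Y = gcls A y" using Y(1) by (rule Cstar_cases)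
    define k where "k n = sub A (ad A (z n) (y n)) (mu A (y n) (z n))" for n
    have k: "gcauchy A k" unfolding k_def using z y by simp
    have "gcls A k \<in> Cker J \<pi>" using Y(2) z y(1) unfolding y(2) k_def by simp
    then have k0: "(\<lambda>n. opnrm J (\<pi> (k n))) \<longlonglongrightarrow> 0" using Cker_iff[OF k] by simp
    obtain B where B: "\<And>n. gamma A (y n) \<le> B" using gcauchy_bounded[OF y(1)] by auto
    have "\<forall>\<^sub>F n in sequentially. 0 < opnrm J (\<pi> (h n))" by (rule order_tendstoD(1)[OF t t0])
    then have "\<forall>\<^sub>F n in sequentially. 1 \<le> (1 + B) * \<bar>1 - (opnrm J (\<pi> (h n)))\<^sup>2 / t\<^sup>2\<bar> + opnrm J (\<pi> (k n))"
    proof (rule eventually_mono)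
      fix n assume p: "0 < opnrm J (\<pi> (h n))"
      have yc: "y n \<in> car A" using y by simp
      have "1 \<le> (1 + opnrm J (\<pi> (y n))) * \<bar>1 - (opnrm J (\<pi> (h n)))\<^sup>2 / t\<^sup>2\<bar> + opnrm J (\<pi> (k n))"
        unfolding k_def z_def by (rule quasi_inverse_remainder_ge[OF \<pi> hs p t0 yc])
      also have "\<dots> \<le> (1 + B) * \<bar>1 - (opnrm J (\<pi> (h n)))\<^sup>2 / t\<^sup>2\<bar> + opnrm J (\<pi> (k n))"
        using B[of n] gamma_upper[OF \<pi> yc] by (intro add_mono mult_right_mono) auto
      finally show "1 \<le> (1 + B) * \<bar>1 - (opnrm J (\<pi> (h n)))\<^sup>2 / t\<^sup>2\<bar> + opnrm J (\<pi> (k n))" .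
    qed
    moreover have "(\<lambda>n. (1 + B) * \<bar>1 - (opnrm J (\<pi> (h n)))\<^sup>2 / t\<^sup>2\<bar> + opnrm J (\<pi> (k n))) \<longlonglongrightarrow> (1 + B) * \<bar>1 - t\<^sup>2 / t\<^sup>2\<bar> + 0"
      using t0 by (intro tendsto_intros t k0) simp
    ultimately have "1 \<le> (1 + B) * \<bar>1 - t\<^sup>2 / t\<^sup>2\<bar> + 0"
      by (intro tendsto_lowerbound[OF _ _ sequentially_bot])
    then show False using t0 by simp
  qed
  from C.ex_Prim_not_lqi[OF Cker_ideal gcls_in[OF z] this]
  obtain Q where Q: "Q \<in> Prim (Cstar A)" "Cker J \<pi> \<subseteq> Q" "gcls A z \<notin> Q" by auto
  note iQ = prime_idealD(1)[OF C.Prim_prime[OF Q(1)]]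
  have "gcls A x \<notin> Q"
  proof
    assume xQ: "gcls A x \<in> Q"
    have "gcls A h \<in> Q" using C.ideal_mult(1)[OF iQ xQ, of "gcls A (\<lambda>n. st A (x n))"] x unfolding h_def by simp
    then have "mu (Cstar A) (gcls A h) (gcls A h) \<in> Q" by (rule C.ideal_mult(1)[OF iQ]) (use h in simp)
    then have "sm (Cstar A) (of_real (1 / t\<^sup>2)) (mu (Cstar A) (gcls A h) (gcls A h)) \<in> Q" by (rule C.ideal_scale[OF iQ])
    then have "gcls A z \<in> Q" using h unfolding z_def by simp
    then show False using Q by simp
  qed
  then show ?thesis using Q by auto
qed

lemma cembed_in_Cker: "a \<in> car A \<Longrightarrow> cembed A a \<in> Cker J \<pi> \<longleftrightarrow> a \<in> rep_ker A J \<pi>"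
  unfolding cembed_def Cker_iff[OF gcauchy_const] rep_ker_iff[OF \<pi>] by (simp add: LIMSEQ_const_iff)

end

end

section \<open>*-Regularity\<close>

text \<open>Approximate within \<open>e / 2\<close> and drop the constant term, which is itself
  below \<open>e / 2\<close> because \<open>\<phi> 0 = 0\<close>. The missing constant term lets the
  polynomial be evaluated in \<open>A\<close>.\<close>

lemma real_poly_approx:
  fixes \<phi> :: "real \<Rightarrow> real"
  assumes c: "continuous_on {-M..M} \<phi>" and z: "\<phi> 0 = 0" and M: "0 \<le> M" and e: "0 < e"
  shows "\<exists>q. \<forall>x. \<bar>x\<bar> \<le> M \<longrightarrow> \<bar>\<phi> x - poly (pCons 0 q) x\<bar> \<le> e"
proof -
  obtain g where g: "real_polynomial_function g" "\<And>x. x \<in> {-M..M} \<Longrightarrow> \<bar>\<phi> x - g x\<bar> < e / 2"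
    using Stone_Weierstrass_real_polynomial_function[OF compact_Icc c, of "e / 2"] e by auto
  obtain a n where a: "g = (\<lambda>x. \<Sum>i\<le>n. a i * x ^ i)" using g(1) by (auto simp: real_polynomial_function_iff_sum)
  obtain b q where bq: "(\<Sum>i\<le>n. monom (a i) i) = pCons b q" by (metis pCons_cases)
  have gp: "g x = b + x * poly q x" for x
    using arg_cong[OF bq, of "\<lambda>p. poly p x"] by (simp add: a poly_sum poly_monom)
  have "\<bar>\<phi> x - poly (pCons 0 q) x\<bar> \<le> e" if "\<bar>x\<bar> \<le> M" for x
  proof -
    have "\<bar>\<phi> x - g x\<bar> < e / 2" "\<bar>\<phi> 0 - g 0\<bar> < e / 2"
      by (rule g(2), use that M in \<open>simp add: abs_le_iff\<close>)+
    moreover have "g x = b + x * poly q x" "g 0 = b" using gp[of x] gp[of 0] by simp_all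
    ultimately show ?thesis using z unfolding poly_pCons by linarith
  qed
  then show ?thesis by auto
qed

lemma opnrm_cong: "(\<And>f. f \<in> l2 J \<Longrightarrow> T f = S f) \<Longrightarrow> opnrm J T = opnrm J S"
  unfolding opnrm_def by (rule arg_cong[where f = Sup]) (rule Collect_cong, metis)

lemma poly_op_of_real_diff:
  "poly_op (map_poly complex_of_real (p - q)) T f =
     (\<lambda>i. poly_op (map_poly complex_of_real p) T f i - poly_op (map_poly complex_of_real q) T f i)"
proof -
  have "map_poly complex_of_real (p - q) = map_poly complex_of_real p + smult (-1) (map_poly complex_of_real q)"
    by (rule poly_eqI) (simp add: coeff_map_poly)
  then show ?thesis by (simp only: poly_op_add poly_op_smult) simp
qed

locale bstar_reg = bstar_herm +
  assumes reg: "star_regular A"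
begin

text \<open>What is drawn from the homeomorphism: it is a bijection, and being a closed map it sends
  the hull of \<open>Z\<close> to a hull-kernel closed set.\<close>

lemma Prim_star_homeo:
  defines "\<phi> \<equiv> \<lambda>Q. {a \<in> car A. cembed A a \<in> Q}"
  shows "Q \<in> Prim (Cstar A) \<Longrightarrow> \<phi> Q \<in> Prim_star A"
    "P \<in> Prim_star A \<Longrightarrow> \<exists>Q\<in>Prim (Cstar A). P = \<phi> Q"
    "Q \<in> Prim (Cstar A) \<Longrightarrow> Q' \<in> Prim (Cstar A) \<Longrightarrow> \<phi> Q = \<phi> Q' \<Longrightarrow> Q = Q'"
    "P \<in> Prim_star A \<Longrightarrow> \<Inter>(\<phi> ` {Q \<in> Prim (Cstar A). Z \<subseteq> Q}) \<subseteq> P \<Longrightarrow> \<exists>Q\<in>Prim (Cstar A). Z \<subseteq> Q \<and> P = \<phi> Q"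
proof -
  have C: "\<forall>P\<in>Prim (Cstar A). prime_ideal (Cstar A) P" by (intro ballI C.Prim_prime)
  have S: "\<forall>P\<in>Prim_star A. prime_ideal A P" by (intro ballI Prim_star_prime)
  have h: "homeomorphic_map (hk_top (Prim (Cstar A))) (hk_top (Prim_star A)) \<phi>"
    using reg unfolding star_regular_def \<phi>_def .
  have im: "\<phi> ` Prim (Cstar A) = Prim_star A" and inj: "inj_on \<phi> (Prim (Cstar A))"
    using homeomorphic_imp_surjective_map[OF h] homeomorphic_imp_injective_map[OF h]
    unfolding topspace_hk_top[OF C Cstar_alg_ax] topspace_hk_top[OF S ax] .
  show "\<phi> Q \<in> Prim_star A" if "Q \<in> Prim (Cstar A)" unfolding im[symmetric] by (rule imageI[OF that])
  show "\<exists>Q\<in>Prim (Cstar A). P = \<phi> Q" if "P \<in> Prim_star A"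
    using that unfolding im[symmetric] by (elim imageE) (rule bexI)
  show "Q = Q'" if "Q \<in> Prim (Cstar A)" "Q' \<in> Prim (Cstar A)" "\<phi> Q = \<phi> Q'"
    by (rule inj_onD[OF inj that(3,1,2)])
  have "closedin (hk_top (Prim_star A)) (\<phi> ` {Q \<in> Prim (Cstar A). Z \<subseteq> Q})"
    using homeomorphic_imp_closed_map[OF h] closedin_hull[OF C Cstar_alg_ax, of Z] unfolding closed_map_def by blast
  then have "\<forall>P\<in>Prim_star A. \<Inter>(\<phi> ` {Q \<in> Prim (Cstar A). Z \<subseteq> Q}) \<subseteq> P \<longrightarrow> P \<in> \<phi> ` {Q \<in> Prim (Cstar A). Z \<subseteq> Q}"
    unfolding closedin_hk_top[OF S ax] by (rule conjunct2)
  note cl = this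
  show "\<exists>Q\<in>Prim (Cstar A). Z \<subseteq> Q \<and> P = \<phi> Q"
    if P: "P \<in> Prim_star A" "\<Inter>(\<phi> ` {Q \<in> Prim (Cstar A). Z \<subseteq> Q}) \<subseteq> P"
  proof -
    obtain Q where "P = \<phi> Q" "Q \<in> {Q \<in> Prim (Cstar A). Z \<subseteq> Q}" using cl[rule_format, OF P] by (rule imageE)
    then show ?thesis by auto
  qed
qed

text \<open>The hull of \<open>Cker J \<pi>\<close> maps onto a closed set whose kernel is contained
  in \<open>rep_ker A J \<pi>\<close>, so some primitive ideal above \<open>Cker J \<pi>\<close> has
  this trace on \<open>A\<close>; by injectivity it is \<open>Q\<close>.\<close>

lemma Cker_subset_Prim:
  assumes ir: "irred_star_rep A J \<pi>" and Q: "Q \<in> Prim (Cstar A)" "rep_ker A J \<pi> = {a \<in> car A. cembed A a \<in> Q}"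
  shows "Cker J \<pi> \<subseteq> Q"
proof -
  have \<pi>: "star_rep A J \<pi>" using ir by (simp add: irred_star_rep_def)
  have P: "rep_ker A J \<pi> \<in> Prim_star A" using ir by (auto simp: Prim_star_def)
  let ?F = "{Q \<in> Prim (Cstar A). Cker J \<pi> \<subseteq> Q}"
  have sep: "\<exists>Q\<in>?F. a \<notin> {a \<in> car A. cembed A a \<in> Q}" if a: "a \<in> car A" "a \<notin> rep_ker A J \<pi>" for a
  proof -
    have "gcls A (\<lambda>n. a) \<notin> Cker J \<pi>" using cembed_in_Cker[OF \<pi> a(1)] a(2) by (simp add: cembed_def)
    from Cker_eq_Inter_Prim[OF \<pi> gcauchy_const[OF a(1)] this] show ?thesis by (auto simp: cembed_def)
  qed
  have "\<Inter>((\<lambda>Q. {a \<in> car A. cembed A a \<in> Q}) ` ?F) \<subseteq> rep_ker A J \<pi>"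
  proof
    fix a assume a: "a \<in> \<Inter>((\<lambda>Q. {a \<in> car A. cembed A a \<in> Q}) ` ?F)"
    obtain b where "b \<in> car A" "b \<notin> rep_ker A J \<pi>" using prime_idealD(2,3)[OF Prim_star_prime[OF P]] by auto
    from sep[OF this] a have "a \<in> car A" by auto
    then show "a \<in> rep_ker A J \<pi>" using sep[of a] a by auto
  qed
  from Prim_star_homeo(4)[OF P this] obtain Q' where Q': "Q' \<in> Prim (Cstar A)" "Cker J \<pi> \<subseteq> Q'"
      "rep_ker A J \<pi> = {a \<in> car A. cembed A a \<in> Q'}" by auto
  have "Q = Q'" by (rule Prim_star_homeo(3)[OF Q(1) Q'(1)]) (use Q(2) Q'(3) in simp)
  then show ?thesis using Q'(2) by simp
qed

text \<open>Primitive ideals of the envelope separate points from \<open>Cker J \<pi>\<close>, and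
  their traces on \<open>A\<close> belong to \<open>Prim_star A\<close>.\<close>

theorem rep_ker_eq_Inter_Prim_star:
  assumes \<pi>: "star_rep A J \<pi>" and a: "a \<in> car A" "a \<notin> rep_ker A J \<pi>"
  shows "\<exists>P\<in>Prim_star A. rep_ker A J \<pi> \<subseteq> P \<and> a \<notin> P"
proof -
  have "gcls A (\<lambda>n. a) \<notin> Cker J \<pi>" using cembed_in_Cker[OF \<pi> a(1)] a(2) by (simp add: cembed_def)
  from Cker_eq_Inter_Prim[OF \<pi> gcauchy_const[OF a(1)] this] obtain Q
    where Q: "Q \<in> Prim (Cstar A)" "Cker J \<pi> \<subseteq> Q" "cembed A a \<notin> Q" by (auto simp: cembed_def)
  have "rep_ker A J \<pi> \<subseteq> {a \<in> car A. cembed A a \<in> Q}"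
    using cembed_in_Cker[OF \<pi>] Q(2) by (auto simp: rep_ker_def)
  then show ?thesis using Prim_star_homeo(1)[OF Q(1)] Q(3) by auto
qed

text \<open>The form in which *-regularity meets functional calculus. The hull of the class of
  \<open>x\<close> in the envelope maps to a closed set containing \<open>E\<close>, hence to one
  containing every element of \<open>Prim_star A\<close> above \<open>\<Inter>E\<close>. If
  \<open>\<pi>\<close> did not kill the class, a primitive ideal above \<open>Cker J \<pi>\<close>
  missing it would have such a trace, against injectivity.\<close>

lemma gcauchy_null_of_hull:
  assumes \<pi>: "star_rep A J \<pi>" and E: "E \<subseteq> Prim_star A" "\<Inter>E \<subseteq> rep_ker A J \<pi>" and x: "gcauchy A x"
    and n: "\<And>P. P \<in> E \<Longrightarrow> \<exists>J' \<pi>'. irred_star_rep A J' \<pi>' \<and> P = rep_ker A J' \<pi>' \<and> (\<lambda>n. opnrm J' (\<pi>' (x n))) \<longlonglongrightarrow> 0"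
  shows "(\<lambda>n. opnrm J (\<pi> (x n))) \<longlonglongrightarrow> 0"
proof (rule ccontr)
  assume "\<not> ?thesis"
  then have "gcls A x \<notin> Cker J \<pi>" by (simp add: Cker_iff[OF \<pi> x])
  then obtain Q where Q: "Q \<in> Prim (Cstar A)" "Cker J \<pi> \<subseteq> Q" "gcls A x \<notin> Q"
    using Cker_eq_Inter_Prim[OF \<pi> x] by auto
  let ?P = "{a \<in> car A. cembed A a \<in> Q}"
  have RP: "rep_ker A J \<pi> \<subseteq> ?P" using cembed_in_Cker[OF \<pi>] Q(2) by (auto simp: rep_ker_def)
  have P: "?P \<in> Prim_star A" by (rule Prim_star_homeo(1)[OF Q(1)])
  have "\<Inter>((\<lambda>Q. {a \<in> car A. cembed A a \<in> Q}) ` {Q \<in> Prim (Cstar A). {gcls A x} \<subseteq> Q}) \<subseteq> \<Inter>E"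
  proof (rule Inter_greatest)
    fix R assume R: "R \<in> E"
    obtain J' \<pi>' where r: "irred_star_rep A J' \<pi>'" "R = rep_ker A J' \<pi>'" "(\<lambda>n. opnrm J' (\<pi>' (x n))) \<longlonglongrightarrow> 0"
      using n[OF R] by auto
    have \<pi>': "star_rep A J' \<pi>'" using r(1) by (simp add: irred_star_rep_def)
    have "R \<in> Prim_star A" using E(1) R by auto
    then obtain Q' where Q': "Q' \<in> Prim (Cstar A)" "R = {a \<in> car A. cembed A a \<in> Q'}" using Prim_star_homeo(2) by auto
    have "gcls A x \<in> Cker J' \<pi>'" using r(3) by (simp add: Cker_iff[OF \<pi>' x])
    then have "gcls A x \<in> Q'" using Cker_subset_Prim[OF r(1) Q'(1)] r(2) Q'(2) by auto
    then show "\<Inter>((\<lambda>Q. {a \<in> car A. cembed A a \<in> Q}) ` {Q \<in> Prim (Cstar A). {gcls A x} \<subseteq> Q}) \<subseteq> R"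
      using Q' by (intro Inter_lower) (auto simp: image_def)
  qed
  also have "\<dots> \<subseteq> ?P" using E(2) RP by (rule subset_trans)
  finally obtain Q' where Q': "Q' \<in> Prim (Cstar A)" "{gcls A x} \<subseteq> Q'" "?P = {a \<in> car A. cembed A a \<in> Q'}"
    using Prim_star_homeo(4)[OF P, of "{gcls A x}"] by auto
  have "Q = Q'" by (rule Prim_star_homeo(3)[OF Q(1) Q'(1) Q'(3)])
  then show False using Q(3) Q'(2) by simp
qed

definition small_at :: "'a \<Rightarrow> real \<Rightarrow> 'a set set" where
  "small_at h d = {rep_ker A J \<pi> | J \<pi>. irred_star_rep A J \<pi> \<and> opnrm J (\<pi> h) \<le> d}"

text \<open>Functional calculus with \<open>\<phi>(t) = t - max (-d) (min d t)\<close>: \<open>\<phi>(h)\<close> vanishes in the representations in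
  which the norm of \<open>h\<close> is at most \<open>d\<close>, but not in one in which it is \<open>2 d\<close>.\<close>
theorem not_Inter_small_at_subset:
  assumes \<pi>: "star_rep A J \<pi>" and h: "h \<in> car A" "st A h = h" and nz: "0 < opnrm J (\<pi> h)"
  shows "\<exists>d>0. \<not> \<Inter>(small_at h d) \<subseteq> rep_ker A J \<pi>"
proof -
  define d where "d = opnrm J (\<pi> h) / 2"
  have d: "0 < d" using nz by (simp add: d_def)
  \<comment> \<open>By contractivity one interval \<open>[-M, M]\<close> serves every
    *-representation, so the polynomial approximations are uniform over them and give a
    \<open>gamma\<close>-Cauchy sequence.\<close>
  define M where "M = nm A h"
  have hM: "opnrm J' (\<pi>' h) \<le> M" if "star_rep A J' \<pi>'" for J' \<pi>'
    unfolding M_def by (rule rep_opnrm_le_nm[OF that h h(1)]) (use ideal_zero[OF rep_ker_ideal[OF that]] h in simp)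
  have M0: "0 \<le> M" unfolding M_def by (rule nm_ge0[OF h(1)])
  define \<phi> where "\<phi> t = t - max (- d) (min d t)" for t
  have cont: "continuous_on {-M..M} \<phi>" unfolding \<phi>_def by (intro continuous_intros)
  have "\<exists>q. \<forall>t. \<bar>t\<bar> \<le> M \<longrightarrow> \<bar>\<phi> t - poly (pCons 0 q) t\<bar> \<le> inverse (real (Suc n))" for n
    by (rule real_poly_approx[OF cont _ M0]) (use d in \<open>auto simp: \<phi>_def\<close>)
  then obtain q where q: "\<And>n t. \<bar>t\<bar> \<le> M \<Longrightarrow> \<bar>\<phi> t - poly (pCons 0 (q n)) t\<bar> \<le> inverse (real (Suc n))" by metis
  define p where "p n = pCons 0 (q n)" for n
  have "\<exists>x\<in>car A. \<forall>J \<pi>. star_rep A J \<pi> \<longrightarrow> (\<forall>f\<in>l2 J. \<pi> x f = poly_op (map_poly complex_of_real (p n)) (\<pi> h) f)" for n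
    using ex_poly_element[OF h(1), of "map_poly complex_of_real (q n)"] by (simp add: p_def map_poly_pCons)
  then obtain x where x: "\<And>n. x n \<in> car A" "\<And>n J \<pi> f. star_rep A J \<pi> \<Longrightarrow> f \<in> l2 J \<Longrightarrow>
      \<pi> (x n) f = poly_op (map_poly complex_of_real (p n)) (\<pi> h) f" by metis
  have diff: "opnrm J' (\<pi>' (sub A (x m) (x n))) \<le> inverse (real (Suc m)) + inverse (real (Suc n))"
    if \<pi>': "star_rep A J' \<pi>'" for J' \<pi>' m n
  proof -
    have "opnrm J' (\<pi>' (sub A (x m) (x n))) = opnrm J' (poly_op (map_poly complex_of_real (p m - p n)) (\<pi>' h))"
      by (rule opnrm_cong) (use x \<pi>' in \<open>simp add: rep_sub poly_op_of_real_diff\<close>)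
    also have "\<dots> \<le> inverse (real (Suc m)) + inverse (real (Suc n))"
    proof (rule opnrm_poly_op_le[OF rep_selfadjoint[OF \<pi>' h] hM[OF \<pi>']])
      fix t assume "\<bar>t\<bar> \<le> M"
      then show "\<bar>poly (p m - p n) t\<bar> \<le> inverse (real (Suc m)) + inverse (real (Suc n))"
        using q[of t m] q[of t n] unfolding p_def[symmetric] poly_diff by linarith
    qed
    finally show ?thesis .
  qed
  have inv0: "(\<lambda>n. inverse (real (Suc n))) \<longlonglongrightarrow> 0" by (rule LIMSEQ_inverse_real_of_nat)
  have gx: "gcauchy A x"
    unfolding gcauchy_def
  proof (intro conjI allI impI x(1))
    fix e :: real assume "e > 0"
    then obtain N where N: "inverse (real (Suc N)) < e / 2" using reals_Archimedean[of "e / 2"] by auto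
    have small: "inverse (real (Suc n)) < e / 2" if "n \<ge> N" for n
      by (rule le_less_trans[OF le_imp_inverse_le N]) (use that in simp_all)
    have "gamma A (sub A (x m) (x n)) < e" if "m \<ge> N" "n \<ge> N" for m n
    proof -
      have "gamma A (sub A (x m) (x n)) \<le> inverse (real (Suc m)) + inverse (real (Suc n))" by (rule gamma_least[OF diff])
      then show ?thesis using small[OF that(1)] small[OF that(2)] by linarith
    qed
    then show "\<exists>N. \<forall>m\<ge>N. \<forall>n\<ge>N. gamma A (sub A (x m) (x n)) < e" by blast
  qed
  have "\<not> \<Inter>(small_at h d) \<subseteq> rep_ker A J \<pi>"
  proof
    assume sub: "\<Inter>(small_at h d) \<subseteq> rep_ker A J \<pi>"
    have "(\<lambda>n. opnrm J (\<pi> (x n))) \<longlonglongrightarrow> 0"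
    proof (rule gcauchy_null_of_hull[OF \<pi> _ sub gx])
      show "small_at h d \<subseteq> Prim_star A" by (auto simp: small_at_def Prim_star_def)
      fix P assume "P \<in> small_at h d"
      then obtain J' \<pi>' where r: "P = rep_ker A J' \<pi>'" "irred_star_rep A J' \<pi>'" "opnrm J' (\<pi>' h) \<le> d" by (auto simp: small_at_def)
      have \<pi>': "star_rep A J' \<pi>'" using r(2) by (simp add: irred_star_rep_def)
      have "opnrm J' (\<pi>' (x n)) \<le> inverse (real (Suc n))" for n
      proof -
        have "opnrm J' (\<pi>' (x n)) = opnrm J' (poly_op (map_poly complex_of_real (p n)) (\<pi>' h))"
          by (rule opnrm_cong) (use x \<pi>' in simp)
        also have "\<dots> \<le> inverse (real (Suc n))"
        \<comment> \<open>The bound \<open>d\<close> makes \<open>\<phi>\<close> vanish and the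
          bound \<open>M\<close> makes the approximation valid; hence
          \<open>min d M\<close>.\<close>
        proof (rule opnrm_poly_op_le[OF rep_selfadjoint[OF \<pi>' h], of "min d M"])
          show "opnrm J' (\<pi>' h) \<le> min d M" using r(3) hM[OF \<pi>'] by simp
          fix t assume t: "\<bar>t\<bar> \<le> min d M"
          then have "\<phi> t = 0" by (auto simp: \<phi>_def abs_le_iff)
          then show "\<bar>poly (p n) t\<bar> \<le> inverse (real (Suc n))" using q[of t n] t unfolding p_def[symmetric] by simp
        qed
        finally show ?thesis .
      qed
      then have "(\<lambda>n. opnrm J' (\<pi>' (x n))) \<longlonglongrightarrow> 0"
        by (rule squeeze_null[OF _ rep_opnrm_ge0[OF \<pi>' x(1)] inv0])
      then show "\<exists>J' \<pi>'. irred_star_rep A J' \<pi>' \<and> P = rep_ker A J' \<pi>' \<and> (\<lambda>n. opnrm J' (\<pi>' (x n))) \<longlonglongrightarrow> 0"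
        using r(1,2) by blast
    qed
    \<comment> \<open>\<open>t - \<phi> t\<close> is at most \<open>d\<close> in modulus, so in
      \<open>\<pi>\<close> the limit of \<open>x n\<close> is within \<open>d\<close> of
      \<open>h\<close>; as the norm of \<open>h\<close> is \<open>2 d\<close>, that limit cannot be
      0.\<close>
    moreover have "2 * d \<le> d + inverse (real (Suc n)) + opnrm J (\<pi> (x n))" for n
    proof -
      have "opnrm J (\<pi> (sub A h (x n))) = opnrm J (poly_op (map_poly complex_of_real ([:0, 1:] - p n)) (\<pi> h))"
        by (rule opnrm_cong) (use x \<pi> h in \<open>simp add: rep_sub poly_op_of_real_diff map_poly_pCons poly_op_pCons\<close>)
      also have "\<dots> \<le> d + inverse (real (Suc n))"
      proof (rule opnrm_poly_op_le[OF rep_selfadjoint[OF \<pi> h] hM[OF \<pi>]])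
        fix t assume t: "\<bar>t\<bar> \<le> M"
        have "\<bar>t - \<phi> t\<bar> \<le> d" using d by (auto simp: \<phi>_def)
        then show "\<bar>poly ([:0, 1:] - p n) t\<bar> \<le> d + inverse (real (Suc n))"
          using q[OF t, of n] unfolding p_def[symmetric] poly_diff by (simp add: abs_le_iff)
      qed
      finally show ?thesis using rep_opnrm_diff[OF \<pi> h(1) x(1)[of n]] by (simp add: d_def)
    qed
    ultimately have "2 * d \<le> d + 0 + 0"
      by (intro LIMSEQ_le_const[OF tendsto_add[OF tendsto_add[OF tendsto_const inv0]]]) auto
    then show False using d by simp
  qed
  then show ?thesis using d by auto
qed

section \<open>Spectral synthesis\<close>

lemma Prim_eq_Inter_Prim_star:
  assumes Q: "Q \<in> Prim A" and a: "a \<in> car A" "a \<notin> Q"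
  shows "\<exists>P\<in>Prim_star A. Q \<subseteq> P \<and> a \<notin> P"
  using Prim_star_rep[OF Q] rep_ker_eq_Inter_Prim_star a by blast

lemma Prim_star_eq_Inter_Prim:
  assumes P: "P \<in> Prim_star A" and a: "a \<in> car A" "a \<notin> P"
  shows "\<exists>Q\<in>Prim A. P \<subseteq> Q \<and> a \<notin> Q"
proof -
  obtain J \<pi> where "irred_star_rep A J \<pi>" "star_rep A J \<pi>" "P = rep_ker A J \<pi>" using P by (rule Prim_star_rep_ker)
  then show ?thesis using rep_ker_eq_Inter_Prim[OF _ a(1)] a(2) by blast
qed

text \<open>Intersection relative to the carrier, so that the empty set has kernel
  \<open>car A\<close> and not \<open>UNIV\<close>.\<close>

definition kern :: "'a set set \<Rightarrow> 'a set" where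
  "kern C = {a \<in> car A. \<forall>P\<in>C. a \<in> P}"

lemma kern_closed_ideal:
  assumes C: "C \<subseteq> Prim_star A" shows "closed_ideal A (kern C)"
proof -
  have iP: "ideal A P" if "P \<in> C" for P using prime_idealD(1)[OF Prim_star_prime] C that by auto
  have cP: "y \<in> P" if P: "P \<in> C" and x: "\<And>n. x n \<in> P" "y \<in> car A" "nconv A x y" for P x y
  proof -
    obtain J \<pi> where r: "irred_star_rep A J \<pi>" "star_rep A J \<pi>" "P = rep_ker A J \<pi>"
      using C P by (meson Prim_star_rep_ker subsetD)
    show ?thesis using rep_ker_closed[OF r(2) _ x(2,3)] x(1) r(3) by simp
  qed
  have "ideal A (kern C)"
    unfolding ideal_def kern_def
    using ideal_zero[OF iP] ideal_add[OF iP] ideal_scale[OF iP] ideal_mult[OF iP] by auto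
  moreover have "y \<in> kern C" if x: "\<forall>n. x n \<in> kern C" and y: "y \<in> car A" "nconv A x y" for x y
  proof -
    have "y \<in> P" if P: "P \<in> C" for P by (rule cP[OF P _ y]) (use x P in \<open>simp add: kern_def\<close>)
    then show ?thesis using y(1) by (simp add: kern_def)
  qed
  ultimately show ?thesis unfolding closed_ideal_def by blast
qed

lemma hull_star_kern:
  assumes "closedin (hk_top (Prim_star A)) C" shows "hull_star A (kern C) = C"
proof -
  have S: "\<forall>P\<in>Prim_star A. prime_ideal A P" by (intro ballI Prim_star_prime)
  have C: "C \<subseteq> Prim_star A" "\<And>P. P \<in> Prim_star A \<Longrightarrow> \<Inter>C \<subseteq> P \<Longrightarrow> P \<in> C"
    using assms unfolding closedin_hk_top[OF S ax] by auto
  have "P \<in> C" if P: "P \<in> Prim_star A" "kern C \<subseteq> P" for P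
  proof (cases "C = {}")
    case True
    then have "car A \<subseteq> P" using P(2) by (simp add: kern_def)
    then show ?thesis using prime_idealD(2,3)[OF Prim_star_prime[OF P(1)]] by auto
  next
    case False
    then have "\<Inter>C \<subseteq> car A" using C(1) prime_idealD(3)[OF Prim_star_prime] by blast
    then have "\<Inter>C \<subseteq> kern C" by (auto simp: kern_def)
    then show ?thesis using C(2)[OF P(1)] P(2) by auto
  qed
  then show ?thesis using C(1) by (auto simp: hull_star_def kern_def)
qed

lemma closedin_hull_star: "closedin (hk_top (Prim_star A)) (hull_star A I)"
  unfolding hull_star_def by (rule closedin_hull[OF _ ax]) (use Prim_star_prime in auto)

lemma usual_if_spectral_synthesis:
  assumes "spectral_synthesis A" shows "usual_spectral_synthesis A"
  unfolding usual_spectral_synthesis_def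
proof (intro allI impI)
  fix C assume C: "closedin (hk_top (Prim_star A)) C"
  have CP: "C \<subseteq> Prim_star A"
    using C closedin_hk_top[of "Prim_star A" A C] Prim_star_prime ax by blast
  have iii: "semisimple_ideal A I" if "closed_ideal A I" "I \<noteq> car A" for I
    using assms that unfolding spectral_synthesis_def by blast
  show "\<exists>!I. closed_ideal A I \<and> hull_star A I = C"
  proof (rule ex1I[of _ "kern C"])
    show "closed_ideal A (kern C) \<and> hull_star A (kern C) = C"
      using kern_closed_ideal[OF CP] hull_star_kern[OF C] by simp
    fix I assume I: "closed_ideal A I \<and> hull_star A I = C"
    have Ic: "I \<subseteq> car A" using I by (simp add: closed_ideal_def ideal_def)
    have "a \<in> I" if a: "a \<in> kern C" for a
    \<comment> \<open>An element outside \<open>I\<close> also shows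
      \<open>I \<noteq> car A\<close>, so that semisimplicity applies.\<close>
    proof (rule ccontr)
      assume n: "a \<notin> I"
      have ac: "a \<in> car A" using a by (simp add: kern_def)
      then obtain S where S: "S \<subseteq> Prim A" "I = \<Inter>S"
        using iii[of I] I n unfolding semisimple_ideal_def by blast
      then obtain Q where Q: "Q \<in> S" "a \<notin> Q" using n by auto
      then obtain P where P: "P \<in> Prim_star A" "Q \<subseteq> P" "a \<notin> P"
        using Prim_eq_Inter_Prim_star[OF _ ac] S(1) by blast
      then have "P \<in> C" using I S(2) Q(1) by (auto simp: hull_star_def)
      then show False using a P(3) by (simp add: kern_def)
    qed
    moreover have "I \<subseteq> kern C" using I Ic by (auto simp: hull_star_def kern_def)
    ultimately show "I = kern C" by auto
  qed
qed

lemma semisimple_if_usual: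
  assumes u: "usual_spectral_synthesis A" and I: "closed_ideal A I" "I \<noteq> car A"
  shows "semisimple_ideal A I"
proof -
  let ?C = "hull_star A I"
  have CP: "?C \<subseteq> Prim_star A" by (auto simp: hull_star_def)
  \<comment> \<open>\<open>I\<close> and the kernel of its hull are closed ideals with the same
    hull, so uniqueness identifies them.\<close>
  have Ik: "I = kern ?C"
    using u closedin_hull_star[of I] kern_closed_ideal[OF CP] hull_star_kern[OF closedin_hull_star[of I]] I(1)
    unfolding usual_spectral_synthesis_def by metis
  define S where "S = {Q \<in> Prim A. I \<subseteq> Q}"
  have sep: "\<exists>Q\<in>S. a \<notin> Q" if a: "a \<in> car A" "a \<notin> I" for a
  proof -
    have "a \<notin> kern ?C" using a(2) Ik by simp
    then obtain P where P: "P \<in> ?C" "a \<notin> P" using a(1) by (auto simp: kern_def)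
    then obtain Q where "Q \<in> Prim A" "P \<subseteq> Q" "a \<notin> Q" using Prim_star_eq_Inter_Prim[OF _ a(1)] CP by blast
    then show ?thesis using P(1) by (auto simp: S_def hull_star_def)
  qed
  have Ic: "I \<subseteq> car A" using I(1) by (simp add: closed_ideal_def ideal_def)
  then obtain b where "b \<in> car A" "b \<notin> I" using I(2) by auto
  from sep[OF this] have ne: "S \<noteq> {}" by auto
  have "Q \<subseteq> car A" if "Q \<in> S" for Q using that prime_idealD(3)[OF Prim_prime] by (auto simp: S_def)
  then have "\<Inter>S \<subseteq> car A" using ne by blast
  then have "\<Inter>S \<subseteq> I" using sep by blast
  moreover have "I \<subseteq> \<Inter>S" by (auto simp: S_def)
  ultimately show ?thesis using ne unfolding semisimple_ideal_def by (intro exI[of _ S]) (auto simp: S_def)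
qed

section \<open>Quotient norms and local compactness\<close>

text \<open>An element of every kernel in \<open>small_at h d\<close> that is not in
  \<open>Q\<close> is missed by some \<open>P\<close> above \<open>Q\<close>; this \<open>P\<close>
  is not in \<open>small_at h d\<close>, so \<open>h\<close> is large there.\<close>

lemma ex_large_irred_rep:
  assumes Q: "Q \<in> Prim A" and n: "\<not> \<Inter>(small_at h d) \<subseteq> Q"
  shows "\<exists>J \<pi>. irred_star_rep A J \<pi> \<and> star_rep A J \<pi> \<and> Q \<subseteq> rep_ker A J \<pi> \<and> d < opnrm J (\<pi> h)"
proof -
  obtain b where b: "b \<in> \<Inter>(small_at h d)" "b \<notin> Q" using n by auto
  have "\<exists>P\<in>Prim_star A. Q \<subseteq> P \<and> b \<notin> P"
  proof (cases "b \<in> car A")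
    case True
    then show ?thesis using Prim_eq_Inter_Prim_star[OF Q _ b(2)] by simp
  next
    \<comment> \<open>Only possible when \<open>small_at h d\<close> is empty and the intersection
      is \<open>UNIV\<close>; then any \<open>P\<close> above \<open>Q\<close> will do.\<close>
    case False
    obtain c where "c \<in> car A" "c \<notin> Q" using prime_idealD(2,3)[OF Prim_prime[OF Q]] by auto
    then obtain P where "P \<in> Prim_star A" "Q \<subseteq> P" using Prim_eq_Inter_Prim_star[OF Q] by auto
    then show ?thesis using False prime_idealD(3)[OF Prim_star_prime] by blast
  qed
  then obtain P where P: "P \<in> Prim_star A" "Q \<subseteq> P" "b \<notin> P" by auto
  obtain J \<pi> where r: "irred_star_rep A J \<pi>" "star_rep A J \<pi>" "P = rep_ker A J \<pi>" using P(1) by (rule Prim_star_rep_ker)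
  have "\<not> opnrm J (\<pi> h) \<le> d"
  proof
    assume "opnrm J (\<pi> h) \<le> d"
    then have "P \<in> small_at h d" using r unfolding small_at_def by blast
    then show False using b(1) P(3) by auto
  qed
  then show ?thesis using r P(2) by (intro exI[of _ J] exI[of _ \<pi>]) simp
qed

lemma ex_not_small_at:
  assumes Q: "Q \<in> Prim A" and a: "a \<in> car A" "a \<notin> Q"
  defines "h \<equiv> mu A (st A a) a"
  shows "\<exists>d>0. \<not> \<Inter>(small_at h d) \<subseteq> Q"
proof -
  obtain \<pi> where \<pi>: "star_rep A UNIV \<pi>" "rep_ker A UNIV \<pi> = Q" using Prim_star_rep[OF Q] by auto
  have h: "h \<in> car A" "st A h = h" unfolding h_def using a(1) by (simp_all add: star_mult star_star)
  have "h \<notin> rep_ker A UNIV \<pi>" using rep_ker_star_mult[OF \<pi>(1) a(1)] a(2) \<pi>(2) unfolding h_def by auto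
  then have "0 < opnrm UNIV (\<pi> h)" using rep_ker_iff[OF \<pi>(1)] h(1) rep_opnrm_ge0[OF \<pi>(1) h(1)] by auto
  from not_Inter_small_at_subset[OF \<pi>(1) h this] show ?thesis by (simp add: \<pi>(2))
qed

lemma Liminf_qnorm_pos:
  assumes P: "P \<in> Prim A" and a: "a \<in> car A - P"
    and F: "eventually (\<lambda>Q. Q \<in> Prim A) F" "limitin (hk_top (Prim A)) (\<lambda>Q. Q) P F"
  shows "Liminf F (\<lambda>Q. ereal (qnorm A a Q)) > 0"
proof -
  have ac: "a \<in> car A" "a \<notin> P" using a by auto
  define h where "h = mu A (st A a) a"
  have h: "h \<in> car A" "st A h = h" unfolding h_def using ac(1) by (simp_all add: star_mult star_star)
  obtain d where d: "d > 0" "\<not> \<Inter>(small_at h d) \<subseteq> P" using ex_not_small_at[OF P ac] unfolding h_def by auto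
  have X: "\<forall>P\<in>Prim A. prime_ideal A P" by (intro ballI Prim_prime)
  define U where "U = {Q \<in> Prim A. \<not> \<Inter>(small_at h d) \<subseteq> Q}"
  have "U = topspace (hk_top (Prim A)) - {Q \<in> Prim A. \<Inter>(small_at h d) \<subseteq> Q}"
    unfolding topspace_hk_top[OF X ax] U_def by auto
  then have "openin (hk_top (Prim A)) U" using closedin_hull[OF X ax] by auto
  moreover have "P \<in> U" using P d(2) by (simp add: U_def)
  ultimately have ev: "eventually (\<lambda>Q. Q \<in> U) F" using F(2) unfolding limitin_def by blast
  have "a \<noteq> zer A" using ac(2) ideal_zero[OF prime_idealD(1)[OF Prim_prime[OF P]]] by auto
  then have "st A a \<noteq> zer A" using star_star[OF ac(1)] star_zero by metis
  then have s: "0 < nm A (st A a)" using nm_eq_0[OF star_in[OF ac(1)]] nm_ge0[OF star_in[OF ac(1)]] by linarith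
  have "d / nm A (st A a) \<le> qnorm A a Q" if Q: "Q \<in> U" for Q
    unfolding qnorm_def
  proof (rule cInf_greatest)
    have QP: "Q \<in> Prim A" using Q by (simp add: U_def)
    note iQ = prime_idealD(1)[OF Prim_prime[OF QP]]
    show "(\<lambda>p. nm A (ad A a p)) ` Q \<noteq> {}" using ideal_zero[OF iQ] by auto
    fix r assume "r \<in> (\<lambda>p. nm A (ad A a p)) ` Q"
    then obtain p where p: "p \<in> Q" "r = nm A (ad A a p)" by auto
    have pc: "p \<in> car A" using ideal_subset[OF iQ p(1)] .
    obtain J \<pi> where \<pi>: "star_rep A J \<pi>" "Q \<subseteq> rep_ker A J \<pi>" "d < opnrm J (\<pi> h)"
      using ex_large_irred_rep[OF QP] Q unfolding U_def by blast
    note iK = rep_ker_ideal[OF \<pi>(1)]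
    \<comment> \<open>\<open>st a * (a + p)\<close> agrees with \<open>h\<close> modulo the kernel
      because \<open>p \<in> Q\<close>; contractivity modulo the kernel then bounds the norm of
      \<open>\<pi> h\<close> by \<open>nm (st a) * nm (a + p)\<close>.\<close>
    have "sub A h (mu A (st A a) (ad A a p)) = sm A (-1) (mu A (st A a) p)"
      unfolding h_def
      by (rule emb_inj) (use ac pc in \<open>simp_all add: emb_sub emb_mult emb_add emb_scale scalar_endo_minus scalar_endo_simps(1) algebra_simps\<close>)
    also have "\<dots> \<in> rep_ker A J \<pi>"
      using \<pi>(2) p(1) ac(1) by (intro ideal_scale[OF iK] ideal_mult(1)[OF iK]) auto
    finally have "opnrm J (\<pi> h) \<le> nm A (mu A (st A a) (ad A a p))"
      by (rule rep_opnrm_le_nm[OF \<pi>(1) h mu_in[OF star_in[OF ac(1)] closed(2)[OF ac(1) pc]]])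
    also have "\<dots> \<le> nm A (st A a) * r" unfolding p(2) by (rule nm_mult) (use ac pc in simp_all)
    finally have "d \<le> r * nm A (st A a)" using \<pi>(3) by (simp add: mult.commute)
    then show "d / nm A (st A a) \<le> r" using s by (simp add: pos_divide_le_eq)
  qed
  then have "eventually (\<lambda>Q. ereal (d / nm A (st A a)) \<le> ereal (qnorm A a Q)) F"
    using ev by (auto elim: eventually_mono)
  then have "ereal (d / nm A (st A a)) \<le> Liminf F (\<lambda>Q. ereal (qnorm A a Q))" by (rule Liminf_bounded)
  moreover have "0 < ereal (d / nm A (st A a))" using d(1) s by simp
  ultimately show ?thesis by (rule less_le_trans[rotated])
qed

lemma Prim_s_prime: "\<forall>P\<in>Prim_s A. prime_ideal A P"
  by (simp add: Prim_s_def)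

lemma Prim_in_Prim_s: "Q \<in> Prim A \<Longrightarrow> Q \<in> Prim_s A"
  unfolding Prim_s_def semisimple_ideal_def using Prim_prime[of Q] by (auto intro!: exI[of _ "{Q}"])

text \<open>For fixed \<open>s\<close>, non-quasi-invertible elements lie in a primitive ideal, which gives compactness as in
  the commutative unital case; left quasi-invertibility is stable under small changes of \<open>s\<close>.\<close>
lemma compactin_not_lqi:
  assumes h: "h \<in> car A" and d: "0 < d"
  shows "compactin (hk_top (Prim_s A)) {P \<in> Prim_s A. \<exists>s\<in>{d..S}. \<not> lqi P (sm A (of_real (1 / s\<^sup>2)) (mu A h h))}"
    (is "compactin _ ?K")
  unfolding compactin_def
proof (intro conjI allI impI)
  show "?K \<subseteq> topspace (hk_top (Prim_s A))" unfolding topspace_hk_top[OF Prim_s_prime ax] by auto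
  fix \<U> assume "Ball \<U> (openin (hk_top (Prim_s A))) \<and> ?K \<subseteq> \<Union>\<U>"
  then have op: "\<And>U. U \<in> \<U> \<Longrightarrow> openin (hk_top (Prim_s A)) U" and cov: "?K \<subseteq> \<Union>\<U>" by auto
  \<comment> \<open>The kernel of the complement of \<open>U\<close>, cut down to the carrier in
    case the complement is empty.\<close>
  define Z where "Z U = {a \<in> car A. \<forall>P\<in>Prim_s A - U. a \<in> P}" for U
  have Zn: "\<not> Z U \<subseteq> Q" if U: "U \<in> \<U>" "Q \<in> U" for U Q
  proof
    assume s: "Z U \<subseteq> Q"
    have UX: "U \<subseteq> Prim_s A" and Uc: "\<forall>P\<in>Prim_s A. \<Inter>(Prim_s A - U) \<subseteq> P \<longrightarrow> P \<in> Prim_s A - U"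
      using op[OF U(1)] unfolding openin_hk_top[OF Prim_s_prime ax] by auto
    have Q: "Q \<in> Prim_s A" using UX U(2) by auto
    have "prime_ideal A Q" using Prim_s_prime Q by blast
    note prime_idealD(2,3)[OF this]
    then have "Prim_s A - U \<noteq> {}" using s by (auto simp: Z_def)
    then have "\<Inter>(Prim_s A - U) \<subseteq> car A" using prime_idealD(3) Prim_s_prime by blast
    then have "\<Inter>(Prim_s A - U) \<subseteq> Q" using s by (auto simp: Z_def)
    then show False using Uc Q U(2) by auto
  qed
  have Zm: "P \<in> U" if "P \<in> Prim_s A" "\<not> Z U \<subseteq> P" for U P using that by (auto simp: Z_def)
  \<comment> \<open>The ideal generated by the kernels \<open>Z U\<close> with
    \<open>U \<in> F\<close>; a point of \<open>Prim_s A\<close> that does not contain it lies in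
    some \<open>U \<in> F\<close>.\<close>
  define G where "G F = \<Inter>{I. ideal A I \<and> (\<forall>U\<in>F. Z U \<subseteq> I)}" for F
  have Zcar: "Z U \<subseteq> car A" for U by (auto simp: Z_def)
  have Gi: "ideal A (G F)" for F
    unfolding G_def by (rule ideal_Inter) (use ideal_car Zcar in auto)
  have GZ: "Z U \<subseteq> G F" if "U \<in> F" for U F using that by (auto simp: G_def)
  have Gle: "G F \<subseteq> I" if "ideal A I" "\<forall>U\<in>F. Z U \<subseteq> I" for F I using that by (auto simp: G_def)
  have Gmono: "G F \<subseteq> G F'" if "F \<subseteq> F'" for F F' by (rule Gle[OF Gi]) (use GZ that in auto)
  \<comment> \<open>The ideal generated by all \<open>Z U\<close>. A primitive ideal above it is
    outside every \<open>U\<close>, so it cannot lie in the covered set; and a remainder in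
    \<open>M\<close> involves only finitely many \<open>U\<close>.\<close>
  define M where "M = \<Union>{G F | F. finite F \<and> F \<subseteq> \<U>}"
  have MI: "G F \<subseteq> M" if "finite F" "F \<subseteq> \<U>" for F using that by (auto simp: M_def)
  have ME: "\<exists>F. finite F \<and> F \<subseteq> \<U> \<and> k \<in> G F" if "k \<in> M" for k using that by (auto simp: M_def)
  have Mi: "ideal A M"
    unfolding ideal_def
  proof (intro conjI ballI allI)
    show "M \<subseteq> car A" using ideal_subset[OF Gi] by (auto simp: M_def)
    show "zer A \<in> M" using MI[of "{}"] ideal_zero[OF Gi] by auto
    fix x assume "x \<in> M"
    then obtain F where F: "finite F" "F \<subseteq> \<U>" "x \<in> G F" using ME by blast
    { fix y assume "y \<in> M"
      then obtain F' where F': "finite F'" "F' \<subseteq> \<U>" "y \<in> G F'" using ME by blast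
      have "ad A x y \<in> G (F \<union> F')"
        by (rule ideal_add[OF Gi subsetD[OF Gmono F(3)] subsetD[OF Gmono F'(3)]]) auto
      then show "ad A x y \<in> M" using MI[of "F \<union> F'"] F F' by auto }
    show "sm A c x \<in> M" for c using ideal_scale[OF Gi F(3)] MI[OF F(1,2)] by auto
    show "mu A a x \<in> M" "mu A x a \<in> M" if "a \<in> car A" for a using ideal_mult[OF Gi F(3) that] MI[OF F(1,2)] by auto
  qed
  define x where "x s = sm A (of_real (1 / s\<^sup>2)) (mu A h h)" for s :: real
  have xc: "x s \<in> car A" for s unfolding x_def using h by simp
  have "\<forall>s\<in>{d..S}. \<exists>T F. open T \<and> s \<in> T \<and> finite F \<and> F \<subseteq> \<U> \<and> (\<forall>s'\<in>T. lqi (G F) (x s'))"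
  proof
    fix s assume s: "s \<in> {d..S}"
    have "lqi M (x s)"
    proof (rule ccontr)
      assume "\<not> lqi M (x s)"
      then obtain Q where Q: "Q \<in> Prim A" "M \<subseteq> Q" "\<not> lqi Q (x s)" using ex_Prim_not_lqi[OF Mi xc] by auto
      then have "Q \<in> ?K" using s Prim_in_Prim_s[OF Q(1)] unfolding x_def by auto
      then obtain U where U: "U \<in> \<U>" "Q \<in> U" using cov by auto
      have "Z U \<subseteq> M" using GZ[of U "{U}"] MI[of "{U}"] U by auto
      then show False using Zn[OF U] Q(2) by auto
    qed
    then obtain y where y: "y \<in> car A" "sub A (ad A (x s) y) (mu A y (x s)) \<in> M" by (auto simp: lqi_def)
    then obtain F where F: "finite F" "F \<subseteq> \<U>" "sub A (ad A (x s) y) (mu A y (x s)) \<in> G F" using ME by blast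
    \<comment> \<open>Moving \<open>s\<close> to \<open>s'\<close> perturbs by a scalar multiple of
      this fixed element, with the scalar tending to 0, so \<open>lqi_perturb\<close> applies near
      \<open>s\<close>.\<close>
    define w where "w = sub A (mu A h h) (mu A y (mu A h h))"
    have w: "w \<in> car A" unfolding w_def using h y by simp
    have e: "sub A (sub A (x s') (x s)) (mu A y (sub A (x s') (x s))) = sm A (of_real (1 / s'\<^sup>2 - 1 / s\<^sup>2)) w" for s'
      unfolding w_def x_def
      by (rule emb_inj)
        (use h y in \<open>simp_all add: emb_sub emb_mult emb_scale scalar_endo_diff of_real_diff algebra_simps
            B.cs_lcomm[of "emb y"] del: of_real_divide\<close>)
    have s0: "s \<noteq> 0" using s d by auto
    have "((\<lambda>s'. \<bar>1 / s'\<^sup>2 - 1 / s\<^sup>2\<bar> * nm A w) \<longlongrightarrow> \<bar>1 / s\<^sup>2 - 1 / s\<^sup>2\<bar> * nm A w) (nhds s)"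
      by (intro tendsto_intros filterlim_ident) (use s0 in auto)
    then have "eventually (\<lambda>s'. \<bar>1 / s'\<^sup>2 - 1 / s\<^sup>2\<bar> * nm A w < 1) (nhds s)" by (rule order_tendstoD) simp
    then obtain T where T: "open T" "s \<in> T" "\<And>s'. s' \<in> T \<Longrightarrow> \<bar>1 / s'\<^sup>2 - 1 / s\<^sup>2\<bar> * nm A w < 1"
      unfolding eventually_nhds by auto
    have "lqi (G F) (x s')" if "s' \<in> T" for s'
      by (rule lqi_perturb[OF Gi xc xc y(1) F(3)]) (use T(3)[OF that] in \<open>simp only: e nm_scale[OF w] norm_of_real\<close>)
    then show "\<exists>T F. open T \<and> s \<in> T \<and> finite F \<and> F \<subseteq> \<U> \<and> (\<forall>s'\<in>T. lqi (G F) (x s'))" using T(1,2) F(1,2) by blast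
  qed
  then obtain T F where TF: "\<And>s. s \<in> {d..S} \<Longrightarrow> open (T s) \<and> s \<in> T s \<and> finite (F s) \<and> F s \<subseteq> \<U> \<and> (\<forall>s'\<in>T s. lqi (G (F s)) (x s'))"
    by metis
  obtain D where D: "D \<subseteq> {d..S}" "finite D" "{d..S} \<subseteq> (\<Union>s\<in>D. T s)"
    by (rule compactE_image[OF compact_Icc[of d S], of "{d..S}" T]) (use TF in auto)
  show "\<exists>\<F>. finite \<F> \<and> \<F> \<subseteq> \<U> \<and> ?K \<subseteq> \<Union>\<F>"
  proof (intro exI[of _ "\<Union>(F ` D)"] conjI subsetI)
    show "finite (\<Union>(F ` D))" using D TF by auto
    show "U \<in> \<U>" if "U \<in> \<Union>(F ` D)" for U using D(1) TF that by blast
    fix P assume "P \<in> ?K"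
    then obtain t where P: "P \<in> Prim_s A" "t \<in> {d..S}" "\<not> lqi P (x t)" unfolding x_def by auto
    then obtain s where s: "s \<in> D" "t \<in> T s" using D(3) by auto
    then have "lqi (G (F s)) (x t)" using TF D(1) by blast
    then have "\<not> G (F s) \<subseteq> P" using lqi_mono P(3) by auto
    then obtain U where "U \<in> F s" "\<not> Z U \<subseteq> P" using Gle[of P "F s"] prime_idealD(1) Prim_s_prime P(1) by blast
    then show "P \<in> \<Union>(\<Union>(F ` D))" using Zm[OF P(1)] s(1) by auto
  qed
qed

text \<open>\<open>P\<close> is an intersection of primitive ideals, one of which misses
  \<open>a\<close>; the number \<open>d\<close> is taken from that one. For \<open>R \<in> U\<close>
  the witness in \<open>[d, nm A h]\<close> is the norm of \<open>\<pi> h\<close> for an irreducible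
  \<open>\<pi>\<close> whose kernel contains \<open>R\<close>.\<close>

lemma locally_compact_Prim_s: "locally_compact_space (hk_top (Prim_s A))"
  unfolding locally_compact_space_def topspace_hk_top[OF Prim_s_prime ax]
proof (intro ballI allI impI)
  fix P assume P: "P \<in> Prim_s A"
  obtain W where W: "W \<subseteq> Prim A" "P = \<Inter>W" using P by (auto simp: Prim_s_def semisimple_ideal_def)
  obtain a where a: "a \<in> car A" "a \<notin> P" using prime_idealD(2,3) Prim_s_prime P by blast
  obtain Q where Q: "Q \<in> W" "a \<notin> Q" using a W by auto
  define h where "h = mu A (st A a) a"
  have h: "h \<in> car A" "st A h = h" unfolding h_def using a(1) by (simp_all add: star_mult star_star)
  obtain d where d: "d > 0" "\<not> \<Inter>(small_at h d) \<subseteq> Q" using ex_not_small_at[OF _ a(1) Q(2)] W(1) Q(1) unfolding h_def by auto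
  define U where "U = {P \<in> Prim_s A. \<not> \<Inter>(small_at h d) \<subseteq> P}"
  define K where "K = {P \<in> Prim_s A. \<exists>s\<in>{d..nm A h}. \<not> lqi P (sm A (of_real (1 / s\<^sup>2)) (mu A h h))}"
  have "U = topspace (hk_top (Prim_s A)) - {Q \<in> Prim_s A. \<Inter>(small_at h d) \<subseteq> Q}"
    unfolding topspace_hk_top[OF Prim_s_prime ax] U_def by auto
  then have "openin (hk_top (Prim_s A)) U" using closedin_hull[OF Prim_s_prime ax] by auto
  moreover have "compactin (hk_top (Prim_s A)) K" unfolding K_def by (rule compactin_not_lqi[OF h(1) d(1)])
  moreover have "P \<in> U" using P d(2) W(2) Q(1) by (auto simp: U_def)
  moreover have "U \<subseteq> K"
  proof
    fix R assume R: "R \<in> U"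
    then obtain V where V: "V \<subseteq> Prim A" "R = \<Inter>V" by (auto simp: U_def Prim_s_def semisimple_ideal_def)
    then obtain Q' where Q': "Q' \<in> V" "\<not> \<Inter>(small_at h d) \<subseteq> Q'" using R unfolding U_def by blast
    obtain J \<pi> where \<pi>: "star_rep A J \<pi>" "Q' \<subseteq> rep_ker A J \<pi>" "d < opnrm J (\<pi> h)"
      using ex_large_irred_rep[OF _ Q'(2)] V(1) Q'(1) by blast
    have "R \<subseteq> rep_ker A J \<pi>" using V(2) Q'(1) \<pi>(2) by auto
    moreover have "\<not> lqi (rep_ker A J \<pi>) (sm A (of_real (1 / (opnrm J (\<pi> h))\<^sup>2)) (mu A h h))"
      by (rule not_lqi_rep_ker[OF \<pi>(1) h]) (use \<pi>(3) d(1) in simp)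
    ultimately have "\<not> lqi R (sm A (of_real (1 / (opnrm J (\<pi> h))\<^sup>2)) (mu A h h))" using lqi_mono by blast
    moreover have "opnrm J (\<pi> h) \<le> nm A h"
      by (rule rep_opnrm_le_nm[OF \<pi>(1) h h(1)]) (use ideal_zero[OF rep_ker_ideal[OF \<pi>(1)]] h in simp)
    ultimately show "R \<in> K" using R \<pi>(3) unfolding K_def U_def by (intro CollectI conjI bexI[of _ "opnrm J (\<pi> h)"]) auto
  qed
  ultimately show "\<exists>U K. openin (hk_top (Prim_s A)) U \<and> compactin (hk_top (Prim_s A)) K \<and> P \<in> U \<and> U \<subseteq> K" by blast
qed

lemma spectral_synthesis_if_usual:
  assumes "usual_spectral_synthesis A" shows "spectral_synthesis A"
  unfolding spectral_synthesis_def
  using locally_compact_Prim_s Liminf_qnorm_pos semisimple_if_usual[OF assms] by blast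

end

theorem theorem2p1:
  fixes A :: "'a bsalg"
  assumes "banach_star_algebra A"
    and "hermitian A"
    and "star_regular A"
    and "star_semisimple A"
  shows "spectral_synthesis A \<longleftrightarrow> usual_spectral_synthesis A"
proof -
  interpret bstar_reg A using assms by unfold_locales
  show ?thesis using usual_if_spectral_synthesis spectral_synthesis_if_usual by blast
qed

end
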